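(* For every integer $N\ge 4$ let $F_N$ be a probability density on $\mathbb{S}^{N-1}(\sqrt N)$ with respect to $d\sigma^N$. Assume that there exists $k>2$ with $$\mathcal{A}_k=\sup_{N}\frac{\sum_{j=1}^N M_k\left(\Pi_1^{(j)}(F_N)\right)}{N}<\infty,$$ that there exists $2<q<k$ such that $$\mathcal{A}^P_q=\sup_N\frac{\sum_{j=1}^NP_q^{(j)}(F_N)}{N}<\infty,\qquad P_q^{(j)}(F_N)=\int_{\mathbb{R}}\frac{\Pi_1^{(j)}(F_N)(v)}{\left(1-\frac{v^2}{N}\right)^{\frac{q}{q-2}}}\,dv,$$ and that there exist constants $C_H,C_I>0$ such that $$\inf_N\frac{H_N(F_N)}{N}\ge C_H,\qquad \sup_N\frac{I_N(F_N)}{N}\le C_I.$$ Then there exist $C_1,C_2>0$, independent of $N$ and $F_N$, such that for any $0<\beta<\frac k2-1$ and every $N$, $$\sum_{j=1}^N\int_{\mathbb{S}^{N-1}(\sqrt N)}F_j^{(N)}\log F_j^{(N)}\,d\sigma^N\le\Bigg(1+\frac{C_1}{C_HN}+\frac{C_2\,2^{\frac32+\frac2q}}{C_H}\left(1+\frac{C_k}{2}\right)^{\frac1k}\left(\left(2C_I+2\right)^{\frac{q}{2(q-1)}}\left(\mathcal{A}^P_q\right)^{\frac{q-2}{2(q-1)}}+2\right)^{\frac{q}{q-1}}\frac{\left(1+\mathcal{A}_k\right)^{\frac1k}}{(2N)^{\frac1{2q}-\frac1{2k}}}$$ $$\qquad+\frac{\mathcal{A}_k}{2C_HN^{\frac k2-1-\beta}}+\frac{N}{2C_H(N-3)}\,\frac{\eta_{N,\beta}}{N^{\frac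 k4-\frac12}\left(1-\frac1{N^\beta}\right)^{\frac k4+\frac12}}\left(2C_I+2\right)^{\frac12}\left(\mathcal{A}_k\right)^{\frac12}\Bigg)H_N(F_N),$$ where $C_k=\sup_{N}\left(\frac2N\right)^{\frac k2}\frac{\Gamma\left(\frac{N+k}{2}\right)}{\Gamma\left(\frac N2\right)}$ and $\eta_{N,\beta}=\sqrt{\sup_{x\in[0,N^{-\beta}]}x(\log x)^2}$.
   Context: $\mathbb{S}^{N-1}(r)\subset\mathbb{R}^N$ is the sphere of radius $r$ centred at the origin; $d\sigma^N_r$ is the uniform probability measure on $\mathbb{S}^{N-1}(r)$ and $d\sigma^N=d\sigma^N_{\sqrt N}$. For a probability density $F_N$ on $\mathbb{S}^{N-1}(\sqrt N)$ (with respect to $d\sigma^N$), $H_N(F_N)=\int_{\mathbb{S}^{N-1}(\sqrt N)}F_N\log F_N\,d\sigma^N$ and $I_N(F_N)=\int_{\mathbb{S}^{N-1}(\sqrt N)}|\nabla_{\mathbb{S}}\log F_N|^2F_N\,d\sigma^N$, where $\nabla_{\mathbb{S}}$ is the gradient on the sphere. $\Pi_1^{(j)}(F_N)$ is the density with respect to Lebesgue measure on $\mathbb{R}$ of the law of the $j$-th coordinate $v_j$ under $F_Nd\sigma^N$ (it is supported in $[-\sqrt N,\sqrt N]$). The first marginal on the sphere in the $j$-th variable is $F_j^{(N)}(v)=\int_{\mathbb{S}^{N-2}(\sqrt{N-v^2})}F_N\,d\sigma^{N-1}_{\sqrt{N-v^2}}$, i.e. the average of $F_N$ over the slice $\{v_j=v\}$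 of $\mathbb{S}^{N-1}(\sqrt N)$; it is regarded as a function on $\mathbb{S}^{N-1}(\sqrt N)$ depending only on $v_j$. For a non-negative measurable $f$ on $\mathbb{R}$, $M_k(f)=\int_{\mathbb{R}}|v|^kf(v)\,dv$. The expression $x(\log x)^2$ is taken to be $0$ at $x=0$. *)

theory Defs
  imports "HOL-Analysis.Analysis"
begin

text \<open>
  The dimension varies along the family, so \<open>\<real>\<^sup>N\<close> is the extensional function space
  \<open>{..<N} \<rightarrow>\<^sub>E UNIV\<close>; coordinates run over \<open>0, \<dots>, N - 1\<close>.  Everything is set up for
  an arbitrary finite index set \<open>I\<close>, because the slice \<open>v\<^sub>j = v\<close> of a sphere in \<open>\<real>\<^sup>I\<close>
  is a sphere in \<open>\<real>\<close>-valued functions on \<open>I - {j}\<close>.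
\<close>

definition sph :: "nat set \<Rightarrow> real \<Rightarrow> (nat \<Rightarrow> real) set" where
  "sph I r = {x \<in> I \<rightarrow>\<^sub>E UNIV. L2_set x I = r}"

text \<open>
  The uniform probability measure on the sphere of radius \<open>r\<close>: the image of the normalised
  Lebesgue measure on the unit ball under the radial projection \<open>x \<mapsto> r x / |x|\<close>.
  The projection sends the (null) origin to itself, off the sphere; restricting to the sphere
  makes it the whole space of the measure without losing mass.  For \<open>r = 0\<close> this is the
  point mass at the origin.
\<close>
definition usph :: "nat set \<Rightarrow> real \<Rightarrow> (nat \<Rightarrow> real) measure" where
  "usph I r = restrict_space
     (distr (uniform_measure (\<Pi>\<^sub>M i\<in>I. lborel) {x \<in> I \<rightarrow>\<^sub>E UNIV. L2_set x I \<le> 1})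
        (\<Pi>\<^sub>M i\<in>I. lborel) (\<lambda>x. \<lambda>i\<in>I. r * x i / L2_set x I))
     (sph I r)"

definition sigmaN :: "nat \<Rightarrow> (nat \<Rightarrow> real) measure" where
  "sigmaN N = usph {..<N} (sqrt (real N))"

definition sph_density :: "nat \<Rightarrow> ((nat \<Rightarrow> real) \<Rightarrow> real) \<Rightarrow> bool" where
  "sph_density N F \<longleftrightarrow> F \<in> borel_measurable (sigmaN N) \<and>
     (\<forall>x\<in>sph {..<N} (sqrt (real N)). 0 \<le> F x) \<and> (\<integral>\<^sup>+x. ennreal (F x) \<partial>sigmaN N) = 1"

text \<open>Isabelle's \<open>ln 0 = 0\<close> gives the convention \<open>0 log 0 = 0\<close>.\<close>
definition entropyN :: "nat \<Rightarrow> ((nat \<Rightarrow> real) \<Rightarrow> real) \<Rightarrow> real" where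
  "entropyN N F = (\<integral>x. F x * ln (F x) \<partial>sigmaN N)"

definition pderiv_coord :: "((nat \<Rightarrow> real) \<Rightarrow> real) \<Rightarrow> nat \<Rightarrow> (nat \<Rightarrow> real) \<Rightarrow> real" where
  "pderiv_coord \<phi> i x = deriv (\<lambda>t. \<phi> (x(i := t))) (x i)"

text \<open>\<open>C\<^sup>1\<close> functions on \<open>\<real>\<^sup>I\<close>; continuity refers to the product topology on functions,
  which on \<open>I \<rightarrow>\<^sub>E UNIV\<close> with \<open>I\<close> finite is the Euclidean topology.\<close>
definition C1_on_coords :: "nat set \<Rightarrow> ((nat \<Rightarrow> real) \<Rightarrow> real) \<Rightarrow> bool" where
  "C1_on_coords I \<phi> \<longleftrightarrow> (\<forall>i\<in>I.
     (\<forall>x\<in>I \<rightarrow>\<^sub>E UNIV. (\<lambda>t. \<phi> (x(i := t))) differentiable (at (x i))) \<and>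
     continuous_on (I \<rightarrow>\<^sub>E UNIV) (pderiv_coord \<phi> i))"

text \<open>The gradient on the sphere of radius \<open>r\<close>: the projection of the ambient gradient to the
  tangent space at \<open>x\<close>.\<close>
definition tgrad :: "nat set \<Rightarrow> real \<Rightarrow> ((nat \<Rightarrow> real) \<Rightarrow> real) \<Rightarrow> (nat \<Rightarrow> real) \<Rightarrow> nat \<Rightarrow> real" where
  "tgrad I r \<phi> x i = pderiv_coord \<phi> i x - x i / r\<^sup>2 * (\<Sum>l\<in>I. x l * pderiv_coord \<phi> l x)"

definition sph_div ::
  "nat set \<Rightarrow> real \<Rightarrow> ((nat \<Rightarrow> real) \<Rightarrow> nat \<Rightarrow> real) \<Rightarrow> (nat \<Rightarrow> real) \<Rightarrow> real" where
  "sph_div I r X x = (\<Sum>i\<in>I. tgrad I r (\<lambda>y. X y i) x i)"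

definition C1_tangent_field ::
  "nat set \<Rightarrow> real \<Rightarrow> ((nat \<Rightarrow> real) \<Rightarrow> nat \<Rightarrow> real) \<Rightarrow> bool" where
  "C1_tangent_field I r X \<longleftrightarrow> (\<forall>i\<in>I. C1_on_coords I (\<lambda>x. X x i)) \<and>
     (\<forall>x\<in>sph I r. (\<Sum>i\<in>I. x i * X x i) = 0)"

text \<open>\<open>G\<close> is a gradient on the sphere of the integrable function \<open>F\<close> in the sense of
  distributions; it is unique up to null sets, and for \<open>F\<close> of class \<open>C\<^sup>1\<close> it is the
  classical gradient.\<close>
definition weak_sph_grad ::
  "nat set \<Rightarrow> real \<Rightarrow> ((nat \<Rightarrow> real) \<Rightarrow> real) \<Rightarrow> ((nat \<Rightarrow> real) \<Rightarrow> nat \<Rightarrow> real) \<Rightarrow> bool" where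
  "weak_sph_grad I r F G \<longleftrightarrow>
     (\<forall>i\<in>I. integrable (usph I r) (\<lambda>x. G x i)) \<and>
     (AE x in usph I r. (\<Sum>i\<in>I. x i * G x i) = 0) \<and>
     (\<forall>X. C1_tangent_field I r X \<longrightarrow>
        (\<integral>x. F x * sph_div I r X x \<partial>usph I r)
          = - (\<integral>x. (\<Sum>i\<in>I. G x i * X x i) \<partial>usph I r))"

text \<open>
  The Fisher information, with the gradient of \<open>log F\<close> being \<open>G / F\<close> for the weak gradient
  \<open>G\<close> of \<open>F\<close>.  As \<open>G\<close> is essentially unique, the infimum selects its value, and
  is \<open>\<infinity>\<close> if \<open>F\<close> has no weak gradient.  Division by zero makes the integrand vanish
  where \<open>F = 0\<close>; there \<open>G = 0\<close> almost everywhere since \<open>F \<ge> 0\<close>.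
\<close>
definition fisherN :: "nat \<Rightarrow> ((nat \<Rightarrow> real) \<Rightarrow> real) \<Rightarrow> ennreal" where
  "fisherN N F = (INF G \<in> {G. weak_sph_grad {..<N} (sqrt (real N)) F G}.
     \<integral>\<^sup>+x. ennreal ((\<Sum>i<N. (G x i / F x)\<^sup>2) * F x) \<partial>sigmaN N)"

text \<open>The Lebesgue density of the law of the \<open>j\<close>-th coordinate under \<open>F d\<sigma>\<^sup>N\<close>.\<close>
definition coord_density :: "nat \<Rightarrow> nat \<Rightarrow> ((nat \<Rightarrow> real) \<Rightarrow> real) \<Rightarrow> real \<Rightarrow> ennreal" where
  "coord_density N j F =
     RN_deriv lborel (distr (density (sigmaN N) (\<lambda>x. ennreal (F x))) lborel (\<lambda>x. x j))"

text \<open>The average of \<open>F\<close> over the slice \<open>v\<^sub>j = v\<close> of the sphere of radius \<open>\<surd>N\<close>.\<close>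
definition sph_marginal :: "nat \<Rightarrow> nat \<Rightarrow> ((nat \<Rightarrow> real) \<Rightarrow> real) \<Rightarrow> real \<Rightarrow> real" where
  "sph_marginal N j F v = (\<integral>w. F (w(j := v)) \<partial>usph ({..<N} - {j}) (sqrt (real N - v\<^sup>2)))"

definition moment :: "real \<Rightarrow> (real \<Rightarrow> ennreal) \<Rightarrow> ennreal" where
  "moment k f = (\<integral>\<^sup>+v. ennreal (\<bar>v\<bar> powr k) * f v \<partial>lborel)"

definition Pmom :: "nat \<Rightarrow> real \<Rightarrow> nat \<Rightarrow> ((nat \<Rightarrow> real) \<Rightarrow> real) \<Rightarrow> ennreal" where
  "Pmom N q j F =
     (\<integral>\<^sup>+v. coord_density N j F v / ennreal ((1 - v\<^sup>2 / real N) powr (q / (q - 2))) \<partial>lborel)"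

definition A_mom :: "(nat \<Rightarrow> (nat \<Rightarrow> real) \<Rightarrow> real) \<Rightarrow> real \<Rightarrow> ennreal" where
  "A_mom F k = (SUP N\<in>{4..}. (\<Sum>j<N. moment k (coord_density N j (F N))) / of_nat N)"

definition A_P :: "(nat \<Rightarrow> (nat \<Rightarrow> real) \<Rightarrow> real) \<Rightarrow> real \<Rightarrow> ennreal" where
  "A_P F q = (SUP N\<in>{4..}. (\<Sum>j<N. Pmom N q j (F N)) / of_nat N)"

definition C_gamma :: "real \<Rightarrow> real" where
  "C_gamma k = (SUP N\<in>{4::nat..}.
     (2 / real N) powr (k / 2) * Gamma ((real N + k) / 2) / Gamma (real N / 2))"

definition eta :: "nat \<Rightarrow> real \<Rightarrow> real" where
  "eta N \<beta> = sqrt (SUP x\<in>{0..real N powr (- \<beta>)}. x * (ln x)\<^sup>2)"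

end

theory Submission
  imports Defs "HOL-Probability.Probability"
begin

text \<open>
  Each coordinate \<open>v\<^sub>j\<close> of the law \<open>F d\<sigma>\<^sup>N\<close> gets a majorant \<open>\<phi>\<^sub>j\<close> of the function
  \<open>(1 - v\<^sup>2/N) F\<^sub>j s\<close>, with \<open>s\<close> the Lebesgue density of \<open>v\<^sub>j\<close> under \<open>\<sigma>\<^sup>N\<close>: convolve the conditional
  expectation of \<open>(1 - v\<^sup>2/N) F + \<epsilon> (|b| + 1)\<close>, \<open>b\<close> the drift in the weak formulation along the \<open>j\<close>-th pole
  field, with the kernel \<open>exp (-|t|/\<epsilon>) / (2 \<epsilon>)\<close>, where \<open>\<epsilon> = 1/\<surd>N\<close>.  Then \<open>ln \<phi>\<^sub>j\<close> is Lipschitz with constant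
  \<open>1/\<epsilon>\<close>, and the Fisher information bounds the total masses: \<open>\<Sum>\<^sub>j ln (\<integral>\<phi>\<^sub>j) = O(\<surd>N)\<close>.

  Gibbs' inequality for \<open>\<Prod>\<^sub>j \<phi>\<^sub>j(v\<^sub>j)\<close> against \<open>F\<close> gives
  \<open>\<Sum>\<^sub>j \<integral>F ln \<phi>\<^sub>j(v\<^sub>j) \<le> H + ln (\<integral>\<Prod>\<^sub>j \<phi>\<^sub>j(v\<^sub>j) d\<sigma>\<^sup>N)\<close>; the Lipschitz bound replaces the sphere by a thin shell,
  hence the last integral by a product of one-dimensional integrals, at the cost of \<open>O(\<surd>N)\<close>.  Up to
  \<open>O(\<surd>N)\<close> the volume of the ball cancels the normalising constants of \<open>s\<close>, and
  \<open>(N/2) \<Sum>\<^sub>j E\<^sub>F (-ln (1 - v\<^sub>j\<^sup>2/N) - v\<^sub>j\<^sup>2/N)\<close> remains.  Interpolating it between \<open>\<Sum>\<^sub>j v\<^sub>j\<^sup>2 = N\<close>, \<open>\<A>\<^sub>k\<close> and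
  \<open>\<A>\<^sup>P\<^sub>q\<close> yields the power \<open>N\<^sup>1\<^sup>-\<^sup>\<delta>\<close> with \<open>\<delta> = 1/(2q) - 1/(2k) < 1/2\<close>.  So the whole error fits into the \<open>C\<^sub>2\<close>
  term, and the other terms of the bound only have to be nonnegative.
\<close>


section \<open>Cones and the uniform measure on the ball\<close>

text \<open>On a product space Gibbs' inequality alone would compare the entropy with those of the
  marginals. On the sphere a product of marginals is not normalised, and estimating its integral
  needs regularity of every factor. The weak gradient gives the marginals only a weak derivative,
  hence majorants with Lipschitz logarithm. Their kernel is the Green function of
  \<open>1 - \<epsilon>\<^sup>2 d\<^sup>2/dt\<^sup>2\<close>, so the weak identity can be used
  directly to compare. The weight 1 - v^2/N is forced: it is the j-th component of the tangential
  part of e_j and vanishes at the poles. Its logarithm, joined to that of s, makes up the correction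
  term, which is why moments singular at the poles enter. A hidden obstacle: the Fisher integrand is
  0 by convention where F = 0, so it controls the integral of |G| only once G = 0 is known almost
  everywhere on {F = 0}. That is proved on meridians (fixed direction of the other coordinates,
  varying height), where it concerns functions of one variable. The lower bound H \<ge> C_H N
  finally turns an additive error into a multiple of H.\<close>

interpretation lborel_prod: product_sigma_finite "\<lambda>_::nat. lborel::real measure"
  by standard

abbreviation lbp :: "nat set \<Rightarrow> (nat \<Rightarrow> real) measure" where
  "lbp I \<equiv> Pi\<^sub>M I (\<lambda>_. lborel)"

definition uball :: "nat set \<Rightarrow> (nat \<Rightarrow> real) set" where
  "uball I = {x \<in> I \<rightarrow>\<^sub>E UNIV. L2_set x I \<le> 1}"

definition rad :: "nat set \<Rightarrow> real \<Rightarrow> (nat \<Rightarrow> real) \<Rightarrow> nat \<Rightarrow> real" where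
  "rad I r x = (\<lambda>i\<in>I. r * x i / L2_set x I)"

lemma measurable_L2_set [measurable]: "(\<lambda>x. L2_set x I) \<in> borel_measurable (lbp I)"
  unfolding L2_set_def by measurable

lemma measurable_rad [measurable]: "rad I r \<in> lbp I \<rightarrow>\<^sub>M lbp I"
  unfolding rad_def by (rule measurable_restrict) measurable

lemma space_lbp: "space (lbp I) = I \<rightarrow>\<^sub>E UNIV"
  by (simp add: space_PiM)

lemma uball_sets [measurable]: "uball I \<in> sets (lbp I)"
proof -
  have "uball I = {x \<in> space (lbp I). L2_set x I \<le> 1}"
    by (auto simp: uball_def space_lbp)
  thus ?thesis by simp
qed

lemma L2_set_scale: "L2_set (\<lambda>i\<in>I. t * x i) I = \<bar>t\<bar> * L2_set x I"
proof -
  have "L2_set (\<lambda>i\<in>I. t * x i) I = L2_set (\<lambda>i. t * x i) I"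
    by (rule L2_set_cong) auto
  also have "\<dots> = \<bar>t\<bar> * L2_set x I"
    by (simp add: L2_set_def power_mult_distrib sum_distrib_left[symmetric] real_sqrt_mult)
  finally show ?thesis .
qed

lemma rad_scale: "t > 0 \<Longrightarrow> rad I r (\<lambda>i\<in>I. t * x i) = rad I r x"
  by (auto simp: rad_def L2_set_scale fun_eq_iff)

lemma L2_set_rad: "r \<ge> 0 \<Longrightarrow> L2_set x I \<noteq> 0 \<Longrightarrow> L2_set (rad I r x) I = r"
proof -
  assume a: "r \<ge> 0" "L2_set x I \<noteq> 0"
  have "rad I r x = (\<lambda>i\<in>I. (r / L2_set x I) * x i)" by (auto simp: rad_def)
  thus ?thesis using a L2_set_scale[of "r / L2_set x I" x I] by simp
qed

lemma nn_integral_lbp_scale: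
  assumes I: "finite I" and t: "t > 0" and g[measurable]: "g \<in> borel_measurable (lbp I)"
  shows "(\<integral>\<^sup>+x. g x \<partial>lbp I) = ennreal (t ^ card I) * (\<integral>\<^sup>+x. g (\<lambda>i\<in>I. t * x i) \<partial>lbp I)"
proof -
  let ?S = "\<lambda>x. \<lambda>i\<in>I. t * x i"
  let ?P = "scale_measure (ennreal (t ^ card I)) (distr (lbp I) (lbp I) ?S)"
  have "?P = lbp I"
  proof (rule lborel_prod.PiM_eqI[OF I])
    fix A :: "nat \<Rightarrow> real set" assume A: "\<And>i. i \<in> I \<Longrightarrow> A i \<in> sets lborel"
    have 1: "emeasure lborel ((*) t -` A i) = ennreal (1 / t) * emeasure lborel (A i)" if "i \<in> I" for i
    proof -
      have "emeasure lborel ((*) t -` A i) = emeasure (distr lborel borel ((*) t)) (A i)"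
        using A[OF that] by (subst emeasure_distr) auto
      also have "\<dots> = ennreal (1 / t) * emeasure lborel (A i)"
        using t A[OF that] by (subst lborel_distr_mult) (auto simp: emeasure_density nn_integral_cmult_indicator divide_inverse)
      finally show ?thesis .
    qed
    have pre: "?S -` (Pi\<^sub>E I A) \<inter> space (lbp I) = Pi\<^sub>E I (\<lambda>i. (*) t -` A i)"
      by (auto simp: space_lbp PiE_iff)
    have B: "(*) t -` A i \<in> sets lborel" if "i \<in> I" for i
      using measurable_sets[of "(*) t" lborel lborel "A i"] A[OF that] by simp
    have "emeasure ?P (Pi\<^sub>E I A) = ennreal (t ^ card I) * emeasure (lbp I) (Pi\<^sub>E I (\<lambda>i. (*) t -` A i))"
      using A I by (simp add: emeasure_distr pre sets_PiM_I_finite)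
    also have "\<dots> = ennreal (t ^ card I) * (\<Prod>i\<in>I. ennreal (1 / t) * emeasure lborel (A i))"
      using I B by (subst lborel_prod.emeasure_PiM) (auto simp: 1)
    also have "\<dots> = (ennreal (t ^ card I) * ennreal ((1 / t) ^ card I)) * (\<Prod>i\<in>I. emeasure lborel (A i))"
      using t by (simp add: prod.distrib ennreal_power mult.assoc)
    also have "ennreal (t ^ card I) * ennreal ((1 / t) ^ card I) = 1"
      using t by (simp add: ennreal_mult'[symmetric] power_mult_distrib[symmetric])
    finally show "emeasure ?P (Pi\<^sub>E I A) = (\<Prod>i\<in>I. emeasure lborel (A i))" by (simp only: mult_1)
  qed simp
  hence "(\<integral>\<^sup>+x. g x \<partial>lbp I) = (\<integral>\<^sup>+x. g x \<partial>?P)" by simp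
  also have "\<dots> = ennreal (t ^ card I) * (\<integral>\<^sup>+x. g (?S x) \<partial>lbp I)"
    by (simp add: nn_integral_scale_measure nn_integral_distr)
  finally show ?thesis .
qed

text \<open>\<open>rad\<close> forgets the length of \<open>x\<close>, so a dilation changes only
  the ball and the volume element.\<close>

lemma nn_integral_cone:
  assumes I: "finite I" and t: "t > 0" and g[measurable]: "g \<in> borel_measurable (lbp I)"
  shows "(\<integral>\<^sup>+x. g (rad I r x) * indicator {..t} (L2_set x I) \<partial>lbp I) =
    ennreal (t ^ card I) * (\<integral>\<^sup>+x. g (rad I r x) * indicator {..1} (L2_set x I) \<partial>lbp I)"
  using t by (subst nn_integral_lbp_scale[OF I t])
    (auto simp: rad_scale L2_set_scale indicator_def intro!: arg_cong[where f="\<lambda>x. _ * x"] nn_integral_cong)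

lemma nn_integral_power_Icc: "(\<integral>\<^sup>+s. ennreal (s ^ n) * indicator {0..1} s \<partial>lborel) = ennreal (1 / real (Suc n))"
  by (subst nn_integral_FTC_Icc[where F = "\<lambda>s. s ^ Suc n / real (Suc n)"])
     (auto intro!: derivative_eq_intros simp del: power_Suc of_nat_Suc)

text \<open>In dimension n the mean of |x| over a cone in the unit ball is n/(n+1). Since 1 - |x| is
  the length of the set of s with |x| \<le> s \<le> 1, Fubini reduces its integral to truncated
  cones, of measure s^n relative to the full one.\<close>

lemma nn_integral_norm_cone:
  assumes I: "finite I" "I \<noteq> {}" and g[measurable]: "g \<in> borel_measurable (lbp I)"
    and fin: "(\<integral>\<^sup>+x. g (rad I r x) * indicator {..1} (L2_set x I) \<partial>lbp I) < \<infinity>"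
  shows "(\<integral>\<^sup>+x. ennreal (L2_set x I) * (g (rad I r x) * indicator {..1} (L2_set x I)) \<partial>lbp I) =
    ennreal (real (card I) / (real (card I) + 1)) *
      (\<integral>\<^sup>+x. g (rad I r x) * indicator {..1} (L2_set x I) \<partial>lbp I)"
    (is "?X = _ * ?C")
proof -
  interpret sigma_finite_measure "lbp I" by (rule lborel_prod.sigma_finite[OF I(1)])
  interpret pair_sigma_finite lborel "lbp I" ..
  define n where "n = card I"
  let ?h = "\<lambda>x. g (rad I r x) * indicator {..1} (L2_set x I)"
  let ?Y = "\<integral>\<^sup>+x. ennreal (1 - L2_set x I) * ?h x \<partial>lbp I"
  have "?X + ?Y = (\<integral>\<^sup>+x. ennreal (L2_set x I) * ?h x + ennreal (1 - L2_set x I) * ?h x \<partial>lbp I)"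
    by (rule nn_integral_add[symmetric]) measurable
  also have "\<dots> = ?C"
    by (intro nn_integral_cong) (auto simp: indicator_def distrib_right[symmetric] ennreal_plus[symmetric] simp del: ennreal_plus)
  finally have XY: "?X + ?Y = ?C" .
  have "?Y = (\<integral>\<^sup>+x. (\<integral>\<^sup>+s. indicator {0<..1} s * (g (rad I r x) * indicator {..s} (L2_set x I)) \<partial>lborel) \<partial>lbp I)"
  proof (intro nn_integral_cong)
    fix x
    have "(\<integral>\<^sup>+s. indicator {0<..1} s * (g (rad I r x) * indicator {..s} (L2_set x I)) \<partial>lborel)
      = (\<integral>\<^sup>+s. g (rad I r x) * indicator ({0<..1} \<inter> {L2_set x I..}) s \<partial>lborel)"
      by (intro nn_integral_cong) (auto simp: indicator_def)
    also have "\<dots> = g (rad I r x) * emeasure lborel ({0<..1} \<inter> {L2_set x I..})"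
      by (rule nn_integral_cmult_indicator) simp
    also have "emeasure lborel ({0<..1} \<inter> {L2_set x I..}) = ennreal (1 - L2_set x I) * indicator {..1} (L2_set x I)"
    proof (cases "L2_set x I > 0")
      case True
      have "{0<..1} \<inter> {L2_set x I..} = {L2_set x I..1}" using True by auto
      thus ?thesis by (cases "L2_set x I \<le> 1") (auto simp: indicator_def)
    next
      case False
      hence 0: "L2_set x I = 0" using L2_set_nonneg[of x I] by linarith
      have "{0<..1} \<inter> {0..} = {0<..1::real}" by auto
      thus ?thesis by (simp add: 0)
    qed
    finally show "ennreal (1 - L2_set x I) * ?h x = (\<integral>\<^sup>+s. indicator {0<..1} s * (g (rad I r x) * indicator {..s} (L2_set x I)) \<partial>lborel)"
      by (simp add: ac_simps)
  qed
  also have "\<dots> = (\<integral>\<^sup>+s. (\<integral>\<^sup>+x. indicator {0<..1} s * (g (rad I r x) * indicator {..s} (L2_set x I)) \<partial>lbp I) \<partial>lborel)"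
  proof (rule Fubini')
    have "(\<lambda>(s, x). indicator {0<..1} s * (g (rad I r x) * indicator {..s} (L2_set x I)))
       = (\<lambda>(s, x). indicator {0<..1} s * (g (rad I r x) * (if L2_set x I \<le> s then 1 else 0)))"
      by (auto simp: fun_eq_iff indicator_def)
    also have "\<dots> \<in> borel_measurable (lborel \<Otimes>\<^sub>M lbp I)" by measurable
    finally show "(\<lambda>(s, x). indicator {0<..1} s * (g (rad I r x) * indicator {..s} (L2_set x I))) \<in> borel_measurable (lborel \<Otimes>\<^sub>M lbp I)" .
  qed
  also have "\<dots> = (\<integral>\<^sup>+s. ?C * (ennreal (s ^ n) * indicator {0..1} s) \<partial>lborel)"
  proof (intro nn_integral_cong_AE)
    have "AE s in lborel. s \<noteq> (0::real)" by (rule AE_lborel_singleton)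
    thus "AE s in lborel. (\<integral>\<^sup>+x. indicator {0<..1} s * (g (rad I r x) * indicator {..s} (L2_set x I)) \<partial>lbp I)
        = ?C * (ennreal (s ^ n) * indicator {0..1} s)"
    proof eventually_elim
      case (elim s)
      show ?case
      proof (cases "s > 0 \<and> s \<le> 1")
        case True
        thus ?thesis using nn_integral_cone[OF I(1), of s g r]
          by (simp add: n_def mult.commute)
      next
        case False thus ?thesis using elim by (auto simp: indicator_def)
      qed
    qed
  qed
  also have "\<dots> = ?C * ennreal (1 / real (Suc n))"
    by (subst nn_integral_cmult) (auto simp: nn_integral_power_Icc simp del: of_nat_Suc)
  finally have Y: "?Y = ?C * ennreal (1 / real (Suc n))" .
  obtain c where c: "?C = ennreal c" "c \<ge> 0" using fin by (cases ?C) auto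
  have Yr: "?Y = ennreal (c / real (Suc n))"
    unfolding Y c(1) using c(2) by (simp add: ennreal_mult'[symmetric] del: of_nat_Suc)
  \<comment> \<open>Cancelling in \<open>ennreal\<close> is legitimate because \<open>?Y\<close> is
    finite; this is where \<open>fin\<close> enters.\<close>
  have "?X = (?X + ?Y) - ?Y" unfolding Yr by simp
  also have "\<dots> = ?C - ?Y" unfolding XY ..
  also have "\<dots> = ennreal (c - c / real (Suc n))"
    unfolding Yr unfolding c(1) using c(2) by (intro ennreal_minus) simp
  also have "c - c / real (Suc n) = real n / (real n + 1) * c" by (simp add: field_simps)
  finally show ?thesis unfolding c(1) using c(2) by (simp add: n_def ennreal_mult'[symmetric])
qed

lemma AE_L2_set_nonzero:
  assumes "finite I" "I \<noteq> {}"
  shows "AE x in lbp I. L2_set x I \<noteq> 0"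
proof (rule AE_I)
  show "{x \<in> space (lbp I). \<not> L2_set x I \<noteq> 0} \<subseteq> Pi\<^sub>E I (\<lambda>_. {0})"
    using assms by (auto simp: space_lbp PiE_iff L2_set_eq_0_iff extensional_def)
  show "emeasure (lbp I) (Pi\<^sub>E I (\<lambda>_. {0})) = 0"
    using assms by (subst lborel_prod.emeasure_PiM) auto
next
  show "Pi\<^sub>E I (\<lambda>_. {0}) \<in> sets (lbp I)"
    using assms by (intro sets_PiM_I_finite) auto
qed

lemma emeasure_uball:
  assumes "finite I"
  shows "emeasure (lbp I) (uball I) = ennreal (unit_ball_vol (real (card I)))"
proof -
  have "uball I = {f. sqrt (\<Sum>i\<in>I. (f i)\<^sup>2) \<le> 1} \<inter> space (lbp I)"
    by (auto simp: uball_def space_lbp L2_set_def)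
  thus ?thesis using emeasure_cball_aux[OF assms, of 1] by simp
qed

definition ub :: "nat set \<Rightarrow> (nat \<Rightarrow> real) measure" where
  "ub I = uniform_measure (lbp I) (uball I)"

lemma sets_ub [simp, measurable_cong]: "sets (ub I) = sets (lbp I)"
  by (simp add: ub_def)

lemma prob_space_ub: "finite I \<Longrightarrow> prob_space (ub I)"
  unfolding ub_def by (rule prob_space_uniform_measure) (auto simp: emeasure_uball unit_ball_vol_pos less_imp_neq[symmetric])

lemma nn_integral_ub:
  assumes I: "finite I" and g[measurable]: "g \<in> borel_measurable (lbp I)"
  shows "(\<integral>\<^sup>+x. g x * indicator {..1} (L2_set x I) \<partial>lbp I) = ennreal (unit_ball_vol (real (card I))) * (\<integral>\<^sup>+x. g x \<partial>ub I)"
proof -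
  have "(\<integral>\<^sup>+x. g x \<partial>ub I) = (\<integral>\<^sup>+x. g x * indicator (uball I) x \<partial>lbp I) / emeasure (lbp I) (uball I)"
    unfolding ub_def by (rule nn_integral_uniform_measure) auto
  also have "(\<integral>\<^sup>+x. g x * indicator (uball I) x \<partial>lbp I) = (\<integral>\<^sup>+x. g x * indicator {..1} (L2_set x I) \<partial>lbp I)"
    by (intro nn_integral_cong) (auto simp: uball_def indicator_def space_lbp)
  also have "emeasure (lbp I) (uball I) = ennreal (unit_ball_vol (real (card I)))"
    by (rule emeasure_uball[OF I])
  finally have *: "(\<integral>\<^sup>+x. g x \<partial>ub I) = (\<integral>\<^sup>+x. g x * indicator {..1} (L2_set x I) \<partial>lbp I) / ennreal (unit_ball_vol (real (card I)))" .
  have "unit_ball_vol (real (card I)) > 0" by simp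
  hence "ennreal (unit_ball_vol (real (card I))) \<noteq> 0" by (simp only: ennreal_eq_0_iff not_le)
  thus ?thesis unfolding *
    by (subst mult.commute, subst ennreal_divide_times) (simp add: ennreal_mult_divide_eq)
qed

lemma AE_ub_nonzero:
  assumes "finite I" "I \<noteq> {}"
  shows "AE x in ub I. L2_set x I \<noteq> 0"
  unfolding ub_def using assms
  by (intro AE_uniform_measureI) (auto intro: AE_mp[OF AE_L2_set_nonzero[OF assms]])

section \<open>Slices of the sphere\<close>

text \<open>Only the direction of \<open>z\<close> matters. Thus one fixed probability space,
  \<open>ub (I - {j})\<close>, parametrises the slices at all heights.\<close>

definition slice_pt :: "nat set \<Rightarrow> nat \<Rightarrow> real \<Rightarrow> real \<Rightarrow> (nat \<Rightarrow> real) \<Rightarrow> nat \<Rightarrow> real" where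
  "slice_pt I j r v z = (rad (I - {j}) (sqrt (r\<^sup>2 - v\<^sup>2)) z)(j := v)"

text \<open>The ratio of the areas of the unit spheres in dimensions n and n + 1, divided by the
  radius: it normalises the density of one coordinate on a sphere in dimension n + 1.\<close>

definition cdens :: "nat \<Rightarrow> real \<Rightarrow> real" where
  "cdens n r = real n * unit_ball_vol (real n) / ((real n + 1) * unit_ball_vol (real n + 1) * r)"

definition sdens :: "nat \<Rightarrow> real \<Rightarrow> real \<Rightarrow> real" where
  "sdens n r v = cdens n r * (1 - v\<^sup>2 / r\<^sup>2) powr (real n / 2 - 1) * indicator {-r<..<r} v"

lemma cdens_nonneg: "r \<ge> 0 \<Longrightarrow> cdens n r \<ge> 0"
  by (auto simp: cdens_def intro!: divide_nonneg_nonneg mult_nonneg_nonneg)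

lemma sdens_nonneg: "r \<ge> 0 \<Longrightarrow> sdens n r v \<ge> 0"
  by (auto simp: sdens_def intro!: mult_nonneg_nonneg cdens_nonneg)

lemma sdens_measurable [measurable]: "sdens n r \<in> borel_measurable borel"
  unfolding sdens_def by measurable

lemma measurable_slice_pt:
  assumes "j \<in> I"
  shows "(\<lambda>(v, z). slice_pt I j r v z) \<in> borel \<Otimes>\<^sub>M lbp (I - {j}) \<rightarrow>\<^sub>M lbp I"
proof -
  have *: "(\<lambda>(v, z). slice_pt I j r v z) = (\<lambda>(v, z). \<lambda>i\<in>I. if i = j then v else sqrt (r\<^sup>2 - v\<^sup>2) * z i / L2_set z (I - {j}))"
    using assms by (auto simp: slice_pt_def rad_def fun_eq_iff)
  show ?thesis unfolding * split_beta
  proof (rule measurable_restrict)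
    fix i assume "i \<in> I"
    show "(\<lambda>x. if i = j then fst x else sqrt (r\<^sup>2 - (fst x)\<^sup>2) * snd x i / L2_set (snd x) (I - {j})) \<in> borel \<Otimes>\<^sub>M lbp (I - {j}) \<rightarrow>\<^sub>M lborel"
    proof (cases "i = j")
      case False
      hence [measurable]: "(\<lambda>x. snd x i) \<in> borel \<Otimes>\<^sub>M lbp (I - {j}) \<rightarrow>\<^sub>M borel"
        using \<open>i \<in> I\<close> by (auto intro!: measurable_compose[OF measurable_snd] simp: measurable_lborel1[symmetric] simp del: measurable_lborel1)
      show ?thesis using False by simp
    qed simp
  qed
qed

lemma slice_pt_scale: "t > 0 \<Longrightarrow> slice_pt I j r v (\<lambda>i\<in>I - {j}. t * z i) = slice_pt I j r v z"
  by (simp add: slice_pt_def rad_scale)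

lemma L2_set_upd:
  assumes "finite I" "j \<in> I"
  shows "L2_set (y(j := a)) I = sqrt (a\<^sup>2 + (L2_set y (I - {j}))\<^sup>2)"
proof -
  have "(\<Sum>i\<in>I - {j}. ((y(j := a)) i)\<^sup>2) = (\<Sum>i\<in>I - {j}. (y i)\<^sup>2)" by (rule sum.cong) auto
  thus ?thesis using assms
    by (simp add: L2_set_def sum.remove[of I j] sum_nonneg)
qed

text \<open>The slope \<tau>, the axis coordinate divided by the length of the rest, is constant on
  rays; on the sphere it determines the height.\<close>

lemma rad_upd_slice:
  assumes I: "finite I" "j \<in> I" and r: "r > 0" and y: "L2_set y (I - {j}) \<noteq> 0"
  shows "rad I r (y(j := L2_set y (I - {j}) * \<tau>)) = slice_pt I j r (r * \<tau> / sqrt (1 + \<tau>\<^sup>2)) y"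
proof -
  define \<rho> where "\<rho> = L2_set y (I - {j})"
  have \<rho>: "\<rho> > 0" using y L2_set_nonneg[of y "I - {j}"] unfolding \<rho>_def by linarith
  have L: "L2_set (y(j := \<rho> * \<tau>)) I = \<rho> * sqrt (1 + \<tau>\<^sup>2)"
  proof -
    have "L2_set (y(j := \<rho> * \<tau>)) I = sqrt (\<rho>\<^sup>2 * (1 + \<tau>\<^sup>2))"
      unfolding L2_set_upd[OF I] \<rho>_def by (simp add: algebra_simps power_mult_distrib)
    thus ?thesis using \<rho> by (simp add: real_sqrt_mult)
  qed
  have p: "1 + \<tau>\<^sup>2 > 0" by (simp add: add_pos_nonneg)
  have "r\<^sup>2 - (r * \<tau> / sqrt (1 + \<tau>\<^sup>2))\<^sup>2 = r\<^sup>2 / (1 + \<tau>\<^sup>2)"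
    using p by (simp add: power_divide power_mult_distrib field_simps)
  hence S: "sqrt (r\<^sup>2 - (r * \<tau> / sqrt (1 + \<tau>\<^sup>2))\<^sup>2) = r / sqrt (1 + \<tau>\<^sup>2)"
    using r by (simp add: real_sqrt_divide)
  show ?thesis
    unfolding slice_pt_def S \<rho>_def[symmetric]
    using I \<rho> p by (auto simp: rad_def fun_eq_iff \<rho>_def[symmetric] L)
qed

text \<open>The substitution from height back to slope. In the form of an image measure it applies
  to every nonnegative measurable integrand at once.\<close>

lemma lborel_tangent_subst:
  assumes r: "r > 0"
  shows "lborel = distr (density lborel (\<lambda>v. ennreal (r\<^sup>2 / sqrt (r\<^sup>2 - v\<^sup>2) ^ 3) * indicator {-r<..<r} v)) borel
     (\<lambda>v. v / sqrt (r\<^sup>2 - v\<^sup>2))" (is "_ = distr ?D borel ?T")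
proof (rule lborel_eqI)
  define tv where "tv \<tau> = r * \<tau> / sqrt (1 + \<tau>\<^sup>2)" for \<tau> :: real
  define J where "J v = r\<^sup>2 / sqrt (r\<^sup>2 - v\<^sup>2) ^ 3" for v
  have p: "1 + \<tau>\<^sup>2 > 0" for \<tau> :: real by (simp add: add_pos_nonneg)
  have tvlt: "\<bar>tv \<tau>\<bar> < r" for \<tau>
  proof -
    have "\<bar>\<tau>\<bar> < sqrt (1 + \<tau>\<^sup>2)" by (rule real_less_rsqrt) simp
    thus ?thesis using r p[of \<tau>] by (simp add: tv_def abs_mult field_simps)
  qed
  have dpos: "r\<^sup>2 - v\<^sup>2 > 0" if "\<bar>v\<bar> < r" for v
    using that r by (simp add: abs_square_less_1 power2_less_imp_less abs_le_square_iff[symmetric] not_le[symmetric])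
  have Ttv: "?T (tv \<tau>) = \<tau>" for \<tau>
  proof -
    have "r\<^sup>2 - (tv \<tau>)\<^sup>2 = r\<^sup>2 / (1 + \<tau>\<^sup>2)"
      using p[of \<tau>] by (simp add: tv_def power_divide power_mult_distrib field_simps)
    thus ?thesis using r p[of \<tau>] by (simp add: tv_def real_sqrt_divide)
  qed
  have der: "(?T has_real_derivative J v) (at v)" if "\<bar>v\<bar> < r" for v
  proof -
    have d: "r\<^sup>2 - v\<^sup>2 > 0" by (rule dpos[OF that])
    define q where "q = sqrt (r\<^sup>2 - v\<^sup>2)"
    have q: "q > 0" "q\<^sup>2 = r\<^sup>2 - v\<^sup>2" using d by (auto simp: q_def)
    have "(?T has_real_derivative (1 * q - v * (- (2 * v) * (inverse q / 2))) / (q * q)) (at v)"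
      unfolding q_def using d by (auto intro!: derivative_eq_intros)
    also have "(1 * q - v * (- (2 * v) * (inverse q / 2))) / (q * q) = (q\<^sup>2 + v\<^sup>2) / q ^ 3"
      using q(1) by (simp add: field_simps power2_eq_square power3_eq_cube)
    also have "\<dots> = J v" using q(2) by (simp add: J_def q_def[symmetric])
    finally show ?thesis .
  qed
  have mono: "?T v < ?T v'" if "\<bar>v\<bar> < r" "\<bar>v'\<bar> < r" "v < v'" for v v'
  proof (rule DERIV_pos_imp_increasing[OF that(3)])
    fix x assume x: "v \<le> x" "x \<le> v'"
    hence "\<bar>x\<bar> < r" using that by auto
    moreover have "J x > 0" unfolding J_def using dpos[OF \<open>\<bar>x\<bar> < r\<close>] r by simp
    ultimately show "\<exists>y. (?T has_real_derivative y) (at x) \<and> y > 0" using der by blast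
  qed
  have iff: "l < ?T v \<longleftrightarrow> tv l < v" "?T v < l \<longleftrightarrow> v < tv l" if "\<bar>v\<bar> < r" for l v
    using mono[OF that tvlt[of l]] mono[OF tvlt[of l] that] Ttv[of l]
    by (smt (verit))+
  have [measurable]: "J \<in> borel_measurable borel" unfolding J_def by measurable
  fix l u :: real assume "\<And>b. b \<in> Basis \<Longrightarrow> l \<bullet> b \<le> u \<bullet> b"
  hence lu: "l \<le> u" by simp
  have tvlu: "tv l \<le> tv u" using iff[OF tvlt[of u], of l] Ttv[of u] lu by (smt (verit))
  have "emeasure (distr ?D borel ?T) (box l u) = emeasure ?D (?T -` {l<..<u})"
    by (subst emeasure_distr) (auto simp: box_real)
  also have "\<dots> = (\<integral>\<^sup>+v. (ennreal (r\<^sup>2 / sqrt (r\<^sup>2 - v\<^sup>2) ^ 3) * indicator {-r<..<r} v) * indicator (?T -` {l<..<u}) v \<partial>lborel)"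
  proof (rule emeasure_density)
    show "?T -` {l<..<u} \<in> sets lborel" 
      using measurable_sets[of ?T borel borel "{l<..<u}"] by simp
  qed measurable
  also have "\<dots> = (\<integral>\<^sup>+v. ennreal (J v) * indicator {tv l..tv u} v \<partial>lborel)"
  proof (rule nn_integral_cong_AE)
    have "AE v in lborel. v \<noteq> tv l" "AE v in lborel. v \<noteq> tv u" by (auto intro: AE_lborel_singleton)
    thus "AE v in lborel. (ennreal (r\<^sup>2 / sqrt (r\<^sup>2 - v\<^sup>2) ^ 3) * indicator {-r<..<r} v) * indicator (?T -` {l<..<u}) v
        = ennreal (J v) * indicator {tv l..tv u} v"
    proof eventually_elim
      case (elim v)
      show ?case using iff[of v l] iff[of v u] elim tvlt[of l] tvlt[of u]
        by (auto simp: J_def indicator_def abs_less_iff)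
    qed
  qed
  also have "\<dots> = ennreal (?T (tv u) - ?T (tv l))"
  proof (rule nn_integral_FTC_Icc[OF _ _ _ tvlu])
    show "(?T has_real_derivative J x) (at x)" if "x \<in> {tv l..tv u}" for x
      using that tvlt[of l] tvlt[of u] by (intro der) auto
    show "J x \<ge> 0" if "x \<in> {tv l..tv u}" for x
      unfolding J_def using less_imp_le[OF dpos[of x]] that tvlt[of l] tvlt[of u]
      by (intro divide_nonneg_nonneg zero_le_power) (auto simp del: real_sqrt_ge_0_iff intro!: real_sqrt_ge_zero)
  qed measurable
  finally show "emeasure (distr ?D borel ?T) (box l u) = (\<Prod>b\<in>Basis. (u - l) \<bullet> b)"
    by (simp add: Ttv)
qed simp

lemma nn_integral_tangent_subst:
  fixes h :: "real \<Rightarrow> ennreal"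
  assumes r: "r > 0" and [measurable]: "h \<in> borel_measurable borel"
  shows "(\<integral>\<^sup>+\<tau>. h \<tau> \<partial>lborel) =
    (\<integral>\<^sup>+v. ennreal (r\<^sup>2 / sqrt (r\<^sup>2 - v\<^sup>2) ^ 3) * indicator {-r<..<r} v * h (v / sqrt (r\<^sup>2 - v\<^sup>2)) \<partial>lborel)"
  by (subst lborel_tangent_subst[OF r]) (simp add: nn_integral_distr nn_integral_density)

text \<open>In the coordinates slope and remaining vector y, an integrand constant on rays
  decouples: for each slope the y-integral runs over a ball whose radius depends on the slope, and
  the power of that radius becomes the density of the height. The bound \<open>g1\<close> keeps the
  cone integrals finite.\<close>

lemma nn_integral_slices:
  assumes I: "finite I" "j \<in> I" and n: "card I = Suc n" "n > 0" and r: "r > 0"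
    and g[measurable]: "g \<in> borel_measurable (lbp I)" and g1: "\<And>x. g x \<le> 1"
  shows "(\<integral>\<^sup>+x. g (rad I r x) \<partial>ub I) =
    (\<integral>\<^sup>+v. ennreal (sdens n r v) * (\<integral>\<^sup>+z. g (slice_pt I j r v z) \<partial>ub (I - {j})) \<partial>lborel)"
proof -
  define I' where "I' = I - {j}"
  have I': "finite I'" "j \<notin> I'" "I = insert j I'" "card I' = n" "I' \<noteq> {}"
  proof -
    show "card I' = n" using I n by (simp add: I'_def card_Diff_singleton)
    thus "I' \<noteq> {}" using n by auto
  qed (use I in \<open>auto simp: I'_def\<close>)
  define V where "V m = unit_ball_vol (real m)" for m
  have V: "V m > 0" for m by (simp add: V_def)
  define R where "R \<tau> = 1 / sqrt (1 + \<tau>\<^sup>2)" for \<tau> :: real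
  define tv where "tv \<tau> = r * \<tau> / sqrt (1 + \<tau>\<^sup>2)" for \<tau> :: real
  have [measurable]: "R \<in> borel_measurable borel" "tv \<in> borel_measurable borel"
    unfolding R_def tv_def by measurable
  have p: "1 + \<tau>\<^sup>2 > 0" for \<tau> :: real by (simp add: add_pos_nonneg)
  have Rp: "R \<tau> > 0" for \<tau> using p[of \<tau>] by (simp add: R_def)
  interpret lb': sigma_finite_measure "lbp I'" by (rule lborel_prod.sigma_finite[OF I'(1)])
  interpret P: pair_sigma_finite lborel "lbp I'" ..
  interpret ub': prob_space "ub I'" by (rule prob_space_ub[OF I'(1)])
  define gs where "gs v z = g (slice_pt I j r v z)" for v z
  have gs_m: "(\<lambda>(v, z). gs v z) \<in> borel_measurable (borel \<Otimes>\<^sub>M lbp I')"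
    using measurable_compose[OF measurable_slice_pt[OF I(2), of r] g] by (simp add: gs_def I'_def split_beta)
  have gs_m1 [measurable]: "(\<lambda>x. gs (a x) (b x)) \<in> borel_measurable M"
    if "a \<in> borel_measurable M" "b \<in> M \<rightarrow>\<^sub>M lbp I'" for a b and M :: "'m measure"
    using measurable_compose[OF measurable_Pair[OF that] gs_m] by simp
  have upd [measurable]: "(\<lambda>x. (b x)(j := a x)) \<in> M \<rightarrow>\<^sub>M lbp I"
    if "a \<in> borel_measurable M" "b \<in> M \<rightarrow>\<^sub>M lbp I'" for a b and M :: "'m measure"
  proof -
    have "(\<lambda>x. (b x)(j := a x)) = (\<lambda>(f, y). f(j := y)) \<circ> (\<lambda>x. (b x, a x))" by auto
    also have "\<dots> \<in> M \<rightarrow>\<^sub>M lbp I" unfolding I'(3)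
      by (rule measurable_comp[OF measurable_Pair[OF that(2)] measurable_add_dim]) (use that in auto)
    finally show ?thesis .
  qed
  have "ennreal (V (Suc n)) * (\<integral>\<^sup>+x. g (rad I r x) \<partial>ub I) = (\<integral>\<^sup>+x. g (rad I r x) * indicator {..1} (L2_set x I) \<partial>lbp I)"
    using nn_integral_ub[OF I(1), of "\<lambda>x. g (rad I r x)"] n by (simp add: V_def)
  also have "\<dots> = (\<integral>\<^sup>+y. (\<integral>\<^sup>+a. g (rad I r (y(j := a))) * indicator {..1} (L2_set (y(j := a)) I) \<partial>lborel) \<partial>lbp I')"
    unfolding I'(3) by (rule lborel_prod.product_nn_integral_insert) (use I' in \<open>simp_all add: I'(3)[symmetric]\<close>)
  \<comment> \<open>The axis coordinate becomes |y| \<tau>, with Jacobian |y|, and the unit ball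
    becomes the condition |y| \<le> R \<tau>.\<close>
  also have "\<dots> = (\<integral>\<^sup>+y. (\<integral>\<^sup>+\<tau>. ennreal (L2_set y I') * (gs (tv \<tau>) y * indicator {..R \<tau>} (L2_set y I')) \<partial>lborel) \<partial>lbp I')"
  proof (rule nn_integral_cong_AE)
    show "AE y in lbp I'. (\<integral>\<^sup>+a. g (rad I r (y(j := a))) * indicator {..1} (L2_set (y(j := a)) I) \<partial>lborel)
       = (\<integral>\<^sup>+\<tau>. ennreal (L2_set y I') * (gs (tv \<tau>) y * indicator {..R \<tau>} (L2_set y I')) \<partial>lborel)"
      using AE_L2_set_nonzero[OF I'(1,5)] AE_space
    proof eventually_elim
      case (elim y)
      define \<rho> where "\<rho> = L2_set y I'"
      have \<rho>: "\<rho> > 0" using elim L2_set_nonneg[of y I'] unfolding \<rho>_def by linarith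
      have yc: "(\<lambda>a::real. y(j := a)) \<in> borel \<rightarrow>\<^sub>M lbp I"
        using elim by (intro upd) auto
      have "(\<integral>\<^sup>+a. g (rad I r (y(j := a))) * indicator {..1} (L2_set (y(j := a)) I) \<partial>lborel)
         = ennreal \<bar>\<rho>\<bar> * (\<integral>\<^sup>+\<tau>. g (rad I r (y(j := 0 + \<rho> * \<tau>))) * indicator {..1} (L2_set (y(j := 0 + \<rho> * \<tau>)) I) \<partial>lborel)"
        using \<rho> yc by (intro nn_integral_real_affine) auto
      also have "\<dots> = ennreal \<rho> * (\<integral>\<^sup>+\<tau>. gs (tv \<tau>) y * indicator {..R \<tau>} \<rho> \<partial>lborel)"
      proof -
        have "L2_set (y(j := \<rho> * \<tau>)) I \<le> 1 \<longleftrightarrow> \<rho> \<le> R \<tau>" for \<tau>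
        proof -
          have "L2_set (y(j := \<rho> * \<tau>)) I = sqrt (\<rho>\<^sup>2 * (1 + \<tau>\<^sup>2))"
            unfolding L2_set_upd[OF I] I'_def[symmetric] \<rho>_def by (simp add: algebra_simps power_mult_distrib)
          also have "\<dots> = \<rho> / R \<tau>" using \<rho> by (simp add: real_sqrt_mult R_def)
          finally have *: "L2_set (y(j := \<rho> * \<tau>)) I = \<rho> / R \<tau>" .
          show ?thesis unfolding * using Rp[of \<tau>] by (simp add: divide_le_eq_1_pos)
        qed
        moreover have "rad I r (y(j := \<rho> * \<tau>)) = slice_pt I j r (tv \<tau>) y" for \<tau>
          using rad_upd_slice[OF I r, of y \<tau>] \<rho> by (simp add: \<rho>_def I'_def tv_def)
        ultimately show ?thesis using \<rho> by (simp add: gs_def indicator_def)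
      qed
      also have "\<dots> = (\<integral>\<^sup>+\<tau>. ennreal \<rho> * (gs (tv \<tau>) y * indicator {..R \<tau>} \<rho>) \<partial>lborel)"
      proof (rule nn_integral_cmult[symmetric])
        have "(\<lambda>\<tau>. gs (tv \<tau>) y * indicator {..R \<tau>} \<rho>) = (\<lambda>\<tau>. gs (tv \<tau>) y * (if \<rho> \<le> R \<tau> then 1 else 0))"
          by (auto simp: fun_eq_iff)
        also have "\<dots> \<in> borel_measurable lborel" using elim by measurable
        finally show "(\<lambda>\<tau>. gs (tv \<tau>) y * indicator {..R \<tau>} \<rho>) \<in> borel_measurable lborel" .
      qed
      finally show ?case by (simp add: \<rho>_def)
    qed
  qed
  also have "\<dots> = (\<integral>\<^sup>+\<tau>. (\<integral>\<^sup>+y. ennreal (L2_set y I') * (gs (tv \<tau>) y * indicator {..R \<tau>} (L2_set y I')) \<partial>lbp I') \<partial>lborel)"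
  proof (rule P.Fubini')
    have "(\<lambda>(\<tau>, y). ennreal (L2_set y I') * (gs (tv \<tau>) y * indicator {..R \<tau>} (L2_set y I')))
       = (\<lambda>(\<tau>, y). ennreal (L2_set y I') * (gs (tv \<tau>) y * (if L2_set y I' \<le> R \<tau> then 1 else 0)))"
      by (auto simp: fun_eq_iff)
    also have "\<dots> \<in> borel_measurable (lborel \<Otimes>\<^sub>M lbp I')" by measurable
    finally show "(\<lambda>(\<tau>, y). ennreal (L2_set y I') * (gs (tv \<tau>) y * indicator {..R \<tau>} (L2_set y I'))) \<in> borel_measurable (lborel \<Otimes>\<^sub>M lbp I')" .
  qed
  \<comment> \<open>At fixed slope the factor \<open>gs\<close> is constant on rays in y. Dilating
    by R \<tau> gives n powers from the volume and one from the weight |y|; the mean of |y| gives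
    n/(n+1).\<close>
  also have "\<dots> = (\<integral>\<^sup>+\<tau>. ennreal (R \<tau> ^ Suc n) * (ennreal (real n / (real n + 1)) * (ennreal (V n) * (\<integral>\<^sup>+z. gs (tv \<tau>) z \<partial>ub I'))) \<partial>lborel)"
  proof (rule nn_integral_cong)
    fix \<tau> :: real
    have sc: "gs (tv \<tau>) (\<lambda>i\<in>I'. R \<tau> * y i) = gs (tv \<tau>) y" for y
      using slice_pt_scale[OF Rp[of \<tau>], of I j r "tv \<tau>" y] by (simp add: gs_def I'_def)
    have m1: "(\<lambda>y. ennreal (L2_set y I') * (gs (tv \<tau>) y * indicator {..b} (L2_set y I'))) \<in> borel_measurable (lbp I')" for b
      by measurable
    have "(\<integral>\<^sup>+y. ennreal (L2_set y I') * (gs (tv \<tau>) y * indicator {..R \<tau>} (L2_set y I')) \<partial>lbp I')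
       = ennreal (R \<tau> ^ n) * (\<integral>\<^sup>+y. ennreal (R \<tau> * L2_set y I') * (gs (tv \<tau>) y * indicator {..1} (L2_set y I')) \<partial>lbp I')"
      by (subst nn_integral_lbp_scale[OF I'(1) Rp[of \<tau>] m1])
         (use Rp[of \<tau>] in \<open>auto simp: sc L2_set_scale I'(4) indicator_def intro!: arg_cong[where f="\<lambda>x. _ * x"] nn_integral_cong\<close>)
    also have "(\<integral>\<^sup>+y. ennreal (R \<tau> * L2_set y I') * (gs (tv \<tau>) y * indicator {..1} (L2_set y I')) \<partial>lbp I')
      = ennreal (R \<tau>) * (\<integral>\<^sup>+y. ennreal (L2_set y I') * (gs (tv \<tau>) y * indicator {..1} (L2_set y I')) \<partial>lbp I')"
      using Rp[of \<tau>] by (simp add: ennreal_mult' mult.assoc nn_integral_cmult)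
    also have "(\<integral>\<^sup>+y. ennreal (L2_set y I') * (gs (tv \<tau>) y * indicator {..1} (L2_set y I')) \<partial>lbp I')
       = ennreal (real n / (real n + 1)) * (\<integral>\<^sup>+y. gs (tv \<tau>) y * indicator {..1} (L2_set y I') \<partial>lbp I')"
    proof -
      let ?r = "sqrt (r\<^sup>2 - (tv \<tau>)\<^sup>2)"
      define gg where "gg w = g (w(j := tv \<tau>))" for w
      have gg: "gs (tv \<tau>) y = gg (rad I' ?r y)" for y by (simp add: gs_def gg_def slice_pt_def I'_def)
      have [measurable]: "gg \<in> borel_measurable (lbp I')" unfolding gg_def by measurable
      have "(\<integral>\<^sup>+y. gg (rad I' ?r y) * indicator {..1} (L2_set y I') \<partial>lbp I') \<le> (\<integral>\<^sup>+y. indicator (uball I') y \<partial>lbp I')"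
        by (intro nn_integral_mono) (auto simp: indicator_def uball_def space_lbp gg_def g1)
      also have "\<dots> < \<infinity>" using I'(1) by (simp add: emeasure_uball)
      finally show ?thesis unfolding gg using nn_integral_norm_cone[OF I'(1,5), of gg ?r] by (simp add: I'(4))
    qed
    also have "(\<integral>\<^sup>+y. gs (tv \<tau>) y * indicator {..1} (L2_set y I') \<partial>lbp I') = ennreal (V n) * (\<integral>\<^sup>+z. gs (tv \<tau>) z \<partial>ub I')"
      using nn_integral_ub[OF I'(1), of "gs (tv \<tau>)"] by (simp add: I'(4) V_def)
    finally show "(\<integral>\<^sup>+y. ennreal (L2_set y I') * (gs (tv \<tau>) y * indicator {..R \<tau>} (L2_set y I')) \<partial>lbp I')
      = ennreal (R \<tau> ^ Suc n) * (ennreal (real n / (real n + 1)) * (ennreal (V n) * (\<integral>\<^sup>+z. gs (tv \<tau>) z \<partial>ub I')))"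
      using Rp[of \<tau>] by (simp add: ennreal_mult' ac_simps)
  qed
  also have "\<dots> = (\<integral>\<^sup>+v. ennreal (r\<^sup>2 / sqrt (r\<^sup>2 - v\<^sup>2) ^ 3) * indicator {-r<..<r} v *
      (ennreal (R (v / sqrt (r\<^sup>2 - v\<^sup>2)) ^ Suc n) * (ennreal (real n / (real n + 1)) * (ennreal (V n) *
        (\<integral>\<^sup>+z. gs (tv (v / sqrt (r\<^sup>2 - v\<^sup>2))) z \<partial>ub I')))) \<partial>lborel)"
    by (rule nn_integral_tangent_subst[OF r]) measurable
  also have "\<dots> = (\<integral>\<^sup>+v. ennreal (V (Suc n)) * (ennreal (sdens n r v) * (\<integral>\<^sup>+z. gs v z \<partial>ub I')) \<partial>lborel)"
  proof (rule nn_integral_cong)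
    fix v
    show "ennreal (r\<^sup>2 / sqrt (r\<^sup>2 - v\<^sup>2) ^ 3) * indicator {-r<..<r} v *
      (ennreal (R (v / sqrt (r\<^sup>2 - v\<^sup>2)) ^ Suc n) * (ennreal (real n / (real n + 1)) * (ennreal (V n) *
        (\<integral>\<^sup>+z. gs (tv (v / sqrt (r\<^sup>2 - v\<^sup>2))) z \<partial>ub I'))))
      = ennreal (V (Suc n)) * (ennreal (sdens n r v) * (\<integral>\<^sup>+z. gs v z \<partial>ub I'))"
    proof (cases "v \<in> {-r<..<r}")
      case False thus ?thesis by (simp add: sdens_def)
    next
      case True
      define q where "q = sqrt (r\<^sup>2 - v\<^sup>2)"
      have "v\<^sup>2 < r\<^sup>2" using True r abs_le_square_iff[of r v] by (auto simp: not_le[symmetric])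
      hence q: "q > 0" "q\<^sup>2 = r\<^sup>2 - v\<^sup>2" by (auto simp: q_def)
      have e1: "1 + (v / q)\<^sup>2 = (r / q)\<^sup>2" using q by (simp add: field_simps)
      have e2: "sqrt (1 + (v / q)\<^sup>2) = r / q" unfolding e1 using r q by simp
      have e3: "tv (v / q) = v" unfolding tv_def e2 using r q by simp
      have e4: "R (v / q) = q / r" unfolding R_def e2 by simp
      \<comment> \<open>Of the n + 1 powers of q/r the Jacobian of the slope takes away three, which
        leaves n - 2 and hence the exponent n/2 - 1 in \<open>sdens\<close>.\<close>
      have "r\<^sup>2 / q ^ 3 * (q / r) ^ Suc n = (1 / r) * (q / r) powr (real n - 2)"
      proof -
        have "(q / r) powr (real n - 2) = (q / r) ^ n / (q / r)\<^sup>2"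
          using q r by (subst powr_diff) (simp add: powr_realpow)
        thus ?thesis using q r by (simp add: field_simps power2_eq_square power3_eq_cube)
      qed
      also have "(q / r) powr (real n - 2) = (1 - v\<^sup>2 / r\<^sup>2) powr (real n / 2 - 1)"
      proof -
        have "1 - v\<^sup>2 / r\<^sup>2 = (q / r)\<^sup>2" using q r by (simp add: field_simps)
        also have "\<dots> = (q / r) powr 2" using q r by (simp add: powr_numeral)
        finally have *: "1 - v\<^sup>2 / r\<^sup>2 = (q / r) powr 2" .
        show ?thesis unfolding * powr_powr by (simp add: algebra_simps)
      qed
      finally have X: "r\<^sup>2 / q ^ 3 * (q / r) ^ Suc n = (1 / r) * (1 - v\<^sup>2 / r\<^sup>2) powr (real n / 2 - 1)" .
      have Y: "W * (a * b / (c * W * r) * Z) = ((1 / r) * Z) * (a / c * b)" if "W > 0" for W a b c Z :: real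
        using that by (simp add: ac_simps)
      have "V (Suc n) * sdens n r v = r\<^sup>2 / q ^ 3 * (q / r) ^ Suc n * (real n / (real n + 1) * V n)"
        unfolding X using Y[OF V[of "Suc n"], of "real n" "V n" "real n + 1" "(1 - v\<^sup>2 / r\<^sup>2) powr (real n / 2 - 1)"] True
        by (simp add: sdens_def cdens_def V_def add.commute)
      hence "ennreal (V (Suc n)) * ennreal (sdens n r v) = ennreal (r\<^sup>2 / q ^ 3) * (ennreal ((q / r) ^ Suc n) * (ennreal (real n / (real n + 1)) * ennreal (V n)))"
        using V[of "Suc n"] V[of n] q r sdens_nonneg[of r n v]
        by (simp only: ennreal_mult'[symmetric] mult.assoc less_imp_le zero_le_divide_iff zero_le_mult_iff zero_le_power of_nat_0_le_iff mult.left_commute zero_le_power2 disj_commute simp_thms)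
      thus ?thesis using True by (simp add: q_def[symmetric] e3 e4 mult.assoc[symmetric] del: power_Suc) 
    qed
  qed
  also have "\<dots> = ennreal (V (Suc n)) * (\<integral>\<^sup>+v. ennreal (sdens n r v) * (\<integral>\<^sup>+z. gs v z \<partial>ub I') \<partial>lborel)"
    by (rule nn_integral_cmult) measurable
  finally have "ennreal (V (Suc n)) * (\<integral>\<^sup>+x. g (rad I r x) \<partial>ub I) = ennreal (V (Suc n)) * (\<integral>\<^sup>+v. ennreal (sdens n r v) * (\<integral>\<^sup>+z. gs v z \<partial>ub I') \<partial>lborel)" .
  thus ?thesis using V[of "Suc n"]
    by (subst (asm) ennreal_mult_cancel_left) (auto simp: gs_def[abs_def] I'_def)
qed

text \<open>The measure inside \<open>usph\<close> before the restriction to the sphere. Its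
  sigma-algebra is that of \<open>lbp I\<close>, so image measures and Fubini apply
  directly.\<close>

definition usph0 :: "nat set \<Rightarrow> real \<Rightarrow> (nat \<Rightarrow> real) measure" where
  "usph0 I r = distr (ub I) (lbp I) (rad I r)"

lemma sets_usph0 [simp, measurable_cong]: "sets (usph0 I r) = sets (lbp I)"
  by (simp add: usph0_def)

lemma space_usph0: "space (usph0 I r) = I \<rightarrow>\<^sub>E UNIV"
  by (simp add: usph0_def space_lbp)

lemma prob_space_usph0: "finite I \<Longrightarrow> prob_space (usph0 I r)"
  unfolding usph0_def by (rule prob_space.prob_space_distr[OF prob_space_ub]) auto

lemma usph_eq: "usph I r = restrict_space (usph0 I r) (sph I r)"
  by (simp add: usph_def usph0_def ub_def uball_def rad_def[abs_def])

lemma sph_sets [measurable]: "sph I r \<in> sets (lbp I)"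
proof -
  have "sph I r = {x \<in> space (lbp I). L2_set x I = r}" by (auto simp: sph_def space_lbp)
  thus ?thesis by simp
qed

lemma space_usph: "space (usph I r) = sph I r"
  by (auto simp: usph_eq space_restrict_space space_usph0 sph_def)

lemma AE_usph0:
  assumes "finite I" "I \<noteq> {}" "r \<ge> 0"
  shows "AE x in usph0 I r. x \<in> sph I r"
  unfolding usph0_def
proof (subst AE_distr_iff)
  show "{x \<in> space (lbp I). x \<in> sph I r} \<in> sets (lbp I)" by measurable
  show "AE x in ub I. rad I r x \<in> sph I r"
    using AE_ub_nonzero[OF assms(1,2)]
    by eventually_elim (use assms L2_set_rad[OF assms(3)] in \<open>auto simp: sph_def rad_def\<close>)
qed simp

context
  fixes I :: "nat set" and r :: real
  assumes I: "finite I" "I \<noteq> {}" and r: "r \<ge> 0"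
begin

lemma AE_usph_iff: "(AE x in usph I r. P x) \<longleftrightarrow> (AE x in usph0 I r. P x)"
proof -
  have "(AE x in usph I r. P x) \<longleftrightarrow> (AE x in usph0 I r. x \<in> sph I r \<longrightarrow> P x)"
    unfolding usph_eq by (rule AE_restrict_space_iff) simp
  also have "\<dots> \<longleftrightarrow> (AE x in usph0 I r. P x)"
  proof
    assume "AE x in usph0 I r. x \<in> sph I r \<longrightarrow> P x"
    thus "AE x in usph0 I r. P x" using AE_usph0[OF I r] by eventually_elim simp
  qed (rule AE_mp, auto)
  finally show ?thesis .
qed

lemma prob_space_usph: "prob_space (usph I r)"
proof (rule prob_spaceI)
  interpret prob_space "usph0 I r" by (rule prob_space_usph0[OF I(1)])
  have "emeasure (usph I r) (space (usph I r)) = emeasure (usph0 I r) (sph I r)"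
    unfolding space_usph unfolding usph_eq by (rule emeasure_restrict_space) auto
  also have "\<dots> = 1" by (subst emeasure_eq_1_AE) (auto intro: AE_usph0[OF I r])
  finally show "emeasure (usph I r) (space (usph I r)) = 1" .
qed

lemma measurable_usph_of_lbp: "g \<in> lbp I \<rightarrow>\<^sub>M M \<Longrightarrow> g \<in> usph I r \<rightarrow>\<^sub>M M"
  unfolding usph_eq by (rule measurable_restrict_space1) (simp cong: measurable_cong_sets)

lemma nn_integral_usph:
  assumes [measurable]: "g \<in> borel_measurable (lbp I)"
  shows "(\<integral>\<^sup>+x. g x \<partial>usph I r) = (\<integral>\<^sup>+x. g x \<partial>usph0 I r)"
proof -
  have "(\<integral>\<^sup>+x. g x \<partial>usph I r) = (\<integral>\<^sup>+x. g x * indicator (sph I r) x \<partial>usph0 I r)"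
    unfolding usph_eq by (rule nn_integral_restrict_space) simp
  also have "\<dots> = (\<integral>\<^sup>+x. g x \<partial>usph0 I r)"
    by (rule nn_integral_cong_AE, rule AE_mp[OF AE_usph0[OF I r]]) auto
  finally show ?thesis .
qed

lemma integral_usph:
  fixes g :: "(nat \<Rightarrow> real) \<Rightarrow> real"
  assumes [measurable]: "g \<in> borel_measurable (lbp I)"
  shows "(\<integral>x. g x \<partial>usph I r) = (\<integral>x. g x \<partial>usph0 I r)"
proof -
  have "(\<integral>x. g x \<partial>usph I r) = (\<integral>x. indicator (sph I r) x *\<^sub>R g x \<partial>usph0 I r)"
    unfolding usph_eq by (rule integral_restrict_space) simp
  also have "\<dots> = (\<integral>x. g x \<partial>usph0 I r)"
    by (rule integral_cong_AE, measurable) (rule AE_mp[OF AE_usph0[OF I r]], auto)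
  finally show ?thesis .
qed

lemma integrable_usph:
  fixes g :: "(nat \<Rightarrow> real) \<Rightarrow> real"
  assumes [measurable]: "g \<in> borel_measurable (lbp I)"
  shows "integrable (usph I r) g \<longleftrightarrow> integrable (usph0 I r) g"
proof -
  have "integrable (usph I r) g \<longleftrightarrow> integrable (usph0 I r) (\<lambda>x. indicator (sph I r) x *\<^sub>R g x)"
    unfolding usph_eq by (rule integrable_restrict_space) simp
  also have "\<dots> \<longleftrightarrow> integrable (usph0 I r) g"
    by (rule integrable_cong_AE, measurable) (rule AE_mp[OF AE_usph0[OF I r]], auto)
  finally show ?thesis .
qed

text \<open>A density given on the sphere is measurable only for the restricted sigma-algebra;
  extended by zero it becomes an admissible integrand for \<open>usph0\<close>.\<close>

lemma borel_measurable_usph_ext: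
  fixes g :: "(nat \<Rightarrow> real) \<Rightarrow> real"
  assumes "g \<in> borel_measurable (usph I r)"
  shows "(\<lambda>x. indicator (sph I r) x * g x) \<in> borel_measurable (lbp I)"
proof -
  have "(\<lambda>x. indicator (sph I r) x *\<^sub>R g x) \<in> borel_measurable (usph0 I r)"
    using assms unfolding usph_eq by (subst (asm) borel_measurable_restrict_space_iff) auto
  thus ?thesis by (simp cong: measurable_cong_sets)
qed

end

definition vlaw :: "nat \<Rightarrow> real \<Rightarrow> real measure" where
  "vlaw n r = density lborel (\<lambda>v. ennreal (sdens n r v))"

lemma sets_vlaw [simp, measurable_cong]: "sets (vlaw n r) = sets borel"
  by (simp add: vlaw_def)

lemma space_vlaw [simp]: "space (vlaw n r) = UNIV"
  by (simp add: vlaw_def)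

context
  fixes I :: "nat set" and j n :: nat and r :: real
  assumes I: "finite I" "j \<in> I" and n: "card I = Suc n" "n > 0" and r: "r > 0"
begin

lemma prob_space_vlaw: "prob_space (vlaw n r)"
proof (rule prob_spaceI)
  interpret u: prob_space "ub I" by (rule prob_space_ub[OF I(1)])
  interpret u': prob_space "ub (I - {j})" by (rule prob_space_ub) (use I in auto)
  show "emeasure (vlaw n r) (space (vlaw n r)) = 1"
    using nn_integral_slices[OF I n r, of "\<lambda>_. 1"]
    by (simp add: vlaw_def emeasure_density u.emeasure_space_1 u'.emeasure_space_1)
qed

text \<open>Under the uniform measure the height and the direction of the remaining coordinates are
  independent, the direction being uniform.\<close>

lemma usph0_disintegration:
  "usph0 I r = distr (vlaw n r \<Otimes>\<^sub>M ub (I - {j})) (lbp I) (\<lambda>(v, z). slice_pt I j r v z)" (is "_ = ?R")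
proof (rule measure_eqI)
  interpret u': prob_space "ub (I - {j})" by (rule prob_space_ub) (use I in auto)
  have m: "(\<lambda>(v, z). slice_pt I j r v z) \<in> vlaw n r \<Otimes>\<^sub>M ub (I - {j}) \<rightarrow>\<^sub>M lbp I"
    using measurable_slice_pt[OF I(2), of r] by (simp cong: measurable_cong_sets)
  fix A assume "A \<in> sets (usph0 I r)"
  hence A[measurable]: "A \<in> sets (lbp I)" by simp
  have m2: "(\<lambda>(v, z). indicator A (slice_pt I j r v z) :: ennreal) \<in> borel_measurable (vlaw n r \<Otimes>\<^sub>M ub (I - {j}))"
    using measurable_compose[OF m, of "indicator A :: _ \<Rightarrow> ennreal"] by (simp add: split_beta')
  have m3: "(\<lambda>(v, z). indicator A (slice_pt I j r v z) :: ennreal) \<in> borel_measurable (lborel \<Otimes>\<^sub>M ub (I - {j}))"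
    using m2 by (simp cong: measurable_cong_sets)
  have "emeasure (usph0 I r) A = (\<integral>\<^sup>+x. indicator A (rad I r x) \<partial>ub I)"
    unfolding usph0_def by (subst nn_integral_indicator[symmetric], simp, subst nn_integral_distr) auto
  also have "\<dots> = (\<integral>\<^sup>+v. ennreal (sdens n r v) * (\<integral>\<^sup>+z. indicator A (slice_pt I j r v z) \<partial>ub (I - {j})) \<partial>lborel)"
    by (rule nn_integral_slices[OF I n r]) (auto simp: indicator_def)
  also have "\<dots> = (\<integral>\<^sup>+v. (\<integral>\<^sup>+z. indicator A (slice_pt I j r v z) \<partial>ub (I - {j})) \<partial>vlaw n r)"
    unfolding vlaw_def by (rule nn_integral_density[symmetric]) (use u'.borel_measurable_nn_integral_fst[OF m3] in auto)
  also have "\<dots> = (\<integral>\<^sup>+p. indicator A (slice_pt I j r (fst p) (snd p)) \<partial>(vlaw n r \<Otimes>\<^sub>M ub (I - {j})))"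
    using u'.nn_integral_fst[OF m2] by (simp add: split_beta')
  also have "\<dots> = emeasure ?R A"
    using m by (subst nn_integral_indicator[symmetric], simp, subst nn_integral_distr) (auto simp: split_beta')
  finally show "emeasure (usph0 I r) A = emeasure ?R A" .
qed simp

lemma nn_integral_usph0:
  assumes [measurable]: "g \<in> borel_measurable (lbp I)"
  shows "(\<integral>\<^sup>+x. g x \<partial>usph0 I r) = (\<integral>\<^sup>+v. (\<integral>\<^sup>+z. g (slice_pt I j r v z) \<partial>ub (I - {j})) \<partial>vlaw n r)"
proof -
  interpret u': prob_space "ub (I - {j})" by (rule prob_space_ub) (use I in auto)
  have m: "(\<lambda>(v, z). slice_pt I j r v z) \<in> vlaw n r \<Otimes>\<^sub>M ub (I - {j}) \<rightarrow>\<^sub>M lbp I"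
    using measurable_slice_pt[OF I(2), of r] by (simp cong: measurable_cong_sets)
  have m2: "(\<lambda>(v, z). g (slice_pt I j r v z)) \<in> borel_measurable (vlaw n r \<Otimes>\<^sub>M ub (I - {j}))"
    using measurable_compose[OF m, of g] by (simp add: split_beta')
  show ?thesis unfolding usph0_disintegration
    using m u'.nn_integral_fst[OF m2] by (subst nn_integral_distr) (auto simp: split_beta')
qed

lemma integrable_slices:
  fixes g :: "(nat \<Rightarrow> real) \<Rightarrow> real"
  assumes g[measurable]: "g \<in> borel_measurable (lbp I)" and int: "integrable (usph0 I r) g"
  shows "integrable (vlaw n r \<Otimes>\<^sub>M ub (I - {j})) (\<lambda>(v, z). g (slice_pt I j r v z))"
    and "(\<integral>x. g x \<partial>usph0 I r) = (\<integral>v. (\<integral>z. g (slice_pt I j r v z) \<partial>ub (I - {j})) \<partial>vlaw n r)"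
    and "integrable (vlaw n r) (\<lambda>v. \<integral>z. g (slice_pt I j r v z) \<partial>ub (I - {j}))"
    and "AE v in vlaw n r. integrable (ub (I - {j})) (\<lambda>z. g (slice_pt I j r v z))"
proof -
  interpret u': prob_space "ub (I - {j})" by (rule prob_space_ub) (use I in auto)
  interpret v: prob_space "vlaw n r" by (rule prob_space_vlaw)
  interpret P: pair_sigma_finite "vlaw n r" "ub (I - {j})" ..
  have m: "(\<lambda>(v, z). slice_pt I j r v z) \<in> vlaw n r \<Otimes>\<^sub>M ub (I - {j}) \<rightarrow>\<^sub>M lbp I"
    using measurable_slice_pt[OF I(2), of r] by (simp cong: measurable_cong_sets)
  show i: "integrable (vlaw n r \<Otimes>\<^sub>M ub (I - {j})) (\<lambda>(v, z). g (slice_pt I j r v z))"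
    using int unfolding usph0_disintegration by (subst (asm) integrable_distr_eq[OF m]) (auto simp: split_beta')
  show "integrable (vlaw n r) (\<lambda>v. \<integral>z. g (slice_pt I j r v z) \<partial>ub (I - {j}))"
    using P.integrable_fst[OF i] .
  show "AE v in vlaw n r. integrable (ub (I - {j})) (\<lambda>z. g (slice_pt I j r v z))"
    using P.AE_integrable_fst[OF i] .
  show "(\<integral>x. g x \<partial>usph0 I r) = (\<integral>v. (\<integral>z. g (slice_pt I j r v z) \<partial>ub (I - {j})) \<partial>vlaw n r)"
    unfolding usph0_disintegration using m P.integral_fst[OF i] by (subst integral_distr) (auto simp: split_beta')
qed

lemma slice_pt_in_sph:
  assumes "v\<^sup>2 < r\<^sup>2" "w \<in> sph (I - {j}) (sqrt (r\<^sup>2 - v\<^sup>2))"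
  shows "w(j := v) \<in> sph I r"
proof -
  have "L2_set (w(j := v)) I = r"
    using assms r by (subst L2_set_upd[OF I]) (auto simp: sph_def)
  thus ?thesis using assms(2) I by (auto simp: sph_def PiE_iff extensional_def)
qed

end

section \<open>Pole fields as test fields\<close>

text \<open>On the sphere this is \<open>h\<close> times the gradient of the coordinate x_j, that
  is, e_j projected to the tangent space. Its flow moves points along the meridians between the
  poles.\<close>

definition pole_field :: "nat \<Rightarrow> real \<Rightarrow> ((nat \<Rightarrow> real) \<Rightarrow> real) \<Rightarrow> (nat \<Rightarrow> real) \<Rightarrow> nat \<Rightarrow> real" where
  "pole_field j r h x i = h x * ((if i = j then 1 else 0) - x j * x i / r\<^sup>2)"

lemma sum_delta_mult:
  fixes f :: "nat \<Rightarrow> real"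
  assumes "finite I" "j \<in> I"
  shows "(\<Sum>i\<in>I. f i * (if i = j then 1 else 0)) = f j" "(\<Sum>i\<in>I. (if i = j then 1 else 0) * f i) = f j"
    "(\<Sum>i\<in>I. f i * (if j = i then 1 else 0)) = f j" "(\<Sum>i\<in>I. (if j = i then 1 else 0) * f i) = f j"
  using assms by (simp_all add: if_distrib[of "\<lambda>x. _ * x"] if_distrib[of "\<lambda>x. x * _"] cong: if_cong)

text \<open>The last term of the divergence reflects that x_j is an eigenfunction of the spherical
  Laplacian, with eigenvalue -(card I - 1)/r^2; the rest is the derivative of \<open>h\<close> along
  the field.\<close>

lemma pole_field_C1:
  fixes h :: "(nat \<Rightarrow> real) \<Rightarrow> real"
  assumes I: "finite I" "j \<in> I" and r: "r > 0"
    and h: "continuous_on (I \<rightarrow>\<^sub>E UNIV) h"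
    and dh: "\<And>l x. l \<in> I \<Longrightarrow> x \<in> I \<rightarrow>\<^sub>E UNIV \<Longrightarrow> ((\<lambda>t. h (x(l := t))) has_real_derivative dh l x) (at (x l))"
    and cdh: "\<And>l. l \<in> I \<Longrightarrow> continuous_on (I \<rightarrow>\<^sub>E UNIV) (dh l)"
  shows "C1_tangent_field I r (pole_field j r h)"
    and "x \<in> sph I r \<Longrightarrow> sph_div I r (pole_field j r h) x =
      dh j x - x j / r\<^sup>2 * (\<Sum>l\<in>I. x l * dh l x) - (real (card I) - 1) / r\<^sup>2 * x j * h x"
proof -
  define \<delta> :: "nat \<Rightarrow> nat \<Rightarrow> real" where "\<delta> i k = (if i = k then 1 else 0)" for i k
  define DX where "DX l i x = dh l x * (\<delta> i j - x j * x i / r\<^sup>2) - h x * (\<delta> l j * x i + x j * \<delta> l i) / r\<^sup>2" for l i x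
  have der: "((\<lambda>t. pole_field j r h (x(l := t)) i) has_real_derivative DX l i x) (at (x l))"
    if "l \<in> I" "i \<in> I" "x \<in> I \<rightarrow>\<^sub>E UNIV" for l i x
  proof -
    have c: "((\<lambda>t. (x(l := t)) k) has_real_derivative \<delta> l k) (at (x l))" for k
      by (cases "l = k") (auto simp: \<delta>_def)
    have "((\<lambda>t. h (x(l := t)) * (\<delta> i j - (x(l := t)) j * (x(l := t)) i / r\<^sup>2)) has_real_derivative
       dh l x * (\<delta> i j - (x(l := x l)) j * (x(l := x l)) i / r\<^sup>2)
        + (0 - (\<delta> l j * (x(l := x l)) i + \<delta> l i * (x(l := x l)) j) / r\<^sup>2) * h (x(l := x l))) (at (x l))"
      by (intro DERIV_mult DERIV_diff DERIV_const DERIV_cdivide dh c that)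
    thus ?thesis by (simp add: pole_field_def \<delta>_def[symmetric] DX_def algebra_simps add_divide_distrib)
  qed
  have pd: "pderiv_coord (\<lambda>y. pole_field j r h y i) l x = DX l i x"
    if "l \<in> I" "i \<in> I" "x \<in> I \<rightarrow>\<^sub>E UNIV" for l i x
    unfolding pderiv_coord_def using der[OF that] by (rule DERIV_imp_deriv)
  have tang: "(\<Sum>i\<in>I. x i * (\<delta> i j - x j * x i / r\<^sup>2)) = 0" and n2: "(\<Sum>i\<in>I. x i * x i) = r\<^sup>2" if "x \<in> sph I r" for x
  proof -
    have "sqrt (\<Sum>i\<in>I. (x i)\<^sup>2) = r" using that by (simp add: sph_def L2_set_def)
    hence "r\<^sup>2 = (\<Sum>i\<in>I. (x i)\<^sup>2)" by (metis real_sqrt_pow2 sum_nonneg zero_le_power2)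
    thus s: "(\<Sum>i\<in>I. x i * x i) = r\<^sup>2" by (simp add: power2_eq_square)
    have "(\<Sum>i\<in>I. x i * (\<delta> i j - x j * x i / r\<^sup>2)) = (\<Sum>i\<in>I. x i * \<delta> i j) - x j / r\<^sup>2 * (\<Sum>i\<in>I. x i * x i)"
      unfolding sum_distrib_left sum_subtractf[symmetric]
      by (intro sum.cong refl) (simp add: algebra_simps)
    thus "(\<Sum>i\<in>I. x i * (\<delta> i j - x j * x i / r\<^sup>2)) = 0"
      using r I unfolding s by (simp add: \<delta>_def sum_delta_mult)
  qed
  have coord: "continuous_on (I \<rightarrow>\<^sub>E UNIV) (\<lambda>x. (x::nat\<Rightarrow>real) k)" for k
    by (rule continuous_on_subset[OF continuous_on_product_coordinates]) simp
  have cDX: "continuous_on (I \<rightarrow>\<^sub>E UNIV) (DX l i)" if "l \<in> I" for l i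
    unfolding DX_def using h cdh[OF that] r
    by (intro continuous_intros coord) auto
  show "C1_tangent_field I r (pole_field j r h)"
    unfolding C1_tangent_field_def C1_on_coords_def
  proof (intro conjI ballI)
    fix i l x assume a: "i \<in> I" "l \<in> I" "x \<in> I \<rightarrow>\<^sub>E (UNIV :: real set)"
    show "(\<lambda>t. pole_field j r h (x(l := t)) i) differentiable at (x l)"
      using der[OF a(2,1,3)] by (metis real_differentiable_def)
  next
    fix i l assume a: "i \<in> I" "l \<in> I"
    show "continuous_on (I \<rightarrow>\<^sub>E UNIV) (pderiv_coord (\<lambda>x. pole_field j r h x i) l)"
      using cDX[OF a(2), of i] by (rule continuous_on_eq) (simp add: pd a)
  next
    fix x assume x: "x \<in> sph I r"
    have "(\<Sum>i\<in>I. x i * pole_field j r h x i) = h x * (\<Sum>i\<in>I. x i * (\<delta> i j - x j * x i / r\<^sup>2))"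
      by (simp add: pole_field_def \<delta>_def sum_distrib_left algebra_simps)
    thus "(\<Sum>i\<in>I. x i * pole_field j r h x i) = 0" using tang[OF x] by simp
  qed
  assume x: "x \<in> sph I r"
  hence xI: "x \<in> I \<rightarrow>\<^sub>E UNIV" by (simp add: sph_def)
  have "sph_div I r (pole_field j r h) x = (\<Sum>i\<in>I. DX i i x) - (\<Sum>i\<in>I. x i / r\<^sup>2 * (\<Sum>l\<in>I. x l * DX l i x))"
    unfolding sph_div_def tgrad_def by (simp add: pd xI sum_subtractf)
  also have "(\<Sum>i\<in>I. DX i i x) = dh j x - x j / r\<^sup>2 * (\<Sum>l\<in>I. x l * dh l x) - h x * x j * (1 + real (card I)) / r\<^sup>2"
  proof -
    have "(\<Sum>i\<in>I. DX i i x) = (\<Sum>i\<in>I. dh i x * \<delta> i j) - x j / r\<^sup>2 * (\<Sum>l\<in>I. x l * dh l x)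
        - h x / r\<^sup>2 * (\<Sum>i\<in>I. x i * \<delta> i j) - h x / r\<^sup>2 * (x j * real (card I))"
      by (simp add: DX_def sum_subtractf sum_distrib_left algebra_simps sum.distrib add_divide_distrib \<delta>_def[of a a for a] sum_divide_distrib)
    thus ?thesis using I by (simp add: \<delta>_def sum_delta_mult algebra_simps add_divide_distrib)
  qed
  \<comment> \<open>The radial part that \<open>tgrad\<close> subtracts. The terms with
    \<open>dh\<close> cancel by tangency; what remains comes from the quadratic term of the field,
    which is not constant along rays.\<close>
  also have "(\<Sum>i\<in>I. x i / r\<^sup>2 * (\<Sum>l\<in>I. x l * DX l i x)) = - 2 * x j * h x / r\<^sup>2"
  proof -
    have a: "(\<Sum>l\<in>I. x l * DX l i x) = (\<delta> i j - x j * x i / r\<^sup>2) * (\<Sum>l\<in>I. x l * dh l x) - 2 * h x * x i * x j / r\<^sup>2" if "i \<in> I" for i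
    proof -
      have "(\<Sum>l\<in>I. x l * DX l i x) = (\<delta> i j - x j * x i / r\<^sup>2) * (\<Sum>l\<in>I. x l * dh l x)
         - h x / r\<^sup>2 * x i * (\<Sum>l\<in>I. x l * \<delta> l j) - h x / r\<^sup>2 * x j * (\<Sum>l\<in>I. x l * \<delta> l i)"
        unfolding sum_distrib_left sum_subtractf[symmetric] DX_def
        by (intro sum.cong refl) (simp add: algebra_simps add_divide_distrib diff_divide_distrib)
      thus ?thesis using I that by (simp add: \<delta>_def sum_delta_mult)
    qed
    define D where "D = (\<Sum>l\<in>I. x l * dh l x)"
    have "(\<Sum>i\<in>I. x i / r\<^sup>2 * (\<Sum>l\<in>I. x l * DX l i x)) =
       (\<Sum>i\<in>I. x i / r\<^sup>2 * ((\<delta> i j - x j * x i / r\<^sup>2) * D - 2 * h x * x i * x j / r\<^sup>2))"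
      by (intro sum.cong refl) (simp add: a D_def)
    also have "\<dots> = D / r\<^sup>2 * (\<Sum>i\<in>I. x i * (\<delta> i j - x j * x i / r\<^sup>2)) - 2 * h x * x j / r ^ 4 * (\<Sum>i\<in>I. x i * x i)"
      unfolding sum_distrib_left sum_subtractf[symmetric]
      by (intro sum.cong refl) (simp add: algebra_simps add_divide_distrib diff_divide_distrib power4_eq_xxxx power2_eq_square)
    finally show ?thesis using tang[OF x] n2[OF x] r by (simp add: power4_eq_xxxx power2_eq_square)
  qed
  finally show "sph_div I r (pole_field j r h) x =
      dh j x - x j / r\<^sup>2 * (\<Sum>l\<in>I. x l * dh l x) - (real (card I) - 1) / r\<^sup>2 * x j * h x"
    by (simp add: algebra_simps add_divide_distrib diff_divide_distrib)
qed

text \<open>The squared positive part is the elementary C1 function from which the soft boxes, the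
  bumps and the cutoff near the poles are all built.\<close>

lemma DERIV_max0_power2: "((\<lambda>t. (max 0 t)\<^sup>2) has_real_derivative 2 * max 0 x) (at (x::real))"
proof -
  consider "x > 0" | "x < 0" | "x = 0" by linarith
  thus ?thesis
  proof cases
    case 1
    have "((\<lambda>t. t\<^sup>2) has_real_derivative 2 * max 0 x) (at x)" using 1 by (auto intro!: derivative_eq_intros)
    thus ?thesis by (rule has_field_derivative_transform_within_open[where S="{0<..}"]) (use 1 in auto)
  next
    case 2
    have "((\<lambda>t. 0) has_real_derivative 2 * max 0 x) (at x)" using 2 by (auto intro!: derivative_eq_intros)
    thus ?thesis by (rule has_field_derivative_transform_within_open[where S="{..<0}"]) (use 2 in auto)
  next
    case 3
    have "((\<lambda>h. ((max 0 h)\<^sup>2 - (max 0 0)\<^sup>2) / (h - 0)) \<longlongrightarrow> 0) (at (0::real))"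
    proof (rule Lim_null_comparison)
      show "\<forall>\<^sub>F h in at 0. norm (((max 0 h)\<^sup>2 - (max 0 0)\<^sup>2) / (h - 0)) \<le> \<bar>h::real\<bar>"
        by (rule always_eventually) (auto simp: max_def power2_eq_square)
      show "((\<lambda>h. \<bar>h::real\<bar>) \<longlongrightarrow> 0) (at 0)" by (rule tendsto_rabs_zero) (rule tendsto_ident_at)
    qed
    thus ?thesis unfolding 3 has_field_derivative_iff by simp
  qed
qed

text \<open>A C1 penalty form of the indicator of the conditions x_i \<rho>(x_j) \<le> a_i, reached
  as m grows. With m = 0 it is identically 1, so the same test lemma also gives the plain weak
  identity.\<close>

definition soft_box :: "nat set \<Rightarrow> nat \<Rightarrow> real \<Rightarrow> (real \<Rightarrow> real) \<Rightarrow> (nat \<Rightarrow> real) \<Rightarrow> (nat \<Rightarrow> real) \<Rightarrow> real" where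
  "soft_box I j m \<rho> a x = exp (- m * (\<Sum>i\<in>I - {j}. (max 0 (x i * \<rho> (x j) - a i))\<^sup>2))"

text \<open>The condition \<open>inv\<close> says that x_i \<rho>(x_j) is constant along the pole
  field. The soft box is then transported unchanged and its derivatives drop out of the divergence,
  leaving a differential operator in x_j alone.\<close>

lemma weak_sph_grad_test:
  assumes I: "finite I" "j \<in> I" and r: "r > 0"
    and F: "weak_sph_grad I r F G"
    and \<psi>: "\<And>v. (\<psi> has_real_derivative \<psi>' v) (at v)" "continuous_on UNIV \<psi>'"
    and \<rho>: "\<And>v. (\<rho> has_real_derivative \<rho>' v) (at v)" "continuous_on UNIV \<rho>'"
    and inv: "\<And>v. \<bar>v\<bar> \<le> r \<Longrightarrow> \<psi> v \<noteq> 0 \<Longrightarrow> \<rho>' v * (1 - v\<^sup>2 / r\<^sup>2) = v * \<rho> v / r\<^sup>2"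
  shows "(\<integral>x. F x * (((1 - (x j)\<^sup>2 / r\<^sup>2) * \<psi>' (x j) - (real (card I) - 1) / r\<^sup>2 * x j * \<psi> (x j)) * soft_box I j m \<rho> a x) \<partial>usph I r)
     = - (\<integral>x. G x j * (\<psi> (x j) * soft_box I j m \<rho> a x) \<partial>usph I r)"
proof -
  define E where "E = soft_box I j m \<rho> a"
  define S where "S y = 2 * max 0 y" for y :: real
  define h where "h x = \<psi> (x j) * E x" for x
  define dh where "dh l x = (if l = j then \<psi>' (x j) * E x + \<psi> (x j) * (E x * (- m * (\<Sum>i\<in>I - {j}. S (x i * \<rho> (x j) - a i) * (x i * \<rho>' (x j)))))
     else \<psi> (x j) * (E x * (- m * (S (x l * \<rho> (x j) - a l) * \<rho> (x j)))))" for l x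
  have c\<psi>: "continuous_on UNIV \<psi>" and c\<rho>: "continuous_on UNIV \<rho>"
    using \<psi>(1) \<rho>(1) by (meson DERIV_continuous_on has_field_derivative_at_within)+
  have coord: "continuous_on (I \<rightarrow>\<^sub>E UNIV) (\<lambda>x. (x::nat\<Rightarrow>real) k)" for k
    by (rule continuous_on_subset[OF continuous_on_product_coordinates]) simp
  note cc = continuous_on_compose2[OF c\<psi> coord] continuous_on_compose2[OF c\<rho> coord]
    continuous_on_compose2[OF \<psi>(2) coord] continuous_on_compose2[OF \<rho>(2) coord]
  have cE: "continuous_on (I \<rightarrow>\<^sub>E UNIV) E"
    unfolding E_def soft_box_def by (intro continuous_intros cc coord) auto
  have 1: "continuous_on (I \<rightarrow>\<^sub>E UNIV) h"
    unfolding h_def by (intro continuous_intros cc cE) auto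
  have 3: "continuous_on (I \<rightarrow>\<^sub>E UNIV) (dh l)" if "l \<in> I" for l
  proof (cases "l = j")
    case True
    show ?thesis unfolding dh_def S_def using True by (simp, intro continuous_intros cc cE coord) auto
  next
    case False
    show ?thesis unfolding dh_def S_def using False by (simp, intro continuous_intros cc cE coord) auto
  qed
  have 2: "((\<lambda>t. h (x(l := t))) has_real_derivative dh l x) (at (x l))" if l: "l \<in> I" "x \<in> I \<rightarrow>\<^sub>E UNIV" for l x
  proof (cases "l = j")
    case True
    have "((\<lambda>t. (max 0 (x i * \<rho> t - a i))\<^sup>2) has_real_derivative S (x i * \<rho> (x j) - a i) * (x i * \<rho>' (x j))) (at (x j))" for i
      unfolding S_def by (rule DERIV_chain2[OF DERIV_max0_power2]) (auto intro!: derivative_eq_intros \<rho>(1))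
    hence "((\<lambda>t. - m * (\<Sum>i\<in>I - {j}. (max 0 (x i * \<rho> t - a i))\<^sup>2)) has_real_derivative
       - m * (\<Sum>i\<in>I - {j}. S (x i * \<rho> (x j) - a i) * (x i * \<rho>' (x j)))) (at (x j))"
      by (intro DERIV_cmult DERIV_sum)
    from DERIV_mult[OF \<psi>(1) DERIV_fun_exp[OF this]]
    have "((\<lambda>t. \<psi> t * exp (- m * (\<Sum>i\<in>I - {j}. (max 0 (x i * \<rho> t - a i))\<^sup>2))) has_real_derivative dh j x) (at (x j))"
      by (simp add: dh_def E_def soft_box_def mult.commute mult.left_commute)
    moreover have "(\<Sum>i\<in>I - {j}. (max 0 ((x(j := t)) i * \<rho> ((x(j := t)) j) - a i))\<^sup>2) =
       (\<Sum>i\<in>I - {j}. (max 0 (x i * \<rho> t - a i))\<^sup>2)" for t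
      by (rule sum.cong) auto
    ultimately show ?thesis unfolding True h_def E_def soft_box_def by simp
  next
    case False
    have d: "((\<lambda>t. (max 0 (t * \<rho> (x j) - a l))\<^sup>2) has_real_derivative S (x l * \<rho> (x j) - a l) * \<rho> (x j)) (at (x l))"
      unfolding S_def by (rule DERIV_chain2[OF DERIV_max0_power2]) (auto intro!: derivative_eq_intros)
    have l': "l \<in> I - {j}" using l False by simp
    have eq: "(\<Sum>i\<in>I - {j}. (max 0 ((x(l := t)) i * \<rho> ((x(l := t)) j) - a i))\<^sup>2) =
       (max 0 (t * \<rho> (x j) - a l))\<^sup>2 + (\<Sum>i\<in>I - {j} - {l}. (max 0 (x i * \<rho> (x j) - a i))\<^sup>2)" for t
      using False I by (subst sum.remove[OF _ l']) (auto intro!: sum.cong)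
    have "((\<lambda>t. - m * (\<Sum>i\<in>I - {j}. (max 0 ((x(l := t)) i * \<rho> ((x(l := t)) j) - a i))\<^sup>2)) has_real_derivative
       - m * (S (x l * \<rho> (x j) - a l) * \<rho> (x j) + 0)) (at (x l))"
      unfolding eq by (intro DERIV_cmult DERIV_add d DERIV_const)
    from DERIV_cmult[OF DERIV_fun_exp[OF this], of "\<psi> (x j)"]
    show ?thesis using False by (simp add: h_def E_def soft_box_def dh_def)
  qed
  have pf1: "C1_tangent_field I r (pole_field j r h)"
    by (rule pole_field_C1(1)[OF I r 1, of dh]) (use 2 3 in blast)+
  have pf2: "sph_div I r (pole_field j r h) x =
      dh j x - x j / r\<^sup>2 * (\<Sum>l\<in>I. x l * dh l x) - (real (card I) - 1) / r\<^sup>2 * x j * h x" if "x \<in> sph I r" for x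
    by (rule pole_field_C1(2)[OF I r 1, of dh]) (use 2 3 that in blast)+
  have div: "sph_div I r (pole_field j r h) x = ((1 - (x j)\<^sup>2 / r\<^sup>2) * \<psi>' (x j) - (real (card I) - 1) / r\<^sup>2 * x j * \<psi> (x j)) * E x"
    if x: "x \<in> sph I r" for x
  proof -
    define K where "K i = \<psi> (x j) * E x * (- m) * S (x i * \<rho> (x j) - a i) * x i" for i
    have xj: "\<bar>x j\<bar> \<le> r"
      using member_le_L2_set[OF I, of x] x L2_set_nonneg[of x I] member_le_L2_set[OF I, of "\<lambda>i. - x i"]
      by (auto simp: sph_def L2_set_def)
    have "dh j x = \<psi>' (x j) * E x + \<rho>' (x j) * (\<Sum>i\<in>I - {j}. K i)"
      by (simp add: dh_def K_def sum_distrib_left algebra_simps)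
    moreover have "(\<Sum>l\<in>I. x l * dh l x) = x j * dh j x + \<rho> (x j) * (\<Sum>i\<in>I - {j}. K i)"
      unfolding sum.remove[OF I] sum_distrib_left
      by (intro arg_cong2[where f="(+)"] sum.cong refl) (auto simp: dh_def K_def)
    ultimately have "dh j x - x j / r\<^sup>2 * (\<Sum>l\<in>I. x l * dh l x)
       = (1 - (x j)\<^sup>2 / r\<^sup>2) * \<psi>' (x j) * E x + (\<rho>' (x j) * (1 - (x j)\<^sup>2 / r\<^sup>2) - x j * \<rho> (x j) / r\<^sup>2) * (\<Sum>i\<in>I - {j}. K i)"
      by (simp add: algebra_simps power2_eq_square diff_divide_distrib add_divide_distrib)
    also have "(\<rho>' (x j) * (1 - (x j)\<^sup>2 / r\<^sup>2) - x j * \<rho> (x j) / r\<^sup>2) * (\<Sum>i\<in>I - {j}. K i) = 0"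
      using inv[OF xj] by (cases "\<psi> (x j) = 0") (auto simp: K_def)
    finally show ?thesis unfolding pf2[OF x] by (simp add: h_def algebra_simps)
  qed
  have "(\<integral>x. F x * (((1 - (x j)\<^sup>2 / r\<^sup>2) * \<psi>' (x j) - (real (card I) - 1) / r\<^sup>2 * x j * \<psi> (x j)) * E x) \<partial>usph I r)
     = (\<integral>x. F x * sph_div I r (pole_field j r h) x \<partial>usph I r)"
    by (rule Bochner_Integration.integral_cong) (auto simp: div space_usph)
  also have "\<dots> = - (\<integral>x. (\<Sum>i\<in>I. G x i * pole_field j r h x i) \<partial>usph I r)"
    using F pf1 by (auto simp: weak_sph_grad_def)
  also have "(\<integral>x. (\<Sum>i\<in>I. G x i * pole_field j r h x i) \<partial>usph I r) = (\<integral>x. G x j * (\<psi> (x j) * E x) \<partial>usph I r)"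
  proof -
    \<comment> \<open>Since \<open>G\<close> is tangential, the radial part of the pole field pairs
      to zero with it and only the component \<open>G x j\<close> survives.\<close>
    have "AE x in usph I r. (\<Sum>i\<in>I. x i * G x i) = 0" using F by (simp add: weak_sph_grad_def)
    hence ae: "AE x in usph I r. (\<Sum>i\<in>I. G x i * pole_field j r h x i) = G x j * (\<psi> (x j) * E x)"
    proof eventually_elim
      case (elim x)
      have "(\<Sum>i\<in>I. G x i * pole_field j r h x i) = h x * (\<Sum>i\<in>I. G x i * (if i = j then 1 else 0)) - h x * x j / r\<^sup>2 * (\<Sum>i\<in>I. x i * G x i)"
        unfolding sum_distrib_left sum_subtractf[symmetric]
        by (intro sum.cong refl) (auto simp: pole_field_def algebra_simps)
      thus ?case using I unfolding elim by (simp add: sum_delta_mult h_def)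
    qed
    have Gm: "(\<lambda>x. G x i) \<in> borel_measurable (usph I r)" if "i \<in> I" for i
      using F that by (auto simp: weak_sph_grad_def)
    have ne: "I \<noteq> {}" using I by auto
    note lift = measurable_usph_of_lbp[OF I(1) ne less_imp_le[OF r]]
    have xm: "(\<lambda>x. x i) \<in> borel_measurable (usph I r)" if "i \<in> I" for i
      using that by (intro lift) simp
    have [measurable]: "\<psi> \<in> borel_measurable borel" "\<rho> \<in> borel_measurable borel"
      using c\<psi> c\<rho> by (auto intro: borel_measurable_continuous_onI)
    have Em: "E \<in> borel_measurable (usph I r)"
      unfolding E_def soft_box_def using I by (intro lift) measurable
    have hm: "h \<in> borel_measurable (usph I r)"
      unfolding h_def using I xm[OF I(2)] Em by measurable
    show ?thesis
    proof (rule integral_cong_AE[OF _ _ ae])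
      show "(\<lambda>x. \<Sum>i\<in>I. G x i * pole_field j r h x i) \<in> borel_measurable (usph I r)"
        unfolding pole_field_def
        by (intro borel_measurable_sum borel_measurable_times borel_measurable_diff borel_measurable_divide Gm hm xm I) auto
      show "(\<lambda>x. G x j * (\<psi> (x j) * E x)) \<in> borel_measurable (usph I r)"
        by (rule borel_measurable_times[OF Gm[OF I(2)] hm[unfolded h_def]])
    qed
  qed
  finally show ?thesis by (simp add: E_def)
qed

section \<open>The weak gradient on the zero set of the density\<close>

lemma integrable_on_Icc_lborel:
  fixes f :: "real \<Rightarrow> real"
  assumes "integrable lborel f"
  shows "f integrable_on {c..d}" "integral {c..d} f = (\<integral>x. indicator {c..d} x * f x \<partial>lborel)"
proof -
  have i: "set_integrable lborel {c..d} f"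
    unfolding set_integrable_def using assms by (intro integrable_mult_indicator) auto
  show "f integrable_on {c..d}" using set_borel_integral_eq_integral(1)[OF i] .
  show "integral {c..d} f = (\<integral>x. indicator {c..d} x * f x \<partial>lborel)"
    using set_borel_integral_eq_integral(2)[OF i] by (simp add: set_lebesgue_integral_def)
qed

lemma lebesgue_differentiation_right:
  fixes f :: "real \<Rightarrow> real"
  assumes "integrable lborel f"
  shows "AE u in lborel. ((\<lambda>h. integral {u..u+h} f / h) \<longlongrightarrow> f u) (at_right 0)"
proof -
  have "f integrable_on cbox a b" for a b
    using integrable_on_Icc_lborel(1)[OF assms] by (simp add: cbox_interval)
  then obtain N where N: "negligible N"
    "\<And>x e. x \<notin> N \<Longrightarrow> 0 < e \<Longrightarrow> \<exists>d>0. \<forall>h. 0 < h \<and> h < d \<longrightarrow>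
       norm (integral (cbox x (x + h *\<^sub>R One)) f /\<^sub>R h ^ DIM(real) - f x) < e"
    by (rule integrable_ccontinuous_explicit) blast
  have "AE u in lebesgue. u \<notin> N" using N(1) by (simp add: negligible_iff_null_sets AE_not_in)
  hence "AE u in lborel. u \<notin> N" by (simp add: AE_completion_iff)
  thus ?thesis
  proof eventually_elim
    case (elim u)
    show ?case
    proof (rule tendstoI)
      fix e :: real assume "e > 0"
      from N(2)[OF elim this] obtain d where d: "d > 0"
        "\<And>h. 0 < h \<Longrightarrow> h < d \<Longrightarrow> norm (integral (cbox u (u + h *\<^sub>R One)) f /\<^sub>R h ^ DIM(real) - f u) < e" by blast
      show "\<forall>\<^sub>F h in at_right 0. dist (integral {u..u+h} f / h) (f u) < e"
        using eventually_at_right_real[OF d(1)]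
        by eventually_elim (use d(2) in \<open>auto simp: dist_real_def cbox_interval divide_inverse mult.commute\<close>)
    qed
  qed
qed

lemma continuous_integral_Icc_right:
  fixes f :: "real \<Rightarrow> real"
  assumes "integrable lborel f"
  shows "continuous_on UNIV (\<lambda>d. integral {c..d} f)"
proof (rule continuous_at_imp_continuous_on, rule ballI)
  fix x :: real
  define a where "a = min c x - 1"
  have eq: "integral {c..d} f = integral {a..max c d} f - integral {a..c} f" for d
  proof (cases "c \<le> d")
    case True
    have "integral {a..c} f + integral {c..d} f = integral {a..d} f"
      by (rule Henstock_Kurzweil_Integration.integral_combine) (use True integrable_on_Icc_lborel[OF assms] in \<open>auto simp: a_def\<close>)
    thus ?thesis using True by (simp add: max_def)
  qed (auto simp: max_def)
  have c': "continuous_on {a..max c x + 1} (\<lambda>d. integral {a..d} f)"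
    by (rule indefinite_integral_continuous_1) (rule integrable_on_Icc_lborel[OF assms])
  have "continuous_on {a<..<x + 1} (\<lambda>d. integral {a..max c d} f - integral {a..c} f)"
    by (intro continuous_intros continuous_on_compose2[OF c']) (auto simp: a_def max_def)
  hence "continuous_on {a<..<x + 1} (\<lambda>d. integral {c..d} f)" by (rule continuous_on_eq) (rule eq[symmetric])
  thus "isCont (\<lambda>d. integral {c..d} f) x"
    by (simp add: continuous_on_eq_continuous_at a_def)
qed

lemma dense_compl_AE:
  fixes a b :: real
  assumes "AE u in lborel. P u" "a < b"
  shows "\<exists>u. a < u \<and> u < b \<and> P u"
proof (rule ccontr)
  assume "\<not> ?thesis"
  hence "AE u in lborel. u \<notin> {a<..<b}" using assms(1) by (auto elim!: eventually_mono)
  hence "emeasure lborel {a<..<b} = 0" by (subst (asm) AE_iff_measurable[of "{a<..<b}"]) auto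
  thus False using assms(2) by simp
qed

text \<open>At a zero u of p \<ge> 0 the integral of q over [u, d] equals p d \<ge> 0; if u is a
  Lebesgue point of q, dividing by d - u gives q u \<ge> 0.\<close>

lemma zero_set_derivative_nonneg:
  fixes p q :: "real \<Rightarrow> real"
  assumes q: "integrable lborel q" and p0: "\<And>u. p u \<ge> 0"
    and P: "AE u in lborel. P u"
    and ftc: "\<And>c d. P c \<Longrightarrow> P d \<Longrightarrow> -b < c \<Longrightarrow> c < d \<Longrightarrow> d < b \<Longrightarrow> p d - p c = integral {c..d} q"
  shows "AE u in lborel. -b < u \<and> u < b \<and> p u = 0 \<longrightarrow> q u \<ge> 0"
  using P lebesgue_differentiation_right[OF q]
proof eventually_elim
  case (elim u)
  show ?case
  proof
    assume u: "-b < u \<and> u < b \<and> p u = 0"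
    \<comment> \<open>\<open>ftc\<close> is available only at good end points. A negative integral
      would stay negative slightly to the right of d, by continuity, and good points are dense
      there.\<close>
    have ge: "integral {u..d} q \<ge> 0" if du: "u < d" "d < b" for d
    proof (rule ccontr)
      assume "\<not> integral {u..d} q \<ge> 0"
      hence lt: "integral {u..d} q < 0" by simp
      have "isCont (\<lambda>d. integral {u..d} q) d"
        using continuous_integral_Icc_right[OF q, of u] by (simp add: continuous_on_eq_continuous_at)
      hence "((\<lambda>d. integral {u..d} q) \<longlongrightarrow> integral {u..d} q) (at_right d)"
        by (auto simp: isCont_def intro: tendsto_mono[OF at_le])
      hence "\<forall>\<^sub>F d' in at_right d. integral {u..d'} q < 0" by (rule order_tendstoD(2)) (rule lt)
      then obtain e where e: "e > d" "\<And>y. d < y \<Longrightarrow> y < e \<Longrightarrow> integral {u..y} q < 0"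
        by (auto simp: eventually_at_right_field)
      obtain y where y: "d < y" "y < min e b" "P y"
        using dense_compl_AE[OF P, of d "min e b"] e(1) du by (auto simp: min_less_iff_conj)
      have "p y - p u = integral {u..y} q" using ftc[OF elim(1) y(3)] u y du by auto
      moreover have "integral {u..y} q < 0" using e(2)[of y] y by auto
      ultimately show False using u p0[of y] by simp
    qed
    have "\<forall>\<^sub>F h in at_right 0. 0 \<le> integral {u..u+h} q / h"
      using eventually_at_right_real[of 0 "b - u"] u by (auto elim!: eventually_mono intro!: divide_nonneg_pos ge)
    thus "q u \<ge> 0" using elim(2) by (intro tendsto_lowerbound) auto
  qed
qed

lemma AE_lborel_uminus:
  assumes "AE u in lborel. P (- u :: real)" shows "AE u in lborel. P u"
proof -
  have "AE u in distr lborel borel uminus. P (- u)"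
    unfolding lborel_distr_uminus by (rule assms)
  from AE_distrD[OF _ this] show ?thesis by simp
qed

text \<open>A zero of p \<ge> 0 is a minimum. The reflected pair p(-u), -q(-u) satisfies the same
  hypotheses, which yields the opposite inequality.\<close>

lemma zero_set_derivative_zero:
  fixes p q :: "real \<Rightarrow> real"
  assumes q: "integrable lborel q" and p0: "\<And>u. p u \<ge> 0"
    and P: "AE u in lborel. P u"
    and ftc: "\<And>c d. P c \<Longrightarrow> P d \<Longrightarrow> -b < c \<Longrightarrow> c < d \<Longrightarrow> d < b \<Longrightarrow> p d - p c = integral {c..d} q"
  shows "AE u in lborel. -b < u \<and> u < b \<and> p u = 0 \<longrightarrow> q u = 0"
proof -
  have qm: "integrable lborel (\<lambda>u. - q (- u))"
    using lborel_integrable_real_affine[OF q, of "-1" 0] by simp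
  have Pm: "AE u in lborel. P (- u)" by (rule AE_lborel_uminus) (simp add: P)
  have "AE u in lborel. -b < u \<and> u < b \<and> p (- u) = 0 \<longrightarrow> - q (- u) \<ge> 0"
  proof (rule zero_set_derivative_nonneg[OF qm p0 Pm])
    fix c d assume "P (- c)" "P (- d)" "-b < c" "c < d" "d < b"
    hence "p (- c) - p (- d) = integral {-d..-c} q" by (intro ftc) auto
    also have "\<dots> = integral {c..d} (\<lambda>u. q (- u))"
      using Henstock_Kurzweil_Integration.integral_reflect_real[of "-c" "-d" q] by simp
    finally show "p (- d) - p (- c) = integral {c..d} (\<lambda>u. - q (- u))" by simp
  qed
  hence "AE u in lborel. -b < - u \<and> - u < b \<and> p (- u) = 0 \<longrightarrow> - q (- u) \<ge> 0"
    by eventually_elim auto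
  from AE_lborel_uminus[where P = "\<lambda>u. -b < u \<and> u < b \<and> p u = 0 \<longrightarrow> - q u \<ge> 0", OF this]
  have "AE u in lborel. -b < u \<and> u < b \<and> p u = 0 \<longrightarrow> - q u \<ge> 0" .
  moreover have "AE u in lborel. -b < u \<and> u < b \<and> p u = 0 \<longrightarrow> q u \<ge> 0"
    by (rule zero_set_derivative_nonneg[OF q p0 P ftc])
  ultimately show ?thesis by eventually_elim auto
qed

section \<open>Trapezoidal tests and the fundamental theorem of calculus\<close>

definition bump' :: "real \<Rightarrow> nat \<Rightarrow> real \<Rightarrow> real" where
  "bump' l n v = real n * (max 0 (v + 1 / n) - max 0 v - max 0 (v - l) + max 0 (v - l - 1 / n))"

text \<open>The C1 primitive of the trapezoid \<open>bump'\<close>, which is 1 on [0, l] with ramps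
  of width 1/n on both sides. As n grows the pair tends to \<open>clip\<close> and the indicator of
  [0, l].\<close>

definition bump :: "real \<Rightarrow> nat \<Rightarrow> real \<Rightarrow> real" where
  "bump l n v = real n / 2 * ((max 0 (v + 1 / n))\<^sup>2 - (max 0 v)\<^sup>2 - (max 0 (v - l))\<^sup>2 + (max 0 (v - l - 1 / n))\<^sup>2)"

definition clip :: "real \<Rightarrow> real \<Rightarrow> real" where
  "clip l v = max 0 v - max 0 (v - l)"

lemma DERIV_bump: "((\<lambda>v. bump l n (v - c)) has_real_derivative bump' l n (v - c)) (at v)"
proof -
  have "((\<lambda>v. (max 0 (v - c + k))\<^sup>2) has_real_derivative 2 * max 0 (v - c + k) * 1) (at v)" for k
    by (rule DERIV_chain2[OF DERIV_max0_power2]) (auto intro!: derivative_eq_intros)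
  from this[of "1/n"] this[of 0] this[of "-l"] this[of "-l-1/n"]
  have "((\<lambda>v. real n / 2 * ((max 0 (v - c + 1 / n))\<^sup>2 - (max 0 (v - c + 0))\<^sup>2 - (max 0 (v - c + -l))\<^sup>2 + (max 0 (v - c + (- l - 1 / n)))\<^sup>2)) has_real_derivative
    real n / 2 * (2 * max 0 (v - c + 1/n) * 1 - 2 * max 0 (v - c + 0) * 1 - 2 * max 0 (v - c + -l) * 1 + 2 * max 0 (v - c + (- l - 1/n)) * 1)) (at v)"
    by (intro DERIV_cmult DERIV_add DERIV_diff)
  thus ?thesis unfolding bump_def bump'_def by (simp add: algebra_simps)
qed

lemma continuous_bump': "continuous_on UNIV (\<lambda>v. bump' l n (v - c))"
  unfolding bump'_def by (intro continuous_intros)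

lemma bump'_bounds: assumes "l > 0" "n > 0" shows "0 \<le> bump' l n v" "bump' l n v \<le> 1"
proof -
  define e where "e = 1 / real n"
  define X where "X = max 0 (v + e) - max 0 v - max 0 (v - l) + max 0 (v - l - e)"
  have i: "e > 0" "real n * e = 1" using assms by (auto simp: e_def)
  have "0 \<le> X \<and> X \<le> e"
    unfolding X_def using i(1) assms(1) by (cases "v \<ge> 0"; cases "v \<ge> l"; cases "v \<ge> l + e"; cases "v + e \<ge> 0") (simp_all add: max_def)
  hence X: "0 \<le> X" "X \<le> e" by blast+
  have eq: "bump' l n v = real n * X" unfolding bump'_def X_def e_def ..
  show "0 \<le> bump' l n v" unfolding eq using X(1) by (rule mult_nonneg_nonneg[OF of_nat_0_le_iff])
  show "bump' l n v \<le> 1" unfolding eq i(2)[symmetric] by (rule mult_left_mono[OF X(2) of_nat_0_le_iff])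
qed

text \<open>The quotient is the mean of \<open>max 0\<close> over [y, y + e], and
  \<open>max 0\<close> is increasing with slope at most 1.\<close>

lemma max0_power2_mean:
  assumes "e > (0::real)"
  shows "max 0 y \<le> ((max 0 (y + e))\<^sup>2 - (max 0 y)\<^sup>2) / (2 * e)"
    "((max 0 (y + e))\<^sup>2 - (max 0 y)\<^sup>2) / (2 * e) \<le> max 0 y + e"
proof -
  have "max 0 y * (2 * e) \<le> (max 0 (y + e))\<^sup>2 - (max 0 y)\<^sup>2 \<and> (max 0 (y + e))\<^sup>2 - (max 0 y)\<^sup>2 \<le> (max 0 y + e) * (2 * e)"
  proof (cases "y \<ge> 0")
    case True
    hence m: "max 0 y = y" "max 0 (y + e) = y + e" using assms by auto
    have "(y + e)\<^sup>2 - y\<^sup>2 = y * (2 * e) + e * e" by algebra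
    moreover have "(y + e) * (2 * e) = y * (2 * e) + e * e + e * e" by algebra
    moreover have "e * e \<ge> 0" by (rule zero_le_square)
    ultimately show ?thesis unfolding m by linarith
  next
    case False
    hence m: "max 0 y = 0" by simp
    have "(max 0 (y + e))\<^sup>2 \<le> e\<^sup>2" using False assms by (intro power_mono) auto
    also have "\<dots> \<le> e * (2 * e)" using assms by (simp add: power2_eq_square)
    finally show ?thesis unfolding m by simp
  qed
  thus "max 0 y \<le> ((max 0 (y + e))\<^sup>2 - (max 0 y)\<^sup>2) / (2 * e)"
    "((max 0 (y + e))\<^sup>2 - (max 0 y)\<^sup>2) / (2 * e) \<le> max 0 y + e"
    using assms by (simp_all only: pos_le_divide_eq pos_divide_le_eq mult_pos_pos zero_less_numeral)
qed

lemma bump_clip: assumes "n > 0" shows "\<bar>bump l n v - clip l v\<bar> \<le> 2 / real n"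
proof -
  define e where "e = 1 / real n"
  have e: "e > 0" "real n / 2 = 1 / (2 * e)" "2 / real n = 2 * e" using assms by (auto simp: e_def)
  have "bump l n v = ((max 0 (v + e))\<^sup>2 - (max 0 v)\<^sup>2) / (2 * e) - ((max 0 ((v - l - e) + e))\<^sup>2 - (max 0 (v - l - e))\<^sup>2) / (2 * e)"
  proof -
    have *: "k * (A - B - C + D) = (A - B) * k - (C - D) * k" for k A B C D :: real by algebra
    have "v - l - e + e = v - l" by simp
    thus ?thesis unfolding bump_def e(2) e_def[symmetric] * by simp
  qed
  moreover have "max 0 (v - l) \<le> max 0 (v - l - e) + e" "max 0 (v - l - e) \<le> max 0 (v - l)" using e(1) by auto
  ultimately show ?thesis using max0_power2_mean[OF e(1), of v] max0_power2_mean[OF e(1), of "v - l - e"]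
    unfolding clip_def e(3) by linarith
qed

lemma bump_tendsto: "(\<lambda>n. bump l (Suc n) v) \<longlonglongrightarrow> clip l v"
proof -
  have "(\<lambda>n. bump l (Suc n) v - clip l v) \<longlonglongrightarrow> 0"
  proof (rule Lim_null_comparison)
    show "\<forall>\<^sub>F n in sequentially. norm (bump l (Suc n) v - clip l v) \<le> 2 * (1 / real (Suc n))"
      using bump_clip[of "Suc n" l v for n] by (auto intro!: always_eventually simp del: of_nat_Suc)
    show "(\<lambda>n. 2 * (1 / real (Suc n))) \<longlonglongrightarrow> 0"
      using tendsto_mult_left[OF LIMSEQ_Suc[OF lim_1_over_n], of 2] by (simp del: of_nat_Suc)
  qed
  thus ?thesis by (rule LIM_zero_cancel)
qed

lemma bump'_tendsto:
  assumes "l > 0" shows "(\<lambda>n. bump' l (Suc n) v) \<longlonglongrightarrow> indicator {0..l} v"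
proof (rule tendsto_eventually)
  have lim: "\<forall>\<^sub>F n in sequentially. 1 / real (Suc n) < \<bar>d\<bar>" if "d \<noteq> 0" for d
    using order_tendstoD(2)[OF LIMSEQ_Suc[OF lim_1_over_n], of "\<bar>d\<bar>"] that by (simp del: of_nat_Suc)
  consider "v < 0" | "0 \<le> v" "v \<le> l" | "l < v" by linarith
  thus "\<forall>\<^sub>F n in sequentially. bump' l (Suc n) v = indicator {0..l} v"
  proof cases
    case 1
    have "v \<noteq> 0" using 1 by simp
    from lim[OF this] show ?thesis
    proof eventually_elim
      case (elim n)
      define e where "e = 1 / real (Suc n)"
      have e: "e > 0" "e < - v" using elim 1 by (auto simp: e_def)
      have "max 0 (v + e) - max 0 v - max 0 (v - l) + max 0 (v - l - e) = 0" using 1 e assms by simp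
      thus ?case using 1 by (simp add: bump'_def e_def)
    qed
  next
    case 2
    have "bump' l (Suc n) v = 1" for n
    proof -
      define e where "e = 1 / real (Suc n)"
      have e: "e > 0" "real (Suc n) * e = 1" by (auto simp: e_def)
      have "max 0 (v + e) - max 0 v - max 0 (v - l) + max 0 (v - l - e) = e" using 2 e(1) by simp
      thus ?thesis using e(2) by (simp add: bump'_def e_def)
    qed
    thus ?thesis using 2 by (intro always_eventually) simp
  next
    case 3
    have "v - l \<noteq> 0" using 3 by simp
    from lim[OF this] show ?thesis
    proof eventually_elim
      case (elim n)
      define e where "e = 1 / real (Suc n)"
      have e: "e > 0" "e < v - l" using elim 3 by (auto simp: e_def)
      have "max 0 (v + e) - max 0 v - max 0 (v - l) + max 0 (v - l - e) = 0" using 3 e assms by simp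
      thus ?case using 3 by (simp add: bump'_def e_def)
    qed
  qed
qed

lemma clip_bounds: "l > 0 \<Longrightarrow> 0 \<le> clip l v" "l > 0 \<Longrightarrow> clip l v \<le> l" "\<bar>clip l v - clip l v'\<bar> \<le> \<bar>v - v'\<bar>"
  by (auto simp: clip_def max_def)

lemma bump_measurable [measurable]: "bump l n \<in> borel_measurable borel" "bump' l n \<in> borel_measurable borel"
  "clip l \<in> borel_measurable borel"
  unfolding bump_def bump'_def clip_def by measurable

lemma clip_scaled_tendsto: "((\<lambda>h. clip h v / h) \<longlongrightarrow> indicator {0<..} v) (at_right 0)"
proof (rule tendsto_eventually, cases "v > 0")
  case True
  show "\<forall>\<^sub>F h in at_right 0. clip h v / h = indicator {0<..} v"
    using eventually_at_right_real[OF True] by eventually_elim (use True in \<open>auto simp: clip_def\<close>)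
next
  case False
  show "\<forall>\<^sub>F h in at_right 0. clip h v / h = indicator {0<..} v"
    using eventually_at_right_less[of 0] by eventually_elim (use False in \<open>auto simp: clip_def\<close>)
qed

text \<open>The tests are differences of two translated bumps, which have bounded support although
  each bump has a plateau. Sharpening the ramps and then shrinking the width shows that p c plus the
  integral of q beyond c takes the same value at any two Lebesgue points of p. Only rational
  parameters are tested, so that later the exceptional sets of directions form a countable
  union.\<close>

lemma ftc_of_bumps:
  fixes p q :: "real \<Rightarrow> real"
  assumes p: "integrable lborel p" and q: "integrable lborel q"
    and test: "\<And>c d l n. c \<in> \<rat> \<Longrightarrow> d \<in> \<rat> \<Longrightarrow> l \<in> \<rat> \<Longrightarrow> l > 0 \<Longrightarrow> n > 0 \<Longrightarrow>
       -b \<le> c - 1 / real n \<Longrightarrow> -b \<le> d - 1 / real n \<Longrightarrow> c + l + 1 / real n \<le> b \<Longrightarrow> d + l + 1 / real n \<le> b \<Longrightarrow>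
       (\<integral>v. p v * (bump' l n (v - c) - bump' l n (v - d)) + q v * (bump l n (v - c) - bump l n (v - d)) \<partial>lborel) = 0"
    and c: "((\<lambda>h. integral {c..c+h} p / h) \<longlongrightarrow> p c) (at_right 0)"
    and d: "((\<lambda>h. integral {d..d+h} p / h) \<longlongrightarrow> p d) (at_right 0)"
    and cd: "-b < c" "c < d" "d < b"
  shows "p d - p c = integral {c..d} q"
proof -
  have [measurable]: "p \<in> borel_measurable borel" "q \<in> borel_measurable borel"
    using p q by (auto dest: borel_measurable_integrable)
  \<comment> \<open>The limit of a single test as the ramps sharpen. \<open>A l c / l\<close> is the
    mean of p over [c, c + l] plus a regularised integral of q over the half-line beyond c.\<close>
  define A where "A l c = integral {c..c+l} p + (\<integral>v. q v * clip l (v - c) \<partial>lborel)" for l c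
  have clq: "norm (q v * clip l y) \<le> l * \<bar>q v\<bar>" if "l > 0" for l v y
  proof -
    have "\<bar>clip l y\<bar> * \<bar>q v\<bar> \<le> l * \<bar>q v\<bar>"
      by (rule mult_right_mono) (use clip_bounds(1,2)[OF that, of y] in auto)
    thus ?thesis by (simp add: abs_mult mult.commute)
  qed
  have iq: "integrable lborel (\<lambda>v. q v * clip l (v - c))" if "l > 0" for l c
    by (rule Bochner_Integration.integrable_bound[OF integrable_mult_right[OF integrable_abs[OF q], of l]])
       (use clq[OF that] that in \<open>auto intro!: AE_I2\<close>)
  have rat: "A l c = A l d" if *: "c \<in> \<rat>" "d \<in> \<rat>" "l \<in> \<rat>" "l > 0" "-b < c" "-b < d" "c + l < b" "d + l < b" for l c d
  proof -
    let ?f = "\<lambda>n v. p v * (bump' l (Suc n) (v - c) - bump' l (Suc n) (v - d)) + q v * (bump l (Suc n) (v - c) - bump l (Suc n) (v - d))"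
    let ?g = "\<lambda>v. p v * (indicator {0..l} (v - c) - indicator {0..l} (v - d)) + q v * (clip l (v - c) - clip l (v - d))"
    have "(\<lambda>n. \<integral>v. ?f n v \<partial>lborel) \<longlonglongrightarrow> (\<integral>v. ?g v \<partial>lborel)"
    proof (rule integral_dominated_convergence)
      show "integrable lborel (\<lambda>v. \<bar>p v\<bar> * 2 + \<bar>q v\<bar> * (2 * l + 4))"
        using p q by (intro Bochner_Integration.integrable_add integrable_mult_left integrable_abs)
      show "AE v in lborel. (\<lambda>n. ?f n v) \<longlonglongrightarrow> ?g v"
        using that by (intro AE_I2 tendsto_intros bump'_tendsto bump_tendsto)
      show "AE v in lborel. norm (?f n v) \<le> \<bar>p v\<bar> * 2 + \<bar>q v\<bar> * (2 * l + 4)" for n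
      proof (rule AE_I2)
        fix v
        have b1: "\<bar>bump' l (Suc n) (v - c) - bump' l (Suc n) (v - d)\<bar> \<le> 2"
          using bump'_bounds[OF *(4), of "Suc n" "v - c"] bump'_bounds[OF *(4), of "Suc n" "v - d"] by linarith
        have "2 / real (Suc n) \<le> 2" by (simp add: divide_le_eq)
        hence b2: "\<bar>bump l (Suc n) (v - c) - bump l (Suc n) (v - d)\<bar> \<le> 2 * l + 4"
          using bump_clip[of "Suc n" l "v - c"] bump_clip[of "Suc n" l "v - d"] clip_bounds(1,2)[OF *(4), of "v - c"] clip_bounds(1,2)[OF *(4), of "v - d"]
          by linarith
        show "norm (?f n v) \<le> \<bar>p v\<bar> * 2 + \<bar>q v\<bar> * (2 * l + 4)"
          unfolding real_norm_def
          by (rule order_trans[OF abs_triangle_ineq]) (auto simp: abs_mult intro!: add_mono mult_left_mono b1 b2)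
      qed
    qed measurable
    moreover have "\<forall>\<^sub>F n in sequentially. (\<integral>v. ?f n v \<partial>lborel) = 0"
    proof -
      define m where "m = Min {c + b, d + b, b - c - l, b - d - l}"
      have m: "m > 0" "m \<le> c + b" "m \<le> d + b" "m \<le> b - c - l" "m \<le> b - d - l" using * by (auto simp: m_def)
      have "\<forall>\<^sub>F n in sequentially. 1 / real (Suc n) < m"
        using order_tendstoD(2)[OF LIMSEQ_Suc[OF lim_1_over_n] m(1)] by (simp del: of_nat_Suc)
      thus ?thesis by eventually_elim (rule test, use * m in \<open>auto simp del: of_nat_Suc\<close>)
    qed
    ultimately have "(\<integral>v. ?g v \<partial>lborel) = 0"
      by (rule LIMSEQ_unique[OF _ tendsto_eventually])
    moreover have "(\<integral>v. ?g v \<partial>lborel) = A l c - A l d"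
    proof -
      have e: "integral {c..c+l} p = (\<integral>v. p v * indicator {0..l} (v - c) \<partial>lborel)" for c
        unfolding integrable_on_Icc_lborel(2)[OF p]
        by (rule Bochner_Integration.integral_cong) (auto simp: indicator_def)
      have i: "integrable lborel (\<lambda>v. p v * indicator {0..l} (v - c))" for c
        by (rule Bochner_Integration.integrable_bound[OF p]) (auto simp: indicator_def)
      have "(\<integral>v. ?g v \<partial>lborel) = (\<integral>v. (p v * indicator {0..l} (v - c) + q v * clip l (v - c)) - (p v * indicator {0..l} (v - d) + q v * clip l (v - d)) \<partial>lborel)"
        by (rule Bochner_Integration.integral_cong) (auto simp: algebra_simps)
      thus ?thesis unfolding A_def e using *(4) by (simp add: i iq)
    qed
    ultimately show ?thesis by simp
  qed
  have contA: "continuous_on UNIV (A l)" if l: "l > 0" for l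
  proof -
    have 1: "continuous_on UNIV (\<lambda>c. integral {c..c+l} p)"
    proof (rule continuous_at_imp_continuous_on, rule ballI)
      fix x :: real
      define a where "a = x - 1"
      have eq: "integral {c..c+l} p = integral {a..c+l} p - integral {a..c} p" if "c > a" for c
        using Henstock_Kurzweil_Integration.integral_combine[of a c "c + l" p] that l integrable_on_Icc_lborel(1)[OF p] by simp
      have "continuous_on {a<..} (\<lambda>c. integral {a..c+l} p - integral {a..c} p)"
        by (intro continuous_intros continuous_on_compose2[OF continuous_integral_Icc_right[OF p, of a]]) auto
      hence "continuous_on {a<..} (\<lambda>c. integral {c..c+l} p)" 
        by (rule continuous_on_eq) (simp add: eq)
      thus "isCont (\<lambda>c. integral {c..c+l} p) x" by (simp add: continuous_on_eq_continuous_at a_def)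
    qed
    have 2: "continuous_on UNIV (\<lambda>c. \<integral>v. q v * clip l (v - c) \<partial>lborel)"
    proof (rule continuous_at_imp_continuous_on, rule ballI)
      fix x :: real
      show "isCont (\<lambda>c. \<integral>v. q v * clip l (v - c) \<partial>lborel) x"
        unfolding isCont_def
      proof (rule tendsto_at_iff_sequentially[THEN iffD2], intro allI impI)
        fix X :: "nat \<Rightarrow> real" assume X: "\<forall>i. X i \<in> UNIV - {x}" "X \<longlonglongrightarrow> x"
        have "(\<lambda>i. \<integral>v. q v * clip l (v - X i) \<partial>lborel) \<longlonglongrightarrow> (\<integral>v. q v * clip l (v - x) \<partial>lborel)"
        proof (rule integral_dominated_convergence)
          show "integrable lborel (\<lambda>v. l * \<bar>q v\<bar>)" using q by (intro integrable_mult_right integrable_abs)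
          show "AE v in lborel. (\<lambda>i. q v * clip l (v - X i)) \<longlonglongrightarrow> q v * clip l (v - x)"
            unfolding clip_def by (intro AE_I2 tendsto_intros X)
          show "AE v in lborel. norm (q v * clip l (v - X i)) \<le> l * \<bar>q v\<bar>" for i
            using clq[OF l] by (intro AE_I2)
        qed measurable
        thus "((\<lambda>c. \<integral>v. q v * clip l (v - c) \<partial>lborel) \<circ> X) \<longlonglongrightarrow> (\<integral>v. q v * clip l (v - x) \<partial>lborel)" by (simp add: o_def)
      qed
    qed
    show ?thesis unfolding A_def by (intro continuous_intros 1 2)
  qed
  have ratdense: "\<exists>X. (\<forall>n. X n \<in> \<rat>) \<and> X \<longlonglongrightarrow> (x::real)" for x
    using closure_sequential[of x \<rat>] Rats_closure_real by auto
  have real: "A l c = A l d" if *: "l \<in> \<rat>" "l > 0" "c + l < b" "d + l < b" for l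
  proof -
    obtain X Y where X: "\<And>n. X n \<in> \<rat>" "X \<longlonglongrightarrow> c" and Y: "\<And>n. Y n \<in> \<rat>" "Y \<longlonglongrightarrow> d" using ratdense by meson
    have lim: "(\<lambda>n. A l (X n)) \<longlonglongrightarrow> A l c" "(\<lambda>n. A l (Y n)) \<longlonglongrightarrow> A l d"
      using contA[OF *(2)] X(2) Y(2) by (auto intro!: continuous_on_tendsto_compose[of UNIV "A l"])
    have ev: "\<forall>\<^sub>F n in sequentially. A l (X n) = A l (Y n)"
    proof -
      have "\<forall>\<^sub>F n in sequentially. -b < X n" "\<forall>\<^sub>F n in sequentially. X n < b - l"
        using order_tendstoD[OF X(2)] cd * by auto
      moreover have "\<forall>\<^sub>F n in sequentially. -b < Y n" "\<forall>\<^sub>F n in sequentially. Y n < b - l"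
        using order_tendstoD[OF Y(2)] cd * by auto
      ultimately show ?thesis by eventually_elim (rule rat, use X(1) Y(1) * in auto)
    qed
    show ?thesis using LIMSEQ_unique[OF tendsto_cong[THEN iffD1, OF ev lim(1)] lim(2)] .
  qed
  \<comment> \<open>The widths stay rational, so density is used only for the positions c and
    d.\<close>
  define l where "l n = 1 / real (Suc n)" for n
  have l: "l n > 0" "l n \<in> \<rat>" "l n \<le> 1" for n by (auto simp: l_def)
  have l0: "l \<longlonglongrightarrow> 0" unfolding l_def using LIMSEQ_Suc[OF lim_1_over_n] by simp
  have lr: "filterlim l (at_right 0) sequentially"
  proof -
    have "l n \<noteq> 0" for n using l(1)[of n] by simp
    thus ?thesis unfolding filterlim_at using l0 l(1) by (auto intro!: always_eventually)
  qed
  have L: "(\<lambda>n. A (l n) e / l n) \<longlonglongrightarrow> p e + (\<integral>v. q v * indicator {0<..} (v - e) \<partial>lborel)"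
    if "((\<lambda>h. integral {e..e+h} p / h) \<longlongrightarrow> p e) (at_right 0)" for e
  proof -
    have "(\<lambda>n. integral {e..e + l n} p / l n) \<longlonglongrightarrow> p e"
      using filterlim_compose[OF that lr] .
    moreover have "(\<lambda>n. \<integral>v. q v * (clip (l n) (v - e) / l n) \<partial>lborel) \<longlonglongrightarrow> (\<integral>v. q v * indicator {0<..} (v - e) \<partial>lborel)"
    proof (rule integral_dominated_convergence)
      show "integrable lborel (\<lambda>v. \<bar>q v\<bar>)" using q by simp
      show "AE v in lborel. (\<lambda>i. q v * (clip (l i) (v - e) / l i)) \<longlonglongrightarrow> q v * indicator {0<..} (v - e)"
        by (intro AE_I2 tendsto_mult tendsto_const filterlim_compose[OF clip_scaled_tendsto lr])
      show "AE v in lborel. norm (q v * (clip (l i) (v - e) / l i)) \<le> \<bar>q v\<bar>" for i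
      proof (rule AE_I2)
        fix v
        have "norm (q v * (clip (l i) (v - e) / l i)) = norm (q v * clip (l i) (v - e)) / l i"
          using l(1)[of i] by (simp add: abs_mult)
        also have "\<dots> \<le> \<bar>q v\<bar>"
          using clq[OF l(1)[of i], of v "v - e"] l(1)[of i] by (simp add: pos_divide_le_eq mult.commute)
        finally show "norm (q v * (clip (l i) (v - e) / l i)) \<le> \<bar>q v\<bar>" .
      qed
    qed measurable
    moreover have "A (l n) e / l n = integral {e..e + l n} p / l n + (\<integral>v. q v * (clip (l n) (v - e) / l n) \<partial>lborel)" for n
      by (simp add: A_def add_divide_distrib)
    ultimately show ?thesis by (simp add: tendsto_add)
  qed
  have ev: "\<forall>\<^sub>F n in sequentially. A (l n) c / l n = A (l n) d / l n"
  proof -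
    have "\<forall>\<^sub>F n in sequentially. l n < b - d" using order_tendstoD(2)[OF l0] cd by auto
    thus ?thesis by eventually_elim (simp add: real[OF l(2,1)] cd, use cd real[OF l(2,1)] in auto)
  qed
  have "p c + (\<integral>v. q v * indicator {0<..} (v - c) \<partial>lborel) = p d + (\<integral>v. q v * indicator {0<..} (v - d) \<partial>lborel)"
    using LIMSEQ_unique[OF tendsto_cong[THEN iffD1, OF ev L[OF c]] L[OF d]] .
  moreover have "(\<integral>v. q v * indicator {0<..} (v - c) \<partial>lborel) - (\<integral>v. q v * indicator {0<..} (v - d) \<partial>lborel) = integral {c..d} q"
  proof -
    have i: "integrable lborel (\<lambda>v. q v * indicator {0<..} (v - e))" for e
      by (rule Bochner_Integration.integrable_bound[OF q]) (auto simp: indicator_def)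
    have "(\<integral>v. q v * indicator {0<..} (v - c) \<partial>lborel) - (\<integral>v. q v * indicator {0<..} (v - d) \<partial>lborel)
       = (\<integral>v. q v * indicator {0<..} (v - c) - q v * indicator {0<..} (v - d) \<partial>lborel)"
      by (simp add: i)
    also have "\<dots> = (\<integral>v. indicator {c..d} v * q v \<partial>lborel)"
    proof (rule integral_cong_AE)
      have "AE v in lborel. v \<noteq> c" by (rule AE_lborel_singleton)
      thus "AE v in lborel. q v * indicator {0<..} (v - c) - q v * indicator {0<..} (v - d) = indicator {c..d} v * q v"
        by eventually_elim (use cd in \<open>auto simp: indicator_def\<close>)
    qed measurable
    finally show ?thesis by (simp add: integrable_on_Icc_lborel(2)[OF q])
  qed
  ultimately show ?thesis by simp
qed

text \<open>The lower orthants are stable under intersection and generate the product sigma-algebra,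
  so a density with zero integral on all of them vanishes.\<close>

lemma AE_zero_of_boxes:
  fixes Q :: "(nat \<Rightarrow> real) \<Rightarrow> real"
  assumes J: "finite J" and P: "sets P = sets (lbp J)" and Q: "integrable P Q"
    and zero: "\<And>a. (\<integral>w. indicator {w. \<forall>i\<in>J. w i \<le> a i} w * Q w \<partial>P) = 0"
  shows "AE w in P. Q w = 0"
proof -
  define E :: "(nat \<Rightarrow> real) set set" where "E = {{f \<in> J \<rightarrow>\<^sub>E UNIV. \<forall>i\<in>J. f i \<in> A i} |A. A \<in> Pi J (\<lambda>_. range atMost)}"
  have spP: "space P = J \<rightarrow>\<^sub>E UNIV" using sets_eq_imp_space_eq[OF P] by (simp add: space_lbp)
  have EP: "E \<subseteq> Pow (J \<rightarrow>\<^sub>E UNIV)" by (auto simp: E_def)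
  have boxE: "{f \<in> J \<rightarrow>\<^sub>E UNIV. \<forall>i\<in>J. f i \<le> a i} \<in> E" for a
    unfolding E_def by (auto intro!: exI[of _ "\<lambda>i. {..a i}"])
  have Ebox: "\<exists>a. X = {f \<in> J \<rightarrow>\<^sub>E UNIV. \<forall>i\<in>J. f i \<le> a i}" if X: "X \<in> E" for X
  proof -
    from X[unfolded E_def mem_Collect_eq] obtain A
      where A: "A \<in> Pi J (\<lambda>_. range atMost)" "X = {f \<in> J \<rightarrow>\<^sub>E UNIV. \<forall>i\<in>J. f i \<in> A i}"
      by (elim exE conjE)
    have "\<forall>i\<in>J. \<exists>b. A i = {..b}" using A(1) by (auto simp: Pi_def)
    then obtain a where "\<forall>i\<in>J. A i = {..a i}" by metis
    thus ?thesis using A(2) by (intro exI[of _ a]) auto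
  qed
  have gen: "sets (lbp J) = sigma_sets (J \<rightarrow>\<^sub>E UNIV) E"
  proof -
    have "sets (lbp J) = sets (Pi\<^sub>M J (\<lambda>_. sigma UNIV (range atMost :: real set set)))"
      by (rule sets_PiM_cong) (simp_all add: borel_eq_atMost[symmetric])
    also have "\<dots> = sets (sigma (J \<rightarrow>\<^sub>E UNIV) {{f \<in> J \<rightarrow>\<^sub>E UNIV. \<forall>i\<in>j. f i \<in> A i} |A j. j \<in> {J} \<and> A \<in> Pi j (\<lambda>_. range atMost)})"
    proof (rule sets_PiM_sigma)
      have "(UNIV :: real set) = (\<Union>n::nat. {..real n})" by (auto simp: real_arch_simple)
      thus "\<exists>S\<subseteq>range atMost. countable S \<and> (UNIV :: real set) = \<Union>S"
        by (intro exI[of _ "range (\<lambda>n::nat. {..real n})"]) auto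
    qed (use J in auto)
    also have "\<dots> = sigma_sets (J \<rightarrow>\<^sub>E UNIV) E"
      unfolding E_def by (subst sets_measure_of) (auto intro!: arg_cong[where f="sigma_sets _"])
    finally show ?thesis .
  qed
  have Es: "X \<in> sets P" if "X \<in> E" for X using that unfolding P gen by (rule sigma_sets.Basic)
  have [measurable]: "Q \<in> borel_measurable P" using Q by auto
  have em: "emeasure (density P (\<lambda>w. ennreal (R w))) X = (\<integral>\<^sup>+w. ennreal (indicator X w * R w) \<partial>P)"
    if "R \<in> borel_measurable P" "X \<in> sets P" for R :: "_ \<Rightarrow> real" and X
    using that by (subst emeasure_density) (auto intro!: nn_integral_cong simp: indicator_def)
  have fin: "(\<integral>\<^sup>+w. ennreal (indicator X w * Q w) \<partial>P) < \<infinity> \<and> (\<integral>\<^sup>+w. ennreal (indicator X w * - Q w) \<partial>P) < \<infinity>" if "X \<in> sets P" for X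
  proof -
    have "integrable P (\<lambda>w. indicator X w * Q w)" "integrable P (\<lambda>w. indicator X w * - Q w)"
      using integrable_mult_indicator[OF that Q] integrable_mult_indicator[OF that integrable_minus[OF Q]] by auto
    thus ?thesis by (auto simp: real_integrable_def less_top)
  qed
  \<comment> \<open>\<open>ennreal\<close> truncates negative values to 0: these are the measures of
    the positive and the negative part of \<open>Q\<close>, both finite, and uniqueness of measures
    applies to them.\<close>
  have "density P (\<lambda>w. ennreal (Q w)) = density P (\<lambda>w. ennreal (- Q w))"
  proof (rule measure_eqI_generator_eq[of E "J \<rightarrow>\<^sub>E UNIV"])
    show "Int_stable E"
    proof (rule Int_stableI)
      fix X Y assume "X \<in> E" "Y \<in> E"
      then obtain a b where "X = {f \<in> J \<rightarrow>\<^sub>E UNIV. \<forall>i\<in>J. f i \<le> a i}" "Y = {f \<in> J \<rightarrow>\<^sub>E UNIV. \<forall>i\<in>J. f i \<le> b i}"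
        using Ebox by meson
      hence "X \<inter> Y = {f \<in> J \<rightarrow>\<^sub>E UNIV. \<forall>i\<in>J. f i \<le> min (a i) (b i)}" by auto
      thus "X \<inter> Y \<in> E" by (simp only: boxE)
    qed
    show "E \<subseteq> Pow (J \<rightarrow>\<^sub>E UNIV)" by fact
    fix X assume X: "X \<in> E"
    obtain a where a: "X = {f \<in> J \<rightarrow>\<^sub>E UNIV. \<forall>i\<in>J. f i \<le> a i}" using Ebox[OF X] by blast
    have i: "integrable P (\<lambda>w. indicator X w * Q w)" using integrable_mult_indicator[OF Es[OF X] Q] by simp
    have "(\<integral>w. indicator X w * Q w \<partial>P) = (\<integral>w. indicator {w. \<forall>i\<in>J. w i \<le> a i} w * Q w \<partial>P)"
      by (rule Bochner_Integration.integral_cong) (auto simp: a spP indicator_def)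
    hence "enn2real (\<integral>\<^sup>+w. ennreal (indicator X w * Q w) \<partial>P) = enn2real (\<integral>\<^sup>+w. ennreal (- (indicator X w * Q w)) \<partial>P)"
      using real_lebesgue_integral_def[OF i] zero[of a] by simp
    hence "ennreal (enn2real (\<integral>\<^sup>+w. ennreal (indicator X w * Q w) \<partial>P)) = ennreal (enn2real (\<integral>\<^sup>+w. ennreal (indicator X w * - Q w) \<partial>P))"
      by simp
    hence "(\<integral>\<^sup>+w. ennreal (indicator X w * Q w) \<partial>P) = (\<integral>\<^sup>+w. ennreal (indicator X w * - Q w) \<partial>P)"
      using fin[OF Es[OF X]] by (simp only: ennreal_enn2real infinity_ennreal_def)
    thus "emeasure (density P (\<lambda>w. ennreal (Q w))) X = emeasure (density P (\<lambda>w. ennreal (- Q w))) X"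
      by (simp only: em Es[OF X] \<open>Q \<in> borel_measurable P\<close> borel_measurable_uminus)
  next
    define A where "A n = {f \<in> J \<rightarrow>\<^sub>E UNIV. \<forall>i\<in>J. f i \<le> real n}" for n
    show "range A \<subseteq> E" using boxE by (auto simp: A_def)
    show "(\<Union>n. A n) = J \<rightarrow>\<^sub>E UNIV"
    proof
      show "J \<rightarrow>\<^sub>E UNIV \<subseteq> (\<Union>n. A n)"
      proof
        fix f :: "nat \<Rightarrow> real" assume f: "f \<in> J \<rightarrow>\<^sub>E UNIV"
        obtain n where n: "(\<Sum>i\<in>J. \<bar>f i\<bar>) \<le> real n" using real_arch_simple by blast
        have "f i \<le> real n" if "i \<in> J" for i
          using member_le_sum[OF that, of "\<lambda>i. \<bar>f i\<bar>"] J n by fastforce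
        thus "f \<in> (\<Union>n. A n)" using f by (auto simp: A_def)
      qed
    qed (auto simp: A_def)
    show "emeasure (density P (\<lambda>w. ennreal (Q w))) (A i) \<noteq> \<infinity>" for i
    proof -
      have "A i \<in> sets P" using boxE Es by (auto simp: A_def)
      thus ?thesis using fin by (simp add: em less_top)
    qed
  qed (simp_all add: P gen)
  moreover have "(\<integral>\<^sup>+w. ennreal (Q w) \<partial>P) \<noteq> \<infinity>" using Q by (simp add: real_integrable_def)
  ultimately have "AE w in P. ennreal (Q w) = ennreal (- Q w)"
    by (subst (asm) finite_density_unique) auto
  thus ?thesis
  proof eventually_elim
    case (elim w)
    thus ?case by (cases "Q w \<ge> 0") (auto simp: ennreal_neg)
  qed
qed

text \<open>The factor \<open>soft_box\<close> is constant along the field only if \<open>\<rho> v = (r\<^sup>2 - v\<^sup>2) powr (-1/2)\<close>,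
  which is singular at the poles; the cutoff below keeps it of class \<open>C\<^sup>1\<close> on all of \<open>\<real>\<close>.\<close>

lemma inv_sqrt_cutoff:
  fixes b r :: real
  assumes "0 < b" "b < r"
  shows "\<exists>\<rho> \<rho>'. (\<forall>v. (\<rho> has_real_derivative \<rho>' v) (at v)) \<and> continuous_on UNIV \<rho>' \<and>
    (\<forall>v. \<bar>v\<bar> \<le> b \<longrightarrow> \<rho> v = 1 / sqrt (r\<^sup>2 - v\<^sup>2) \<and> \<rho>' v * (1 - v\<^sup>2 / r\<^sup>2) = v * \<rho> v / r\<^sup>2)"
proof -
  define \<kappa> where "\<kappa> = (r\<^sup>2 - b\<^sup>2) / 2"
  have \<kappa>: "\<kappa> > 0" using assms by (simp add: \<kappa>_def power_strict_mono)
  \<comment> \<open>A positive C1 function equal to y for y \<ge> 2\<kappa>, to \<kappa> +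
    y^2/(4\<kappa>) in between, and to \<kappa> for y \<le> 0. Here 2\<kappa> = r^2 - b^2 is the
    least value of r^2 - v^2 on |v| \<le> b, so nothing changes there.\<close>
  define m where "m y = y + (max 0 (2 * \<kappa> - y))\<^sup>2 / (4 * \<kappa>) - (max 0 (- y))\<^sup>2 / (4 * \<kappa>)" for y
  define m' where "m' y = 1 - max 0 (2 * \<kappa> - y) / (2 * \<kappa>) + max 0 (- y) / (2 * \<kappa>)" for y
  have m: "m y > 0" for y
  proof -
    consider "y \<ge> 2 * \<kappa>" | "0 \<le> y" "y < 2 * \<kappa>" | "y < 0" by linarith
    thus ?thesis
    proof cases
      case 1 thus ?thesis using \<kappa> by (simp add: m_def)
    next
      case 2
      have "m y = \<kappa> + y\<^sup>2 / (4 * \<kappa>)"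
        using 2 \<kappa> by (simp add: m_def field_simps power2_eq_square)
      thus ?thesis using \<kappa> by (simp add: add_pos_nonneg)
    next
      case 3
      have "m y = \<kappa>" using 3 \<kappa> by (simp add: m_def field_simps power2_eq_square)
      thus ?thesis using \<kappa> by simp
    qed
  qed
  have dm: "(m has_real_derivative m' y) (at y)" for y
  proof -
    have 1: "((\<lambda>y. (max 0 (2 * \<kappa> - y))\<^sup>2) has_real_derivative 2 * max 0 (2 * \<kappa> - y) * (-1)) (at y)"
      by (rule DERIV_chain2[OF DERIV_max0_power2]) (auto intro!: derivative_eq_intros)
    have 2: "((\<lambda>y. (max 0 (- y))\<^sup>2) has_real_derivative 2 * max 0 (- y) * (-1)) (at y)"
      by (rule DERIV_chain2[OF DERIV_max0_power2]) (auto intro!: derivative_eq_intros)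
    have "(m has_real_derivative 1 + (2 * max 0 (2 * \<kappa> - y) * (-1)) / (4 * \<kappa>) - (2 * max 0 (- y) * (-1)) / (4 * \<kappa>)) (at y)"
      unfolding m_def by (intro DERIV_diff DERIV_add DERIV_ident DERIV_cdivide 1 2)
    thus ?thesis using \<kappa> by (simp add: m'_def field_simps)
  qed
  have cm: "continuous_on UNIV m" using dm by (meson DERIV_continuous_on has_field_derivative_at_within)
  have cm': "continuous_on UNIV m'" unfolding m'_def using \<kappa> by (intro continuous_intros) auto
  define \<rho> where "\<rho> v = 1 / sqrt (m (r\<^sup>2 - v\<^sup>2))" for v
  define \<rho>' where "\<rho>' v = v * m' (r\<^sup>2 - v\<^sup>2) / (sqrt (m (r\<^sup>2 - v\<^sup>2))) ^ 3" for v
  have d\<rho>: "(\<rho> has_real_derivative \<rho>' v) (at v)" for v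
  proof -
    define s where "s = sqrt (m (r\<^sup>2 - v\<^sup>2))"
    have s: "s > 0" using m by (simp add: s_def)
    have "((\<lambda>v. m (r\<^sup>2 - v\<^sup>2)) has_real_derivative m' (r\<^sup>2 - v\<^sup>2) * (- (2 * v))) (at v)"
      by (rule DERIV_chain2[OF dm]) (auto intro!: derivative_eq_intros)
    from DERIV_chain2[OF DERIV_real_sqrt[OF m[of "r\<^sup>2 - v\<^sup>2"]] this]
    have "((\<lambda>v. sqrt (m (r\<^sup>2 - v\<^sup>2))) has_real_derivative inverse s / 2 * (m' (r\<^sup>2 - v\<^sup>2) * (- (2 * v)))) (at v)"
      by (simp add: s_def)
    from DERIV_inverse'[OF this] s
    have "((\<lambda>v. inverse (sqrt (m (r\<^sup>2 - v\<^sup>2)))) has_real_derivative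
        - (inverse s * (inverse s / 2 * (m' (r\<^sup>2 - v\<^sup>2) * (- (2 * v)))) * inverse s)) (at v)"
      by (simp add: s_def)
    moreover have "- (inverse s * (inverse s / 2 * (m' (r\<^sup>2 - v\<^sup>2) * (- (2 * v)))) * inverse s) = \<rho>' v"
      using s by (simp add: \<rho>'_def s_def[symmetric] field_simps power3_eq_cube)
    ultimately show ?thesis unfolding \<rho>_def by (simp add: inverse_eq_divide)
  qed
  have c\<rho>': "continuous_on UNIV \<rho>'"
    unfolding \<rho>'_def using m
    by (intro continuous_intros continuous_on_compose2[OF cm'] continuous_on_compose2[OF cm]) (auto simp: less_imp_neq[symmetric])
  have "\<rho> v = 1 / sqrt (r\<^sup>2 - v\<^sup>2) \<and> \<rho>' v * (1 - v\<^sup>2 / r\<^sup>2) = v * \<rho> v / r\<^sup>2" if v: "\<bar>v\<bar> \<le> b" for v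
  proof -
    have "v\<^sup>2 \<le> b\<^sup>2" using v assms by (simp add: abs_le_square_iff[symmetric])
    hence y: "r\<^sup>2 - v\<^sup>2 \<ge> 2 * \<kappa>" by (simp add: \<kappa>_def)
    hence e: "m (r\<^sup>2 - v\<^sup>2) = r\<^sup>2 - v\<^sup>2" "m' (r\<^sup>2 - v\<^sup>2) = 1" using \<kappa> by (auto simp: m_def m'_def)
    define s where "s = sqrt (r\<^sup>2 - v\<^sup>2)"
    have s: "s > 0" "s\<^sup>2 = r\<^sup>2 - v\<^sup>2" using y \<kappa> by (auto simp: s_def)
    have "1 - v\<^sup>2 / r\<^sup>2 = s\<^sup>2 / r\<^sup>2" using s assms by (simp add: field_simps)
    moreover have "\<rho> v = 1 / s" "\<rho>' v = v / s ^ 3" by (simp_all add: \<rho>_def \<rho>'_def e s_def)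
    moreover have "v / s ^ 3 * (s\<^sup>2 / r\<^sup>2) = v * (1 / s) / r\<^sup>2"
      using s(1) by (simp add: power3_eq_cube power2_eq_square)
    ultimately show ?thesis by (simp add: s_def)
  qed
  thus ?thesis using d\<rho> c\<rho>' by blast
qed

lemma sph_coord_le: "finite I \<Longrightarrow> j \<in> I \<Longrightarrow> x \<in> sph I r \<Longrightarrow> \<bar>x j\<bar> \<le> r"
  using member_le_L2_set[of I j x] member_le_L2_set[of I j "\<lambda>i. - x i"]
  by (auto simp: sph_def L2_set_def abs_le_iff)

lemma lbp_coord: "i \<in> I \<Longrightarrow> (\<lambda>x. x i) \<in> borel_measurable (lbp I)"
  by simp

lemma continuous_Icc_bounded:
  fixes f :: "real \<Rightarrow> real"
  assumes "continuous_on UNIV f"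
  shows "\<exists>K\<ge>0. \<forall>v. \<bar>v\<bar> \<le> r \<longrightarrow> \<bar>f v\<bar> \<le> K"
proof -
  have "compact (f ` {-r..r})"
    by (rule compact_continuous_image[OF continuous_on_subset[OF assms]]) auto
  then obtain K where K: "\<And>y. y \<in> f ` {-r..r} \<Longrightarrow> norm y \<le> K"
    using compact_imp_bounded bounded_iff by metis
  show ?thesis
  proof (intro exI[of _ "max K 0"] conjI allI impI)
    fix v assume "\<bar>v\<bar> \<le> r"
    hence "f v \<in> f ` {-r..r}" by (auto simp: abs_le_iff)
    from K[OF this] show "\<bar>f v\<bar> \<le> max K 0" by simp
  qed simp
qed

lemma rad_rad: "s > 0 \<Longrightarrow> L2_set z I \<noteq> 0 \<Longrightarrow> rad I t (rad I s z) = rad I t z"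
proof -
  assume a: "s > 0" "L2_set z I \<noteq> 0"
  have "rad I s z = (\<lambda>i\<in>I. (s / L2_set z I) * z i)" by (auto simp: rad_def)
  moreover have "s / L2_set z I > 0" using a L2_set_nonneg[of z I] by (simp add: less_le)
  ultimately show ?thesis using rad_scale[of "s / L2_set z I" I t z] by simp
qed

section \<open>The weak identity on meridians\<close>

context
  fixes I :: "nat set" and j n :: nat and r :: real and F :: "(nat \<Rightarrow> real) \<Rightarrow> real" and G :: "(nat \<Rightarrow> real) \<Rightarrow> nat \<Rightarrow> real"
  assumes I: "finite I" "j \<in> I" and n: "card I = Suc n" "n > 0" and r: "r > 0"
    and F: "integrable (usph I r) F" and F0: "\<And>x. x \<in> sph I r \<Longrightarrow> F x \<ge> 0"
    and wg: "weak_sph_grad I r F G"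
begin

definition "Fe x = indicator (sph I r) x * F x"
definition "Ge x = indicator (sph I r) x * G x j"

lemma I_ne: "I \<noteq> {}" using I by auto

lemma Fe_m [measurable]: "Fe \<in> borel_measurable (lbp I)"
  unfolding Fe_def[abs_def] using F by (intro borel_measurable_usph_ext[OF I(1) I_ne less_imp_le[OF r]]) auto

lemma Ge_m [measurable]: "Ge \<in> borel_measurable (lbp I)"
  unfolding Ge_def[abs_def] using wg I(2)
  by (intro borel_measurable_usph_ext[OF I(1) I_ne less_imp_le[OF r]]) (auto simp: weak_sph_grad_def)

lemma Fe_int: "integrable (usph0 I r) Fe"
proof -
  have "integrable (usph I r) Fe"
    using F by (rule Bochner_Integration.integrable_cong[THEN iffD1, rotated -1]) (auto simp: Fe_def space_usph)
  thus ?thesis using integrable_usph[OF I(1) I_ne less_imp_le[OF r] Fe_m] by simp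
qed

lemma Ge_int: "integrable (usph0 I r) Ge"
proof -
  have "integrable (usph I r) (\<lambda>x. G x j)" using wg I(2) by (auto simp: weak_sph_grad_def)
  hence "integrable (usph I r) Ge"
    by (rule Bochner_Integration.integrable_cong[THEN iffD1, rotated -1]) (auto simp: Ge_def space_usph)
  thus ?thesis using integrable_usph[OF I(1) I_ne less_imp_le[OF r] Ge_m] by simp
qed

lemma Fe_nonneg: "Fe x \<ge> 0"
  using F0 by (auto simp: Fe_def indicator_def)

lemma off_sphere: "x \<notin> sph I r \<Longrightarrow> Fe x = 0 \<and> Ge x = 0"
  by (simp add: Fe_def Ge_def)

lemma integrable_bounded_mult:
  assumes f: "integrable (usph0 I r) f" and [measurable]: "g \<in> borel_measurable (lbp I)"
    and off: "\<And>x. x \<notin> sph I r \<Longrightarrow> f x = (0::real)" and g: "\<And>x. x \<in> sph I r \<Longrightarrow> \<bar>g x\<bar> \<le> (K::real)"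
  shows "integrable (usph0 I r) (\<lambda>x. f x * g x)"
proof (rule Bochner_Integration.integrable_bound[OF integrable_mult_right[OF integrable_abs[OF f], of K]])
  have "\<bar>f x\<bar> * \<bar>g x\<bar> \<le> \<bar>K\<bar> * \<bar>f x\<bar>" for x
  proof (cases "x \<in> sph I r")
    case True
    hence "\<bar>g x\<bar> \<le> \<bar>K\<bar>" using g[OF True] by linarith
    from mult_right_mono[OF this, of "\<bar>f x\<bar>"] show ?thesis by (simp add: mult.commute)
  qed (simp add: off)
  thus "AE x in usph0 I r. norm (f x * g x) \<le> norm (K * \<bar>f x\<bar>)"
    by (intro AE_I2) (simp add: abs_mult)
  show "(\<lambda>x. f x * g x) \<in> borel_measurable (usph0 I r)" using f by measurable
qed

text \<open>The weak identity for the pole field with profile \<psi>, brought to one side: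
  \<open>F\<close> times the divergence plus \<open>G\<close> against the field. Its integral over
  the sphere is 0; the aim is that it is 0 on almost every meridian.\<close>

definition "Hfun \<psi> \<psi>' x = Fe x * ((1 - (x j)\<^sup>2 / r\<^sup>2) * \<psi>' (x j) - real n / r\<^sup>2 * x j * \<psi> (x j)) + Ge x * \<psi> (x j)"

lemma Hfun_m:
  assumes "continuous_on UNIV \<psi>" "continuous_on UNIV \<psi>'"
  shows "Hfun \<psi> \<psi>' \<in> borel_measurable (lbp I)"
proof -
  have [measurable]: "\<psi> \<in> borel_measurable borel" "\<psi>' \<in> borel_measurable borel"
    using assms by (auto intro: borel_measurable_continuous_onI)
  have [measurable]: "(\<lambda>x. x j) \<in> borel_measurable (lbp I)" using I(2) by simp
  show ?thesis unfolding Hfun_def[abs_def] by measurable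
qed

lemma Hfun_int:
  assumes "continuous_on UNIV \<psi>" "continuous_on UNIV \<psi>'"
  shows "integrable (usph0 I r) (\<lambda>x. Fe x * ((1 - (x j)\<^sup>2 / r\<^sup>2) * \<psi>' (x j) - real n / r\<^sup>2 * x j * \<psi> (x j)))"
    "integrable (usph0 I r) (\<lambda>x. Ge x * \<psi> (x j))"
    "integrable (usph0 I r) (Hfun \<psi> \<psi>')"
proof -
  have [measurable]: "\<psi> \<in> borel_measurable borel" "\<psi>' \<in> borel_measurable borel"
    using assms by (auto intro: borel_measurable_continuous_onI)
  have [measurable]: "(\<lambda>x. x j) \<in> borel_measurable (lbp I)" using I(2) by simp
  have c: "continuous_on UNIV (\<lambda>v. (1 - v\<^sup>2 / r\<^sup>2) * \<psi>' v - real n / r\<^sup>2 * v * \<psi> v)"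
    using r by (intro continuous_intros assms) auto
  obtain K where K: "\<And>v. \<bar>v\<bar> \<le> r \<Longrightarrow> \<bar>(1 - v\<^sup>2 / r\<^sup>2) * \<psi>' v - real n / r\<^sup>2 * v * \<psi> v\<bar> \<le> K"
    using continuous_Icc_bounded[OF c] by blast
  obtain K' where K': "\<And>v. \<bar>v\<bar> \<le> r \<Longrightarrow> \<bar>\<psi> v\<bar> \<le> K'"
    using continuous_Icc_bounded[OF assms(1)] by blast
  show 1: "integrable (usph0 I r) (\<lambda>x. Fe x * ((1 - (x j)\<^sup>2 / r\<^sup>2) * \<psi>' (x j) - real n / r\<^sup>2 * x j * \<psi> (x j)))"
    by (rule integrable_bounded_mult[OF Fe_int, where K=K]) (use K sph_coord_le[OF I] in \<open>auto simp: off_sphere\<close>)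
  show 2: "integrable (usph0 I r) (\<lambda>x. Ge x * \<psi> (x j))"
    by (rule integrable_bounded_mult[OF Ge_int, where K=K']) (use K' sph_coord_le[OF I] in \<open>auto simp: off_sphere\<close>)
  show "integrable (usph0 I r) (Hfun \<psi> \<psi>')"
    unfolding Hfun_def[abs_def] using 1 2 by (rule Bochner_Integration.integrable_add)
qed

lemma Hfun_off: "x \<notin> sph I r \<Longrightarrow> Hfun \<psi> \<psi>' x = 0"
  by (simp add: Hfun_def off_sphere)

lemma Hfun_soft_box:
  assumes \<psi>: "\<And>v. (\<psi> has_real_derivative \<psi>' v) (at v)" "continuous_on UNIV \<psi>'"
    and \<rho>: "\<And>v. (\<rho> has_real_derivative \<rho>' v) (at v)" "continuous_on UNIV \<rho>'"
    and inv: "\<And>v. \<bar>v\<bar> \<le> r \<Longrightarrow> \<psi> v \<noteq> 0 \<Longrightarrow> \<rho>' v * (1 - v\<^sup>2 / r\<^sup>2) = v * \<rho> v / r\<^sup>2"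
    and m: "m \<ge> 0"
  shows "integrable (usph0 I r) (\<lambda>x. Hfun \<psi> \<psi>' x * soft_box I j m \<rho> a x)"
    and "(\<integral>x. Hfun \<psi> \<psi>' x * soft_box I j m \<rho> a x \<partial>usph0 I r) = 0"
proof -
  define E where "E = soft_box I j m \<rho> a"
  define A where "A v = (1 - v\<^sup>2 / r\<^sup>2) * \<psi>' v - real n / r\<^sup>2 * v * \<psi> v" for v
  have c\<psi>: "continuous_on UNIV \<psi>" and c\<rho>: "continuous_on UNIV \<rho>"
    using \<psi>(1) \<rho>(1) by (meson DERIV_continuous_on has_field_derivative_at_within)+
  have [measurable]: "\<psi> \<in> borel_measurable borel" "\<psi>' \<in> borel_measurable borel" "\<rho> \<in> borel_measurable borel"
    using c\<psi> c\<rho> \<psi>(2) by (auto intro: borel_measurable_continuous_onI)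
  have [measurable]: "A \<in> borel_measurable borel" unfolding A_def by measurable
  have [measurable]: "(\<lambda>x. x j) \<in> borel_measurable (lbp I)" using I(2) by simp
  have xi: "(\<lambda>x. x i) \<in> borel_measurable (lbp I)" if "i \<in> I" for i by (rule lbp_coord[OF that])
  have rj: "(\<lambda>x. \<rho> (x j)) \<in> borel_measurable (lbp I)"
    by (rule measurable_compose[OF xi[OF I(2)]]) simp
  have "(\<lambda>x. (max 0 (x i * \<rho> (x j) - c))\<^sup>2) \<in> borel_measurable (lbp I)" if "i \<in> I" for i c
    by (intro borel_measurable_power borel_measurable_max borel_measurable_diff borel_measurable_times borel_measurable_const xi[OF that] rj)
  hence [measurable]: "(\<lambda>x. \<Sum>i\<in>I - {j}. (max 0 (x i * \<rho> (x j) - a i))\<^sup>2) \<in> borel_measurable (lbp I)"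
    by (intro borel_measurable_sum) auto
  have [measurable]: "E \<in> borel_measurable (lbp I)"
    unfolding E_def soft_box_def by measurable
  have E1: "\<bar>E x\<bar> \<le> 1" for x
    using m by (auto simp: E_def soft_box_def intro!: mult_nonneg_nonneg sum_nonneg)
  have i1: "integrable (usph0 I r) (\<lambda>x. Fe x * A (x j) * E x)"
    by (rule integrable_bounded_mult[OF Hfun_int(1)[OF c\<psi> \<psi>(2), folded A_def], where K=1])
       (auto simp: off_sphere E1)
  have i2: "integrable (usph0 I r) (\<lambda>x. Ge x * \<psi> (x j) * E x)"
    by (rule integrable_bounded_mult[OF Hfun_int(2)[OF c\<psi> \<psi>(2)], where K=1])
       (auto simp: off_sphere E1)
  have Heq: "Hfun \<psi> \<psi>' x * E x = Fe x * A (x j) * E x + Ge x * \<psi> (x j) * E x" for x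
    by (simp add: Hfun_def A_def algebra_simps)
  show "integrable (usph0 I r) (\<lambda>x. Hfun \<psi> \<psi>' x * soft_box I j m \<rho> a x)"
    unfolding E_def[symmetric] Heq using i1 i2 by (rule Bochner_Integration.integrable_add)
  note us = integral_usph[OF I(1) I_ne less_imp_le[OF r]]
  have "(\<integral>x. Fe x * A (x j) * E x \<partial>usph0 I r) = (\<integral>x. Fe x * A (x j) * E x \<partial>usph I r)"
    by (rule us[symmetric]) measurable
  also have "\<dots> = (\<integral>x. F x * (A (x j) * E x) \<partial>usph I r)"
    by (rule Bochner_Integration.integral_cong) (auto simp: Fe_def space_usph)
  also have "\<dots> = - (\<integral>x. G x j * (\<psi> (x j) * E x) \<partial>usph I r)"
    using weak_sph_grad_test[OF I r wg \<psi> \<rho> inv, of m a] n by (simp add: A_def E_def)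
  also have "(\<integral>x. G x j * (\<psi> (x j) * E x) \<partial>usph I r) = (\<integral>x. Ge x * \<psi> (x j) * E x \<partial>usph I r)"
    by (rule Bochner_Integration.integral_cong) (auto simp: Ge_def space_usph)
  also have "\<dots> = (\<integral>x. Ge x * \<psi> (x j) * E x \<partial>usph0 I r)"
    by (rule us) measurable
  finally show "(\<integral>x. Hfun \<psi> \<psi>' x * soft_box I j m \<rho> a x \<partial>usph0 I r) = 0"
    unfolding E_def[symmetric] Heq using i1 i2 by simp
qed

lemma soft_box_tendsto:
  "(\<lambda>k. soft_box I j (real k) \<rho> a x) \<longlonglongrightarrow> indicator {x. \<forall>i\<in>I - {j}. x i * \<rho> (x j) \<le> a i} x"
proof (cases "\<forall>i\<in>I - {j}. x i * \<rho> (x j) \<le> a i")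
  case True
  hence "(\<Sum>i\<in>I - {j}. (max 0 (x i * \<rho> (x j) - a i))\<^sup>2) = 0" by (intro sum.neutral) auto
  thus ?thesis using True by (simp add: soft_box_def)
next
  case False
  define S where "S = (\<Sum>i\<in>I - {j}. (max 0 (x i * \<rho> (x j) - a i))\<^sup>2)"
  obtain i where i: "i \<in> I - {j}" "x i * \<rho> (x j) > a i" using False by force
  have "0 < (max 0 (x i * \<rho> (x j) - a i))\<^sup>2" using i by simp
  also have "\<dots> \<le> S" unfolding S_def by (rule member_le_sum) (use I i in auto)
  finally have S: "S > 0" .
  have "(\<lambda>k. exp (- S) ^ k) \<longlonglongrightarrow> 0" by (rule LIMSEQ_power_zero) (use S in auto)
  moreover have "exp (- S) ^ k = soft_box I j (real k) \<rho> a x" for k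
    by (simp add: soft_box_def S_def[symmetric] exp_of_nat_mult[symmetric])
  ultimately show ?thesis using False by simp
qed

text \<open>In the limit of large m the soft box becomes a sharp one. Because \<psi> vanishes near
  the poles, \<rho> is the exact inverse root wherever it matters, so the box restricts only the
  direction; by the disintegration it leaves the integral over the height.\<close>

lemma Hfun_box:
  assumes b: "0 < b" "b < r"
    and \<psi>: "\<And>v. (\<psi> has_real_derivative \<psi>' v) (at v)" "continuous_on UNIV \<psi>'"
    and supp: "\<And>v. \<bar>v\<bar> > b \<Longrightarrow> \<psi> v = 0 \<and> \<psi>' v = 0"
  shows "(\<integral>z. indicator {w. \<forall>i\<in>I - {j}. w i \<le> a i} (rad (I - {j}) 1 z) *
           (\<integral>v. Hfun \<psi> \<psi>' (slice_pt I j r v z) \<partial>vlaw n r) \<partial>ub (I - {j})) = 0"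
    and "integrable (ub (I - {j})) (\<lambda>z. \<integral>v. Hfun \<psi> \<psi>' (slice_pt I j r v z) \<partial>vlaw n r)"
proof -
  obtain \<rho> \<rho>' where \<rho>: "\<And>v. (\<rho> has_real_derivative \<rho>' v) (at v)" "continuous_on UNIV \<rho>'"
    "\<And>v. \<bar>v\<bar> \<le> b \<Longrightarrow> \<rho> v = 1 / sqrt (r\<^sup>2 - v\<^sup>2) \<and> \<rho>' v * (1 - v\<^sup>2 / r\<^sup>2) = v * \<rho> v / r\<^sup>2"
    using inv_sqrt_cutoff[OF b] by blast
  have inv: "\<rho>' v * (1 - v\<^sup>2 / r\<^sup>2) = v * \<rho> v / r\<^sup>2" if "\<psi> v \<noteq> 0" for v
    using supp[of v] \<rho>(3)[of v] that by (cases "\<bar>v\<bar> \<le> b") auto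
  have c\<psi>: "continuous_on UNIV \<psi>" and c\<rho>: "continuous_on UNIV \<rho>"
    using \<psi>(1) \<rho>(1) by (meson DERIV_continuous_on has_field_derivative_at_within)+
  have [measurable]: "\<rho> \<in> borel_measurable borel" using c\<rho> by (rule borel_measurable_continuous_onI)
  have [measurable]: "(\<lambda>x. x j) \<in> borel_measurable (lbp I)" using I(2) by simp
  define D where "D = {x. \<forall>i\<in>I - {j}. x i * \<rho> (x j) \<le> a i}"
  have Dm: "(indicator D :: _ \<Rightarrow> real) \<in> borel_measurable (lbp I)"
  proof -
    have xi: "(\<lambda>x. x i) \<in> borel_measurable (lbp I)" if "i \<in> I" for i by (rule lbp_coord[OF that])
    have rj: "(\<lambda>x. \<rho> (x j)) \<in> borel_measurable (lbp I)"
      by (rule measurable_compose[OF xi[OF I(2)]]) simp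
    have "{x \<in> space (lbp I). x i * \<rho> (x j) \<le> c} \<in> sets (lbp I)" if "i \<in> I" for i c
      by (intro borel_measurable_le borel_measurable_times borel_measurable_const xi[OF that] rj)
    hence "{x \<in> space (lbp I). \<forall>i\<in>I - {j}. x i * \<rho> (x j) \<le> a i} \<in> sets (lbp I)"
      using I by (intro sets.sets_Collect_finite_All) auto
    hence "D \<inter> space (lbp I) \<in> sets (lbp I)" by (simp add: D_def Int_def conj_commute)
    thus ?thesis by (simp add: borel_measurable_indicator_iff)
  qed
  have Hm: "Hfun \<psi> \<psi>' \<in> borel_measurable (lbp I)" by (rule Hfun_m[OF c\<psi> \<psi>(2)])
  have Hi: "integrable (usph0 I r) (Hfun \<psi> \<psi>')" by (rule Hfun_int(3)[OF c\<psi> \<psi>(2)])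
  note sb = Hfun_soft_box[OF \<psi> \<rho>(1,2) inv]
  have "(\<lambda>k. \<integral>x. Hfun \<psi> \<psi>' x * soft_box I j (real k) \<rho> a x \<partial>usph0 I r) \<longlonglongrightarrow> (\<integral>x. Hfun \<psi> \<psi>' x * indicator D x \<partial>usph0 I r)"
  proof (rule integral_dominated_convergence[where w="\<lambda>x. \<bar>Hfun \<psi> \<psi>' x\<bar>"])
    show "AE x in usph0 I r. (\<lambda>k. Hfun \<psi> \<psi>' x * soft_box I j (real k) \<rho> a x) \<longlonglongrightarrow> Hfun \<psi> \<psi>' x * indicator D x"
      unfolding D_def by (intro AE_I2 tendsto_intros soft_box_tendsto)
    show "AE x in usph0 I r. norm (Hfun \<psi> \<psi>' x * soft_box I j (real k) \<rho> a x) \<le> \<bar>Hfun \<psi> \<psi>' x\<bar>" for k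
      by (intro AE_I2) (auto simp: abs_mult soft_box_def intro!: mult_left_le mult_nonneg_nonneg sum_nonneg)
    show "(\<lambda>x. Hfun \<psi> \<psi>' x * indicator D x) \<in> borel_measurable (usph0 I r)"
      using Hm Dm by (simp cong: measurable_cong_sets)
    show "(\<lambda>x. Hfun \<psi> \<psi>' x * soft_box I j (real k) \<rho> a x) \<in> borel_measurable (usph0 I r)" for k
      using sb(1)[of "real k" a] by auto
  qed (use Hi in auto)
  hence z: "(\<integral>x. Hfun \<psi> \<psi>' x * indicator D x \<partial>usph0 I r) = 0"
    using sb(2)[of "real k" a for k] by (simp add: LIMSEQ_const_iff)
  interpret u': prob_space "ub (I - {j})" by (rule prob_space_ub) (use I in auto)
  interpret v: prob_space "vlaw n r" by (rule prob_space_vlaw[OF I n r])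
  interpret P: pair_sigma_finite "vlaw n r" "ub (I - {j})" ..
  have i1: "integrable (usph0 I r) (\<lambda>x. Hfun \<psi> \<psi>' x * indicator D x)"
    by (rule integrable_bounded_mult[OF Hi Dm, where K=1]) (auto simp: Hfun_off)
  have m1: "(\<lambda>x. Hfun \<psi> \<psi>' x * indicator D x) \<in> borel_measurable (lbp I)" using Hm Dm by measurable
  note s1 = integrable_slices[OF I n r m1 i1]
  note s2 = integrable_slices[OF I n r Hm Hi]
  show "integrable (ub (I - {j})) (\<lambda>z. \<integral>v. Hfun \<psi> \<psi>' (slice_pt I j r v z) \<partial>vlaw n r)"
    using P.integrable_snd[OF s2(1)] .
  have eq: "Hfun \<psi> \<psi>' (slice_pt I j r v z) * indicator D (slice_pt I j r v z) =
      indicator {w. \<forall>i\<in>I - {j}. w i \<le> a i} (rad (I - {j}) 1 z) * Hfun \<psi> \<psi>' (slice_pt I j r v z)" for v z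
  proof (cases "\<bar>v\<bar> \<le> b")
    case False
    thus ?thesis using supp[of v] by (simp add: Hfun_def slice_pt_def)
  next
    case True
    have "v\<^sup>2 \<le> b\<^sup>2" using True b by (simp add: abs_le_square_iff[symmetric])
    moreover have "b\<^sup>2 < r\<^sup>2" using b by (simp add: power_strict_mono)
    ultimately have "sqrt (r\<^sup>2 - v\<^sup>2) > 0" by simp
    hence "slice_pt I j r v z i * \<rho> v = rad (I - {j}) 1 z i" if "i \<in> I - {j}" for i
      using that \<rho>(3)[OF True] by (simp add: slice_pt_def rad_def)
    hence "slice_pt I j r v z \<in> D \<longleftrightarrow> (\<forall>i\<in>I - {j}. rad (I - {j}) 1 z i \<le> a i)"
      by (simp add: D_def) (simp add: slice_pt_def)
    thus ?thesis by (simp add: indicator_def)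
  qed
  have "0 = (\<integral>v. (\<integral>z. Hfun \<psi> \<psi>' (slice_pt I j r v z) * indicator D (slice_pt I j r v z) \<partial>ub (I - {j})) \<partial>vlaw n r)"
    using s1(2) z by simp
  also have "\<dots> = (\<integral>z. (\<integral>v. Hfun \<psi> \<psi>' (slice_pt I j r v z) * indicator D (slice_pt I j r v z) \<partial>vlaw n r) \<partial>ub (I - {j}))"
    by (rule P.Fubini_integral[symmetric]) (rule s1(1))
  also have "\<dots> = (\<integral>z. indicator {w. \<forall>i\<in>I - {j}. w i \<le> a i} (rad (I - {j}) 1 z) *
           (\<integral>v. Hfun \<psi> \<psi>' (slice_pt I j r v z) \<partial>vlaw n r) \<partial>ub (I - {j}))"
    unfolding eq by simp
  finally show "(\<integral>z. indicator {w. \<forall>i\<in>I - {j}. w i \<le> a i} (rad (I - {j}) 1 z) *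
           (\<integral>v. Hfun \<psi> \<psi>' (slice_pt I j r v z) \<partial>vlaw n r) \<partial>ub (I - {j})) = 0" ..
qed

text \<open>The integral over the height depends on \<open>z\<close> only through
  \<open>rad (I - {j}) 1 z\<close>. It is thus a function on the unit sphere of the remaining
  coordinates whose integral over every box is 0, the situation of
  \<open>AE_zero_of_boxes\<close>.\<close>

lemma AE_Hfun_zero:
  assumes b: "0 < b" "b < r"
    and \<psi>: "\<And>v. (\<psi> has_real_derivative \<psi>' v) (at v)" "continuous_on UNIV \<psi>'"
    and supp: "\<And>v. \<bar>v\<bar> > b \<Longrightarrow> \<psi> v = 0 \<and> \<psi>' v = 0"
  shows "AE z in ub (I - {j}). (\<integral>v. Hfun \<psi> \<psi>' (slice_pt I j r v z) \<partial>vlaw n r) = 0"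
proof -
  define I' where "I' = I - {j}"
  have "card I' = n" using I n by (simp add: I'_def card_Diff_singleton)
  hence "I' \<noteq> {}" using n by auto
  moreover have "finite I'" using I by (simp add: I'_def)
  ultimately have I': "finite I'" "I' \<noteq> {}" by auto
  define Q where "Q z = (\<integral>v. Hfun \<psi> \<psi>' (slice_pt I j r v z) \<partial>vlaw n r)" for z
  interpret v: prob_space "vlaw n r" by (rule prob_space_vlaw[OF I n r])
  have c\<psi>: "continuous_on UNIV \<psi>"
    using \<psi>(1) by (meson DERIV_continuous_on has_field_derivative_at_within)
  have Hm: "Hfun \<psi> \<psi>' \<in> borel_measurable (lbp I)" by (rule Hfun_m[OF c\<psi> \<psi>(2)])
  have Qm [measurable]: "Q \<in> borel_measurable (lbp I')"
  proof -
    have "(\<lambda>(z, v). slice_pt I j r v z) \<in> lbp I' \<Otimes>\<^sub>M vlaw n r \<rightarrow>\<^sub>M lbp I"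
      using measurable_compose[OF measurable_pair_swap' measurable_slice_pt[OF I(2), of r]]
      by (simp add: I'_def split_beta' cong: measurable_cong_sets)
    from measurable_compose[OF this Hm]
    show ?thesis unfolding Q_def by (intro v.borel_measurable_lebesgue_integral) (simp add: split_beta')
  qed
  have Qrad: "Q (rad I' 1 z) = Q z" if "L2_set z I' \<noteq> 0" for z
    using rad_rad[of 1 z I'] that by (simp add: Q_def slice_pt_def I'_def[symmetric])
  have Qi: "integrable (ub I') Q"
    using Hfun_box(2)[OF b \<psi> supp] by (simp add: Q_def[abs_def] I'_def)
  have nz: "AE z in ub I'. Q (rad I' 1 z) = Q z"
    using AE_ub_nonzero[OF I'] by eventually_elim (rule Qrad)
  have Qri: "integrable (ub I') (\<lambda>z. Q (rad I' 1 z))"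
    using integrable_cong_AE[OF _ _ nz] Qi by simp
  have Qi': "integrable (usph0 I' 1) Q"
    unfolding usph0_def using Qri by (subst integrable_distr_eq) auto
  have "AE w in usph0 I' 1. Q w = 0"
  proof (rule AE_zero_of_boxes[OF I'(1) _ Qi'])
    fix a :: "nat \<Rightarrow> real"
    have "(indicator {w. \<forall>i\<in>I'. w i \<le> a i} :: _ \<Rightarrow> real) \<in> borel_measurable (lbp I')"
    proof -
      have "{x \<in> space (lbp I'). x i \<le> c} \<in> sets (lbp I')" if "i \<in> I'" for i c
        using that by measurable
      hence "{x \<in> space (lbp I'). \<forall>i\<in>I'. x i \<le> a i} \<in> sets (lbp I')"
        using I' by (intro sets.sets_Collect_finite_All) auto
      hence "{w. \<forall>i\<in>I'. w i \<le> a i} \<inter> space (lbp I') \<in> sets (lbp I')" by (simp add: Int_def conj_commute)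
      thus ?thesis by (simp add: borel_measurable_indicator_iff)
    qed
    note [measurable] = this
    have "(\<integral>w. indicator {w. \<forall>i\<in>I'. w i \<le> a i} w * Q w \<partial>usph0 I' 1) =
      (\<integral>z. indicator {w. \<forall>i\<in>I'. w i \<le> a i} (rad I' 1 z) * Q (rad I' 1 z) \<partial>ub I')"
      unfolding usph0_def by (subst integral_distr) auto
    also have "\<dots> = (\<integral>z. indicator {w. \<forall>i\<in>I'. w i \<le> a i} (rad I' 1 z) * Q z \<partial>ub I')"
    proof (rule integral_cong_AE)
      show "AE z in ub I'. indicator {w. \<forall>i\<in>I'. w i \<le> a i} (rad I' 1 z) * Q (rad I' 1 z) = indicator {w. \<forall>i\<in>I'. w i \<le> a i} (rad I' 1 z) * Q z"
        using nz by eventually_elim simp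
      show "(\<lambda>z. indicator {w. \<forall>i\<in>I'. w i \<le> a i} (rad I' 1 z) * Q (rad I' 1 z)) \<in> borel_measurable (ub I')"
        by measurable
      show "(\<lambda>z. indicator {w. \<forall>i\<in>I'. w i \<le> a i} (rad I' 1 z) * Q z) \<in> borel_measurable (ub I')"
        by measurable
    qed
    also have "\<dots> = 0" using Hfun_box(1)[OF b \<psi> supp, of a] by (simp add: Q_def I'_def)
    finally show "(\<integral>w. indicator {w. \<forall>i\<in>I'. w i \<le> a i} w * Q w \<partial>usph0 I' 1) = 0" .
  qed simp
  hence "AE z in ub I'. Q (rad I' 1 z) = 0"
    unfolding usph0_def by (rule AE_distrD[rotated]) simp
  thus ?thesis using nz unfolding I'_def[symmetric] Q_def[symmetric] by eventually_elim simp
qed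
end

text \<open>The plateau height does not depend on the position of the bump; this is what makes the
  difference of two translates vanish outside a bounded interval.\<close>

lemma bump_outside:
  assumes "k > 0" "l > 0"
  shows "y \<le> - 1 / real k \<Longrightarrow> bump l k y = 0 \<and> bump' l k y = 0"
    and "l + 1 / real k \<le> y \<Longrightarrow> bump l k y = l + 1 / real k \<and> bump' l k y = 0"
proof -
  define e where "e = 1 / real k"
  have e: "e > 0" "real k * e = 1" using assms by (auto simp: e_def)
  show "bump l k y = 0 \<and> bump' l k y = 0" if y: "y \<le> - 1 / real k"
  proof -
    have "y \<le> - e" using y by (simp add: e_def)
    hence "max 0 (y + e) = 0" "max 0 y = 0" "max 0 (y - l) = 0" "max 0 (y - l - e) = 0"
      using assms(2) e by auto
    thus ?thesis unfolding bump_def bump'_def e_def[symmetric] by simp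
  qed
  show "bump l k y = l + 1 / real k \<and> bump' l k y = 0" if y: "l + 1 / real k \<le> y"
  proof -
    have "l + e \<le> y" using y by (simp add: e_def)
    hence m: "max 0 (y + e) = y + e" "max 0 y = y" "max 0 (y - l) = y - l" "max 0 (y - l - e) = y - l - e"
      using assms(2) e by auto
    have "(y + e)\<^sup>2 - y\<^sup>2 - (y - l)\<^sup>2 + (y - l - e)\<^sup>2 = 2 * (l + e) * e" by algebra
    hence "real k / 2 * ((y + e)\<^sup>2 - y\<^sup>2 - (y - l)\<^sup>2 + (y - l - e)\<^sup>2) = (l + e) * (real k * e)" by simp
    thus ?thesis unfolding bump_def bump'_def e_def[symmetric] m e(2) by simp
  qed
qed

lemma sdens_pos: "r > 0 \<Longrightarrow> n > 0 \<Longrightarrow> \<bar>v\<bar> < r \<Longrightarrow> sdens n r v > 0"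
proof -
  assume a: "r > 0" "n > 0" "\<bar>v\<bar> < r"
  have "v\<^sup>2 < r\<^sup>2" using a by (metis abs_le_square_iff abs_of_pos not_le)
  hence "1 - v\<^sup>2 / r\<^sup>2 > 0" using a by simp
  moreover have "cdens n r > 0"
    using a by (auto simp: cdens_def intro!: divide_pos_pos mult_pos_pos)
  ultimately show ?thesis using a by (auto simp: sdens_def abs_less_iff)
qed

lemma sdens_outside: "\<not> \<bar>v\<bar> < r \<Longrightarrow> sdens n r v = 0"
  by (auto simp: sdens_def abs_less_iff)

text \<open>On almost every meridian the weighted density p = s f (1 - v^2/r^2) has a weak
  derivative q, and q reduces to s g where f = 0. The result on zero sets in one variable then gives
  g = 0 there.\<close>

lemma AE_slice_zero:
  assumes I: "finite I" "j \<in> I" and n: "card I = Suc n" "n > 0" and r: "r > 0"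
    and F: "integrable (usph I r) F" and F0: "\<And>x. x \<in> sph I r \<Longrightarrow> F x \<ge> 0"
    and wg: "weak_sph_grad I r F G"
    and b: "0 < b" "b < r"
  shows "AE z in ub (I - {j}). AE v in lborel. -b < v \<and> v < b \<longrightarrow>
     Fe I r F (slice_pt I j r v z) = 0 \<longrightarrow> Ge I j r G (slice_pt I j r v z) = 0"
proof -
  note ctx = I n r F F0 wg
  interpret u': prob_space "ub (I - {j})" by (rule prob_space_ub) (use I in auto)
  interpret v: prob_space "vlaw n r" by (rule prob_space_vlaw[OF I n r])
  interpret P: pair_sigma_finite "vlaw n r" "ub (I - {j})" ..
  define f where "f z v = Fe I r F (slice_pt I j r v z)" for z v
  define g where "g z v = Ge I j r G (slice_pt I j r v z)" for z v
  \<comment> \<open>Countably many tests, so that one null set of directions serves all of them; the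
    inequalities keep the supports inside [-b, b].\<close>
  define X where "X = {(c, d, l, k). c \<in> \<rat> \<and> d \<in> \<rat> \<and> l \<in> \<rat> \<and> l > 0 \<and> k > 0 \<and>
       -b \<le> c - 1 / real k \<and> -b \<le> d - 1 / real k \<and> c + l + 1 / real k \<le> b \<and> d + l + 1 / real k \<le> b}"
  have "countable X"
    by (rule countable_subset[of _ "\<rat> \<times> \<rat> \<times> \<rat> \<times> (UNIV :: nat set)"])
       (auto simp: X_def intro!: countable_SIGMA countable_rat)
  have t: "AE z in ub (I - {j}). \<forall>(c, d, l, k)\<in>X. (\<integral>v. Hfun I j n r F G (\<lambda>v. bump l k (v - c) - bump l k (v - d))
       (\<lambda>v. bump' l k (v - c) - bump' l k (v - d)) (slice_pt I j r v z) \<partial>vlaw n r) = 0"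
  proof (subst AE_ball_countable[OF \<open>countable X\<close>], clarify)
    fix c d l k assume x: "(c, d, l, k) \<in> X"
    show "AE z in ub (I - {j}). (\<integral>v. Hfun I j n r F G (\<lambda>v. bump l k (v - c) - bump l k (v - d))
       (\<lambda>v. bump' l k (v - c) - bump' l k (v - d)) (slice_pt I j r v z) \<partial>vlaw n r) = 0"
    proof (rule AE_Hfun_zero[OF ctx b])
      show "((\<lambda>v. bump l k (v - c) - bump l k (v - d)) has_real_derivative bump' l k (v - c) - bump' l k (v - d)) (at v)" for v
        by (intro DERIV_diff DERIV_bump)
      show "continuous_on UNIV (\<lambda>v. bump' l k (v - c) - bump' l k (v - d))"
        by (intro continuous_on_diff continuous_bump')
      show "bump l k (v - c) - bump l k (v - d) = 0 \<and> bump' l k (v - c) - bump' l k (v - d) = 0" if "\<bar>v\<bar> > b" for v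
      proof -
        have kl: "k > 0" "l > 0" using x by (auto simp: X_def)
        consider "v > b" | "v < - b" using \<open>\<bar>v\<bar> > b\<close> by linarith
        thus ?thesis
        proof cases
          case 1
          have "l + 1 / real k \<le> v - c" "l + 1 / real k \<le> v - d" using 1 x by (auto simp: X_def)
          thus ?thesis using bump_outside(2)[OF kl] by simp
        next
          case 2
          have "v - c \<le> - 1 / real k" "v - d \<le> - 1 / real k" using 2 x by (auto simp: X_def)
          thus ?thesis using bump_outside(1)[OF kl] by simp
        qed
      qed
    qed
  qed
  have fi: "AE z in ub (I - {j}). integrable (vlaw n r) (f z)"
    unfolding f_def using P.AE_integrable_snd[OF integrable_slices(1)[OF I n r Fe_m[OF ctx] Fe_int[OF ctx]]] .
  have gi: "AE z in ub (I - {j}). integrable (vlaw n r) (g z)"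
    unfolding g_def using P.AE_integrable_snd[OF integrable_slices(1)[OF I n r Ge_m[OF ctx] Ge_int[OF ctx]]] .
  from t fi gi show ?thesis
  proof eventually_elim
    case (elim z)
    have [measurable]: "f z \<in> borel_measurable borel" "g z \<in> borel_measurable borel"
      using elim by (auto dest!: borel_measurable_integrable)
    have sf: "integrable lborel (\<lambda>v. sdens n r v * f z v)" and sg: "integrable lborel (\<lambda>v. sdens n r v * g z v)"
      using elim(2,3) sdens_nonneg[OF less_imp_le[OF r]] unfolding vlaw_def
      by (auto simp: integrable_density)
    \<comment> \<open>Read off from \<open>Hfun\<close> times the density of the height: p collects
      the coefficient of \<psi>' and q that of \<psi>.\<close>
    define p where "p v = sdens n r v * f z v * (1 - v\<^sup>2 / r\<^sup>2)" for v
    define q where "q v = sdens n r v * g z v - sdens n r v * f z v * (real n / r\<^sup>2 * v)" for v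
    have [measurable]: "p \<in> borel_measurable borel" "q \<in> borel_measurable borel" unfolding p_def q_def by measurable
    have w: "0 \<le> 1 - v\<^sup>2 / r\<^sup>2" "1 - v\<^sup>2 / r\<^sup>2 \<le> 1" if "\<bar>v\<bar> < r" for v
    proof -
      have "v\<^sup>2 \<le> r\<^sup>2" using that by (simp add: abs_le_square_iff[symmetric])
      thus "0 \<le> 1 - v\<^sup>2 / r\<^sup>2" "1 - v\<^sup>2 / r\<^sup>2 \<le> 1" using r by auto
    qed
    have bm: "integrable lborel (\<lambda>v. sdens n r v * f z v * h v)"
      if "h \<in> borel_measurable borel" "\<And>v. \<bar>v\<bar> < r \<Longrightarrow> \<bar>h v\<bar> \<le> K" for h :: "real \<Rightarrow> real" and K
    proof (rule Bochner_Integration.integrable_bound[OF integrable_mult_right[OF integrable_abs[OF sf], of K]])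
      show "(\<lambda>v. sdens n r v * f z v * h v) \<in> borel_measurable lborel" using that(1) by simp
      have "\<bar>sdens n r v * f z v\<bar> * \<bar>h v\<bar> \<le> \<bar>K\<bar> * \<bar>sdens n r v * f z v\<bar>" for v
      proof (cases "\<bar>v\<bar> < r")
        case True
        hence "\<bar>h v\<bar> \<le> \<bar>K\<bar>" using that(2)[OF True] by linarith
        from mult_right_mono[OF this, of "\<bar>sdens n r v * f z v\<bar>"] show ?thesis by (simp add: mult.commute)
      qed (simp add: sdens_outside)
      thus "AE v in lborel. norm (sdens n r v * f z v * h v) \<le> norm (K * \<bar>sdens n r v * f z v\<bar>)"
        by (intro AE_I2) (simp add: abs_mult)
    qed
    have pi: "integrable lborel p" unfolding p_def by (rule bm[of "\<lambda>v. 1 - v\<^sup>2 / r\<^sup>2" 1]) (use w in \<open>auto simp: abs_le_iff\<close>)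
    have qi: "integrable lborel q"
      unfolding q_def
    proof (intro Bochner_Integration.integrable_diff sg bm[of "\<lambda>v. real n / r\<^sup>2 * v" "real n / r\<^sup>2 * r"])
      show "\<bar>real n / r\<^sup>2 * v\<bar> \<le> real n / r\<^sup>2 * r" if "\<bar>v\<bar> < r" for v
        unfolding abs_mult using that r by (intro mult_mono) auto
    qed simp
    have p0: "p v \<ge> 0" for v
      using w(1)[of v] sdens_outside[of v r n] sdens_nonneg[OF less_imp_le[OF r], of n v] Fe_nonneg[OF ctx]
      by (cases "\<bar>v\<bar> < r") (auto simp: p_def f_def intro!: mult_nonneg_nonneg)
    have "AE v in lborel. -b < v \<and> v < b \<and> p v = 0 \<longrightarrow> q v = 0"
    proof (rule zero_set_derivative_zero[OF qi p0 lebesgue_differentiation_right[OF pi]])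
      fix c d
      assume c: "((\<lambda>h. integral {c..c+h} p / h) \<longlongrightarrow> p c) (at_right 0)"
        and d: "((\<lambda>h. integral {d..d+h} p / h) \<longlongrightarrow> p d) (at_right 0)" and cd: "-b < c" "c < d" "d < b"
      show "p d - p c = integral {c..d} q"
      proof (rule ftc_of_bumps[OF pi qi _ c d cd])
        fix c d l :: real and k :: nat
        assume "c \<in> \<rat>" "d \<in> \<rat>" "l \<in> \<rat>" "l > 0" "k > 0" "-b \<le> c - 1 / real k" "-b \<le> d - 1 / real k"
          "c + l + 1 / real k \<le> b" "d + l + 1 / real k \<le> b"
        hence "(c, d, l, k) \<in> X" by (simp add: X_def)
        hence "0 = (\<integral>v. Hfun I j n r F G (\<lambda>v. bump l k (v - c) - bump l k (v - d))
           (\<lambda>v. bump' l k (v - c) - bump' l k (v - d)) (slice_pt I j r v z) \<partial>vlaw n r)"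
          using elim(1) by fastforce
        also have "\<dots> = (\<integral>v. f z v * ((1 - v\<^sup>2 / r\<^sup>2) * (bump' l k (v - c) - bump' l k (v - d)) - real n / r\<^sup>2 * v * (bump l k (v - c) - bump l k (v - d)))
            + g z v * (bump l k (v - c) - bump l k (v - d)) \<partial>vlaw n r)"
          by (rule Bochner_Integration.integral_cong) (auto simp: Hfun_def[OF ctx] f_def g_def slice_pt_def)
        also have "\<dots> = (\<integral>v. sdens n r v *\<^sub>R (f z v * ((1 - v\<^sup>2 / r\<^sup>2) * (bump' l k (v - c) - bump' l k (v - d)) - real n / r\<^sup>2 * v * (bump l k (v - c) - bump l k (v - d)))
            + g z v * (bump l k (v - c) - bump l k (v - d))) \<partial>lborel)"
          unfolding vlaw_def using sdens_nonneg[OF less_imp_le[OF r]] by (intro integral_density) auto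
        also have "\<dots> = (\<integral>v. p v * (bump' l k (v - c) - bump' l k (v - d)) + q v * (bump l k (v - c) - bump l k (v - d)) \<partial>lborel)"
          by (rule Bochner_Integration.integral_cong) (auto simp: p_def q_def algebra_simps add_divide_distrib diff_divide_distrib)
        finally show "(\<integral>v. p v * (bump' l k (v - c) - bump' l k (v - d)) + q v * (bump l k (v - c) - bump l k (v - d)) \<partial>lborel) = 0" ..
      qed
    qed
    thus ?case
    proof eventually_elim
      case (elim v)
      show ?case
      proof (intro impI)
        assume v: "-b < v \<and> v < b" and "Fe I r F (slice_pt I j r v z) = 0"
        hence "f z v = 0" by (simp add: f_def)
        hence "sdens n r v * g z v = 0" using elim v by (auto simp: p_def q_def)
        moreover have "sdens n r v > 0" using v b n r by (intro sdens_pos) auto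
        ultimately show "Ge I j r G (slice_pt I j r v z) = 0" by (simp add: g_def)
      qed
    qed
  qed
qed

text \<open>As usual for Sobolev functions: \<open>\<nabla>F = 0\<close> almost everywhere on \<open>{F = 0}\<close> when \<open>F \<ge> 0\<close>.\<close>

theorem weak_sph_grad_zero_set:
  assumes I: "finite I" "j \<in> I" and n: "card I = Suc n" "n > 0" and r: "r > 0"
    and F: "integrable (usph I r) F" and F0: "\<And>x. x \<in> sph I r \<Longrightarrow> F x \<ge> 0"
    and wg: "weak_sph_grad I r F G"
  shows "AE x in usph I r. F x = 0 \<longrightarrow> G x j = 0"
proof -
  note ctx = I n r F F0 wg
  interpret u': prob_space "ub (I - {j})" by (rule prob_space_ub) (use I in auto)
  interpret v: prob_space "vlaw n r" by (rule prob_space_vlaw[OF I n r])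
  interpret P: pair_sigma_finite "vlaw n r" "ub (I - {j})" ..
  define R where "R x \<longleftrightarrow> (Fe I r F x = 0 \<longrightarrow> Ge I j r G x = 0)" for x
  note [measurable] = Fe_m[OF ctx] Ge_m[OF ctx]
  have Rm: "{x \<in> space (lbp I). R x} \<in> sets (lbp I)" unfolding R_def by measurable
  have m: "(\<lambda>(v, z). slice_pt I j r v z) \<in> vlaw n r \<Otimes>\<^sub>M ub (I - {j}) \<rightarrow>\<^sub>M lbp I"
    using measurable_slice_pt[OF I(2), of r] by (simp cong: measurable_cong_sets)
  have Rm2: "{p \<in> space (vlaw n r \<Otimes>\<^sub>M ub (I - {j})). R (slice_pt I j r (fst p) (snd p))} \<in> sets (vlaw n r \<Otimes>\<^sub>M ub (I - {j}))"
  proof -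
    have "(\<lambda>(v, z). slice_pt I j r v z) -` {x \<in> space (lbp I). R x} \<inter> space (vlaw n r \<Otimes>\<^sub>M ub (I - {j}))
       = {p \<in> space (vlaw n r \<Otimes>\<^sub>M ub (I - {j})). R (slice_pt I j r (fst p) (snd p))}"
      using measurable_space[OF m] by (auto simp: split_beta')
    thus ?thesis using measurable_sets[OF m Rm] by simp
  qed
  \<comment> \<open>The cutoff needs b < r, so the open interval of heights is exhausted by
    countably many closed ones.\<close>
  define b where "b k = r * (1 - 1 / (real k + 2))" for k :: nat
  have b: "0 < b k" "b k < r" for k
  proof -
    have e: "0 < 1 / (real k + 2)" "1 / (real k + 2) < 1" by auto
    show "0 < b k" unfolding b_def using r e by (intro mult_pos_pos) auto
    show "b k < r" using mult_strict_left_mono[of "1 - 1 / (real k + 2)" 1 r] r e by (simp add: b_def)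
  qed
  have "AE z in ub (I - {j}). \<forall>k. AE v in lborel. -b k < v \<and> v < b k \<longrightarrow> R (slice_pt I j r v z)"
    unfolding R_def by (subst AE_all_countable) (intro allI AE_slice_zero[OF ctx b])
  hence "AE z in ub (I - {j}). AE v in vlaw n r. R (slice_pt I j r v z)"
  proof eventually_elim
    case (elim z)
    hence "AE v in lborel. \<forall>k. -b k < v \<and> v < b k \<longrightarrow> R (slice_pt I j r v z)" by (subst AE_all_countable)
    thus ?case unfolding vlaw_def
    proof (subst AE_density, simp, eventually_elim)
      case (elim v)
      show ?case
      proof
        assume "0 < ennreal (sdens n r v)"
        hence "\<bar>v\<bar> < r" using sdens_outside[of v r n] by (cases "\<bar>v\<bar> < r") auto
        hence "\<bar>v\<bar> / r < 1" using r by simp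
        moreover have "(\<lambda>k. 1 - 1 / real (k + 2)) \<longlonglongrightarrow> 1 - 0"
          using LIMSEQ_ignore_initial_segment[OF lim_1_over_n, of 2] by (intro tendsto_diff tendsto_const) 
        ultimately have "\<forall>\<^sub>F k in sequentially. \<bar>v\<bar> / r < 1 - 1 / real (k + 2)"
          by (intro order_tendstoD(1)) auto
        then obtain k where "\<bar>v\<bar> / r < 1 - 1 / real (k + 2)" by (auto simp: eventually_sequentially)
        hence "\<bar>v\<bar> < b k" using r by (simp add: b_def pos_divide_less_eq mult.commute add.commute)
        thus "R (slice_pt I j r v z)" using elim by (auto simp: abs_less_iff)
      qed
    qed
  qed
  \<comment> \<open>The null sets were found direction by direction. Both variables are exchanged so
    that a null set of the product, and hence of the sphere, results.\<close>
  hence "AE v in vlaw n r. AE z in ub (I - {j}). R (slice_pt I j r v z)"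
    by (subst P.AE_commute[OF Rm2])
  hence "AE p in vlaw n r \<Otimes>\<^sub>M ub (I - {j}). R (slice_pt I j r (fst p) (snd p))"
    by (subst P.AE_pair_iff[OF Rm2, symmetric])
  hence "AE x in usph0 I r. R x"
    unfolding usph0_disintegration[OF I n r] by (subst AE_distr_iff[OF m Rm]) (simp add: split_beta')
  moreover have "I \<noteq> {}" using I by auto
  ultimately have "AE x in usph I r. R x \<and> x \<in> sph I r"
    using AE_usph0[OF I(1) _ less_imp_le[OF r]] by (subst AE_usph_iff[OF I(1) _ less_imp_le[OF r]]) auto
  thus ?thesis
    by eventually_elim (auto simp: R_def Fe_def[OF ctx] Ge_def[OF ctx])
qed

section \<open>Log-Lipschitz majorants\<close>

lemma nn_integral_laplace:
  assumes e: "e > (0::real)"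
  shows "(\<integral>\<^sup>+t. ennreal (exp (- \<bar>t - y\<bar> / e) / (2 * e)) \<partial>lborel) = 1"
proof -
  define k where "k t = exp (- t / e) / (2 * e)" for t
  have [measurable]: "k \<in> borel_measurable borel" unfolding k_def by measurable
  have kn: "k t \<ge> 0" for t using e by (simp add: k_def)
  have half: "(\<integral>\<^sup>+t. ennreal (k t) * indicator {0..} t \<partial>lborel) = ennreal (1 / 2)"
  proof -
    have "((\<lambda>t. - exp (- t / e) / 2) \<longlongrightarrow> 0) at_top"
    proof -
      have "filterlim (\<lambda>t::real. t * (1 / e)) at_top at_top"
        using e by (intro filterlim_at_top_mult_tendsto_pos[OF tendsto_const _ filterlim_ident]) auto
      hence "filterlim (\<lambda>t. - t / e) at_bot at_top"
        by (simp add: filterlim_uminus_at_bot)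
      from filterlim_compose[OF exp_at_bot this]
      have "((\<lambda>t. exp (- t / e)) \<longlongrightarrow> 0) at_top" .
      from tendsto_mult_left[OF this, of "- 1 / 2"] show ?thesis by simp
    qed
    moreover have "((\<lambda>t. - exp (- t / e) / 2) has_real_derivative k t) (at t)" for t
      unfolding k_def using e by (auto intro!: derivative_eq_intros simp: field_simps)
    ultimately have "(\<integral>\<^sup>+t. ennreal (k t) * indicator {0..} t \<partial>lborel) = ennreal (0 - (- exp (- 0 / e) / 2))"
      using kn by (intro nn_integral_FTC_atLeast) auto
    thus ?thesis by simp
  qed
  have "(\<integral>\<^sup>+t. ennreal (exp (- \<bar>t - y\<bar> / e) / (2 * e)) \<partial>lborel) = (\<integral>\<^sup>+t. ennreal (exp (- \<bar>y + 1 * t - y\<bar> / e) / (2 * e)) \<partial>lborel)"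
    by (subst nn_integral_real_affine[where c=1 and t=y]) auto
  also have "\<dots> = (\<integral>\<^sup>+t. ennreal (k t) * indicator {0..} t + ennreal (k (- t)) * indicator {0..} (- t) \<partial>lborel)"
  proof (rule nn_integral_cong_AE)
    have "AE t in lborel. t \<noteq> (0::real)" by (rule AE_lborel_singleton)
    thus "AE t in lborel. ennreal (exp (- \<bar>y + 1 * t - y\<bar> / e) / (2 * e)) = ennreal (k t) * indicator {0..} t + ennreal (k (- t)) * indicator {0..} (- t)"
      by eventually_elim (auto simp: k_def indicator_def)
  qed
  also have "\<dots> = (\<integral>\<^sup>+t. ennreal (k t) * indicator {0..} t \<partial>lborel) + (\<integral>\<^sup>+t. ennreal (k (- t)) * indicator {0..} (- t) \<partial>lborel)"
    by (rule nn_integral_add) auto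
  also have "(\<integral>\<^sup>+t. ennreal (k (- t)) * indicator {0..} (- t) \<partial>lborel) = (\<integral>\<^sup>+t. ennreal (k t) * indicator {0..} t \<partial>lborel)"
    using nn_integral_real_affine[of "\<lambda>t. ennreal (k t) * indicator {0..} t" "-1" 0] by simp
  also have "(\<integral>\<^sup>+t. ennreal (k t) * indicator {0..} t \<partial>lborel) + (\<integral>\<^sup>+t. ennreal (k t) * indicator {0..} t \<partial>lborel) = 1"
    unfolding half by (subst ennreal_plus[symmetric]) simp_all
  finally show ?thesis .
qed

text \<open>The assumption \<open>weak\<close> says that the law of \<open>Y\<close> weighted by
  \<open>a\<close> has the law weighted by \<open>b\<close> as its derivative in the sense of
  distributions.\<close>

locale weak_density = prob_space M for M :: "'a measure" +
  fixes Y a b :: "'a \<Rightarrow> real" and r \<epsilon> :: real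
  assumes Y [measurable]: "Y \<in> borel_measurable M" and Yr: "\<And>x. x \<in> space M \<Longrightarrow> \<bar>Y x\<bar> \<le> r"
    and a: "integrable M a" and a0: "\<And>x. x \<in> space M \<Longrightarrow> a x \<ge> 0" and b: "integrable M b"
    and r: "r > 0" and eps: "\<epsilon> > 0"
    and weak: "\<And>\<psi> \<psi>'. (\<And>v. (\<psi> has_real_derivative \<psi>' v) (at v)) \<Longrightarrow> continuous_on UNIV \<psi>' \<Longrightarrow>
      (\<integral>x. a x * \<psi>' (Y x) \<partial>M) = - (\<integral>x. b x * \<psi> (Y x) \<partial>M)"
begin

text \<open>The summand \<epsilon> |b| pays for the drift term in the comparison; the additional
  \<epsilon> keeps \<open>\<phi>\<close> strictly positive, so that its logarithm is defined
  everywhere.\<close>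

definition "K x = a x + \<epsilon> * (\<bar>b x\<bar> + 1)"
definition "kern t y = exp (- \<bar>t - y\<bar> / \<epsilon>) / (2 * \<epsilon>)"
text \<open>Convolution of the kernel with the image under \<open>Y\<close> of the measure with
  density \<open>K\<close>, written as an integral over \<open>M\<close>, so that no conditional
  expectation has to be constructed.\<close>

definition "\<phi> t = (\<integral>x. K x * kern t (Y x) \<partial>M)"

lemma K_nonneg: "x \<in> space M \<Longrightarrow> K x \<ge> 0"
  using a0 eps by (simp add: K_def)

lemma K_int: "integrable M K"
  unfolding K_def using a b by simp

lemma K_ge: "x \<in> space M \<Longrightarrow> K x \<ge> \<epsilon>"
  using a0[of x] eps by (simp add: K_def algebra_simps)

lemma meas [measurable]: "a \<in> borel_measurable M" "b \<in> borel_measurable M" "K \<in> borel_measurable M"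
  using a b K_int by auto

lemma kern_bounds: "kern t y > 0" "kern t y \<le> 1 / (2 * \<epsilon>)"
  using eps by (auto simp: kern_def divide_le_cancel intro!: divide_right_mono)

lemma kern_meas [measurable]: "(\<lambda>(t, y). kern t y) \<in> borel_measurable (borel \<Otimes>\<^sub>M borel)"
  unfolding kern_def by measurable

lemma Kk_int: "integrable M (\<lambda>x. K x * kern t (Y x))"
proof (rule Bochner_Integration.integrable_bound[OF integrable_mult_right[OF K_int, of "1 / (2 * \<epsilon>)"]])
  show "AE x in M. norm (K x * kern t (Y x)) \<le> norm (1 / (2 * \<epsilon>) * K x)"
  proof (rule AE_I2)
    fix x assume "x \<in> space M"
    have "\<bar>K x\<bar> * \<bar>kern t (Y x)\<bar> \<le> \<bar>K x\<bar> * (1 / (2 * \<epsilon>))"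
      by (intro mult_left_mono) (use kern_bounds[of t "Y x"] in auto)
    thus "norm (K x * kern t (Y x)) \<le> norm (1 / (2 * \<epsilon>) * K x)" using eps by (simp add: abs_mult)
  qed
qed measurable

lemma \<phi>_nn: "ennreal (\<phi> t) = (\<integral>\<^sup>+x. ennreal (K x * kern t (Y x)) \<partial>M)"
  unfolding \<phi>_def using Kk_int K_nonneg kern_bounds(1)
  by (intro nn_integral_eq_integral[symmetric]) (auto intro!: AE_I2 mult_nonneg_nonneg[OF K_nonneg less_imp_le[OF kern_bounds(1)]])

lemma \<phi>_meas [measurable]: "\<phi> \<in> borel_measurable borel"
  unfolding \<phi>_def by (rule borel_measurable_lebesgue_integral) measurable

text \<open>The Lipschitz bound 1/\<epsilon> for ln \<open>\<phi>\<close> in multiplicative form. It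
  passes from the kernel to any mixture of its translates with nonnegative weights.\<close>

lemma \<phi>_lipschitz: "\<phi> t * exp (- \<bar>t - t'\<bar> / \<epsilon>) \<le> \<phi> t'"
proof -
  have "\<phi> t * exp (- \<bar>t - t'\<bar> / \<epsilon>) = (\<integral>x. (K x * kern t (Y x)) * exp (- \<bar>t - t'\<bar> / \<epsilon>) \<partial>M)"
    unfolding \<phi>_def by simp
  also have "\<dots> \<le> \<phi> t'"
    unfolding \<phi>_def
  proof (rule integral_mono[OF integrable_mult_left[OF Kk_int] Kk_int])
    fix x assume x: "x \<in> space M"
    have "- \<bar>t - Y x\<bar> + - \<bar>t - t'\<bar> \<le> - \<bar>t' - Y x\<bar>" by linarith
    from divide_right_mono[OF this less_imp_le[OF eps]]
    have "- \<bar>t - Y x\<bar> / \<epsilon> + - \<bar>t - t'\<bar> / \<epsilon> \<le> - \<bar>t' - Y x\<bar> / \<epsilon>" by (simp only: add_divide_distrib)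
    hence "exp (- \<bar>t - Y x\<bar> / \<epsilon>) * exp (- \<bar>t - t'\<bar> / \<epsilon>) \<le> exp (- \<bar>t' - Y x\<bar> / \<epsilon>)"
      by (simp only: exp_add[symmetric] exp_le_cancel_iff)
    hence "kern t (Y x) * exp (- \<bar>t - t'\<bar> / \<epsilon>) \<le> kern t' (Y x)"
      using eps by (simp add: kern_def divide_right_mono)
    from mult_left_mono[OF this K_nonneg[OF x]]
    show "(K x * kern t (Y x)) * exp (- \<bar>t - t'\<bar> / \<epsilon>) \<le> K x * kern t' (Y x)" by (simp add: mult.assoc)
  qed
  finally show ?thesis .
qed

lemma \<phi>_pos: "\<phi> t \<ge> exp (- (\<bar>t\<bar> + r) / \<epsilon>) / 2"
proof -
  have "exp (- (\<bar>t\<bar> + r) / \<epsilon>) / 2 = (\<integral>x. exp (- (\<bar>t\<bar> + r) / \<epsilon>) / 2 \<partial>M)" by (simp add: prob_space)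
  also have "\<dots> \<le> \<phi> t" unfolding \<phi>_def
  proof (rule integral_mono[OF _ Kk_int])
    fix x assume x: "x \<in> space M"
    have "- (\<bar>t\<bar> + r) \<le> - \<bar>t - Y x\<bar>" using Yr[OF x] by linarith
    from divide_right_mono[OF this less_imp_le[OF eps]]
    have "exp (- (\<bar>t\<bar> + r) / \<epsilon>) \<le> exp (- \<bar>t - Y x\<bar> / \<epsilon>)" by (simp only: exp_le_cancel_iff)
    hence "exp (- (\<bar>t\<bar> + r) / \<epsilon>) / 2 \<le> \<epsilon> * kern t (Y x)" using eps by (simp add: kern_def)
    also have "\<dots> \<le> K x * kern t (Y x)" using K_ge[OF x] kern_bounds(1)[of t "Y x"] by (intro mult_right_mono) auto
    finally show "exp (- (\<bar>t\<bar> + r) / \<epsilon>) / 2 \<le> K x * kern t (Y x)" .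
  qed simp
  finally show ?thesis .
qed

lemma nn_integral_\<phi>: "(\<integral>\<^sup>+t. ennreal (\<phi> t) \<partial>lborel) = ennreal (\<integral>x. K x \<partial>M)"
proof -
  interpret P: pair_sigma_finite lborel M ..
  have "(\<integral>\<^sup>+t. ennreal (\<phi> t) \<partial>lborel) = (\<integral>\<^sup>+t. (\<integral>\<^sup>+x. ennreal (K x * kern t (Y x)) \<partial>M) \<partial>lborel)"
    by (simp add: \<phi>_nn)
  also have "\<dots> = (\<integral>\<^sup>+x. (\<integral>\<^sup>+t. ennreal (K x * kern t (Y x)) \<partial>lborel) \<partial>M)"
    by (rule P.Fubini'[symmetric]) measurable
  also have "\<dots> = (\<integral>\<^sup>+x. ennreal (K x) \<partial>M)"
  proof (rule nn_integral_cong)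
    fix x assume x: "x \<in> space M"
    have "(\<integral>\<^sup>+t. ennreal (K x * kern t (Y x)) \<partial>lborel) = ennreal (K x) * (\<integral>\<^sup>+t. ennreal (kern t (Y x)) \<partial>lborel)"
      using K_nonneg[OF x] by (simp add: ennreal_mult' nn_integral_cmult)
    also have "(\<integral>\<^sup>+t. ennreal (kern t (Y x)) \<partial>lborel) = 1"
      unfolding kern_def by (rule nn_integral_laplace[OF eps])
    finally show "(\<integral>\<^sup>+t. ennreal (K x * kern t (Y x)) \<partial>lborel) = ennreal (K x)" by simp
  qed
  also have "\<dots> = ennreal (\<integral>x. K x \<partial>M)"
    using K_int K_nonneg by (intro nn_integral_eq_integral) (auto intro!: AE_I2)
  finally show ?thesis .
qed

lemma ex_antiderivative:
  assumes "continuous_on UNIV (g :: real \<Rightarrow> real)"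
  shows "\<exists>H. \<forall>v. (H has_real_derivative g v) (at v)"
  using einterval_antiderivative[of "-\<infinity>" "\<infinity>" g] assms
  by (auto simp: continuous_on_eq_continuous_at has_real_derivative_iff_has_vector_derivative)

text \<open>With \<open>u = \<theta> * kern\<close> one has \<open>u - \<epsilon>\<^sup>2 u'' = \<theta>\<close>; testing the weak identity with
  \<open>\<psi> = - \<epsilon>\<^sup>2 u'\<close>, and using \<open>\<bar>\<psi>\<bar> \<le> \<epsilon> u\<close>, bounds the law of \<open>Y\<close> under the density \<open>a\<close> by \<open>\<phi>\<close>.\<close>

lemma majorant_test:
  assumes \<theta>: "continuous_on UNIV \<theta>" and \<theta>0: "\<And>v. \<theta> v \<ge> 0"
  shows "(\<integral>\<^sup>+x. ennreal (a x * \<theta> (Y x)) \<partial>M) \<le> (\<integral>\<^sup>+t. ennreal (\<theta> t * \<phi> t) * indicator {-r..r} t \<partial>lborel)"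
proof -
  have [measurable]: "\<theta> \<in> borel_measurable borel" using \<theta> by (rule borel_measurable_continuous_onI)
  have c1: "continuous_on UNIV (\<lambda>v. \<theta> v * exp (v / \<epsilon>))" and c2: "continuous_on UNIV (\<lambda>v. \<theta> v * exp (- v / \<epsilon>))"
    using eps by (auto intro!: continuous_intros \<theta>)
  obtain H1 where H1: "\<And>v. (H1 has_real_derivative \<theta> v * exp (v / \<epsilon>)) (at v)"
    using ex_antiderivative[OF c1] by blast
  obtain H2 where H2: "\<And>v. (H2 has_real_derivative \<theta> v * exp (- v / \<epsilon>)) (at v)"
    using ex_antiderivative[OF c2] by blast
  \<comment> \<open>One-sided exponential averages of \<theta> started at -r and at r. They solve A'
    = (\<theta> - A)/\<epsilon> and B' = (B - \<theta>)/\<epsilon>, so their half sum is, on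
    [-r, r], the convolution of \<theta> cut off to [-r, r]. Defined through antiderivatives they
    are C1 on the whole line; signs are needed only on [-r, r], where \<open>Y\<close> takes its
    values.\<close>
  define A where "A y = exp (- y / \<epsilon>) * (H1 y - H1 (-r)) / \<epsilon>" for y
  define B where "B y = exp (y / \<epsilon>) * (H2 r - H2 y) / \<epsilon>" for y
  define u where "u y = (A y + B y) / 2" for y
  define \<psi> where "\<psi> y = \<epsilon> * (A y - B y) / 2" for y
  have dA: "(A has_real_derivative (\<theta> y - A y) / \<epsilon>) (at y)" for y
  proof -
    have "(A has_real_derivative (exp (- y / \<epsilon>) * (- 1 / \<epsilon>) * (H1 y - H1 (-r)) + (\<theta> y * exp (y / \<epsilon>) - 0) * exp (- y / \<epsilon>)) / \<epsilon>) (at y)"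
      unfolding A_def using eps by (intro DERIV_cdivide DERIV_mult DERIV_diff H1 DERIV_const DERIV_fun_exp) (auto intro!: derivative_eq_intros)
    moreover have "exp (y / \<epsilon>) * exp (- y / \<epsilon>) = 1" by (simp add: exp_add[symmetric])
    ultimately show ?thesis by (simp add: A_def algebra_simps)
  qed
  have dB: "(B has_real_derivative (B y - \<theta> y) / \<epsilon>) (at y)" for y
  proof -
    have "(B has_real_derivative (exp (y / \<epsilon>) * (1 / \<epsilon>) * (H2 r - H2 y) + (0 - \<theta> y * exp (- y / \<epsilon>)) * exp (y / \<epsilon>)) / \<epsilon>) (at y)"
      unfolding B_def using eps by (intro DERIV_cdivide DERIV_mult DERIV_diff H2 DERIV_const DERIV_fun_exp) (auto intro!: derivative_eq_intros)
    moreover have "exp (- y / \<epsilon>) * exp (y / \<epsilon>) = 1" by (simp add: exp_add[symmetric])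
    ultimately show ?thesis by (simp add: B_def algebra_simps)
  qed
  have d\<psi>: "(\<psi> has_real_derivative \<theta> y - u y) (at y)" for y
  proof -
    have "(\<psi> has_real_derivative (\<epsilon> * ((\<theta> y - A y) / \<epsilon> - (B y - \<theta> y) / \<epsilon>)) / 2) (at y)"
      unfolding \<psi>_def by (intro DERIV_cdivide DERIV_cmult DERIV_diff dA dB)
    moreover have "(\<epsilon> * ((\<theta> y - A y) / \<epsilon> - (B y - \<theta> y) / \<epsilon>)) / 2 = \<theta> y - u y"
      using eps by (simp add: u_def field_simps)
    ultimately show ?thesis by simp
  qed
  have cAB: "continuous_on UNIV A" "continuous_on UNIV B"
    by (intro continuous_at_imp_continuous_on ballI DERIV_isCont[OF dA] DERIV_isCont[OF dB])+
  have cu: "continuous_on UNIV u" unfolding u_def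
    by (intro continuous_on_divide continuous_on_add cAB continuous_on_const) auto
  have c\<psi>: "continuous_on UNIV \<psi>" unfolding \<psi>_def
    by (intro continuous_on_divide continuous_on_mult continuous_on_diff cAB continuous_on_const) auto
  have [measurable]: "u \<in> borel_measurable borel" "\<psi> \<in> borel_measurable borel"
    using cu c\<psi> by (auto intro: borel_measurable_continuous_onI)
  have ftc1: "(\<integral>\<^sup>+t. ennreal (\<theta> t * exp (t / \<epsilon>)) * indicator {-r..y} t \<partial>lborel) = ennreal (H1 y - H1 (-r))" if "-r \<le> y" for y
    using that \<theta>0 by (intro nn_integral_FTC_Icc[OF _ H1]) auto
  have ftc2: "(\<integral>\<^sup>+t. ennreal (\<theta> t * exp (- t / \<epsilon>)) * indicator {y..r} t \<partial>lborel) = ennreal (H2 r - H2 y)" if "y \<le> r" for y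
    using that \<theta>0 by (intro nn_integral_FTC_Icc[OF _ H2]) auto
  have mono1: "H1 (-r) \<le> H1 y" if "-r \<le> y" for y
    by (rule DERIV_nonneg_imp_nondecreasing[OF that]) (use H1 \<theta>0 in \<open>metis exp_ge_zero zero_le_mult_iff\<close>)
  have mono2: "H2 y \<le> H2 r" if "y \<le> r" for y
    by (rule DERIV_nonneg_imp_nondecreasing[OF that]) (use H2 \<theta>0 in \<open>metis exp_ge_zero zero_le_mult_iff\<close>)
  have AB0: "A y \<ge> 0" "B y \<ge> 0" if "\<bar>y\<bar> \<le> r" for y
    using mono1[of y] mono2[of y] that eps by (auto simp: A_def B_def abs_le_iff)
  have u_nn: "ennreal (u y) = (\<integral>\<^sup>+t. ennreal (\<theta> t * kern t y) * indicator {-r..r} t \<partial>lborel)" if y: "\<bar>y\<bar> \<le> r" for y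
  proof -
    have yr: "-r \<le> y" "y \<le> r" using y by auto
    have "ennreal (A y / 2) = (\<integral>\<^sup>+t. ennreal (exp (- y / \<epsilon>) / (2 * \<epsilon>)) * (ennreal (\<theta> t * exp (t / \<epsilon>)) * indicator {-r..y} t) \<partial>lborel)"
    proof -
      have "A y / 2 = exp (- y / \<epsilon>) / (2 * \<epsilon>) * (H1 y - H1 (-r))" by (simp add: A_def)
      moreover have "ennreal (exp (- y / \<epsilon>) / (2 * \<epsilon>) * (H1 y - H1 (-r))) = ennreal (exp (- y / \<epsilon>) / (2 * \<epsilon>)) * ennreal (H1 y - H1 (-r))"
        using eps by (intro ennreal_mult') auto
      ultimately show ?thesis by (simp only: ftc1[OF yr(1), symmetric]) (rule nn_integral_cmult[symmetric], measurable)
    qed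
    moreover have "ennreal (B y / 2) = (\<integral>\<^sup>+t. ennreal (exp (y / \<epsilon>) / (2 * \<epsilon>)) * (ennreal (\<theta> t * exp (- t / \<epsilon>)) * indicator {y..r} t) \<partial>lborel)"
    proof -
      have "B y / 2 = exp (y / \<epsilon>) / (2 * \<epsilon>) * (H2 r - H2 y)" by (simp add: B_def)
      moreover have "ennreal (exp (y / \<epsilon>) / (2 * \<epsilon>) * (H2 r - H2 y)) = ennreal (exp (y / \<epsilon>) / (2 * \<epsilon>)) * ennreal (H2 r - H2 y)"
        using eps by (intro ennreal_mult') auto
      ultimately show ?thesis by (simp only: ftc2[OF yr(2), symmetric]) (rule nn_integral_cmult[symmetric], measurable)
    qed
    moreover have "ennreal (u y) = ennreal (A y / 2) + ennreal (B y / 2)"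
      using AB0[OF y] by (simp add: u_def add_divide_distrib)
    ultimately have "ennreal (u y) = (\<integral>\<^sup>+t. ennreal (exp (- y / \<epsilon>) / (2 * \<epsilon>)) * (ennreal (\<theta> t * exp (t / \<epsilon>)) * indicator {-r..y} t)
        + ennreal (exp (y / \<epsilon>) / (2 * \<epsilon>)) * (ennreal (\<theta> t * exp (- t / \<epsilon>)) * indicator {y..r} t) \<partial>lborel)"
      by (simp add: nn_integral_add)
    also have "\<dots> = (\<integral>\<^sup>+t. ennreal (\<theta> t * kern t y) * indicator {-r..r} t \<partial>lborel)"
    proof (rule nn_integral_cong_AE)
      have "AE t in lborel. t \<noteq> y" by (rule AE_lborel_singleton)
      thus "AE t in lborel. ennreal (exp (- y / \<epsilon>) / (2 * \<epsilon>)) * (ennreal (\<theta> t * exp (t / \<epsilon>)) * indicator {-r..y} t)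
        + ennreal (exp (y / \<epsilon>) / (2 * \<epsilon>)) * (ennreal (\<theta> t * exp (- t / \<epsilon>)) * indicator {y..r} t) = ennreal (\<theta> t * kern t y) * indicator {-r..r} t"
      proof eventually_elim
        case (elim t)
        show ?case
        proof (cases "t < y")
          case True
          have "exp (- y / \<epsilon>) * exp (t / \<epsilon>) = exp (- \<bar>t - y\<bar> / \<epsilon>)"
            using True by (simp add: exp_add[symmetric] diff_divide_distrib)
          hence "exp (- y / \<epsilon>) / (2 * \<epsilon>) * (\<theta> t * exp (t / \<epsilon>)) = \<theta> t * kern t y"
            by (simp add: kern_def mult.commute mult.left_commute)
          thus ?thesis using True yr eps \<theta>0[of t] by (auto simp: indicator_def ennreal_mult'[symmetric])
        next
          case False
          hence ty: "t > y" using elim by simp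
          have "exp (y / \<epsilon>) * exp (- t / \<epsilon>) = exp (- \<bar>t - y\<bar> / \<epsilon>)"
            using ty by (simp add: exp_add[symmetric] diff_divide_distrib)
          hence "exp (y / \<epsilon>) / (2 * \<epsilon>) * (\<theta> t * exp (- t / \<epsilon>)) = \<theta> t * kern t y"
            by (simp add: kern_def mult.commute mult.left_commute)
          thus ?thesis using ty yr eps \<theta>0[of t] by (auto simp: indicator_def ennreal_mult'[symmetric])
        qed
      qed
    qed
    finally show ?thesis .
  qed
  have bnd: "integrable M (\<lambda>x. f x * h (Y x))" if f: "integrable M f" and h: "continuous_on UNIV h" for f :: "'a \<Rightarrow> real" and h
  proof -
    have [measurable]: "h \<in> borel_measurable borel" using h by (rule borel_measurable_continuous_onI)
    have "compact (h ` {-r..r})" by (rule compact_continuous_image[OF continuous_on_subset[OF h]]) auto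
    then obtain C where C: "\<And>y. y \<in> h ` {-r..r} \<Longrightarrow> norm y \<le> C" using compact_imp_bounded bounded_iff by metis
    show ?thesis
    proof (rule Bochner_Integration.integrable_bound[OF integrable_mult_right[OF integrable_abs[OF f], of C]])
      show "AE x in M. norm (f x * h (Y x)) \<le> norm (C * \<bar>f x\<bar>)"
      proof (rule AE_I2)
        fix x assume "x \<in> space M"
        hence "\<bar>h (Y x)\<bar> \<le> \<bar>C\<bar>" using C[of "h (Y x)"] Yr[of x] by (force simp: abs_le_iff)
        from mult_right_mono[OF this, of "\<bar>f x\<bar>"] show "norm (f x * h (Y x)) \<le> norm (C * \<bar>f x\<bar>)"
          by (simp add: abs_mult mult.commute)
      qed
    qed (use f in measurable)
  qed
  have "(\<integral>x. a x * \<theta> (Y x) \<partial>M) = (\<integral>x. a x * u (Y x) \<partial>M) + (\<integral>x. a x * (\<theta> (Y x) - u (Y x)) \<partial>M)"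
    using bnd[OF a \<theta>] bnd[OF a cu] by (simp add: right_diff_distrib)
  also have "(\<integral>x. a x * (\<theta> (Y x) - u (Y x)) \<partial>M) = - (\<integral>x. b x * \<psi> (Y x) \<partial>M)"
    by (rule weak[OF d\<psi>]) (intro continuous_intros \<theta> cu)
  also have "(\<integral>x. a x * u (Y x) \<partial>M) + - (\<integral>x. b x * \<psi> (Y x) \<partial>M) = (\<integral>x. a x * u (Y x) - b x * \<psi> (Y x) \<partial>M)"
    using bnd[OF a cu] bnd[OF b c\<psi>] by simp
  also have "\<dots> \<le> (\<integral>x. K x * u (Y x) \<partial>M)"
  proof (rule integral_mono)
    fix x assume x: "x \<in> space M"
    note ab = AB0[OF Yr[OF x]]
    have "\<bar>A (Y x) - B (Y x)\<bar> \<le> A (Y x) + B (Y x)" using ab by simp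
    hence "\<bar>\<psi> (Y x)\<bar> \<le> \<epsilon> * u (Y x)" using eps by (simp add: \<psi>_def u_def abs_mult)
    from mult_left_mono[OF this, of "\<bar>b x\<bar>"] have "- (b x * \<psi> (Y x)) \<le> \<epsilon> * \<bar>b x\<bar> * u (Y x)"
      by (simp add: abs_mult[symmetric] mult_ac)
    moreover have "\<epsilon> * u (Y x) \<ge> 0" using eps ab by (simp add: u_def)
    ultimately show "a x * u (Y x) - b x * \<psi> (Y x) \<le> K x * u (Y x)" by (simp add: K_def algebra_simps)
  qed (use bnd[OF a cu] bnd[OF b c\<psi>] bnd[OF K_int cu] in auto)
  finally have le: "(\<integral>x. a x * \<theta> (Y x) \<partial>M) \<le> (\<integral>x. K x * u (Y x) \<partial>M)" .
  have u0: "u (Y x) \<ge> 0" if "x \<in> space M" for x using AB0[OF Yr[OF that]] by (simp add: u_def)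
  have "(\<integral>\<^sup>+x. ennreal (a x * \<theta> (Y x)) \<partial>M) = ennreal (\<integral>x. a x * \<theta> (Y x) \<partial>M)"
    using bnd[OF a \<theta>] a0 \<theta>0 by (intro nn_integral_eq_integral) auto
  also have "\<dots> \<le> ennreal (\<integral>x. K x * u (Y x) \<partial>M)" using le by (rule ennreal_leI)
  also have "\<dots> = (\<integral>\<^sup>+x. ennreal (K x * u (Y x)) \<partial>M)"
    using bnd[OF K_int cu] K_nonneg u0 by (intro nn_integral_eq_integral[symmetric]) auto
  also have "\<dots> = (\<integral>\<^sup>+x. (\<integral>\<^sup>+t. ennreal (K x) * (ennreal (\<theta> t * kern t (Y x)) * indicator {-r..r} t) \<partial>lborel) \<partial>M)"
    by (intro nn_integral_cong) (simp add: K_nonneg ennreal_mult' u_nn[OF Yr] nn_integral_cmult)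
  also have "\<dots> = (\<integral>\<^sup>+t. (\<integral>\<^sup>+x. ennreal (K x) * (ennreal (\<theta> t * kern t (Y x)) * indicator {-r..r} t) \<partial>M) \<partial>lborel)"
  proof -
    interpret P: pair_sigma_finite lborel M ..
    show ?thesis by (rule P.Fubini') measurable
  qed
  also have "\<dots> = (\<integral>\<^sup>+t. ennreal (\<theta> t * \<phi> t) * indicator {-r..r} t \<partial>lborel)"
  proof (rule nn_integral_cong)
    fix t
    have "(\<integral>\<^sup>+x. ennreal (K x) * (ennreal (\<theta> t * kern t (Y x)) * indicator {-r..r} t) \<partial>M)
       = (\<integral>\<^sup>+x. (ennreal (\<theta> t) * indicator {-r..r} t) * ennreal (K x * kern t (Y x)) \<partial>M)"
      by (intro nn_integral_cong) (simp add: K_nonneg ennreal_mult' \<theta>0 mult_ac)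
    also have "\<dots> = (ennreal (\<theta> t) * indicator {-r..r} t) * ennreal (\<phi> t)"
      by (subst nn_integral_cmult) (auto simp: \<phi>_nn)
    finally show "(\<integral>\<^sup>+x. ennreal (K x) * (ennreal (\<theta> t * kern t (Y x)) * indicator {-r..r} t) \<partial>M) = ennreal (\<theta> t * \<phi> t) * indicator {-r..r} t"
      by (simp add: ennreal_mult' \<theta>0 mult_ac)
  qed
  finally show ?thesis .
qed

text \<open>Trapezoids approximating the indicator of [x, x + h] turn \<open>majorant_test\<close>
  into an inequality between integrals over intervals; Lebesgue differentiation makes it
  pointwise.\<close>

lemma density_le_\<phi>:
  assumes f: "integrable lborel f" "\<And>v. f v \<ge> (0::real)"
    and law: "\<And>h. h \<in> borel_measurable borel \<Longrightarrow> (\<And>v. h v \<ge> 0) \<Longrightarrow>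
      (\<integral>\<^sup>+x. ennreal (a x * h (Y x)) \<partial>M) = (\<integral>\<^sup>+v. ennreal (f v * h v) \<partial>lborel)"
  shows "AE v in lborel. \<bar>v\<bar> < r \<longrightarrow> f v \<le> \<phi> v"
proof -
  have [measurable]: "f \<in> borel_measurable borel" using f by auto
  have \<phi>i: "integrable lborel \<phi>"
  proof (rule integrableI_nonneg)
    show "AE t in lborel. 0 \<le> \<phi> t" using \<phi>_pos by (intro AE_I2) (meson divide_nonneg_pos exp_ge_zero order_trans zero_less_numeral)
    show "(\<integral>\<^sup>+t. ennreal (\<phi> t) \<partial>lborel) < \<infinity>" by (simp add: nn_integral_\<phi>)
  qed simp
  have \<phi>0: "\<phi> t \<ge> 0" for t using \<phi>_pos[of t] by (meson divide_nonneg_pos exp_ge_zero order_trans zero_less_numeral)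
  have int: "integral {x..x+h} f \<le> integral {x..x+h} \<phi>" if h: "h > 0" for x h
  proof -
    have *: "(\<integral>v. f v * bump' h (Suc n) (v - x) \<partial>lborel) \<le> (\<integral>v. \<phi> v * bump' h (Suc n) (v - x) \<partial>lborel)" for n
    proof -
      note bb = bump'_bounds[OF h, of "Suc n"]
      have i: "integrable lborel (\<lambda>v. g v * bump' h (Suc n) (v - x))" if "integrable lborel g" for g
        by (rule Bochner_Integration.integrable_bound[OF that])
           (use that bb in \<open>auto simp: abs_mult intro!: AE_I2 mult_left_le\<close>)
      have "ennreal (\<integral>v. f v * bump' h (Suc n) (v - x) \<partial>lborel) = (\<integral>\<^sup>+v. ennreal (f v * bump' h (Suc n) (v - x)) \<partial>lborel)"
        using i[OF f(1)] f(2) bb by (intro nn_integral_eq_integral[symmetric]) auto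
      also have "\<dots> = (\<integral>\<^sup>+y. ennreal (a y * bump' h (Suc n) (Y y - x)) \<partial>M)"
        by (rule law[symmetric]) (use bb in auto)
      also have "\<dots> \<le> (\<integral>\<^sup>+t. ennreal (bump' h (Suc n) (t - x) * \<phi> t) * indicator {-r..r} t \<partial>lborel)"
        by (rule majorant_test[OF continuous_bump']) (use bb in auto)
      also have "\<dots> \<le> (\<integral>\<^sup>+t. ennreal (\<phi> t * bump' h (Suc n) (t - x)) \<partial>lborel)"
        by (intro nn_integral_mono) (auto simp: indicator_def mult.commute)
      also have "\<dots> = ennreal (\<integral>v. \<phi> v * bump' h (Suc n) (v - x) \<partial>lborel)"
        using i[OF \<phi>i] \<phi>0 bb by (intro nn_integral_eq_integral) auto
      finally show ?thesis
        using \<phi>0 bb by (subst (asm) ennreal_le_iff) (auto intro!: integral_nonneg_AE AE_I2)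
    qed
    have lim: "(\<lambda>n. \<integral>v. g v * bump' h (Suc n) (v - x) \<partial>lborel) \<longlonglongrightarrow> integral {x..x+h} g" if g: "integrable lborel g" for g
    proof -
      note bb = bump'_bounds[OF h]
      have "integral {x..x+h} g = (\<integral>v. g v * indicator {0..h} (v - x) \<partial>lborel)"
        unfolding integrable_on_Icc_lborel(2)[OF g]
        by (rule Bochner_Integration.integral_cong) (auto simp: indicator_def)
      moreover have "(\<lambda>n. \<integral>v. g v * bump' h (Suc n) (v - x) \<partial>lborel) \<longlonglongrightarrow> (\<integral>v. g v * indicator {0..h} (v - x) \<partial>lborel)"
        by (rule integral_dominated_convergence[where w="\<lambda>v. \<bar>g v\<bar>"])
           (use g bb in \<open>auto simp: abs_mult intro!: AE_I2 mult_left_le tendsto_intros bump'_tendsto[OF h]\<close>)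
      ultimately show ?thesis by simp
    qed
    show ?thesis by (rule LIMSEQ_le[OF lim[OF f(1)] lim[OF \<phi>i]]) (use * in blast)
  qed
  show ?thesis
    using lebesgue_differentiation_right[OF f(1)] lebesgue_differentiation_right[OF \<phi>i]
  proof eventually_elim
    case (elim v)
    have "f v \<le> \<phi> v"
    proof (rule tendsto_le[OF _ elim(2) elim(1)])
      show "\<forall>\<^sub>F h in at_right 0. integral {v..v+h} f / h \<le> integral {v..v+h} \<phi> / h"
        using eventually_at_right_less[of 0] by eventually_elim (intro divide_right_mono int, auto)
    qed simp
    thus ?case by simp
  qed
qed

end

section \<open>Volumes of balls\<close>

text \<open>Log-convexity at the midpoint of x and x + 1, combined with the functional
  equation.\<close>

lemma Gamma_add_half_le:
  assumes x: "x > (0::real)"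
  shows "Gamma (x + 1 / 2) \<le> sqrt x * Gamma x"
proof -
  have pos: "Gamma x > 0" "Gamma (x + 1) > 0" "Gamma (x + 1 / 2) > 0" using x by (auto intro!: Gamma_real_pos)
  have "(ln \<circ> Gamma) ((1 - 1 / 2) *\<^sub>R x + (1 / 2) *\<^sub>R (x + 1)) \<le> (1 - 1 / 2) * (ln \<circ> Gamma) x + 1 / 2 * (ln \<circ> Gamma) (x + 1)"
    by (rule convex_onD[OF log_convex_Gamma_real]) (use x in auto)
  moreover have "(1 - 1 / 2) *\<^sub>R x + (1 / 2) *\<^sub>R (x + 1) = x + 1 / 2" by (simp add: field_simps)
  ultimately have "2 * ln (Gamma (x + 1 / 2)) \<le> ln (Gamma x) + ln (Gamma (x + 1))" by (simp add: o_def)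
  hence "ln ((Gamma (x + 1 / 2))\<^sup>2) \<le> ln (Gamma x * Gamma (x + 1))" using pos by (simp add: ln_mult ln_realpow)
  hence "(Gamma (x + 1 / 2))\<^sup>2 \<le> Gamma x * Gamma (x + 1)" using pos by (subst (asm) ln_le_cancel_iff) auto
  also have "Gamma (x + 1) = x * Gamma x" using x by (intro Gamma_plus1) (auto elim!: nonpos_Ints_cases)
  finally have "(Gamma (x + 1 / 2))\<^sup>2 \<le> (sqrt x * Gamma x)\<^sup>2" using x by (simp add: power2_eq_square mult_ac)
  thus ?thesis by (rule power2_le_imp_le) (use pos x in \<open>intro mult_nonneg_nonneg; simp\<close>)
qed

lemma unit_ball_vol_nonzero: "unit_ball_vol (real n) \<noteq> 0" "unit_ball_vol (real n + 1) \<noteq> 0"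
  by (rule unit_ball_vol_pos[THEN less_imp_neq, THEN not_sym], simp)+

lemma unit_ball_vol_Suc:
  "unit_ball_vol (real n + 1) = sqrt pi * Gamma (real n / 2 + 1) / Gamma (real n / 2 + 1 + 1 / 2) * unit_ball_vol (real n)"
proof -
  have "Gamma (real n / 2 + 1) > 0" by (intro Gamma_real_pos) auto
  hence g: "Gamma (real n / 2 + 1) \<noteq> 0" by (rule less_imp_neq[THEN not_sym])
  have p: "pi powr ((real n + 1) / 2) = sqrt pi * pi powr (real n / 2)"
    by (simp add: add_divide_distrib powr_add powr_half_sqrt)
  have e: "(real n + 1) / 2 + 1 = real n / 2 + 1 + 1 / 2" by (simp add: field_simps)
  show ?thesis unfolding unit_ball_vol_def p e using g by simp
qed

lemma unit_ball_vol_Suc_ge: "sqrt (2 * pi / (real n + 2)) * unit_ball_vol (real n) \<le> unit_ball_vol (real n + 1)"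
proof -
  define x where "x = real n / 2 + 1"
  have x: "x > 0" by (simp add: x_def)
  have g: "Gamma x > 0" "Gamma (x + 1 / 2) > 0" using x by (auto intro!: Gamma_real_pos)
  have "sqrt (2 * pi / (real n + 2)) = sqrt pi / sqrt x"
  proof -
    have "2 * pi / (real n + 2) = pi / x" by (simp add: x_def field_simps)
    thus ?thesis by (simp add: real_sqrt_divide)
  qed
  also have "\<dots> \<le> sqrt pi * Gamma x / Gamma (x + 1 / 2)"
    using Gamma_add_half_le[OF x] g x by (simp add: field_simps)
  finally show ?thesis unfolding unit_ball_vol_Suc x_def[symmetric] by (intro mult_right_mono) auto
qed

text \<open>The same Gamma bound with the argument shifted by a half: it now controls the numerator
  of the ratio instead of the denominator.\<close>

lemma unit_ball_vol_Suc_le: "unit_ball_vol (real n + 1) \<le> sqrt (2 * pi / (real n + 1)) * unit_ball_vol (real n)"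
proof -
  define x where "x = (real n + 1) / 2"
  have x: "x > 0" by (simp add: x_def)
  have g: "Gamma x > 0" "Gamma (x + 1 / 2) > 0" using x by (auto intro!: Gamma_real_pos)
  have e: "real n / 2 + 1 = x + 1 / 2" "x + 1 / 2 + 1 / 2 = x + 1" by (auto simp: x_def field_simps)
  have G1: "Gamma (x + 1) = x * Gamma x" using x by (intro Gamma_plus1) (auto elim!: nonpos_Ints_cases)
  have "sqrt pi * Gamma (x + 1 / 2) / Gamma (x + 1) \<le> sqrt pi * (sqrt x * Gamma x) / (x * Gamma x)"
    unfolding G1 using Gamma_add_half_le[OF x] g x by (intro divide_right_mono mult_left_mono) auto
  also have "\<dots> = sqrt pi / sqrt x"
  proof -
    have gx: "Gamma x \<noteq> 0" using g(1) by (rule less_imp_neq[THEN not_sym])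
    have "sqrt pi * (sqrt x * Gamma x) / (x * Gamma x) = sqrt pi * (sqrt x / x)" using gx by simp
    also have "sqrt x / x = 1 / sqrt x" using real_div_sqrt[of x] x by (simp add: field_simps)
    finally show ?thesis by simp
  qed
  also have "\<dots> = sqrt (2 * pi / (real n + 1))"
    unfolding real_sqrt_divide[symmetric] by (simp add: x_def)
  finally have le: "sqrt pi * Gamma (x + 1 / 2) / Gamma (x + 1) \<le> sqrt (2 * pi / (real n + 1))" .
  show ?thesis unfolding unit_ball_vol_Suc e by (rule mult_right_mono[OF le]) simp
qed

text \<open>A one-sided Stirling bound, weaker by half a logarithm, which is harmless beside errors
  of order sqrt N. The induction rests on (n + 1) (ln (n + 1) - ln n) \<ge> 1.\<close>

lemma ln_fact_le: "n \<ge> 1 \<Longrightarrow> ln (fact n :: real) \<le> 1 + (real n + 1) * ln (real n) - real n"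
proof (induction n rule: nat_induct_at_least)
  case base show ?case by simp
next
  case (Suc n)
  have n: "real n \<ge> 1" using Suc by simp
  have "ln (real n / (real n + 1)) \<le> real n / (real n + 1) - 1" using n by (intro ln_le_minus_one) auto
  also have "\<dots> = - 1 / (real n + 1)" using n by (simp add: field_simps)
  finally have "1 / (real n + 1) \<le> ln (real n + 1) - ln (real n)" using n by (simp add: ln_div)
  hence "1 \<le> (real n + 1) * (ln (real n + 1) - ln (real n))" using n by (simp add: field_simps)
  moreover have "ln (fact (Suc n) :: real) = ln (real n + 1) + ln (fact n)"
    by (simp add: ln_mult add.commute)
  ultimately show ?case using Suc.IH by (simp add: algebra_simps)
qed

text \<open>Iterates \<open>unit_ball_vol_Suc_ge\<close>; the factors n + 2 multiply up to (N +
  1)!.\<close>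

lemma ln_unit_ball_vol_ge: "real N / 2 * ln (2 * pi) - ln (fact (Suc N)) / 2 \<le> ln (unit_ball_vol (real N))"
proof (induction N)
  case 0 show ?case by simp
next
  case (Suc N)
  have "ln (sqrt (2 * pi / (real N + 2)) * unit_ball_vol (real N)) \<le> ln (unit_ball_vol (real N + 1))"
    using unit_ball_vol_Suc_ge[of N] by (subst ln_le_cancel_iff) (auto intro!: mult_pos_pos)
  moreover have "ln (sqrt (2 * pi / (real N + 2)) * unit_ball_vol (real N)) = ln (2 * pi) / 2 - ln (real N + 2) / 2 + ln (unit_ball_vol (real N))"
    by (simp add: ln_mult ln_sqrt ln_div diff_divide_distrib unit_ball_vol_nonzero)
  moreover have f: "ln (fact (Suc (Suc N)) :: real) = ln (real N + 2) + ln (fact (Suc N))"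
    by (subst fact_Suc, subst ln_mult) (auto simp del: fact_Suc simp: add.commute)
  moreover have v: "unit_ball_vol (real (Suc N)) = unit_ball_vol (real N + 1)" by (simp add: add.commute)
  moreover have l: "real (Suc N) / 2 * ln (2 * pi) = real N / 2 * ln (2 * pi) + ln (2 * pi) / 2"
    by (simp add: distrib_right add_divide_distrib)
  moreover have "A + a / 2 - (b + f) / 2 \<le> y" if "x \<le> y" "x = a / 2 - b / 2 + v" "A - f / 2 \<le> v" for A a b f v x y :: real
    using that by (simp add: field_simps)
  ultimately show ?case unfolding f v l using Suc by blast
qed

text \<open>\<open>cdens\<close> is the value of the coordinate density at height 0; on the sphere
  of radius sqrt N it is close to the Gaussian value 1/sqrt (2 pi).\<close>

lemma ln_cdens_ge:
  assumes "n \<ge> 1"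
  shows "ln (cdens n (sqrt (real (Suc n)))) \<ge> - ln (2 * pi) / 2 - 1 / real n"
proof -
  define V where "V = unit_ball_vol (real n)"
  define N where "N = real n + 1"
  have V: "V > 0" by (simp add: V_def)
  have N: "N > 1" using assms by (simp add: N_def)
  have V1: "unit_ball_vol (real n + 1) > 0" by simp
  have "real n / N / sqrt (2 * pi) = real n * V / (N * (sqrt (2 * pi / N) * V) * sqrt N)"
    using V N by (simp add: real_sqrt_divide field_simps)
  also have "\<dots> \<le> real n * V / (N * unit_ball_vol (real n + 1) * sqrt N)"
    using unit_ball_vol_Suc_le[of n] V N V1 unfolding V_def N_def
    by (intro divide_left_mono mult_right_mono mult_left_mono mult_pos_pos) auto
  also have "\<dots> = cdens n (sqrt (real (Suc n)))" by (simp add: cdens_def V_def N_def add.commute)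
  finally have "ln (real n / N / sqrt (2 * pi)) \<le> ln (cdens n (sqrt (real (Suc n))))"
    using assms N by (subst ln_le_cancel_iff) (auto simp: cdens_def intro!: divide_pos_pos mult_pos_pos)
  moreover have "ln (real n / N / sqrt (2 * pi)) = ln (real n / N) - ln (2 * pi) / 2"
    using assms N by (subst ln_div) (auto simp: ln_sqrt)
  moreover have "ln (real n / N) \<ge> - 1 / real n"
  proof -
    have "ln (N / real n) \<le> N / real n - 1" using assms N by (intro ln_le_minus_one) auto
    also have "\<dots> = 1 / real n" using assms by (simp add: N_def field_simps)
    finally show ?thesis using assms N by (simp add: ln_div)
  qed
  ultimately show ?thesis by simp
qed

text \<open>Compares \<open>c\<^sub>N\<^sup>-\<^sup>N\<close>, the cost of replacing the marginals of \<open>\<sigma>\<^sup>N\<close> by Lebesgue measure, with the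
  volume of the ball of radius \<open>\<surd>N\<close>; both are \<open>(2 \<pi> e)\<^sup>N\<^sup>/\<^sup>2\<close> up to powers of \<open>N\<close>.\<close>

lemma volume_defect:
  fixes N :: nat
  assumes N: "N \<ge> 4"
  shows "- real N * ln (cdens (N - 1) (sqrt (real N))) - ln (sqrt (real N) ^ N * unit_ball_vol (real N)) + real N / 2
    \<le> 3 + ln (real N + 1)"
proof -
  have N': "Suc (N - 1) = N" "N - 1 \<ge> 1" "real (N - 1) = real N - 1" using N by auto
  have 1: "- real N * ln (cdens (N - 1) (sqrt (real N))) \<le> real N * ln (2 * pi) / 2 + 2"
  proof -
    have "- ln (cdens (N - 1) (sqrt (real N))) \<le> ln (2 * pi) / 2 + 1 / (real N - 1)"
      using ln_cdens_ge[OF N'(2)] unfolding N'(1,3) by simp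
    from mult_left_mono[OF this, of "real N"]
    have "- real N * ln (cdens (N - 1) (sqrt (real N))) \<le> real N * ln (2 * pi) / 2 + real N / (real N - 1)"
      by (simp add: distrib_left)
    moreover have "real N / (real N - 1) \<le> 2" using N by (simp add: divide_le_eq)
    ultimately show ?thesis by linarith
  qed
  have "ln (sqrt (real N) ^ N * unit_ball_vol (real N)) = real N / 2 * ln (real N) + ln (unit_ball_vol (real N))"
    using N by (subst ln_mult) (auto simp: ln_realpow ln_sqrt unit_ball_vol_nonzero)
  moreover have "ln (fact (Suc N) :: real) \<le> (real N + 2) * ln (real N + 1) - real N"
    using ln_fact_le[of "Suc N"] by (simp add: algebra_simps)
  moreover have "real N * (ln (real N + 1) - ln (real N)) \<le> 1"
  proof -
    have "ln ((real N + 1) / real N) \<le> (real N + 1) / real N - 1" using N by (intro ln_le_minus_one) auto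
    also have "\<dots> = 1 / real N" using N by (simp add: field_simps)
    finally have "ln (real N + 1) - ln (real N) \<le> 1 / real N" using N by (subst (asm) ln_div) auto
    from mult_left_mono[OF this, of "real N"] N show ?thesis by simp
  qed
  ultimately show ?thesis using 1 ln_unit_ball_vol_ge[of N] by (simp add: algebra_simps)
qed

section \<open>From the sphere to a product integral\<close>

lemma sum_abs_le_L2_set: "(\<Sum>i\<in>I. \<bar>x i\<bar>) \<le> sqrt (real (card I)) * L2_set x I"
  using L2_set_mult_ineq[where f=x and g="\<lambda>_. 1" and A=I] by (simp add: L2_set_def[of "\<lambda>_. 1"] mult.commute)

text \<open>The sphere integral, multiplied by the volume of the unit ball, is an integral over that
  ball of a function constant on rays, and at least half of it sits in the shell of thickness 1/N.
  There the point r x differs from its radial projection by at most 1 in the l1 norm, so the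
  Lipschitz bounds cost exp (1/\<epsilon>). After that the integrand is a genuine product, and the
  shell may be enlarged to the whole space.\<close>

lemma prod_sphere_le:
  fixes p :: "nat \<Rightarrow> real \<Rightarrow> real" and c :: "nat \<Rightarrow> real"
  assumes I: "finite I" "I \<noteq> {}" and e: "\<epsilon> > 0"
    and [measurable]: "\<And>i. p i \<in> borel_measurable borel"
    and pos: "\<And>i t. p i t > 0"
    and lip: "\<And>i t t'. p i t * exp (- \<bar>t - t'\<bar> / \<epsilon>) \<le> p i t'"
    and tot: "\<And>i. i \<in> I \<Longrightarrow> (\<integral>\<^sup>+t. ennreal (p i t) \<partial>lborel) \<le> ennreal (c i)" "\<And>i. i \<in> I \<Longrightarrow> c i \<ge> 0"
  shows "(\<integral>\<^sup>+y. ennreal (\<Prod>i\<in>I. p i (y i)) \<partial>usph0 I (sqrt (real (card I)))) \<le>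
    ennreal (2 * exp (1 / \<epsilon>) * (\<Prod>i\<in>I. c i) / (sqrt (real (card I)) ^ card I * unit_ball_vol (real (card I))))"
proof -
  define N where "N = card I"
  have N: "N > 0" using I by (simp add: N_def card_gt_0_iff)
  define r where "r = sqrt (real N)"
  have r: "r > 0" using N by (simp add: r_def)
  define V where "V = unit_ball_vol (real N)"
  have V: "V > 0" by (simp add: V_def)
  define \<Phi> where "\<Phi> x = (\<Prod>i\<in>I. p i (x i))" for x
  have [measurable]: "\<Phi> \<in> borel_measurable (lbp I)" unfolding \<Phi>_def by measurable
  have \<Phi>0: "\<Phi> x > 0" for x by (auto simp: \<Phi>_def intro!: prod_pos pos)
  have lip\<Phi>: "\<Phi> x \<le> exp ((\<Sum>i\<in>I. \<bar>x i - y i\<bar>) / \<epsilon>) * \<Phi> y" for x y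
  proof -
    have "p i (x i) \<le> exp (\<bar>x i - y i\<bar> / \<epsilon>) * p i (y i)" for i
    proof -
      have "p i (x i) = exp (\<bar>x i - y i\<bar> / \<epsilon>) * (p i (x i) * exp (- \<bar>x i - y i\<bar> / \<epsilon>))"
        by (simp add: mult.left_commute exp_add[symmetric])
      also have "\<dots> \<le> exp (\<bar>x i - y i\<bar> / \<epsilon>) * p i (y i)" by (intro mult_left_mono lip) auto
      finally show ?thesis .
    qed
    hence "\<Phi> x \<le> (\<Prod>i\<in>I. exp (\<bar>x i - y i\<bar> / \<epsilon>) * p i (y i))"
      unfolding \<Phi>_def by (intro prod_mono) (auto intro: less_imp_le pos)
    thus ?thesis by (simp add: \<Phi>_def prod.distrib exp_sum[symmetric] I sum_divide_distrib)
  qed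
  define C where "C = (\<integral>\<^sup>+x. ennreal (\<Phi> (rad I r x)) * indicator {..1} (L2_set x I) \<partial>lbp I)"
  have Ceq: "C = ennreal V * (\<integral>\<^sup>+y. ennreal (\<Phi> y) \<partial>usph0 I r)"
    using nn_integral_ub[OF I(1), of "\<lambda>x. ennreal (\<Phi> (rad I r x))"]
    by (simp add: C_def V_def N_def usph0_def nn_integral_distr)
  \<comment> \<open>Finiteness allows solving C = \<rho>^N C + S for C.\<close>
  have Cfin: "C < \<infinity>"
  proof -
    define B where "B = exp (r * r / \<epsilon>) * \<Phi> (\<lambda>_. 0)"
    have "\<Phi> (rad I r x) \<le> B" for x
    proof -
      have "(\<Sum>i\<in>I. \<bar>rad I r x i - 0\<bar>) \<le> sqrt (real N) * L2_set (rad I r x) I"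
        using sum_abs_le_L2_set[of "rad I r x" I] by (simp add: N_def)
      also have "L2_set (rad I r x) I \<le> r"
      proof (cases "L2_set x I = 0")
        case True
        have "L2_set (rad I r x) I = L2_set (\<lambda>_. 0) I" by (rule L2_set_cong) (auto simp: rad_def True)
        thus ?thesis using r by (simp add: L2_set_def)
      qed (use L2_set_rad[OF less_imp_le[OF r]] in auto)
      finally have "(\<Sum>i\<in>I. \<bar>rad I r x i - 0\<bar>) / \<epsilon> \<le> r * r / \<epsilon>" using e r by (intro divide_right_mono) (auto simp: r_def)
      hence "exp ((\<Sum>i\<in>I. \<bar>rad I r x i - 0\<bar>) / \<epsilon>) * \<Phi> (\<lambda>_. 0) \<le> B" unfolding B_def
        using \<Phi>0[of "\<lambda>_. 0"] by (intro mult_right_mono) auto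
      thus ?thesis using lip\<Phi>[of "rad I r x" "\<lambda>_. 0"] by linarith
    qed
    hence "C \<le> (\<integral>\<^sup>+x. ennreal B * indicator (uball I) x \<partial>lbp I)"
      unfolding C_def by (intro nn_integral_mono) (auto simp: indicator_def uball_def space_lbp intro: ennreal_leI)
    also have "\<dots> = ennreal B * emeasure (lbp I) (uball I)" by (rule nn_integral_cmult_indicator) simp
    also have "\<dots> < \<infinity>" using I(1) by (simp add: emeasure_uball ennreal_mult_less_top)
    finally show ?thesis .
  qed
  \<comment> \<open>Thin enough for an l1 displacement of at most r^2/N = 1, thick enough that the
    inner ball carries at most the fraction exp (-1) of C.\<close>
  define \<rho> where "\<rho> = 1 - 1 / real N"
  define S where "S = (\<integral>\<^sup>+x. ennreal (\<Phi> (rad I r x)) * indicator {\<rho><..1} (L2_set x I) \<partial>lbp I)"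
  have \<rho>: "\<rho> \<ge> 0" "\<rho> \<le> 1" using N by (auto simp: \<rho>_def divide_le_eq)
  have "C = (\<integral>\<^sup>+x. ennreal (\<Phi> (rad I r x)) * indicator {..\<rho>} (L2_set x I) \<partial>lbp I) + S"
    unfolding C_def S_def using \<rho>
    by (subst nn_integral_add[symmetric]) (auto simp: indicator_def intro!: nn_integral_cong)
  also have "(\<integral>\<^sup>+x. ennreal (\<Phi> (rad I r x)) * indicator {..\<rho>} (L2_set x I) \<partial>lbp I) = ennreal (\<rho> ^ N) * C"
  proof (cases "\<rho> = 0")
    case True
    have "(\<integral>\<^sup>+x. ennreal (\<Phi> (rad I r x)) * indicator {..\<rho>} (L2_set x I) \<partial>lbp I) = (\<integral>\<^sup>+x. 0 \<partial>lbp I)"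
    proof (rule nn_integral_cong_AE)
      show "AE x in lbp I. ennreal (\<Phi> (rad I r x)) * indicator {..\<rho>} (L2_set x I) = 0"
        using AE_L2_set_nonzero[OF I]
      proof eventually_elim
        case (elim x)
        have "L2_set x I > 0" using elim L2_set_nonneg[of x I] by linarith
        thus ?case by (simp add: True)
      qed
    qed
    thus ?thesis using True N by (simp add: zero_power)
  next
    case False
    thus ?thesis using \<rho> nn_integral_cone[OF I(1), of \<rho> "\<lambda>x. ennreal (\<Phi> x)" r] by (simp add: C_def N_def)
  qed
  finally have CS: "C = ennreal (\<rho> ^ N) * C + S" .
  have Sle: "S \<le> ennreal (exp (1 / \<epsilon>) * (\<Prod>i\<in>I. c i) / r ^ N)"
  proof -
    have "S \<le> (\<integral>\<^sup>+x. ennreal (exp (1 / \<epsilon>)) * ennreal (\<Phi> (\<lambda>i\<in>I. r * x i)) \<partial>lbp I)"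
      unfolding S_def
    proof (intro nn_integral_mono)
      fix x
      show "ennreal (\<Phi> (rad I r x)) * indicator {\<rho><..1} (L2_set x I) \<le> ennreal (exp (1 / \<epsilon>)) * ennreal (\<Phi> (\<lambda>i\<in>I. r * x i))"
      proof (cases "\<rho> < L2_set x I \<and> L2_set x I \<le> 1")
        case True
        define L where "L = L2_set x I"
        have L: "L > 0" "\<rho> < L" "L \<le> 1" using True \<rho> by (auto simp: L_def)
        have "(\<Sum>i\<in>I. \<bar>rad I r x i - (\<lambda>i\<in>I. r * x i) i\<bar>) = (\<Sum>i\<in>I. r * (1 / L - 1) * \<bar>x i\<bar>)"
        proof (intro sum.cong refl)
          fix i assume i: "i \<in> I"
          have "rad I r x i - (\<lambda>i\<in>I. r * x i) i = r * (1 / L - 1) * x i"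
            using i by (simp add: rad_def L_def[symmetric] algebra_simps)
          moreover have "r * (1 / L - 1) \<ge> 0" using r L by auto
          ultimately show "\<bar>rad I r x i - (\<lambda>i\<in>I. r * x i) i\<bar> = r * (1 / L - 1) * \<bar>x i\<bar>" by (simp only: abs_mult[of "r * (1 / L - 1)" "x i"] abs_of_nonneg)
        qed
        also have "\<dots> = r * (1 / L - 1) * (\<Sum>i\<in>I. \<bar>x i\<bar>)" by (simp add: sum_distrib_left)
        also have "\<dots> \<le> r * (1 / L - 1) * (r * L)"
          using sum_abs_le_L2_set[of x I] r L by (intro mult_left_mono) (auto simp: r_def N_def L_def)
        also have "\<dots> = (r * r) * (1 - L)" using L by (simp add: field_simps)
        also have "\<dots> \<le> (r * r) * (1 / real N)" using L r by (intro mult_left_mono) (auto simp: \<rho>_def)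
        also have "\<dots> = 1" using N by (simp add: r_def)
        finally have "(\<Sum>i\<in>I. \<bar>rad I r x i - (\<lambda>i\<in>I. r * x i) i\<bar>) / \<epsilon> \<le> 1 / \<epsilon>" using e by (intro divide_right_mono) auto
        hence "exp ((\<Sum>i\<in>I. \<bar>rad I r x i - (\<lambda>i\<in>I. r * x i) i\<bar>) / \<epsilon>) * \<Phi> (\<lambda>i\<in>I. r * x i) \<le> exp (1 / \<epsilon>) * \<Phi> (\<lambda>i\<in>I. r * x i)"
          using \<Phi>0[of "\<lambda>i\<in>I. r * x i"] by (intro mult_right_mono) auto
        hence "\<Phi> (rad I r x) \<le> exp (1 / \<epsilon>) * \<Phi> (\<lambda>i\<in>I. r * x i)"
          using lip\<Phi>[of "rad I r x" "\<lambda>i\<in>I. r * x i"] by linarith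
        hence "ennreal (\<Phi> (rad I r x)) \<le> ennreal (exp (1 / \<epsilon>)) * ennreal (\<Phi> (\<lambda>i\<in>I. r * x i))"
          by (simp add: ennreal_mult'[symmetric] ennreal_leI)
        thus ?thesis using True by simp
      qed auto
    qed
    also have "\<dots> = ennreal (exp (1 / \<epsilon>)) * (\<integral>\<^sup>+x. ennreal (\<Phi> (\<lambda>i\<in>I. r * x i)) \<partial>lbp I)"
      by (rule nn_integral_cmult) measurable
    also have "(\<integral>\<^sup>+x. ennreal (\<Phi> (\<lambda>i\<in>I. r * x i)) \<partial>lbp I) = ennreal (1 / r ^ N) * (\<integral>\<^sup>+x. ennreal (\<Phi> x) \<partial>lbp I)"
      using nn_integral_lbp_scale[OF I(1) r, of "\<lambda>x. ennreal (\<Phi> x)"] r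
      by (simp add: N_def mult.assoc[symmetric] ennreal_mult'[symmetric])
    also have "(\<integral>\<^sup>+x. ennreal (\<Phi> x) \<partial>lbp I) = (\<Prod>i\<in>I. \<integral>\<^sup>+t. ennreal (p i t) \<partial>lborel)"
      unfolding \<Phi>_def using lborel_prod.product_nn_integral_prod[OF I(1), of "\<lambda>i t. ennreal (p i t)"]
      by (simp add: prod_ennreal[symmetric] less_imp_le[OF pos])
    also have "\<dots> \<le> (\<Prod>i\<in>I. ennreal (c i))" by (intro prod_mono_ennreal tot)
    also have "\<dots> = ennreal (\<Prod>i\<in>I. c i)" using tot(2) by (simp add: prod_ennreal)
    finally have "S \<le> ennreal (exp (1 / \<epsilon>)) * (ennreal (1 / r ^ N) * ennreal (\<Prod>i\<in>I. c i))"
      by (simp add: mult_left_mono)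
    also have "\<dots> = ennreal (exp (1 / \<epsilon>) * (1 / r ^ N * (\<Prod>i\<in>I. c i)))"
      using r by (simp add: ennreal_mult'[symmetric])
    finally show ?thesis by (simp add: field_simps)
  qed
  obtain C' where C': "C = ennreal C'" "C' \<ge> 0" using Cfin by (cases C) auto
  obtain S' where S': "S = ennreal S'" "S' \<ge> 0" "S' \<le> exp (1 / \<epsilon>) * (\<Prod>i\<in>I. c i) / r ^ N"
  proof -
    have nn: "0 \<le> exp (1 / \<epsilon>) * (\<Prod>i\<in>I. c i) / r ^ N" using r tot(2) by (auto intro!: divide_nonneg_nonneg mult_nonneg_nonneg prod_nonneg)
    have "S < top" using Sle by (rule order_le_less_trans) simp
    then obtain s where "S = ennreal s" "s \<ge> 0" by (cases S) auto
    thus thesis using that[of s] Sle nn by simp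
  qed
  have "\<rho> ^ N \<le> 1 / 2"
  proof -
    have "\<rho> \<le> exp (- (1 / real N))" using exp_ge_add_one_self[of "- (1 / real N)"] by (simp add: \<rho>_def)
    hence "\<rho> ^ N \<le> exp (- (1 / real N)) ^ N" using \<rho> by (intro power_mono) auto
    also have "\<dots> = exp (- 1)" using N by (simp add: exp_of_nat_mult[symmetric])
    also have "\<dots> \<le> 1 / 2" using exp_ge_add_one_self[of 1] by (simp add: exp_minus field_simps)
    finally show ?thesis .
  qed
  moreover have "C' = \<rho> ^ N * C' + S'"
    using CS \<rho> C' S' by (simp add: ennreal_mult'[symmetric] ennreal_plus[symmetric] del: ennreal_plus)
  moreover have "\<rho> ^ N * C' \<le> 1 / 2 * C'" using calculation(1) C'(2) by (intro mult_right_mono)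
  ultimately have "C' \<le> 2 * (exp (1 / \<epsilon>) * (\<Prod>i\<in>I. c i) / r ^ N)" using S'(3) by linarith
  hence "C' / V \<le> 2 * exp (1 / \<epsilon>) * (\<Prod>i\<in>I. c i) / (r ^ N * V)" using V by (simp add: field_simps)
  moreover have "(\<integral>\<^sup>+y. ennreal (\<Phi> y) \<partial>usph0 I r) = ennreal (C' / V)"
  proof -
    have "ennreal V * (\<integral>\<^sup>+y. ennreal (\<Phi> y) \<partial>usph0 I r) = ennreal V * ennreal (C' / V)"
      using V C' Ceq by (simp add: ennreal_mult'[symmetric])
    thus ?thesis using V by (subst (asm) ennreal_mult_cancel_left) auto
  qed
  ultimately show ?thesis by (simp add: \<Phi>_def r_def N_def V_def ennreal_leI)
qed

text \<open>\<open>Z\<close> need only bound the mass of \<open>P\<close> from above, which suits an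
  estimate like \<open>prod_sphere_le\<close>. The pointwise inequality is ln y \<le> y - 1 at y =
  P/(Z F).\<close>

lemma (in prob_space) gibbs_inequality:
  fixes F P :: "'a \<Rightarrow> real"
  assumes F: "integrable M F" "\<And>x. x \<in> space M \<Longrightarrow> F x \<ge> 0" "(\<integral>x. F x \<partial>M) = 1"
    and FlF: "integrable M (\<lambda>x. F x * ln (F x))" and FlP: "integrable M (\<lambda>x. F x * ln (P x))"
    and [measurable]: "P \<in> borel_measurable M" and P: "\<And>x. x \<in> space M \<Longrightarrow> P x > 0"
    and Z: "(\<integral>\<^sup>+x. ennreal (P x) \<partial>M) \<le> ennreal Z" "Z > 0"
  shows "(\<integral>x. F x * ln (P x) \<partial>M) \<le> (\<integral>x. F x * ln (F x) \<partial>M) + ln Z"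
proof -
  have Pi: "integrable M P"
    using P order_le_less_trans[OF Z(1)] by (intro integrableI_nonneg) (auto intro!: AE_I2 less_imp_le)
  have "ennreal (\<integral>x. P x \<partial>M) = (\<integral>\<^sup>+x. ennreal (P x) \<partial>M)"
    using Pi P by (intro nn_integral_eq_integral[symmetric]) (auto intro!: AE_I2 less_imp_le)
  hence "ennreal (\<integral>x. P x \<partial>M) \<le> ennreal Z" using Z(1) by simp
  hence PZ: "(\<integral>x. P x \<partial>M) \<le> Z" using Z(2) by (subst (asm) ennreal_le_iff) auto
  have "(\<integral>x. F x * ln (P x) - F x * ln Z - F x * ln (F x) \<partial>M) \<le> (\<integral>x. P x / Z - F x \<partial>M)"
  proof (rule integral_mono)
    fix x assume x: "x \<in> space M"
    show "F x * ln (P x) - F x * ln Z - F x * ln (F x) \<le> P x / Z - F x"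
    proof (cases "F x = 0")
      case True thus ?thesis using P[OF x] Z by simp
    next
      case False
      hence f: "F x > 0" using F(2)[OF x] by simp
      have "ln (P x / (Z * F x)) \<le> P x / (Z * F x) - 1"
        using P[OF x] Z f by (intro ln_le_minus_one) auto
      moreover have "ln (P x / (Z * F x)) = ln (P x) - ln Z - ln (F x)"
        using P[OF x] Z f by (simp add: ln_div ln_mult)
      ultimately have "F x * (ln (P x) - ln Z - ln (F x)) \<le> F x * (P x / (Z * F x) - 1)"
        using f by (intro mult_left_mono) auto
      thus ?thesis using f by (simp add: algebra_simps)
    qed
  qed (use F FlF FlP Pi in auto)
  also have "\<dots> = (\<integral>x. P x \<partial>M) / Z - 1" using Pi F by simp
  also have "\<dots> \<le> 0" using PZ Z by simp
  finally show ?thesis using F FlF FlP by simp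
qed

section \<open>The entropy of the marginals in a fixed dimension\<close>

lemma distr_usph0_coord:
  assumes I: "finite I" "j \<in> I" and n: "card I = Suc n" "n > 0" and r: "r > 0"
  shows "distr (usph0 I r) borel (\<lambda>x. x j) = vlaw n r"
proof (rule measure_eqI)
  interpret u': prob_space "ub (I - {j})" by (rule prob_space_ub) (use I in auto)
  fix A :: "real set" assume "A \<in> sets (distr (usph0 I r) borel (\<lambda>x. x j))"
  hence A[measurable]: "A \<in> sets borel" by simp
  have [measurable]: "(\<lambda>x. x j) \<in> borel_measurable (lbp I)" by (rule lbp_coord[OF I(2)])
  have "emeasure (distr (usph0 I r) borel (\<lambda>x. x j)) A = (\<integral>\<^sup>+x. indicator A (x j) \<partial>usph0 I r)"
    by (subst nn_integral_indicator[symmetric], simp, subst nn_integral_distr) auto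
  also have "\<dots> = (\<integral>\<^sup>+v. (\<integral>\<^sup>+z. indicator A (slice_pt I j r v z j) \<partial>ub (I - {j})) \<partial>vlaw n r)"
    by (rule nn_integral_usph0[OF I n r]) measurable
  also have "\<dots> = (\<integral>\<^sup>+v. indicator A v \<partial>vlaw n r)"
    by (simp add: slice_pt_def u'.emeasure_space_1)
  finally show "emeasure (distr (usph0 I r) borel (\<lambda>x. x j)) A = emeasure (vlaw n r) A" by simp
qed simp

lemma xlnx_ge: "x \<ge> 0 \<Longrightarrow> x * ln x \<ge> -(1::real)"
proof (cases "x = 0")
  case False
  assume "x \<ge> 0"
  hence x: "x > 0" using False by simp
  have "ln (1 / x) \<le> 1 / x - 1" using x by (intro ln_le_minus_one) auto
  hence "- ln x \<le> 1 / x - 1" using x by (simp add: ln_div)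
  from mult_left_mono[OF this, of x] x show ?thesis by (simp add: algebra_simps)
qed simp

text \<open>\<open>G\<close> is one admissible weak gradient rather than the infimum in
  \<open>fisherN\<close>. The integrability assumptions exclude the default value 0 of the integrals
  that occur.\<close>

locale sphere_density =
  fixes N :: nat and F :: "(nat \<Rightarrow> real) \<Rightarrow> real" and G :: "(nat \<Rightarrow> real) \<Rightarrow> nat \<Rightarrow> real" and D :: real
  assumes N: "N \<ge> 4" and dens: "sph_density N F"
    and wg: "weak_sph_grad {..<N} (sqrt (real N)) F G"
    and D: "D > 0" and fisher: "(\<integral>\<^sup>+x. ennreal ((\<Sum>i<N. (G x i / F x)\<^sup>2) * F x) \<partial>sigmaN N) \<le> ennreal (D * real N)"
    and FlF: "integrable (sigmaN N) (\<lambda>x. F x * ln (F x))"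
    and Flw: "\<And>j. j < N \<Longrightarrow> integrable (sigmaN N) (\<lambda>x. F x * ln (1 - (x j)\<^sup>2 / real N))"
begin

definition "R = sqrt (real N)"
definition "n = N - 1"

lemma R: "R > 0" "R\<^sup>2 = real N" using N by (auto simp: R_def)
lemma n: "card {..<N} = Suc n" "n > 0" "real n = real N - 1" using N by (auto simp: n_def)
lemma ne: "{..<N} \<noteq> {}" using N by (auto simp: lessThan_empty_iff)
lemma sig: "sigmaN N = usph {..<N} R" by (simp add: sigmaN_def R_def)
lemma wgR: "weak_sph_grad {..<N} R F G" using wg by (simp add: R_def)

sublocale S: prob_space "usph {..<N} R"
  by (rule prob_space_usph[OF finite_lessThan ne less_imp_le[OF R(1)]])

lemma space_S: "space (usph {..<N} R) = sph {..<N} R" by (rule space_usph)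

lemma F_meas: "F \<in> borel_measurable (usph {..<N} R)" using dens by (simp add: sph_density_def sig)
lemma F0: "x \<in> sph {..<N} R \<Longrightarrow> F x \<ge> 0" using dens by (simp add: sph_density_def R_def)

lemma F_int: "integrable (usph {..<N} R) F"
  using dens F0 F_meas by (intro integrableI_nonneg) (auto simp: sph_density_def sig space_S intro!: AE_I2)

lemma F_one: "(\<integral>x. F x \<partial>usph {..<N} R) = 1"
proof -
  have "ennreal (\<integral>x. F x \<partial>usph {..<N} R) = (\<integral>\<^sup>+x. ennreal (F x) \<partial>usph {..<N} R)"
    using F_int F0 by (intro nn_integral_eq_integral[symmetric]) (auto simp: space_S intro!: AE_I2)
  also have "\<dots> = 1" using dens by (simp add: sph_density_def sig)
  finally show ?thesis using F_int F0 by (simp add: space_S integral_nonneg_AE AE_I2)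
qed

lemma G_int: "j < N \<Longrightarrow> integrable (usph {..<N} R) (\<lambda>x. G x j)"
  using wgR by (auto simp: weak_sph_grad_def)

lemma xj_le: "j < N \<Longrightarrow> x \<in> sph {..<N} R \<Longrightarrow> \<bar>x j\<bar> \<le> R"
  by (rule sph_coord_le) auto

lemma xj_meas: "j < N \<Longrightarrow> (\<lambda>x. x j) \<in> borel_measurable (usph {..<N} R)"
  by (intro measurable_usph_of_lbp[OF finite_lessThan ne less_imp_le[OF R(1)]] lbp_coord) simp

lemma Fh_int:
  fixes h :: "real \<Rightarrow> real" and C :: real
  assumes j: "j < N" and h: "h \<in> borel_measurable borel" "\<And>v. \<bar>v\<bar> \<le> R \<Longrightarrow> \<bar>h v\<bar> \<le> C" and f: "integrable (usph {..<N} R) f"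
  shows "integrable (usph {..<N} R) (\<lambda>x. f x * h (x j))"
proof (rule Bochner_Integration.integrable_bound[OF integrable_mult_right[OF integrable_abs[OF f], of C]])
  show "(\<lambda>x. f x * h (x j)) \<in> borel_measurable (usph {..<N} R)"
    using f measurable_compose[OF xj_meas[OF j] h(1)] by (intro borel_measurable_times) auto
  show "AE x in usph {..<N} R. norm (f x * h (x j)) \<le> norm (C * \<bar>f x\<bar>)"
  proof (rule AE_I2)
    fix x assume "x \<in> space (usph {..<N} R)"
    hence "\<bar>h (x j)\<bar> \<le> \<bar>C\<bar>" using h(2)[OF xj_le[OF j, of x]] by (auto simp: space_S)
    from mult_right_mono[OF this, of "\<bar>f x\<bar>"] show "norm (f x * h (x j)) \<le> norm (C * \<bar>f x\<bar>)"
      by (simp add: abs_mult mult.commute)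
  qed
qed

lemma w_bounds: "\<bar>v\<bar> \<le> R \<Longrightarrow> 0 \<le> 1 - v\<^sup>2 / real N" "1 - v\<^sup>2 / real N \<le> 1"
proof -
  show "0 \<le> 1 - v\<^sup>2 / real N" if "\<bar>v\<bar> \<le> R"
  proof -
    have "v\<^sup>2 \<le> real N" using that R by (metis abs_le_square_iff abs_of_pos)
    thus ?thesis using N by (simp add: divide_le_eq)
  qed
qed simp

text \<open>Testing with the pole field produces exactly this pair: \<open>aw\<close> multiplies
  \<psi>', and \<open>bw\<close>, the gradient minus the divergence term, multiplies \<psi>.\<close>

definition "aw j x = (1 - (x j)\<^sup>2 / real N) * F x"
definition "bw j x = G x j - real n / real N * x j * F x"
text \<open>This choice balances two errors: the Lipschitz cost 1/\<epsilon> of the shell, and the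
  surplus mass \<epsilon> times the sum of the \<open>Vj\<close>, which is of order \<epsilon> N.
  Both become of order sqrt N.\<close>

definition "\<epsilon> = 1 / R"

lemma aw_int: "j < N \<Longrightarrow> integrable (usph {..<N} R) (aw j)"
  using Fh_int[of j "\<lambda>v. 1 - v\<^sup>2 / real N" 1, OF _ _ _ F_int] w_bounds
  by (simp add: aw_def[abs_def] mult.commute)

lemma xF_int: "j < N \<Longrightarrow> integrable (usph {..<N} R) (\<lambda>x. \<bar>x j\<bar> * F x)" "j < N \<Longrightarrow> integrable (usph {..<N} R) (\<lambda>x. x j * F x)"
  using Fh_int[of j "\<lambda>v. \<bar>v\<bar>" R, OF _ _ _ F_int] Fh_int[of j "\<lambda>v. v" R, OF _ _ _ F_int]
  by (simp_all add: mult.commute)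

lemma bw_int: "j < N \<Longrightarrow> integrable (usph {..<N} R) (bw j)"
  unfolding bw_def[abs_def] mult.assoc using G_int[of j] xF_int(2)[of j] by (intro Bochner_Integration.integrable_diff) auto

lemma weak_density_coord:
  assumes j: "j < N"
  shows "weak_density (usph {..<N} R) (\<lambda>x. x j) (aw j) (bw j) R \<epsilon>"
proof unfold_locales
  fix \<psi> \<psi>' :: "real \<Rightarrow> real"
  assume \<psi>: "\<And>v. (\<psi> has_real_derivative \<psi>' v) (at v)" and c: "continuous_on UNIV \<psi>'"
  have c\<psi>: "continuous_on UNIV \<psi>" by (intro continuous_at_imp_continuous_on ballI DERIV_isCont[OF \<psi>])
  have [measurable]: "\<psi> \<in> borel_measurable borel" "\<psi>' \<in> borel_measurable borel"
    using c c\<psi> by (auto intro: borel_measurable_continuous_onI)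
  obtain C C' where C: "\<And>v. \<bar>v\<bar> \<le> R \<Longrightarrow> \<bar>\<psi> v\<bar> \<le> C" and C': "\<And>v. \<bar>v\<bar> \<le> R \<Longrightarrow> \<bar>\<psi>' v\<bar> \<le> C'"
    using continuous_Icc_bounded[OF c\<psi>, of R] continuous_Icc_bounded[OF c, of R] by blast
  have i1: "integrable (usph {..<N} R) (\<lambda>x. aw j x * \<psi>' (x j))"
    by (rule Fh_int[OF j _ C' aw_int[OF j]]) auto
  have i2: "integrable (usph {..<N} R) (\<lambda>x. (x j * F x) * \<psi> (x j))"
    by (rule Fh_int[OF j _ C xF_int(2)[OF j]]) auto
  have i3: "integrable (usph {..<N} R) (\<lambda>x. G x j * \<psi> (x j))"
    by (rule Fh_int[OF j _ C G_int[OF j]]) auto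
  \<comment> \<open>With m = 0 the soft box is 1, and \<rho> = 0 meets the transport condition
    trivially.\<close>
  have "(\<integral>x. F x * (((1 - (x j)\<^sup>2 / R\<^sup>2) * \<psi>' (x j) - (real (card {..<N}) - 1) / R\<^sup>2 * x j * \<psi> (x j)) * soft_box {..<N} j 0 (\<lambda>_. 0) (\<lambda>_. 0) x) \<partial>usph {..<N} R)
     = - (\<integral>x. G x j * (\<psi> (x j) * soft_box {..<N} j 0 (\<lambda>_. 0) (\<lambda>_. 0) x) \<partial>usph {..<N} R)"
    by (rule weak_sph_grad_test[OF _ _ R(1) wgR \<psi> c, where \<rho>'="\<lambda>_. 0"]) (use j in auto)
  hence "(\<integral>x. aw j x * \<psi>' (x j) - real n / real N * ((x j * F x) * \<psi> (x j)) \<partial>usph {..<N} R) = - (\<integral>x. G x j * \<psi> (x j) \<partial>usph {..<N} R)"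
    by (simp add: soft_box_def R(2) n(3) aw_def algebra_simps)
  hence "(\<integral>x. aw j x * \<psi>' (x j) \<partial>usph {..<N} R) = real n / real N * (\<integral>x. (x j * F x) * \<psi> (x j) \<partial>usph {..<N} R) - (\<integral>x. G x j * \<psi> (x j) \<partial>usph {..<N} R)"
    using i1 i2 by simp
  also have "\<dots> = - (\<integral>x. G x j * \<psi> (x j) - real n / real N * ((x j * F x) * \<psi> (x j)) \<partial>usph {..<N} R)"
    using i2 i3 by simp
  also have "\<dots> = - (\<integral>x. bw j x * \<psi> (x j) \<partial>usph {..<N} R)"
    by (simp add: bw_def algebra_simps)
  finally show "(\<integral>x. aw j x * \<psi>' (x j) \<partial>usph {..<N} R) = - (\<integral>x. bw j x * \<psi> (x j) \<partial>usph {..<N} R)" .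
qed (use j xj_meas xj_le F0 w_bounds aw_int bw_int R in \<open>auto simp: space_S aw_def \<epsilon>_def intro!: mult_nonneg_nonneg\<close>)

definition "ph j = weak_density.\<phi> (usph {..<N} R) (\<lambda>x. x j) (aw j) (bw j) \<epsilon>"
text \<open>An upper bound for the integral of |\<open>bw j\<close>| + 1, the coefficient of
  \<epsilon> in the mass of the majorant.\<close>

definition "Vj j = (\<integral>x. \<bar>G x j\<bar> \<partial>usph {..<N} R) + (\<integral>x. \<bar>x j\<bar> * F x \<partial>usph {..<N} R) + 1"

lemma eps: "\<epsilon> > 0" using R by (simp add: \<epsilon>_def)

lemma Vj_nonneg: "Vj j \<ge> 0"
  using F0 by (auto simp: Vj_def space_S intro!: add_nonneg_nonneg integral_nonneg_AE AE_I2)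

lemma ph_total:
  assumes j: "j < N" shows "(\<integral>\<^sup>+t. ennreal (ph j t) \<partial>lborel) \<le> ennreal (1 + \<epsilon> * Vj j)"
proof -
  interpret W: weak_density "usph {..<N} R" "\<lambda>x. x j" "aw j" "bw j" R \<epsilon> by (rule weak_density_coord[OF j])
  have "(\<integral>x. W.K x \<partial>usph {..<N} R) = (\<integral>x. aw j x \<partial>usph {..<N} R) + \<epsilon> * ((\<integral>x. \<bar>bw j x\<bar> \<partial>usph {..<N} R) + 1)"
    using aw_int[OF j] bw_int[OF j] by (simp add: W.K_def S.prob_space)
  also have "(\<integral>x. aw j x \<partial>usph {..<N} R) \<le> (\<integral>x. F x \<partial>usph {..<N} R)"
    using w_bounds F0 by (intro integral_mono aw_int[OF j] F_int) (auto simp: aw_def space_S intro!: mult_left_le_one_le w_bounds xj_le[OF j])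
  also have "(\<integral>x. F x \<partial>usph {..<N} R) = 1" by (rule F_one)
  also have "(\<integral>x. \<bar>bw j x\<bar> \<partial>usph {..<N} R) \<le> (\<integral>x. \<bar>G x j\<bar> + \<bar>x j\<bar> * F x \<partial>usph {..<N} R)"
  proof (intro integral_mono integrable_abs bw_int[OF j] Bochner_Integration.integrable_add G_int[OF j] xF_int[OF j])
    fix x assume x: "x \<in> space (usph {..<N} R)"
    have "real n / real N \<le> 1" using n(3) N by simp
    hence "real n / real N * (\<bar>x j\<bar> * F x) \<le> 1 * (\<bar>x j\<bar> * F x)"
      using F0[of x] x by (intro mult_right_mono) (auto simp: space_S)
    moreover have "\<bar>bw j x\<bar> \<le> \<bar>G x j\<bar> + \<bar>real n / real N * x j * F x\<bar>" unfolding bw_def by (rule abs_triangle_ineq4)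
    moreover have "\<bar>real n / real N * x j * F x\<bar> = real n / real N * (\<bar>x j\<bar> * F x)"
      using F0[of x] x by (simp add: abs_mult space_S)
    ultimately show "\<bar>bw j x\<bar> \<le> \<bar>G x j\<bar> + \<bar>x j\<bar> * F x" by linarith
  qed
  finally have "(\<integral>x. W.K x \<partial>usph {..<N} R) \<le> 1 + \<epsilon> * Vj j"
    using eps G_int[OF j] xF_int(1)[OF j] by (simp add: Vj_def add.assoc)
  thus ?thesis unfolding ph_def W.nn_integral_\<phi> by (rule ennreal_leI)
qed

lemma ph_pos: "j < N \<Longrightarrow> ph j t > 0"
  and ph_meas: "j < N \<Longrightarrow> ph j \<in> borel_measurable borel"
  and ph_lip: "j < N \<Longrightarrow> ph j t * exp (- \<bar>t - t'\<bar> / \<epsilon>) \<le> ph j t'"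
proof -
  assume j: "j < N"
  interpret W: weak_density "usph {..<N} R" "\<lambda>x. x j" "aw j" "bw j" R \<epsilon> by (rule weak_density_coord[OF j])
  show "ph j t > 0" unfolding ph_def using W.\<phi>_pos[of t] exp_gt_zero[of "- (\<bar>t\<bar> + R) / \<epsilon>"] by linarith
  show "ph j \<in> borel_measurable borel" unfolding ph_def by (rule W.\<phi>_meas)
  show "ph j t * exp (- \<bar>t - t'\<bar> / \<epsilon>) \<le> ph j t'" unfolding ph_def by (rule W.\<phi>_lipschitz)
qed

lemma ln_ph_bounded:
  assumes j: "j < N" shows "\<exists>C. \<forall>v. \<bar>v\<bar> \<le> R \<longrightarrow> \<bar>ln (ph j v)\<bar> \<le> C"
proof (intro exI allI impI)
  fix v assume v: "\<bar>v\<bar> \<le> R"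
  have lip: "ln (ph j t) - \<bar>t - t'\<bar> / \<epsilon> \<le> ln (ph j t')" for t t'
  proof -
    have "ln (ph j t * exp (- \<bar>t - t'\<bar> / \<epsilon>)) \<le> ln (ph j t')"
      using ph_lip[OF j, of t t'] ph_pos[OF j] by (subst ln_le_cancel_iff) (auto intro!: mult_pos_pos)
    moreover have "ln (ph j t * exp (- \<bar>t - t'\<bar> / \<epsilon>)) = ln (ph j t) + - \<bar>t - t'\<bar> / \<epsilon>"
      using ph_pos[OF j, of t] by (subst ln_mult) auto
    ultimately show ?thesis by simp
  qed
  have "\<bar>v\<bar> / \<epsilon> \<le> R / \<epsilon>" using v eps by (intro divide_right_mono) auto
  thus "\<bar>ln (ph j v)\<bar> \<le> \<bar>ln (ph j 0)\<bar> + R / \<epsilon>" using lip[of v 0] lip[of 0 v] by auto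
qed

lemma F_ln_ph_int: "j < N \<Longrightarrow> integrable (usph {..<N} R) (\<lambda>x. F x * ln (ph j (x j)))"
proof -
  assume j: "j < N"
  obtain C where "\<And>v. \<bar>v\<bar> \<le> R \<Longrightarrow> \<bar>ln (ph j v)\<bar> \<le> C" using ln_ph_bounded[OF j] by blast
  thus ?thesis by (intro Fh_int[OF j _ _ F_int, where h="\<lambda>v. ln (ph j v)"]) (use ph_meas[OF j] in measurable)
qed

text \<open>Cauchy-Schwarz in the form of Young's inequality keeps the gradients of order N in
  total. The other 2 N come from the sum of |x_j|, at most N on the sphere, and from the constant 1
  in each \<open>Vj\<close>.\<close>

lemma sum_Vj: "(\<Sum>j<N. Vj j) \<le> real N * (sqrt D + 2)"
proof -
  \<comment> \<open>The Young parameter that equalises the contributions D N/lam and lam N.\<close>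
  define lam where "lam = sqrt D"
  have lam: "lam > 0" "lam * lam = D" using D by (auto simp: lam_def)
  define E where "E x = (\<Sum>i<N. (G x i / F x)\<^sup>2) * F x" for x
  have Gm: "(\<lambda>x. G x i) \<in> borel_measurable (usph {..<N} R)" if "i < N" for i using G_int[OF that] by auto
  have Em: "E \<in> borel_measurable (usph {..<N} R)"
    unfolding E_def using F_meas by (intro borel_measurable_times borel_measurable_sum borel_measurable_power borel_measurable_divide Gm) auto
  have E0: "E x \<ge> 0" if "x \<in> sph {..<N} R" for x using F0[OF that] by (auto simp: E_def intro!: mult_nonneg_nonneg sum_nonneg)
  have Ele: "(\<integral>\<^sup>+x. ennreal (E x) \<partial>usph {..<N} R) \<le> ennreal (D * real N)" using fisher by (simp add: sig E_def)
  have Ei: "integrable (usph {..<N} R) E"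
    using Em E0 order_le_less_trans[OF Ele] by (intro integrableI_nonneg) (auto simp: space_S intro!: AE_I2)
  have EI: "(\<integral>x. E x \<partial>usph {..<N} R) \<le> D * real N"
  proof -
    have "ennreal (\<integral>x. E x \<partial>usph {..<N} R) = (\<integral>\<^sup>+x. ennreal (E x) \<partial>usph {..<N} R)"
      using Ei E0 by (intro nn_integral_eq_integral[symmetric]) (auto simp: space_S intro!: AE_I2)
    with Ele have "ennreal (\<integral>x. E x \<partial>usph {..<N} R) \<le> ennreal (D * real N)" by simp
    thus ?thesis using D by (subst (asm) ennreal_le_iff) auto
  qed
  \<comment> \<open>\<open>E\<close> vanishes by convention where F = 0, so there the gradient
    itself must be known to vanish.\<close>
  have "AE x in usph {..<N} R. \<forall>j\<in>{..<N}. F x = 0 \<longrightarrow> G x j = 0"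
    by (rule AE_finite_allI) (use weak_sph_grad_zero_set[OF _ _ n(1,2) R(1) F_int F0 wgR] in auto)
  hence "(\<integral>x. (\<Sum>j<N. \<bar>G x j\<bar>) \<partial>usph {..<N} R) \<le> (\<integral>x. (E x / lam + lam * real N * F x) / 2 \<partial>usph {..<N} R)"
  proof (intro integral_mono_AE)
    assume ae: "AE x in usph {..<N} R. \<forall>j\<in>{..<N}. F x = 0 \<longrightarrow> G x j = 0"
    show "AE x in usph {..<N} R. (\<Sum>j<N. \<bar>G x j\<bar>) \<le> (E x / lam + lam * real N * F x) / 2"
      using ae AE_space
    proof eventually_elim
      case (elim x)
      have f: "F x \<ge> 0" using elim F0 by (simp add: space_S)
      have "\<bar>G x j\<bar> \<le> ((G x j / F x)\<^sup>2 * F x / lam + lam * F x) / 2" if "j < N" for j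
      proof (cases "F x = 0")
        case True thus ?thesis using elim that by auto
      next
        case False
        hence f: "F x > 0" using f by simp
        define g where "g = \<bar>G x j\<bar> / F x"
        have "2 * g * lam \<le> g\<^sup>2 + lam * lam" using sum_squares_bound[of g lam] by (simp add: power2_eq_square)
        hence "2 * g \<le> g\<^sup>2 / lam + lam" using lam(1) by (simp add: field_simps)
        from mult_right_mono[OF this less_imp_le[OF f]]
        have "2 * (g * F x) \<le> g\<^sup>2 * F x / lam + lam * F x" by (simp add: algebra_simps)
        moreover have "g * F x = \<bar>G x j\<bar>" "g\<^sup>2 = (G x j / F x)\<^sup>2" using f by (auto simp: g_def power_divide)
        ultimately show ?thesis by simp
      qed
      hence "(\<Sum>j<N. \<bar>G x j\<bar>) \<le> (\<Sum>j<N. ((G x j / F x)\<^sup>2 * F x / lam + lam * F x) / 2)" by (intro sum_mono) auto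
      also have "\<dots> = (E x / lam + lam * real N * F x) / 2"
        by (simp add: E_def sum.distrib sum_divide_distrib[symmetric] sum_distrib_right)
      finally show ?case .
    qed
  qed (use G_int Ei F_int in auto)
  also have "\<dots> \<le> real N * lam"
  proof -
    have "(\<integral>x. (E x / lam + lam * real N * F x) / 2 \<partial>usph {..<N} R) = ((\<integral>x. E x \<partial>usph {..<N} R) / lam + lam * real N) / 2"
      using Ei F_int F_one by simp
    also have "\<dots> \<le> (D * real N / lam + lam * real N) / 2" using EI lam by (simp add: divide_right_mono)
    also have "\<dots> = real N * lam" using lam by (simp add: field_simps)
    finally show ?thesis .
  qed
  finally have 1: "(\<Sum>j<N. \<integral>x. \<bar>G x j\<bar> \<partial>usph {..<N} R) \<le> real N * lam"
    using G_int by (subst (asm) Bochner_Integration.integral_sum) auto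
  have "(\<integral>x. (\<Sum>j<N. \<bar>x j\<bar> * F x) \<partial>usph {..<N} R) \<le> (\<integral>x. real N * F x \<partial>usph {..<N} R)"
  proof (rule integral_mono)
    fix x assume "x \<in> space (usph {..<N} R)"
    hence x: "x \<in> sph {..<N} R" by (simp add: space_S)
    have "(\<Sum>j<N. \<bar>x j\<bar>) \<le> sqrt (real (card {..<N})) * L2_set x {..<N}" by (rule sum_abs_le_L2_set)
    also have "\<dots> = real N" using x by (simp add: sph_def R_def)
    finally show "(\<Sum>j<N. \<bar>x j\<bar> * F x) \<le> real N * F x"
      unfolding sum_distrib_right[symmetric] using F0[OF x] by (rule mult_right_mono)
  qed (use xF_int F_int in auto)
  hence 2: "(\<Sum>j<N. \<integral>x. \<bar>x j\<bar> * F x \<partial>usph {..<N} R) \<le> real N"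
    using xF_int F_int F_one by (subst (asm) Bochner_Integration.integral_sum) auto
  show ?thesis using 1 2 by (simp add: Vj_def sum.distrib lam_def[symmetric] algebra_simps)
qed

text \<open>The product of the majorants is the trial density. The logarithm of its mass bound
  consists of ln 2 \<le> 1, the shell cost 1/\<epsilon> = R, the logarithms ln (1 + \<epsilon> V_j)
  \<le> \<epsilon> V_j with sum at most R (sqrt D + 2), and the volume.\<close>

lemma gibbs_step:
  "(\<Sum>j<N. \<integral>x. F x * ln (ph j (x j)) \<partial>usph {..<N} R) \<le>
     entropyN N F + 1 + R * (sqrt D + 3) - ln (R ^ N * unit_ball_vol (real N))"
proof -
  \<comment> \<open>\<open>prod_sphere_le\<close> asks for positivity and the Lipschitz bound at
    every index, so the family is continued beyond N by a copy of \<open>ph 0\<close>.\<close>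
  define p where "p j = (if j < N then ph j else ph 0)" for j
  have N0: "0 < N" using N by simp
  have pp: "p j t > 0" "p j \<in> borel_measurable borel" "p j t * exp (- \<bar>t - t'\<bar> / \<epsilon>) \<le> p j t'" for j t t'
    using ph_pos ph_meas ph_lip N0 by (auto simp: p_def)
  define c where "c j = 1 + \<epsilon> * Vj j" for j
  have c: "c j \<ge> 1" for j using Vj_nonneg[of j] eps by (simp add: c_def)
  define Z where "Z = 2 * exp (1 / \<epsilon>) * (\<Prod>j<N. c j) / (R ^ N * unit_ball_vol (real N))"
  have prodc: "(\<Prod>j<N. c j) > 0" using c by (intro prod_pos) (auto intro: less_le_trans[OF zero_less_one])
  have vol: "R ^ N * unit_ball_vol (real N) > 0" using R by (intro mult_pos_pos zero_less_power) auto
  have Zp: "Z > 0" unfolding Z_def by (intro divide_pos_pos[OF _ vol] mult_pos_pos prodc) auto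
  have c0: "c j \<ge> 0" for j using c[of j] by linarith
  have tot: "(\<integral>\<^sup>+t. ennreal (p j t) \<partial>lborel) \<le> ennreal (c j)" if "j \<in> {..<N}" for j
    using ph_total[of j] that by (simp add: p_def c_def)
  have "(\<integral>\<^sup>+y. ennreal (\<Prod>j<N. p j (y j)) \<partial>usph0 {..<N} R) \<le> ennreal Z"
    using prod_sphere_le[OF finite_lessThan ne eps pp(2,1,3) tot c0] by (simp add: Z_def R_def)
  moreover have Pm: "(\<lambda>y. \<Prod>j<N. p j (y j)) \<in> borel_measurable (lbp {..<N})"
    by (intro borel_measurable_prod measurable_compose[OF lbp_coord pp(2)]) 
  ultimately have Zle: "(\<integral>\<^sup>+y. ennreal (\<Prod>j<N. p j (y j)) \<partial>usph {..<N} R) \<le> ennreal Z"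
    by (subst nn_integral_usph[OF finite_lessThan ne less_imp_le[OF R(1)]]) auto
  have lnP: "F x * ln (\<Prod>j<N. p j (x j)) = (\<Sum>j<N. F x * ln (ph j (x j)))" for x
  proof -
    have "ph i t \<noteq> 0" if "i < N" for i t using ph_pos[OF that, of t] by simp
    moreover have "(\<Prod>j<N. p j (x j)) = (\<Prod>j<N. ph j (x j))" by (rule prod.cong) (auto simp: p_def)
    ultimately have "ln (\<Prod>j<N. p j (x j)) = (\<Sum>j<N. ln (ph j (x j)))" by (simp only:) (rule ln_prod, auto)
    thus ?thesis by (simp add: sum_distrib_left)
  qed
  have "(\<integral>x. F x * ln (\<Prod>j<N. p j (x j)) \<partial>usph {..<N} R) \<le> (\<integral>x. F x * ln (F x) \<partial>usph {..<N} R) + ln Z"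
  proof (rule S.gibbs_inequality[OF F_int _ F_one _ _ _ _ Zle Zp])
    show "integrable (usph {..<N} R) (\<lambda>x. F x * ln (F x))" using FlF by (simp add: sig)
    show "integrable (usph {..<N} R) (\<lambda>x. F x * ln (\<Prod>j<N. p j (x j)))"
      unfolding lnP using F_ln_ph_int by auto
    show "(\<lambda>x. \<Prod>j<N. p j (x j)) \<in> borel_measurable (usph {..<N} R)"
      by (rule measurable_usph_of_lbp[OF finite_lessThan ne less_imp_le[OF R(1)] Pm])
  qed (use F0 pp(1) in \<open>auto simp: space_S intro!: prod_pos\<close>)
  hence "(\<Sum>j<N. \<integral>x. F x * ln (ph j (x j)) \<partial>usph {..<N} R) \<le> entropyN N F + ln Z"
    unfolding lnP using F_ln_ph_int by (subst (asm) Bochner_Integration.integral_sum) (auto simp: entropyN_def sig)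
  moreover have "ln Z = ln 2 + 1 / \<epsilon> + (\<Sum>j<N. ln (c j)) - ln (R ^ N * unit_ball_vol (real N))"
  proof -
    have "ln Z = ln (2 * exp (1 / \<epsilon>) * (\<Prod>j<N. c j)) - ln (R ^ N * unit_ball_vol (real N))"
      unfolding Z_def using vol by (intro ln_divide_pos) (auto intro!: mult_pos_pos prodc)
    also have "ln (2 * exp (1 / \<epsilon>) * (\<Prod>j<N. c j)) = ln (2 * exp (1 / \<epsilon>)) + ln (\<Prod>j<N. c j)"
      using prodc by (intro ln_mult_pos) auto
    also have "ln (2 * exp (1 / \<epsilon>)) = ln 2 + 1 / \<epsilon>" by (subst ln_mult) auto
    also have "ln (\<Prod>j<N. c j) = (\<Sum>j<N. ln (c j))" 
    proof (rule ln_prod)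
      show "c j \<noteq> 0" for j using c[of j] by auto
    qed simp
    finally show ?thesis .
  qed
  moreover have "(\<Sum>j<N. ln (c j)) \<le> R * (sqrt D + 2)"
  proof -
    have "(\<Sum>j<N. ln (c j)) \<le> (\<Sum>j<N. \<epsilon> * Vj j)"
    proof (rule sum_mono)
      fix j show "ln (c j) \<le> \<epsilon> * Vj j" using ln_le_minus_one[of "c j"] c[of j] by (simp add: c_def)
    qed
    also have "\<dots> \<le> \<epsilon> * (real N * (sqrt D + 2))"
      unfolding sum_distrib_left[symmetric] using sum_Vj eps by (intro mult_left_mono) auto
    also have "\<epsilon> * (real N * (sqrt D + 2)) = R * (sqrt D + 2)"
    proof -
      have "\<epsilon> * real N = R" using R by (simp add: \<epsilon>_def power2_eq_square field_simps flip: R(2))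
      thus ?thesis by (simp only: mult.assoc[symmetric])
    qed
    finally show ?thesis .
  qed
  moreover have "1 / \<epsilon> = R" by (simp add: \<epsilon>_def)
  moreover have "ln (2::real) \<le> 1" using ln_le_minus_one[of 2] by simp
  ultimately show ?thesis by (simp add: algebra_simps)
qed

section \<open>Marginals as averages over slices\<close>

definition "F1 x = indicator (sph {..<N} R) x * F x"

lemma F1_meas [measurable]: "F1 \<in> borel_measurable (lbp {..<N})"
  unfolding F1_def[abs_def] by (rule borel_measurable_usph_ext[OF finite_lessThan ne less_imp_le[OF R(1)] F_meas])

lemma F1_nonneg: "F1 x \<ge> 0"
  using F0[of x] by (auto simp: F1_def indicator_def)

lemma usph_F1:
  assumes "(\<lambda>x. F1 x * h x) \<in> borel_measurable (lbp {..<N})"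
  shows "(\<integral>x. F x * h x \<partial>usph {..<N} R) = (\<integral>x. F1 x * h x \<partial>usph0 {..<N} R)"
    and "integrable (usph {..<N} R) (\<lambda>x. F x * h x) \<longleftrightarrow> integrable (usph0 {..<N} R) (\<lambda>x. F1 x * h x)"
proof -
  note c = finite_lessThan ne less_imp_le[OF R(1)]
  have "(\<integral>x. F x * h x \<partial>usph {..<N} R) = (\<integral>x. F1 x * h x \<partial>usph {..<N} R)"
    by (rule Bochner_Integration.integral_cong) (auto simp: F1_def space_S)
  thus "(\<integral>x. F x * h x \<partial>usph {..<N} R) = (\<integral>x. F1 x * h x \<partial>usph0 {..<N} R)"
    using integral_usph[OF c assms] by simp
  have "integrable (usph {..<N} R) (\<lambda>x. F x * h x) \<longleftrightarrow> integrable (usph {..<N} R) (\<lambda>x. F1 x * h x)"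
    by (rule Bochner_Integration.integrable_cong) (auto simp: F1_def space_S)
  thus "integrable (usph {..<N} R) (\<lambda>x. F x * h x) \<longleftrightarrow> integrable (usph0 {..<N} R) (\<lambda>x. F1 x * h x)"
    using integrable_usph[OF c assms] by simp
qed

text \<open>Agrees with \<open>sph_marginal\<close> for |v| < R. Taken over a space independent of
  v, it is measurable in v by Fubini.\<close>

definition "mg j v = (\<integral>z. F1 (slice_pt {..<N} j R v z) \<partial>ub ({..<N} - {j}))"

lemma mg_nonneg: "mg j v \<ge> 0"
  unfolding mg_def using F1_nonneg by (intro integral_nonneg_AE AE_I2) auto

context
  fixes j :: nat assumes j: "j < N"
begin

lemma jI: "j \<in> {..<N}" using j by simp

lemma F1_int: "integrable (usph0 {..<N} R) F1"
  using usph_F1(2)[of "\<lambda>_. 1"] F_int by simp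

lemmas slices = integrable_slices[OF finite_lessThan jI n(1,2) R(1)]

lemma mg_meas [measurable]: "mg j \<in> borel_measurable borel"
  using borel_measurable_integrable[OF slices(3)[OF F1_meas F1_int]] by (simp add: mg_def[abs_def])

lemma sph_marginal_eq:
  assumes v: "\<bar>v\<bar> < R"
  shows "sph_marginal N j F v = mg j v"
proof -
  let ?I = "{..<N} - {j}"
  let ?s = "sqrt (R\<^sup>2 - v\<^sup>2)"
  have vR: "v\<^sup>2 < R\<^sup>2" using v R by (metis abs_le_square_iff abs_of_pos not_le)
  have "card ?I = n" using j n by (simp add: card_Diff_singleton)
  hence ne': "?I \<noteq> {}" using n(2) by (metis card.empty less_irrefl)
  have fin: "finite ?I" by simp
  have s: "?s \<ge> 0" using vR by simp
  have upd: "(\<lambda>w. w(j := v)) \<in> lbp ?I \<rightarrow>\<^sub>M lbp {..<N}"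
  proof -
    have e: "insert j ?I = {..<N}" using j by auto
    have "(\<lambda>w. w(j := v)) = (\<lambda>(f, y). f(j := y)) \<circ> (\<lambda>w. (w, v))" by auto
    also have "\<dots> \<in> lbp ?I \<rightarrow>\<^sub>M lbp {..<N}"
      using measurable_comp[OF measurable_Pair[OF measurable_ident measurable_const] measurable_add_dim, of v "\<lambda>_. lborel" j ?I] 
      unfolding e by (simp add: id_def)
    finally show ?thesis .
  qed
  have m: "(\<lambda>w. F1 (w(j := v))) \<in> borel_measurable (lbp ?I)" by (rule measurable_compose[OF upd F1_meas])
  have "sph_marginal N j F v = (\<integral>w. F (w(j := v)) \<partial>usph ?I ?s)" by (simp add: sph_marginal_def R(2))
  also have "\<dots> = (\<integral>w. F1 (w(j := v)) \<partial>usph ?I ?s)"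
  proof (rule Bochner_Integration.integral_cong[OF refl])
    fix w assume "w \<in> space (usph ?I ?s)"
    hence "w(j := v) \<in> sph {..<N} R"
      by (intro slice_pt_in_sph[OF finite_lessThan jI n(1,2) R(1) vR]) (simp add: space_usph)
    thus "F (w(j := v)) = F1 (w(j := v))" by (simp add: F1_def)
  qed
  also have "\<dots> = (\<integral>w. F1 (w(j := v)) \<partial>usph0 ?I ?s)" by (rule integral_usph[OF fin ne' s m])
  also have "\<dots> = (\<integral>z. F1 ((rad ?I ?s z)(j := v)) \<partial>ub ?I)"
    unfolding usph0_def using m by (subst integral_distr) auto
  finally show ?thesis by (simp add: mg_def slice_pt_def)
qed

lemma AE_vlaw: "AE v in vlaw n R. \<bar>v\<bar> < R"
  unfolding vlaw_def
proof (subst AE_density, simp, intro AE_I2 impI)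
  fix v assume "0 < ennreal (sdens n R v)"
  thus "\<bar>v\<bar> < R" using sdens_outside[of v R n] by (cases "\<bar>v\<bar> < R") auto
qed

lemma integral_coord:
  fixes g :: "real \<Rightarrow> real"
  assumes [measurable]: "g \<in> borel_measurable borel"
  shows "(\<integral>x. g (x j) \<partial>usph {..<N} R) = (\<integral>v. g v \<partial>vlaw n R)"
proof -
  have [measurable]: "(\<lambda>x. x j) \<in> borel_measurable (lbp {..<N})" by (rule lbp_coord[OF jI])
  have m: "(\<lambda>x. g (x j)) \<in> borel_measurable (lbp {..<N})" by measurable
  have "(\<integral>x. g (x j) \<partial>usph {..<N} R) = (\<integral>x. g (x j) \<partial>usph0 {..<N} R)"
    by (rule integral_usph[OF finite_lessThan ne less_imp_le[OF R(1)] m])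
  also have "\<dots> = (\<integral>v. g v \<partial>distr (usph0 {..<N} R) borel (\<lambda>x. x j))"
    by (rule integral_distr[symmetric]) (simp_all add: lbp_coord[OF jI] cong: measurable_cong_sets)
  finally show ?thesis unfolding distr_usph0_coord[OF finite_lessThan jI n(1,2) R(1)] .
qed

lemma integral_F_coord:
  fixes h :: "real \<Rightarrow> real"
  assumes h[measurable]: "h \<in> borel_measurable borel" and i: "integrable (usph {..<N} R) (\<lambda>x. F x * h (x j))"
  shows "integrable (vlaw n R) (\<lambda>v. mg j v * h v)"
    and "(\<integral>x. F x * h (x j) \<partial>usph {..<N} R) = (\<integral>v. mg j v * h v \<partial>vlaw n R)"
proof -
  have [measurable]: "(\<lambda>x. x j) \<in> borel_measurable (lbp {..<N})" by (rule lbp_coord[OF jI])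
  have m: "(\<lambda>x. F1 x * h (x j)) \<in> borel_measurable (lbp {..<N})" by measurable
  have i0: "integrable (usph0 {..<N} R) (\<lambda>x. F1 x * h (x j))" using usph_F1(2)[OF m] i by simp
  have e: "(\<integral>z. F1 (slice_pt {..<N} j R v z) * h (slice_pt {..<N} j R v z j) \<partial>ub ({..<N} - {j})) = mg j v * h v" for v
    by (simp add: mg_def slice_pt_def)
  show "integrable (vlaw n R) (\<lambda>v. mg j v * h v)" using slices(3)[OF m i0] unfolding e .
  show "(\<integral>x. F x * h (x j) \<partial>usph {..<N} R) = (\<integral>v. mg j v * h v \<partial>vlaw n R)"
    using slices(2)[OF m i0] usph_F1(1)[OF m] unfolding e by simp
qed

text \<open>The left side is the Lebesgue density of the law of the j-th coordinate under
  \<open>aw j\<close>, and \<open>density_le_\<phi>\<close> bounds such a density by the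
  majorant.\<close>

lemma AE_marginal_le:
  "AE v in lborel. \<bar>v\<bar> < R \<longrightarrow> sdens n R v * (1 - v\<^sup>2 / real N) * mg j v \<le> ph j v"
proof -
  interpret W: weak_density "usph {..<N} R" "\<lambda>x. x j" "aw j" "bw j" R \<epsilon> by (rule weak_density_coord[OF j])
  define f where "f v = sdens n R v * (1 - v\<^sup>2 / real N) * mg j v" for v
  have [measurable]: "f \<in> borel_measurable borel" unfolding f_def by measurable
  have f0: "f v \<ge> 0" for v
    using w_bounds(1)[of v] sdens_outside[of v R n] sdens_nonneg[OF less_imp_le[OF R(1)], of n v] mg_nonneg[of j v]
    by (cases "\<bar>v\<bar> < R") (auto simp: f_def intro!: mult_nonneg_nonneg)
  have [measurable]: "(\<lambda>x. x j) \<in> borel_measurable (lbp {..<N})" by (rule lbp_coord[OF jI])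
  have law: "(\<integral>\<^sup>+x. ennreal (aw j x * h (x j)) \<partial>usph {..<N} R) = (\<integral>\<^sup>+v. ennreal (f v * h v) \<partial>lborel)"
    if h[measurable]: "h \<in> borel_measurable borel" and h0: "\<And>v. h v \<ge> 0" for h :: "real \<Rightarrow> real"
  proof -
    define W where "W v = (1 - v\<^sup>2 / real N) * h v" for v
    have [measurable]: "W \<in> borel_measurable borel" unfolding W_def by measurable
    have "(\<integral>\<^sup>+x. ennreal (aw j x * h (x j)) \<partial>usph {..<N} R) = (\<integral>\<^sup>+x. ennreal (F1 x * W (x j)) \<partial>usph {..<N} R)"
      by (rule nn_integral_cong) (auto simp: aw_def F1_def W_def space_S mult_ac)
    also have "\<dots> = (\<integral>\<^sup>+x. ennreal (F1 x * W (x j)) \<partial>usph0 {..<N} R)"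
      by (rule nn_integral_usph[OF finite_lessThan ne less_imp_le[OF R(1)]]) measurable
    also have "\<dots> = (\<integral>\<^sup>+v. (\<integral>\<^sup>+z. ennreal (F1 (slice_pt {..<N} j R v z) * W (slice_pt {..<N} j R v z j)) \<partial>ub ({..<N} - {j})) \<partial>vlaw n R)"
      by (rule nn_integral_usph0[OF finite_lessThan jI n(1,2) R(1)]) measurable
    also have "\<dots> = (\<integral>\<^sup>+v. ennreal (mg j v * W v) \<partial>vlaw n R)"
    proof (rule nn_integral_cong_AE)
      show "AE v in vlaw n R. (\<integral>\<^sup>+z. ennreal (F1 (slice_pt {..<N} j R v z) * W (slice_pt {..<N} j R v z j)) \<partial>ub ({..<N} - {j})) = ennreal (mg j v * W v)"
        using slices(4)[OF F1_meas F1_int] AE_vlaw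
      proof eventually_elim
        case (elim v)
        have W0: "W v \<ge> 0" using w_bounds(1)[of v] elim h0 by (auto simp: W_def)
        have "(\<integral>\<^sup>+z. ennreal (F1 (slice_pt {..<N} j R v z) * W (slice_pt {..<N} j R v z j)) \<partial>ub ({..<N} - {j}))
          = (\<integral>\<^sup>+z. ennreal (F1 (slice_pt {..<N} j R v z) * W v) \<partial>ub ({..<N} - {j}))" by (simp add: slice_pt_def)
        also have "\<dots> = ennreal (\<integral>z. F1 (slice_pt {..<N} j R v z) * W v \<partial>ub ({..<N} - {j}))"
          using elim W0 F1_nonneg by (intro nn_integral_eq_integral) (auto intro!: AE_I2)
        finally show ?case by (simp add: mg_def)
      qed
    qed
    also have "\<dots> = (\<integral>\<^sup>+v. ennreal (sdens n R v) * ennreal (mg j v * W v) \<partial>lborel)"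
      unfolding vlaw_def
    proof (rule nn_integral_density)
      have "(\<lambda>v. mg j v * W v) \<in> borel_measurable borel"
        by (rule borel_measurable_times[OF mg_meas \<open>W \<in> borel_measurable borel\<close>])
      from measurable_compose[OF this measurable_ennreal]
      show "(\<lambda>v. ennreal (mg j v * W v)) \<in> borel_measurable lborel" by simp
    qed simp
    also have "\<dots> = (\<integral>\<^sup>+v. ennreal (f v * h v) \<partial>lborel)"
      using sdens_nonneg[OF less_imp_le[OF R(1)], of n]
      by (intro nn_integral_cong) (simp add: ennreal_mult'[symmetric] f_def W_def mult_ac)
    finally show ?thesis .
  qed
  have "integrable lborel f"
  proof (rule integrableI_nonneg)
    have "(\<integral>\<^sup>+v. ennreal (f v) \<partial>lborel) = (\<integral>\<^sup>+x. ennreal (aw j x) \<partial>usph {..<N} R)" using law[of "\<lambda>_. 1"] by simp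
    also have "\<dots> = ennreal (\<integral>x. aw j x \<partial>usph {..<N} R)"
    proof (rule nn_integral_eq_integral[OF aw_int[OF j]], rule AE_I2)
      fix x assume "x \<in> space (usph {..<N} R)"
      thus "0 \<le> aw j x" unfolding aw_def space_S
        by (intro mult_nonneg_nonneg F0 w_bounds(1) xj_le[OF j])
    qed
    finally show "(\<integral>\<^sup>+v. ennreal (f v) \<partial>lborel) < \<infinity>" by simp
  qed (use f0 in auto)
  from W.density_le_\<phi>[OF this f0 law] show ?thesis by (simp add: f_def ph_def)
qed

text \<open>With w = 1 - v^2/N, \<open>AE_marginal_le\<close> gives ln mg \<le> ln ph - ln (s w).
  The weight w raises the exponent n/2 - 1 of the density s to n/2, whence the factor (N -
  1)/2.\<close>

lemma marginal_step:
  "(\<integral>x. sph_marginal N j F (x j) * ln (sph_marginal N j F (x j)) \<partial>sigmaN N) \<le>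
     (\<integral>x. F x * ln (ph j (x j)) \<partial>usph {..<N} R) - ln (cdens n R)
       - (real N - 1) / 2 * (\<integral>x. F x * ln (1 - (x j)\<^sup>2 / real N) \<partial>usph {..<N} R)"
proof -
  interpret v: prob_space "vlaw n R" by (rule prob_space_vlaw[OF finite_lessThan jI n(1,2) R(1)])
  have [measurable]: "ph j \<in> borel_measurable borel" by (rule ph_meas[OF j])
  define L where "L v = ln (ph j v) - ln (cdens n R) - (real N - 1) / 2 * ln (1 - v\<^sup>2 / real N)" for v
  have [measurable]: "L \<in> borel_measurable borel" unfolding L_def by measurable
  have i1: "integrable (usph {..<N} R) (\<lambda>x. F x * ln (ph j (x j)))" by (rule F_ln_ph_int[OF j])
  have i2: "integrable (usph {..<N} R) (\<lambda>x. F x * ln (1 - (x j)\<^sup>2 / real N))" using Flw[OF j] by (simp add: sig)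
  have FL: "F x * L (x j) = F x * ln (ph j (x j)) - ln (cdens n R) * F x - (real N - 1) / 2 * (F x * ln (1 - (x j)\<^sup>2 / real N))" for x
    by (simp add: L_def algebra_simps)
  have iL: "integrable (usph {..<N} R) (\<lambda>x. F x * L (x j))"
    unfolding FL using i1 i2 F_int by simp
  have IL: "(\<integral>x. F x * L (x j) \<partial>usph {..<N} R) = (\<integral>x. F x * ln (ph j (x j)) \<partial>usph {..<N} R) - ln (cdens n R)
       - (real N - 1) / 2 * (\<integral>x. F x * ln (1 - (x j)\<^sup>2 / real N) \<partial>usph {..<N} R)"
    unfolding FL using i1 i2 F_int F_one by simp
  \<comment> \<open>At the poles the slice degenerates and \<open>sph_marginal\<close> may differ
    from \<open>mg\<close>. \<open>H\<close> copies the two values, so the integrands agree at every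
    point of the sphere, and it is still measurable; the poles are null for the law of the
    height.\<close>
  define H where "H v = (if v = R then sph_marginal N j F R else if v = - R then sph_marginal N j F (- R) else mg j v)" for v
  have [measurable]: "H \<in> borel_measurable borel" unfolding H_def by measurable
  have "(\<integral>x. sph_marginal N j F (x j) * ln (sph_marginal N j F (x j)) \<partial>sigmaN N) = (\<integral>x. H (x j) * ln (H (x j)) \<partial>usph {..<N} R)"
    unfolding sig
  proof (rule Bochner_Integration.integral_cong[OF refl])
    fix x assume "x \<in> space (usph {..<N} R)"
    hence "\<bar>x j\<bar> \<le> R" by (intro xj_le[OF j]) (simp add: space_S)
    hence "sph_marginal N j F (x j) = H (x j)"
      using sph_marginal_eq[of "x j"] by (cases "\<bar>x j\<bar> < R") (auto simp: H_def)
    thus "sph_marginal N j F (x j) * ln (sph_marginal N j F (x j)) = H (x j) * ln (H (x j))" by simp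
  qed
  also have "\<dots> = (\<integral>v. H v * ln (H v) \<partial>vlaw n R)" by (rule integral_coord) measurable
  also have "\<dots> = (\<integral>v. mg j v * ln (mg j v) \<partial>vlaw n R)"
  proof (rule integral_cong_AE)
    show "AE v in vlaw n R. H v * ln (H v) = mg j v * ln (mg j v)"
      using AE_vlaw by eventually_elim (auto simp: H_def)
  qed measurable
  also have "\<dots> \<le> (\<integral>v. mg j v * L v \<partial>vlaw n R)"
  proof -
    have le: "AE v in vlaw n R. mg j v * ln (mg j v) \<le> mg j v * L v"
    proof -
      have "AE v in vlaw n R. \<bar>v\<bar> < R \<longrightarrow> sdens n R v * (1 - v\<^sup>2 / real N) * mg j v \<le> ph j v"
        using AE_marginal_le unfolding vlaw_def by (subst AE_density) (auto elim!: eventually_mono)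
      thus ?thesis using AE_vlaw
      proof eventually_elim
        case (elim v)
        show ?case
        proof (cases "mg j v = 0")
          case False
          hence m: "mg j v > 0" using mg_nonneg[of j v] by simp
          have "v\<^sup>2 < R\<^sup>2" using elim R by (metis abs_le_square_iff abs_of_pos not_le)
          hence w: "1 - v\<^sup>2 / real N > 0" using R N by simp
          have s: "sdens n R v > 0" using elim by (intro sdens_pos[OF R(1) n(2)]) auto
          have cd: "cdens n R > 0" using R(1) n(2) by (auto simp: cdens_def intro!: divide_pos_pos mult_pos_pos)
          have sw: "ln (sdens n R v * (1 - v\<^sup>2 / real N)) = ln (cdens n R) + (real N - 1) / 2 * ln (1 - v\<^sup>2 / real N)"
          proof -
            have "ln (sdens n R v) = ln (cdens n R) + (real n / 2 - 1) * ln (1 - v\<^sup>2 / real N)"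
            proof -
              have "sdens n R v = cdens n R * (1 - v\<^sup>2 / real N) powr (real n / 2 - 1)"
                using elim by (simp add: sdens_def R(2) abs_less_iff)
              moreover have "(1 - v\<^sup>2 / real N) powr (real n / 2 - 1) > 0" unfolding powr_gt_zero using w by (rule less_imp_neq[THEN not_sym])
              ultimately have "ln (sdens n R v) = ln (cdens n R) + ln ((1 - v\<^sup>2 / real N) powr (real n / 2 - 1))"
                using cd by (simp only: ln_mult_pos)
              thus ?thesis by (simp only: ln_powr)
            qed
            moreover have "ln (sdens n R v * (1 - v\<^sup>2 / real N)) = ln (sdens n R v) + ln (1 - v\<^sup>2 / real N)"
              using s w by (rule ln_mult_pos)
            ultimately show ?thesis by (simp add: n(3) algebra_simps diff_divide_distrib)
          qed
          have "ln (sdens n R v * (1 - v\<^sup>2 / real N) * mg j v) \<le> ln (ph j v)"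
            using elim s w m ph_pos[OF j, of v] by (subst ln_le_cancel_iff) auto
          moreover have "ln (sdens n R v * (1 - v\<^sup>2 / real N) * mg j v) = ln (sdens n R v * (1 - v\<^sup>2 / real N)) + ln (mg j v)"
            using s w m by (intro ln_mult_pos) auto
          ultimately have "ln (mg j v) \<le> L v" unfolding sw L_def by linarith
          thus ?thesis using m by (intro mult_left_mono) auto
        qed simp
      qed
    qed
    have im: "integrable (vlaw n R) (\<lambda>v. mg j v * L v)" by (rule integral_F_coord(1)[OF _ iL]) measurable
    show ?thesis
    proof (rule integral_mono_AE[OF _ im le])
      show "integrable (vlaw n R) (\<lambda>v. mg j v * ln (mg j v))"
      \<comment> \<open>Between -1, the crude lower bound of x ln x, and the integrable function mg
        L; the constant is integrable for a probability law.\<close>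
      proof (rule Bochner_Integration.integrable_bound[where f="\<lambda>v. \<bar>mg j v * L v\<bar> + 1"])
        show "integrable (vlaw n R) (\<lambda>v. \<bar>mg j v * L v\<bar> + 1)" using im by simp
        show "AE v in vlaw n R. norm (mg j v * ln (mg j v)) \<le> norm (\<bar>mg j v * L v\<bar> + 1)"
          using le
        proof eventually_elim
          case (elim v)
          show ?case using elim xlnx_ge[OF mg_nonneg[of j v]] by auto
        qed
      qed measurable
    qed
  qed
  also have "\<dots> = (\<integral>x. F x * L (x j) \<partial>usph {..<N} R)" by (rule integral_F_coord(2)[OF _ iL, symmetric]) measurable
  finally show ?thesis unfolding IL .
qed
end

text \<open>The volumes leave a term -N/2, which is written as -N/2 times the sum of the means of
  x_j^2/N, equal to 1 on the sphere. This removes the first-order part of -ln (1 - t), so the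
  correction is of second order at t = 0.\<close>

theorem marginal_entropy_sum:
  "(\<Sum>j<N. \<integral>x. sph_marginal N j F (x j) * ln (sph_marginal N j F (x j)) \<partial>sigmaN N) \<le>
     entropyN N F + 4 + ln (real N + 1) + sqrt (real N) * (sqrt D + 3)
       + real N / 2 * (\<Sum>j<N. \<integral>x. F x * (- ln (1 - (x j)\<^sup>2 / real N) - (x j)\<^sup>2 / real N) \<partial>sigmaN N)"
proof -
  define W where "W j = (\<integral>x. F x * ln (1 - (x j)\<^sup>2 / real N) \<partial>usph {..<N} R)" for j
  define T where "T j = (\<integral>x. F x * ((x j)\<^sup>2 / real N) \<partial>usph {..<N} R)" for j
  have it: "integrable (usph {..<N} R) (\<lambda>x. F x * ((x j)\<^sup>2 / real N))" if "j < N" for j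
    using w_bounds by (intro Fh_int[OF that _ _ F_int, where C=1 and h="\<lambda>v. v\<^sup>2 / real N"]) (auto simp: abs_le_iff)
  have iw: "integrable (usph {..<N} R) (\<lambda>x. F x * ln (1 - (x j)\<^sup>2 / real N))" if "j < N" for j
    using Flw[OF that] by (simp add: sig)
  have "(\<Sum>j<N. \<integral>x. sph_marginal N j F (x j) * ln (sph_marginal N j F (x j)) \<partial>sigmaN N)
     \<le> (\<Sum>j<N. (\<integral>x. F x * ln (ph j (x j)) \<partial>usph {..<N} R) - ln (cdens n R) - (real N - 1) / 2 * W j)"
    unfolding W_def by (intro sum_mono marginal_step) auto
  also have "\<dots> = (\<Sum>j<N. \<integral>x. F x * ln (ph j (x j)) \<partial>usph {..<N} R) - real N * ln (cdens n R) + (real N - 1) / 2 * - (\<Sum>j<N. W j)"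
    unfolding sum_subtractf sum_distrib_left[symmetric] by simp
  also have "\<dots> \<le> (entropyN N F + 1 + R * (sqrt D + 3) - ln (R ^ N * unit_ball_vol (real N))) - real N * ln (cdens n R) + real N / 2 * - (\<Sum>j<N. W j)"
  proof -
    \<comment> \<open>The sign permits replacing (N - 1)/2 by the N/2 that matches the volume
      term.\<close>
    have "W j \<le> 0" if "j < N" for j
    proof -
      have "W j \<le> (\<integral>x. 0 \<partial>usph {..<N} R)" unfolding W_def
      proof (rule integral_mono[OF iw[OF that]])
        fix x assume x: "x \<in> space (usph {..<N} R)"
        have b: "0 \<le> 1 - (x j)\<^sup>2 / real N" "1 - (x j)\<^sup>2 / real N \<le> 1"
          using w_bounds[of "x j"] xj_le[OF that, of x] x by (auto simp: space_S)
        have "ln (1 - (x j)\<^sup>2 / real N) \<le> 0"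
        proof -
          have "ln y \<le> 0" if "0 \<le> y" "y \<le> 1" for y :: real using that by (cases "y = 0") auto
          thus ?thesis using b by blast
        qed
        thus "F x * ln (1 - (x j)\<^sup>2 / real N) \<le> 0" using F0[of x] x by (simp add: space_S mult_nonneg_nonpos)
      qed simp
      thus ?thesis by simp
    qed
    hence "- (\<Sum>j<N. W j) \<ge> 0" using sum_nonpos[of "{..<N}" W] by auto
    hence "(real N - 1) / 2 * - (\<Sum>j<N. W j) \<le> real N / 2 * - (\<Sum>j<N. W j)" by (intro mult_right_mono) auto
    thus ?thesis using gibbs_step by linarith
  qed
  also have "\<dots> \<le> entropyN N F + 4 + ln (real N + 1) + R * (sqrt D + 3) + real N / 2 * (- (\<Sum>j<N. W j) - 1)"
    using volume_defect[OF N] unfolding n_def[symmetric] R_def[symmetric] by (simp add: algebra_simps)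
  also have "- (\<Sum>j<N. W j) - 1 = (\<Sum>j<N. \<integral>x. F x * (- ln (1 - (x j)\<^sup>2 / real N) - (x j)\<^sup>2 / real N) \<partial>sigmaN N)"
  proof -
    have "(\<Sum>j<N. T j) = (\<integral>x. (\<Sum>j<N. F x * ((x j)\<^sup>2 / real N)) \<partial>usph {..<N} R)"
      unfolding T_def using it by (subst Bochner_Integration.integral_sum) auto
    also have "\<dots> = (\<integral>x. F x \<partial>usph {..<N} R)"
    proof (rule Bochner_Integration.integral_cong[OF refl])
      fix x assume "x \<in> space (usph {..<N} R)"
      hence "L2_set x {..<N} = R" by (simp add: space_S sph_def)
      hence "(\<Sum>j<N. (x j)\<^sup>2) = real N" using R(2) by (metis L2_set_def real_sqrt_pow2 sum_nonneg zero_le_power2)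
      thus "(\<Sum>j<N. F x * ((x j)\<^sup>2 / real N)) = F x"
        using N by (simp add: sum_distrib_left[symmetric] sum_divide_distrib[symmetric])
    qed
    finally have T1: "(\<Sum>j<N. T j) = 1" using F_one by simp
    have "(\<integral>x. F x * (- ln (1 - (x j)\<^sup>2 / real N) - (x j)\<^sup>2 / real N) \<partial>usph {..<N} R) = - W j - T j" if "j < N" for j
    proof -
      have "(\<integral>x. F x * (- ln (1 - (x j)\<^sup>2 / real N) - (x j)\<^sup>2 / real N) \<partial>usph {..<N} R)
         = (\<integral>x. - (F x * ln (1 - (x j)\<^sup>2 / real N)) - F x * ((x j)\<^sup>2 / real N) \<partial>usph {..<N} R)"
        by (simp add: right_diff_distrib)
      also have "\<dots> = - W j - T j" unfolding W_def T_def using it[OF that] iw[OF that] by simp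
      finally show ?thesis .
    qed
    hence "(\<Sum>j<N. \<integral>x. F x * (- ln (1 - (x j)\<^sup>2 / real N) - (x j)\<^sup>2 / real N) \<partial>sigmaN N) = (\<Sum>j<N. - W j - T j)"
      unfolding sig by (intro sum.cong) auto
    thus ?thesis using T1 by (simp add: sum_subtractf sum_negf)
  qed
  finally show ?thesis by (simp add: R_def)
qed
end

section \<open>Moments and the logarithmic correction\<close>

text \<open>Log-convexity places x + t below the chord from x to x + M, and the functional equation,
  used M times, bounds the far end.\<close>

lemma Gamma_add_le:
  assumes x: "x > (0::real)" and t: "0 < t" "t \<le> real M"
  shows "Gamma (x + t) \<le> (x + real M) powr t * Gamma x"
proof -
  have pos: "Gamma y > 0" if "y > 0" for y :: real using that by (rule Gamma_real_pos)
  have M: "real M > 0" using t by linarith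
  have G: "ln (Gamma (x + real m)) \<le> real m * ln (x + real M) + ln (Gamma x)" if "m \<le> M" for m
    using that
  proof (induction m)
    case (Suc m)
    have "Gamma (x + real m + 1) = (x + real m) * Gamma (x + real m)"
      using x by (intro Gamma_plus1) (auto elim!: nonpos_Ints_cases)
    hence "ln (Gamma (x + real (Suc m))) = ln (x + real m) + ln (Gamma (x + real m))"
      using x pos[of "x + real m"] by (simp add: ln_mult_pos add_ac)
    also have "ln (x + real m) \<le> ln (x + real M)" using x Suc.prems by (subst ln_le_cancel_iff) auto
    also have "ln (Gamma (x + real m)) \<le> real m * ln (x + real M) + ln (Gamma x)" using Suc by simp
    finally show ?case by (simp add: algebra_simps)
  qed simp
  define s where "s = t / real M"
  have s: "0 \<le> s" "s \<le> 1" "s * real M = t" using t M by (auto simp: s_def)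
  have "(ln \<circ> Gamma) ((1 - s) *\<^sub>R x + s *\<^sub>R (x + real M)) \<le> (1 - s) * (ln \<circ> Gamma) x + s * (ln \<circ> Gamma) (x + real M)"
    by (rule convex_onD[OF log_convex_Gamma_real]) (use x s in auto)
  moreover have "(1 - s) *\<^sub>R x + s *\<^sub>R (x + real M) = x + t" using s(3) by (simp add: algebra_simps)
  ultimately have "ln (Gamma (x + t)) \<le> (1 - s) * ln (Gamma x) + s * ln (Gamma (x + real M))" by (simp add: o_def)
  moreover have "s * ln (Gamma (x + real M)) \<le> s * (real M * ln (x + real M) + ln (Gamma x))"
    using s(1) G[of M] by (intro mult_left_mono) auto
  moreover have "(1 - s) * ln (Gamma x) + s * (real M * ln (x + real M) + ln (Gamma x)) = (s * real M) * ln (x + real M) + ln (Gamma x)"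
    by (simp add: algebra_simps)
  ultimately have "ln (Gamma (x + t)) \<le> (s * real M) * ln (x + real M) + ln (Gamma x)" by linarith
  also have "\<dots> = ln ((x + real M) powr t * Gamma x)"
    using x M pos[OF x] unfolding s(3) by (subst ln_mult_pos) (auto simp: ln_powr)
  finally show ?thesis using x t pos[OF x] pos[of "x + t"] M by (subst (asm) ln_le_cancel_iff) auto
qed

text \<open>A supremum of reals says something about its members only for a bounded family. So the
  Gamma quotients are first bounded uniformly in N; the member N = 4 then fixes the sign.\<close>

lemma C_gamma_nonneg:
  assumes k: "k > 2" shows "C_gamma k \<ge> 0"
proof -
  define f where "f N = (2 / real N) powr (k / 2) * Gamma ((real N + k) / 2) / Gamma (real N / 2)" for N :: nat
  obtain M :: nat where M: "k / 2 \<le> real M" using real_arch_simple by blast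
  have f0: "f N > 0" if "N \<ge> 4" for N
    using that k by (auto simp: f_def intro!: divide_pos_pos mult_pos_pos Gamma_real_pos)
  have "f N \<le> (1 + real M / 2) powr (k / 2)" if N: "N \<ge> 4" for N
  proof -
    have x: "real N / 2 > 0" using N by simp
    have G: "Gamma (real N / 2) > 0" using x by (rule Gamma_real_pos)
    have "Gamma (real N / 2 + k / 2) \<le> (real N / 2 + real M) powr (k / 2) * Gamma (real N / 2)"
      using k M by (intro Gamma_add_le[OF x]) auto
    hence "f N \<le> (2 / real N) powr (k / 2) * ((real N / 2 + real M) powr (k / 2) * Gamma (real N / 2)) / Gamma (real N / 2)"
      unfolding f_def add_divide_distrib using G by (intro divide_right_mono mult_left_mono) auto
    also have "\<dots> = (2 / real N) powr (k / 2) * (real N / 2 + real M) powr (k / 2)" using G less_imp_neq[OF G] by simp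
    also have "\<dots> = ((2 / real N) * (real N / 2 + real M)) powr (k / 2)" by (rule powr_mult[symmetric])
    also have "\<dots> \<le> (1 + real M / 2) powr (k / 2)"
    proof (rule powr_mono2)
      have "real M * 4 \<le> real M * real N" using N by (intro mult_left_mono) auto
      thus "(2 / real N) * (real N / 2 + real M) \<le> 1 + real M / 2" using N by (simp add: field_simps)
    qed (use k in auto)
    finally show ?thesis .
  qed
  hence "bdd_above (f ` {4..})" by (intro bdd_aboveI2) auto
  hence "f 4 \<le> C_gamma k" unfolding C_gamma_def f_def[symmetric] by (intro cSUP_upper) auto
  thus ?thesis using f0[of 4] by simp
qed

text \<open>Boundedness again comes first: ln (1/sqrt x) \<le> 1/sqrt x gives |ln x| \<le> 2/sqrt x,
  hence x (ln x)^2 \<le> 4 on (0, 1]. The point x = 0 then gives the sign.\<close>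

lemma eta_nonneg:
  assumes "N \<ge> 1" "\<beta> > 0" shows "eta N \<beta> \<ge> 0"
proof -
  have "x * (ln x)\<^sup>2 \<le> 4" if x: "x \<in> {0..real N powr - \<beta>}" for x
  proof (cases "x = 0")
    case False
    hence x0: "x > 0" using x by simp
    have "real N powr - \<beta> \<le> real N powr 0" using assms by (intro powr_mono) auto
    hence x1: "x \<le> 1" using x assms by simp
    have "ln (1 / sqrt x) \<le> 1 / sqrt x - 1" using x0 by (intro ln_le_minus_one) auto
    hence "- ln x \<le> 2 / sqrt x" using x0 by (simp add: ln_divide_pos ln_sqrt)
    hence "\<bar>ln x\<bar> \<le> 2 / sqrt x" using x0 x1 by simp
    hence "\<bar>ln x\<bar>\<^sup>2 \<le> (2 / sqrt x)\<^sup>2" by (rule power_mono) simp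
    hence "(ln x)\<^sup>2 \<le> 4 / x" using x0 by (simp add: power_divide)
    from mult_left_mono[OF this, of x] x0 show ?thesis by simp
  qed simp
  hence "bdd_above ((\<lambda>x. x * (ln x)\<^sup>2) ` {0..real N powr - \<beta>})" by (intro bdd_aboveI2) auto
  hence "0 * (ln 0)\<^sup>2 \<le> (SUP x\<in>{0..real N powr - \<beta>}. x * (ln x)\<^sup>2)"
    by (rule cSUP_upper[rotated]) auto
  thus ?thesis by (simp add: eta_def)
qed

lemma ennreal_le_of_div:
  assumes "x / of_nat N \<le> (c::ennreal)" "N > 0" shows "x \<le> c * of_nat N"
proof -
  have "x / of_nat N * of_nat N = of_nat N * (x / of_nat N)" by (rule mult.commute)
  also have "\<dots> = of_nat N * x / of_nat N" by (rule ennreal_times_divide)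
  also have "\<dots> = x * of_nat N / of_nat N" by (subst mult.commute) (rule refl)
  also have "\<dots> = x" using assms(2) by (intro mult_divide_eq_ennreal) auto
  finally have "x = x / of_nat N * of_nat N" by (rule sym)
  also have "\<dots> \<le> c * of_nat N" using assms(1) by (rule mult_right_mono) simp
  finally show ?thesis .
qed

lemma ennreal_one_le_inverse: "x \<le> 1 \<Longrightarrow> 1 \<le> inverse (x :: ennreal)"
proof (cases x)
  case (real r)
  assume "x \<le> 1"
  hence r: "r \<le> 1" "r \<ge> 0" using real by (auto simp: ennreal_le_1)
  show ?thesis
  proof (cases "r = 0")
    case False
    hence "inverse x = ennreal (inverse r)" using real r by (simp add: inverse_ennreal)
    moreover have "1 \<le> inverse r" using False r by (simp add: one_le_inverse)
    ultimately show ?thesis by (simp add: ennreal_ge_1)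
  qed (use real in simp)
qed (auto simp: top_unique)

section \<open>Moments as expectations under the density\<close>

context
  fixes N :: nat and F :: "(nat \<Rightarrow> real) \<Rightarrow> real"
  assumes N: "N \<ge> 4" and dens: "sph_density N F"
begin

lemma lessThan_dim_facts: "finite {..<N}" "card {..<N} = Suc (N - 1)" "N - 1 > 0" "sqrt (real N) > 0" "{..<N} \<noteq> {}"
  using N by (auto simp: lessThan_empty_iff)

lemma space_sigmaN: "space (sigmaN N) = sph {..<N} (sqrt (real N))"
  by (simp add: sigmaN_def space_usph)

lemma density_meas [measurable]: "F \<in> borel_measurable (sigmaN N)"
  using dens by (simp add: sph_density_def)

lemma coord_meas: "j < N \<Longrightarrow> (\<lambda>x. x j) \<in> borel_measurable (sigmaN N)"
  unfolding sigmaN_def by (intro measurable_usph_of_lbp[OF lessThan_dim_facts(1,5) less_imp_le[OF lessThan_dim_facts(4)]] lbp_coord) simp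

text \<open>The derivative \<open>RN_deriv\<close> represents the law only if that law is absolutely
  continuous; this is inherited from the coordinate law of the uniform measure, which has the
  density \<open>sdens\<close>.\<close>

lemma density_coord_density:
  assumes j: "j < N"
  shows "density lborel (coord_density N j F) = distr (density (sigmaN N) (\<lambda>x. ennreal (F x))) lborel (\<lambda>x. x j)"
    (is "_ = ?D")
  unfolding coord_density_def
proof (rule sigma_finite_measure.density_RN_deriv)
  have [measurable]: "(\<lambda>x. x j) \<in> borel_measurable (sigmaN N)" by (rule coord_meas[OF j])
  have jI: "j \<in> {..<N}" using j by simp
  show "absolutely_continuous lborel ?D"
    unfolding absolutely_continuous_def
  proof
    fix A :: "real set" assume A: "A \<in> null_sets lborel"
    hence [measurable]: "A \<in> sets borel" by (auto simp: null_sets_def)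
    have "AE v in lborel. v \<notin> A" using A by (rule AE_not_in)
    hence "AE v in vlaw (N - 1) (sqrt (real N)). v \<notin> A"
      unfolding vlaw_def by (subst AE_density) (auto elim!: eventually_mono)
    hence "AE v in distr (usph0 {..<N} (sqrt (real N))) borel (\<lambda>x. x j). v \<notin> A"
      unfolding distr_usph0_coord[OF lessThan_dim_facts(1) jI lessThan_dim_facts(2,3,4)] .
    hence "AE x in usph0 {..<N} (sqrt (real N)). x j \<notin> A"
      by (rule AE_distrD[rotated]) (simp add: lbp_coord[OF jI] cong: measurable_cong_sets)
    hence ae: "AE x in sigmaN N. x j \<notin> A"
      unfolding sigmaN_def by (simp add: AE_usph_iff[OF lessThan_dim_facts(1,5) less_imp_le[OF lessThan_dim_facts(4)]])
    have "emeasure ?D A = (\<integral>\<^sup>+x. indicator A (x j) \<partial>density (sigmaN N) (\<lambda>x. ennreal (F x)))"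
      by (subst nn_integral_indicator[symmetric], simp, subst nn_integral_distr) auto
    also have "\<dots> = (\<integral>\<^sup>+x. ennreal (F x) * indicator A (x j) \<partial>sigmaN N)"
      by (subst nn_integral_density) auto
    also have "\<dots> = (\<integral>\<^sup>+x. 0 \<partial>sigmaN N)"
      by (rule nn_integral_cong_AE, use ae in eventually_elim) simp
    finally show "A \<in> null_sets ?D" by (auto simp: null_sets_def)
  qed
qed (auto intro: lborel.sigma_finite_measure_axioms)

lemma nn_integral_coord_density:
  assumes j: "j < N" and [measurable]: "g \<in> borel_measurable borel"
  shows "(\<integral>\<^sup>+v. coord_density N j F v * g v \<partial>lborel) = (\<integral>\<^sup>+x. ennreal (F x) * g (x j) \<partial>sigmaN N)"
proof -
  have [measurable]: "(\<lambda>x. x j) \<in> borel_measurable (sigmaN N)" by (rule coord_meas[OF j])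
  have [measurable]: "coord_density N j F \<in> borel_measurable borel"
    unfolding coord_density_def using borel_measurable_RN_deriv[of lborel] by simp
  have "(\<integral>\<^sup>+v. coord_density N j F v * g v \<partial>lborel) = (\<integral>\<^sup>+v. g v \<partial>density lborel (coord_density N j F))"
    by (rule nn_integral_density[symmetric]) auto
  also have "\<dots> = (\<integral>\<^sup>+x. g (x j) \<partial>density (sigmaN N) (\<lambda>x. ennreal (F x)))"
    unfolding density_coord_density[OF j] by (subst nn_integral_distr) auto
  also have "\<dots> = (\<integral>\<^sup>+x. ennreal (F x) * g (x j) \<partial>sigmaN N)"
    by (rule nn_integral_density) auto
  finally show ?thesis .
qed

lemma moment_coord_density:
  "j < N \<Longrightarrow> moment k (coord_density N j F) = (\<integral>\<^sup>+x. ennreal (F x) * ennreal (\<bar>x j\<bar> powr k) \<partial>sigmaN N)"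
  unfolding moment_def using nn_integral_coord_density[of j "\<lambda>v. ennreal (\<bar>v\<bar> powr k)"] by (simp add: mult.commute)

lemma Pmom_coord:
  "j < N \<Longrightarrow> Pmom N q j F = (\<integral>\<^sup>+x. ennreal (F x) * inverse (ennreal ((1 - (x j)\<^sup>2 / real N) powr (q / (q - 2)))) \<partial>sigmaN N)"
  unfolding Pmom_def divide_ennreal_def
  using nn_integral_coord_density[of j "\<lambda>v. inverse (ennreal ((1 - v\<^sup>2 / real N) powr (q / (q - 2))))"] by simp

lemma w_sph:
  assumes "x \<in> sph {..<N} (sqrt (real N))" "j < N"
  shows "0 \<le> 1 - (x j)\<^sup>2 / real N" "1 - (x j)\<^sup>2 / real N \<le> 1"
proof -
  have "\<bar>x j\<bar> \<le> sqrt (real N)" using assms by (intro sph_coord_le) auto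
  hence "\<bar>x j\<bar>\<^sup>2 \<le> (sqrt (real N))\<^sup>2" by (intro power_mono) auto
  hence "(x j)\<^sup>2 \<le> real N" by simp
  thus "0 \<le> 1 - (x j)\<^sup>2 / real N" using N by (simp add: divide_le_eq)
qed simp

text \<open>Makes the average moment p at least 1, so that powers of p are monotone in the
  exponent.\<close>

lemma Pmom_ge_1:
  assumes j: "j < N" and q: "q > 2" shows "Pmom N q j F \<ge> 1"
proof -
  have "1 = (\<integral>\<^sup>+x. ennreal (F x) \<partial>sigmaN N)" using dens by (simp add: sph_density_def)
  also have "\<dots> \<le> Pmom N q j F"
    unfolding Pmom_coord[OF j]
  proof (rule nn_integral_mono)
    fix x assume "x \<in> space (sigmaN N)"
    hence w: "0 \<le> 1 - (x j)\<^sup>2 / real N" "1 - (x j)\<^sup>2 / real N \<le> 1"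
      using w_sph[OF _ j] by (auto simp: space_sigmaN)
    have "(1 - (x j)\<^sup>2 / real N) powr (q / (q - 2)) \<le> 1 powr (q / (q - 2))"
      using w q by (intro powr_mono2) auto
    hence "ennreal ((1 - (x j)\<^sup>2 / real N) powr (q / (q - 2))) \<le> 1" by (simp add: ennreal_le_1)
    hence "1 \<le> inverse (ennreal ((1 - (x j)\<^sup>2 / real N) powr (q / (q - 2))))"
      using ennreal_one_le_inverse by blast
    from mult_left_mono[OF this, of "ennreal (F x)"]
    show "ennreal (F x) \<le> ennreal (F x) * inverse (ennreal ((1 - (x j)\<^sup>2 / real N) powr (q / (q - 2))))" by simp
  qed
  finally show ?thesis .
qed
end

text \<open>Near 0 the left side is at most 2 t^2; near 1 any negative power of 1 - t beats the
  logarithm at the price 1/c, and 4 t^2 \<ge> 1 supplies the factor 4. As s \<le> 2, t^2 may be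
  relaxed to the power s.\<close>

lemma neg_ln_one_minus_le:
  assumes t: "0 \<le> t" "t < (1::real)" and c: "c > 0" and s: "s \<le> 2" 
  shows "- ln (1 - t) - t \<le> (2 + 4 / c) * (t powr s * (1 - t) powr (- c))"
proof (cases "t = 0")
  case False
  hence t0: "t > 0" using t by simp
  have p1: "(1 - t) powr (- c) \<ge> 1" 
  proof -
    have "(1 - t) powr c \<le> 1 powr c" using t c by (intro powr_mono2) auto
    thus ?thesis using t by (simp add: powr_minus one_le_inverse)
  qed
  have "t powr 2 \<le> t powr s" using t t0 s by (intro powr_mono') auto
  hence ts: "t\<^sup>2 \<le> t powr s" using t0 by simp
  have "- ln (1 - t) - t \<le> (2 + 4 / c) * (t\<^sup>2 * (1 - t) powr (- c))"
  proof (cases "t \<le> 1 / 2")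
    case True
    have "- ln (1 - t) - t \<le> 2 * t\<^sup>2" using ln_one_minus_pos_lower_bound[OF t(1) True] by simp
    also have "\<dots> \<le> (2 + 4 / c) * (t\<^sup>2 * (1 - t) powr (- c))"
      using p1 c mult_left_mono[OF p1, of "t\<^sup>2"] by (intro mult_mono) auto
    finally show ?thesis .
  next
    case False
    have "ln ((1 - t) powr (- c)) \<le> (1 - t) powr (- c) - 1" using t by (intro ln_le_minus_one) auto
    hence "c * - ln (1 - t) \<le> (1 - t) powr (- c)" using t by (simp add: ln_powr)
    hence "- ln (1 - t) \<le> (1 - t) powr (- c) / c" using c by (simp add: field_simps)
    also have "\<dots> \<le> 4 / c * (t\<^sup>2 * (1 - t) powr (- c))"
    proof -
      have "(1 / 2)\<^sup>2 \<le> t\<^sup>2" using False by (intro power_mono) auto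
      hence "1 \<le> 4 * t\<^sup>2" by (simp add: power_divide)
      from mult_right_mono[OF this, of "(1 - t) powr (- c) / c"] c show ?thesis by (simp add: mult_ac)
    qed
    also have "\<dots> \<le> (2 + 4 / c) * (t\<^sup>2 * (1 - t) powr (- c))" by (intro mult_right_mono) auto
    finally show ?thesis using t by simp
  qed
  also have "\<dots> \<le> (2 + 4 / c) * (t powr s * (1 - t) powr (- c))"
    using c ts by (intro mult_left_mono mult_right_mono) auto
  finally show ?thesis .
qed simp

text \<open>A weighted mean of the three numbers with the weights given away: each factor is bounded
  by the corresponding power of the maximum.\<close>

lemma young3:
  fixes a b c :: real
  assumes "a \<ge> 0" "b \<ge> 0" "c \<ge> 0" "l1 > 0" "l2 > 0" "l3 > 0" "l1 + l2 + l3 = 1"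
  shows "a powr l1 * b powr l2 * c powr l3 \<le> a + b + c"
proof (cases "a = 0 \<or> b = 0 \<or> c = 0")
  case True thus ?thesis using assms by auto
next
  case False
  define m where "m = max a (max b c)"
  have m: "m > 0" "a \<le> m" "b \<le> m" "c \<le> m" using False assms by (auto simp: m_def)
  have "a powr l1 * b powr l2 * c powr l3 \<le> m powr l1 * m powr l2 * m powr l3"
    using m assms by (intro mult_mono powr_mono2) auto
  also have "\<dots> = m" using m assms by (simp add: powr_add[symmetric])
  also have "\<dots> \<le> a + b + c" using assms by (auto simp: m_def)
  finally show ?thesis .
qed

text \<open>With t = v_j^2/N the correction is bounded by a geometric mean, with exponents l1, 1/k,
  \<kappa> of sum 1, of N t, |v_j|^k/(1 + a) and (1 - t)^(-q/(q-2))/p. Each of these has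
  expectations adding up to at most N over j, by the sphere constraint and the two moment bounds.
  The total power of N is 1/2 + 1/k + \<kappa>, and the upper bound on \<kappa> says exactly that
  this is at most 1 - (1/(2q) - 1/(2k)).\<close>

lemma correction_bound:
  fixes N :: nat and F :: "(nat \<Rightarrow> real) \<Rightarrow> real" and k q a p \<kappa> :: real
  assumes N: "N \<ge> 4" and dens: "sph_density N F" and kq: "k > 2" "2 < q" "q < k"
    and M: "(\<Sum>j<N. moment k (coord_density N j F)) \<le> ennreal a * of_nat N" and a: "a \<ge> 0"
    and P: "(\<Sum>j<N. Pmom N q j F) \<le> ennreal p * of_nat N" and p: "p \<ge> 1"
    and \<kappa>: "0 < \<kappa>" "\<kappa> \<le> 1 / 2 - 1 / (2 * k) - 1 / (2 * q)"
  shows "j < N \<Longrightarrow> integrable (sigmaN N) (\<lambda>x. F x * ln (1 - (x j)\<^sup>2 / real N))"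
    and "real N / 2 * (\<Sum>j<N. \<integral>x. F x * (- ln (1 - (x j)\<^sup>2 / real N) - (x j)\<^sup>2 / real N) \<partial>sigmaN N)
      \<le> 3 / 2 * (2 + 4 / (q / (q - 2) * \<kappa>)) * (real N powr (1 - (1 / (2 * q) - 1 / (2 * k))) * (1 + a) powr (1 / k) * p powr \<kappa>)"
proof -
  note b = lessThan_dim_facts[OF N dens]
  note sp = space_sigmaN[OF N dens]
  interpret S: prob_space "sigmaN N"
    unfolding sigmaN_def by (rule prob_space_usph[OF b(1,5) less_imp_le[OF b(4)]])
  define e where "e = q / (q - 2)"
  have e: "e > 0" using kq by (simp add: e_def)
  define w where "w j x = 1 - (x j)\<^sup>2 / real N" for j and x :: "nat \<Rightarrow> real"
  have w: "0 \<le> w j x" "w j x \<le> 1" if "x \<in> space (sigmaN N)" "j < N" for j x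
    using w_sph[OF N dens, of x j] that by (auto simp: w_def sp)
  have F0: "F x \<ge> 0" if "x \<in> space (sigmaN N)" for x using dens that by (auto simp: sph_density_def sp)
  note [measurable] = density_meas[OF N dens] 
  have xm: "(\<lambda>x. x j) \<in> borel_measurable (sigmaN N)" if "j < N" for j by (rule coord_meas[OF N dens that])
  have wm: "w j \<in> borel_measurable (sigmaN N)" if "j < N" for j
    unfolding w_def[abs_def] using xm[OF that] by measurable
  have Fi: "integrable (sigmaN N) F"
    using dens F0 by (intro integrableI_nonneg) (auto simp: sph_density_def intro!: AE_I2)
  have F1: "(\<integral>x. F x \<partial>sigmaN N) = 1"
  proof -
    have "ennreal (\<integral>x. F x \<partial>sigmaN N) = 1"
      using nn_integral_eq_integral[OF Fi] F0 dens by (auto simp: sph_density_def intro!: AE_I2)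
    thus ?thesis by (simp add: ennreal_eq_1)
  qed
  define fM where "fM j x = F x * \<bar>x j\<bar> powr k" for j x
  define fP where "fP j x = F x * w j x powr (- e)" for j x
  have fMm: "fM j \<in> borel_measurable (sigmaN N)" if "j < N" for j
    unfolding fM_def[abs_def] using xm[OF that] by measurable
  have fPm: "fP j \<in> borel_measurable (sigmaN N)" if "j < N" for j
    unfolding fP_def[abs_def] using wm[OF that] by measurable
  have fM0: "fM j x \<ge> 0" and fP0: "fP j x \<ge> 0" if "x \<in> space (sigmaN N)" for j x
    using F0[OF that] by (auto simp: fM_def fP_def)
  have top: "ennreal c * of_nat N < \<infinity>" for c by (simp add: ennreal_mult_less_top of_nat_less_top)
  have Mnn: "(\<integral>\<^sup>+x. ennreal (fM j x) \<partial>sigmaN N) = moment k (coord_density N j F)" if "j < N" for j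
    unfolding moment_coord_density[OF N dens that] fM_def
    by (intro nn_integral_cong) (simp add: ennreal_mult' F0)
  have Pfin: "Pmom N q j F < \<infinity>" if "j < N" for j
  proof -
    have "Pmom N q j F \<le> (\<Sum>j<N. Pmom N q j F)" using that by (intro member_le_sum) auto
    thus ?thesis using P top[of p] by (meson order_le_less_trans)
  qed
  \<comment> \<open>Finite \<open>Pmom\<close> excludes mass at the poles, where the inverse weight
    is infinite. This matters because the real \<open>powr\<close> and \<open>ln\<close> return
    default values at 0.\<close>
  have good: "AE x in sigmaN N. F x = 0 \<or> w j x > 0" if j: "j < N" for j
  proof -
    have "AE x in sigmaN N. ennreal (F x) * inverse (ennreal (w j x powr e)) \<noteq> \<infinity>"
    proof (rule nn_integral_noteq_infinite)
      show "(\<lambda>x. ennreal (F x) * inverse (ennreal (w j x powr e))) \<in> borel_measurable (sigmaN N)"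
        using wm[OF j] by measurable
      show "(\<integral>\<^sup>+x. ennreal (F x) * inverse (ennreal (w j x powr e)) \<partial>sigmaN N) \<noteq> \<infinity>"
        using Pfin[OF j] unfolding Pmom_coord[OF N dens j] w_def e_def by simp
    qed
    thus ?thesis using AE_space
    proof eventually_elim
      case (elim x)
      show ?case
      proof (rule ccontr)
        assume "\<not> (F x = 0 \<or> w j x > 0)"
        hence "w j x = 0" "F x > 0" using w(1)[OF elim(2) j] F0[OF elim(2)] by auto
        thus False using elim(1) by (simp add: ennreal_mult_top)
      qed
    qed
  qed
  have Pnn: "(\<integral>\<^sup>+x. ennreal (fP j x) \<partial>sigmaN N) = Pmom N q j F" if j: "j < N" for j
    unfolding Pmom_coord[OF N dens j]
  proof (rule nn_integral_cong_AE)
    show "AE x in sigmaN N. ennreal (fP j x) = ennreal (F x) * inverse (ennreal ((1 - (x j)\<^sup>2 / real N) powr (q / (q - 2))))"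
      using good[OF j] AE_space
    proof eventually_elim
      case (elim x)
      show ?case
      proof (cases "F x = 0")
        case False
        hence wp: "w j x > 0" using elim by simp
        have "inverse (ennreal (w j x powr e)) = ennreal (inverse (w j x powr e))" using wp by (intro inverse_ennreal) simp
        thus ?thesis using F0[OF elim(2)] by (simp add: fP_def e_def[symmetric] w_def[symmetric] powr_minus ennreal_mult')
      qed (simp add: fP_def)
    qed
  qed
  have Mfin: "moment k (coord_density N j F) < \<infinity>" if "j < N" for j
  proof -
    have "moment k (coord_density N j F) \<le> (\<Sum>j<N. moment k (coord_density N j F))" using that by (intro member_le_sum) auto
    thus ?thesis using M top[of a] by (meson order_le_less_trans)
  qed
  have Mi: "integrable (sigmaN N) (fM j)" if "j < N" for j
    using fMm[OF that] Mnn[OF that] Mfin[OF that] fM0 by (intro integrableI_nonneg) (auto intro!: AE_I2)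
  have Pi: "integrable (sigmaN N) (fP j)" if "j < N" for j
    using fPm[OF that] Pnn[OF that] Pfin[OF that] fP0 by (intro integrableI_nonneg) (auto intro!: AE_I2)
  have sumM: "(\<Sum>j<N. \<integral>x. fM j x \<partial>sigmaN N) \<le> a * real N"
  proof -
    have "ennreal (\<Sum>j<N. \<integral>x. fM j x \<partial>sigmaN N) = (\<Sum>j<N. ennreal (\<integral>x. fM j x \<partial>sigmaN N))"
      using fM0 by (intro sum_ennreal[symmetric] integral_nonneg_AE AE_I2) auto
    also have "\<dots> = (\<Sum>j<N. moment k (coord_density N j F))"
      using fM0 by (intro sum.cong refl, subst Mnn[symmetric], simp) (auto intro!: nn_integral_eq_integral[symmetric] Mi AE_I2)
    also have "\<dots> \<le> ennreal (a * real N)" using M a by (simp add: ennreal_mult' ennreal_of_nat_eq_real_of_nat)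
    finally show ?thesis using a by (subst (asm) ennreal_le_iff) auto
  qed
  have sumP: "(\<Sum>j<N. \<integral>x. fP j x \<partial>sigmaN N) \<le> p * real N"
  proof -
    have "ennreal (\<Sum>j<N. \<integral>x. fP j x \<partial>sigmaN N) = (\<Sum>j<N. ennreal (\<integral>x. fP j x \<partial>sigmaN N))"
      using fP0 by (intro sum_ennreal[symmetric] integral_nonneg_AE AE_I2) auto
    also have "\<dots> = (\<Sum>j<N. Pmom N q j F)"
      using fP0 by (intro sum.cong refl, subst Pnn[symmetric], simp) (auto intro!: nn_integral_eq_integral[symmetric] Pi AE_I2)
    also have "\<dots> \<le> ennreal (p * real N)" using P p by (simp add: ennreal_mult' ennreal_of_nat_eq_real_of_nat)
    finally show ?thesis using p by (subst (asm) ennreal_le_iff) auto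
  qed
  show lnint: "integrable (sigmaN N) (\<lambda>x. F x * ln (1 - (x j)\<^sup>2 / real N))" if j: "j < N" for j
  proof (rule Bochner_Integration.integrable_bound[OF integrable_mult_right[OF Pi[OF j], of "1 / e"]])
    show "(\<lambda>x. F x * ln (1 - (x j)\<^sup>2 / real N)) \<in> borel_measurable (sigmaN N)"
      using wm[OF j] unfolding w_def[symmetric] by measurable
    show "AE x in sigmaN N. norm (F x * ln (1 - (x j)\<^sup>2 / real N)) \<le> norm (1 / e * fP j x)"
      using good[OF j] AE_space
    proof eventually_elim
      case (elim x)
      show ?case
      proof (cases "F x = 0")
        case False
        hence wp: "w j x > 0" using elim by simp
        have "ln (w j x powr (- e)) \<le> w j x powr (- e) - 1" using wp by (intro ln_le_minus_one) simp
        hence "e * - ln (w j x) \<le> w j x powr (- e)" using wp by (simp add: ln_powr)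
        moreover have "ln (w j x) \<le> 0" using wp w(2)[OF elim(2) j] by simp
        ultimately have "\<bar>ln (w j x)\<bar> \<le> 1 / e * w j x powr (- e)" using e by (simp add: field_simps)
        from mult_left_mono[OF this, of "F x"] F0[OF elim(2)] e show ?thesis
          by (simp add: w_def[symmetric] fP_def abs_mult mult_ac)
      qed simp
    qed
  qed
  define l1 where "l1 = 1 - 1 / k - \<kappa>"
  have l1: "l1 > 0"
  proof -
    have "1 / k < 1 / 2" using kq by (simp add: field_simps)
    moreover have "\<kappa> < 1 / 2" using \<kappa> kq by (smt (verit) divide_pos_pos)
    ultimately show ?thesis by (simp add: l1_def)
  qed
  \<comment> \<open>Calibrated so that t^(l1 + 1/2) (1 - t)^(-e \<kappa>) is \<open>B0\<close> times
    the geometric mean: |x_j| = sqrt (N t) brings the extra half power of both N and t.\<close>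
  define B0 where "B0 = real N powr (- l1 - 1 / 2) * (1 + a) powr (1 / k) * p powr \<kappa>"
  define C0 where "C0 = 2 + 4 / (e * \<kappa>)"
  have C0: "C0 > 0" using e \<kappa> by (auto simp: C0_def intro!: add_pos_pos)
  have B0: "B0 \<ge> 0" by (simp add: B0_def)
  define T where "T j x = F x * ((x j)\<^sup>2 / real N)" for j x
  have Ti: "integrable (sigmaN N) (T j)" if j: "j < N" for j
  proof (rule Bochner_Integration.integrable_bound[OF Fi])
    show "T j \<in> borel_measurable (sigmaN N)" unfolding T_def[abs_def] using xm[OF j] by measurable
    show "AE x in sigmaN N. norm (T j x) \<le> norm (F x)"
    proof (rule AE_I2)
      fix x assume x: "x \<in> space (sigmaN N)"
      have "(x j)\<^sup>2 / real N \<le> 1" using w(1)[OF x j] by (simp add: w_def)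
      thus "norm (T j x) \<le> norm (F x)" unfolding T_def real_norm_def abs_mult by (intro mult_left_le) auto
    qed
  qed
  have sumT: "(\<Sum>j<N. \<integral>x. T j x \<partial>sigmaN N) = 1"
  proof -
    have "(\<Sum>j<N. \<integral>x. T j x \<partial>sigmaN N) = (\<integral>x. (\<Sum>j<N. T j x) \<partial>sigmaN N)"
      using Ti by (subst Bochner_Integration.integral_sum) auto
    also have "\<dots> = (\<integral>x. F x \<partial>sigmaN N)"
    proof (rule Bochner_Integration.integral_cong[OF refl])
      fix x assume "x \<in> space (sigmaN N)"
      hence "sqrt (\<Sum>j<N. (x j)\<^sup>2) = sqrt (real N)" by (simp add: sp sph_def L2_set_def)
      hence "(\<Sum>j<N. (x j)\<^sup>2) = real N" by simp
      thus "(\<Sum>j<N. T j x) = F x"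
        using N by (simp add: T_def sum_distrib_left[symmetric] sum_divide_distrib[symmetric])
    qed
    finally show ?thesis using F1 by simp
  qed
  have pt: "AE x in sigmaN N. F x * (- ln (1 - (x j)\<^sup>2 / real N) - (x j)\<^sup>2 / real N)
      \<le> C0 * B0 * (real N * T j x + fM j x / (1 + a) + fP j x / p)" if j: "j < N" for j
    using good[OF j] AE_space
  proof eventually_elim
    case (elim x)
    show ?case
    proof (cases "F x = 0")
      case True thus ?thesis by (simp add: T_def fM_def fP_def)
    next
      case False
      hence f: "F x > 0" using F0[OF elim(2)] by simp
      define t where "t = (x j)\<^sup>2 / real N"
      have wt: "w j x = 1 - t" by (simp add: w_def t_def)
      have t: "0 \<le> t" "t < 1" using elim False by (auto simp: wt t_def)
      have "1 / k > 0" using kq by simp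
      hence "l1 + 1 / 2 \<le> 2" using \<kappa>(1) unfolding l1_def by linarith
      hence "- ln (1 - t) - t \<le> C0 * (t powr (l1 + 1 / 2) * (1 - t) powr (- (e * \<kappa>)))"
        unfolding C0_def using e \<kappa> by (intro neg_ln_one_minus_le t) auto
      also have "t powr (l1 + 1 / 2) * (1 - t) powr (- (e * \<kappa>)) =
         B0 * ((real N * t) powr l1 * (\<bar>x j\<bar> powr k / (1 + a)) powr (1 / k) * ((1 - t) powr (- e) / p) powr \<kappa>)"
      proof -
        have Np: "real N > 0" using N by simp
        have xj: "\<bar>x j\<bar> = real N powr (1 / 2) * t powr (1 / 2)"
        proof -
          have "\<bar>x j\<bar> = sqrt (real N * t)" using Np by (simp add: t_def)
          also have "\<dots> = real N powr (1 / 2) * t powr (1 / 2)" using t Np by (simp add: real_sqrt_mult powr_half_sqrt)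
          finally show ?thesis .
        qed
        have 1: "(real N * t) powr l1 = real N powr l1 * t powr l1" using t by (intro powr_mult)
        have 2: "(\<bar>x j\<bar> powr k / (1 + a)) powr (1 / k) = real N powr (1 / 2) * t powr (1 / 2) / (1 + a) powr (1 / k)"
          using a kq xj by (simp add: powr_divide powr_powr)
        have 3: "((1 - t) powr (- e) / p) powr \<kappa> = (1 - t) powr (- (e * \<kappa>)) / p powr \<kappa>"
          using p by (simp add: powr_divide powr_powr)
        have 4: "real N powr (- l1 - 1 / 2) * (real N powr l1 * real N powr (1 / 2)) = 1"
          using Np by (simp add: powr_add[symmetric])
        have 5: "t powr (l1 + 1 / 2) = t powr l1 * t powr (1 / 2)" by (rule powr_add)
        have nz: "(1 + a) powr (1 / k) \<noteq> 0" "p powr \<kappa> \<noteq> 0" using a p by auto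
        have "X * A * P * (N1 * t1 * (N2 * t2 / A) * (u / P)) = (X * (N1 * N2)) * (t1 * t2 * u)" if "A \<noteq> 0" "P \<noteq> 0" for X A P N1 t1 N2 t2 u :: real
          using that by simp
        from this[OF nz] show ?thesis unfolding B0_def 1 2 3 5 by (simp only: 4 mult_1)
      qed
      also have "C0 * (B0 * ((real N * t) powr l1 * (\<bar>x j\<bar> powr k / (1 + a)) powr (1 / k) * ((1 - t) powr (- e) / p) powr \<kappa>))
         \<le> C0 * (B0 * (real N * t + \<bar>x j\<bar> powr k / (1 + a) + (1 - t) powr (- e) / p))"
        using C0 B0 t a p l1 kq \<kappa> by (intro mult_left_mono young3) (auto simp: l1_def)
      finally have "- ln (1 - t) - t \<le> C0 * (B0 * (real N * t + \<bar>x j\<bar> powr k / (1 + a) + (1 - t) powr (- e) / p))" .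
      from mult_left_mono[OF this less_imp_le[OF f]] show ?thesis
        unfolding T_def fM_def fP_def wt t_def[symmetric] by (simp add: algebra_simps)
    qed
  qed
  have bi: "integrable (sigmaN N) (\<lambda>x. C0 * B0 * (real N * T j x + fM j x / (1 + a) + fP j x / p))" if "j < N" for j
    using Ti[OF that] Mi[OF that] Pi[OF that] by auto
  have li: "integrable (sigmaN N) (\<lambda>x. F x * (- ln (1 - (x j)\<^sup>2 / real N) - (x j)\<^sup>2 / real N))" if "j < N" for j
  proof -
    have "integrable (sigmaN N) (\<lambda>x. - (F x * ln (1 - (x j)\<^sup>2 / real N)) - T j x)"
      using lnint[OF that] Ti[OF that] by auto
    thus ?thesis by (simp add: T_def right_diff_distrib)
  qed
  have "(\<Sum>j<N. \<integral>x. F x * (- ln (1 - (x j)\<^sup>2 / real N) - (x j)\<^sup>2 / real N) \<partial>sigmaN N)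
     \<le> (\<Sum>j<N. \<integral>x. C0 * B0 * (real N * T j x + fM j x / (1 + a) + fP j x / p) \<partial>sigmaN N)"
    by (intro sum_mono integral_mono_AE li bi pt) auto
  also have "\<dots> = (\<Sum>j<N. C0 * B0 * (real N * (\<integral>x. T j x \<partial>sigmaN N) + (\<integral>x. fM j x \<partial>sigmaN N) / (1 + a) + (\<integral>x. fP j x \<partial>sigmaN N) / p))"
    using Ti Mi Pi by (intro sum.cong refl) simp
  also have "\<dots> = C0 * B0 * (real N * (\<Sum>j<N. \<integral>x. T j x \<partial>sigmaN N) + (\<Sum>j<N. \<integral>x. fM j x \<partial>sigmaN N) / (1 + a) + (\<Sum>j<N. \<integral>x. fP j x \<partial>sigmaN N) / p)"
    by (simp add: sum.distrib sum_distrib_left[symmetric] sum_divide_distrib[symmetric])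
  also have "\<dots> \<le> C0 * B0 * (real N + real N + real N)"
  proof (intro mult_left_mono add_mono)
    have "(\<Sum>j<N. \<integral>x. fM j x \<partial>sigmaN N) \<le> (1 + a) * real N" using sumM by (simp add: algebra_simps)
    thus "(\<Sum>j<N. \<integral>x. fM j x \<partial>sigmaN N) / (1 + a) \<le> real N" using a by (simp add: pos_divide_le_eq mult.commute)
    show "(\<Sum>j<N. \<integral>x. fP j x \<partial>sigmaN N) / p \<le> real N" using sumP p by (simp add: pos_divide_le_eq mult.commute)
  qed (use sumT C0 B0 in auto)
  finally have "real N / 2 * (\<Sum>j<N. \<integral>x. F x * (- ln (1 - (x j)\<^sup>2 / real N) - (x j)\<^sup>2 / real N) \<partial>sigmaN N)
     \<le> real N / 2 * (C0 * B0 * (real N + real N + real N))" by (intro mult_left_mono) auto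
  also have "\<dots> = 3 / 2 * C0 * (real N powr (2 - l1 - 1 / 2) * (1 + a) powr (1 / k) * p powr \<kappa>)"
  proof -
    have "real N powr 2 * real N powr (- l1 - 1 / 2) = real N powr (2 - l1 - 1 / 2)"
      by (subst powr_add[symmetric]) (rule arg_cong[where f = "(powr) (real N)"], simp)
    moreover have "real N powr 2 = real N * real N" using N by (simp add: powr_numeral power2_eq_square)
    ultimately have "real N powr (2 - l1 - 1 / 2) = real N * real N * real N powr (- l1 - 1 / 2)" by simp
    thus ?thesis by (simp only: B0_def) (simp add: algebra_simps)
  qed
  also have "\<dots> \<le> 3 / 2 * C0 * (real N powr (1 - (1 / (2 * q) - 1 / (2 * k))) * (1 + a) powr (1 / k) * p powr \<kappa>)"
  proof -
    have "2 - l1 - 1 / 2 \<le> 1 - (1 / (2 * q) - 1 / (2 * k))"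
    proof -
      have "1 / k = 1 / (2 * k) + 1 / (2 * k)" by simp
      thus ?thesis using \<kappa>(2) unfolding l1_def by linarith
    qed
    hence "real N powr (2 - l1 - 1 / 2) \<le> real N powr (1 - (1 / (2 * q) - 1 / (2 * k)))" using N by (intro powr_mono) auto
    thus ?thesis using C0 by (intro mult_left_mono mult_right_mono) auto
  qed
  finally show "real N / 2 * (\<Sum>j<N. \<integral>x. F x * (- ln (1 - (x j)\<^sup>2 / real N) - (x j)\<^sup>2 / real N) \<partial>sigmaN N)
      \<le> 3 / 2 * (2 + 4 / (q / (q - 2) * \<kappa>)) * (real N powr (1 - (1 / (2 * q) - 1 / (2 * k))) * (1 + a) powr (1 / k) * p powr \<kappa>)"
    by (simp add: C0_def e_def)
qed

text \<open>All factors of the target are at least 1. As 1/(2q) - 1/(2k) is at most 1/2, sqrt n is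
  below the power of n; raised to q/(q-1), the two powers in the bracket dominate sqrt D and
  p^\<kappa>, the latter by the assumption on \<kappa>. The number 10 is a generous bound for the
  terms sqrt n (sqrt D + 7).\<close>

lemma error_terms_le:
  fixes n k q a p D C0 \<kappa> :: real
  assumes n: "n \<ge> 4" and kq: "2 < q" "q < k" and a: "a \<ge> 0" and p: "p \<ge> 1"
    and D: "D \<ge> 1" and C0: "C0 \<ge> 0" and \<kappa>: "\<kappa> \<le> q * (q - 2) / (2 * (q - 1)\<^sup>2)"
  shows "4 + ln (n + 1) + sqrt n * (sqrt D + 3)
      + 3 / 2 * C0 * (n powr (1 - (1 / (2 * q) - 1 / (2 * k))) * (1 + a) powr (1 / k) * p powr \<kappa>)
    \<le> (10 + 3 / 2 * C0) * (n powr (1 - (1 / (2 * q) - 1 / (2 * k))) * (1 + a) powr (1 / k)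
      * ((2 * D) powr (q / (2 * (q - 1))) * p powr ((q - 2) / (2 * (q - 1))) + 2) powr (q / (q - 1)))"
    (is "_ \<le> _ * (?M * ?A * (?U * ?V + 2) powr ?r)")
proof -
  define Q where "Q = (?U * ?V + 2) powr ?r"
  have r: "?r \<ge> 1" "?r > 0" using kq by (auto simp: field_simps)
  have A: "?A \<ge> 1" using a kq by (intro ge_one_powr_ge_zero) auto
  have U: "?U \<ge> 1" using D kq by (intro ge_one_powr_ge_zero) auto
  have V: "?V \<ge> 1" using p kq by (intro ge_one_powr_ge_zero) auto
  have "?U * 1 \<le> ?U * ?V" using U V by (intro mult_left_mono) auto
  hence QU: "?U powr ?r \<le> Q" unfolding Q_def using U r by (intro powr_mono2) auto
  have "1 * ?V \<le> ?U * ?V" using U V by (intro mult_right_mono) auto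
  hence QV: "?V powr ?r \<le> Q" unfolding Q_def using V r by (intro powr_mono2) auto
  have "1 powr ?r \<le> ?U powr ?r" using U r by (intro powr_mono2) auto
  hence Q1: "Q \<ge> 1" using QU by simp
  have "sqrt D \<le> sqrt (2 * D)" using D by (intro real_sqrt_le_mono) auto
  also have "\<dots> = (2 * D) powr (1 / 2)" using D by (simp add: powr_half_sqrt)
  \<comment> \<open>With r = q/(q-1) \<ge> 1 the exponent on the right is r^2/2, at least
    1/2.\<close>
  also have "\<dots> \<le> (2 * D) powr (q / (2 * (q - 1)) * ?r)"
  proof (rule powr_mono)
    have "1 * 1 \<le> ?r * ?r" by (intro mult_mono) (use r in auto)
    hence half: "1 * 1 / 2 \<le> ?r * ?r / 2" by (rule divide_right_mono) simp
    have eq: "q / (2 * (q - 1)) * ?r = ?r * ?r / 2" by (subst times_divide_times_eq, subst times_divide_times_eq) (simp add: algebra_simps)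
    show "1 / 2 \<le> q / (2 * (q - 1)) * ?r" using half unfolding eq mult_1 .
  qed (use D in auto)
  also have "\<dots> = ?U powr ?r" by (simp only: powr_powr)
  finally have QD: "sqrt D \<le> Q" using QU by linarith
  have "p powr \<kappa> \<le> p powr ((q - 2) / (2 * (q - 1)) * ?r)"
  proof (rule powr_mono)
    have "(q - 2) / (2 * (q - 1)) * ?r = q * (q - 2) / (2 * (q - 1)\<^sup>2)"
      by (subst times_divide_times_eq) (simp add: power2_eq_square mult_ac)
    thus "\<kappa> \<le> (q - 2) / (2 * (q - 1)) * ?r" using \<kappa> by simp
  qed (use p in auto)
  also have "\<dots> = ?V powr ?r" by (simp only: powr_powr)
  finally have Qp: "p powr \<kappa> \<le> Q" using QV by linarith
  have sn: "sqrt n \<ge> 2" using n by (intro real_le_rsqrt) simp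
  have "1 / (2 * q) \<le> 1 / 2" "1 / (2 * k) \<ge> 0" using kq by (auto simp: field_simps)
  hence "n powr (1 / 2) \<le> ?M" using n by (intro powr_mono) linarith+
  hence nM: "sqrt n \<le> ?M" using n by (simp add: powr_half_sqrt)
  have "ln (n + 1) \<le> ln ((1 + sqrt n)\<^sup>2)" using n sn by (intro ln_mono) (auto simp: power2_sum)
  also have "\<dots> = 2 * ln (1 + sqrt n)" using n by (simp add: ln_realpow)
  also have "ln (1 + sqrt n) \<le> sqrt n" using ln_add_one_self_le_self[of "sqrt n"] n by simp
  finally have "4 + ln (n + 1) + sqrt n * (sqrt D + 3) \<le> sqrt n * (sqrt D + 7)"
    using sn by (simp add: algebra_simps)
  also have "\<dots> \<le> ?M * (10 * Q)" using nM QD Q1 D n by (intro mult_mono) auto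
  also have "\<dots> = 10 * (?M * 1 * Q)" by simp
  also have "\<dots> \<le> 10 * (?M * ?A * Q)" using A Q1 by (intro mult_left_mono mult_right_mono) auto
  finally have 1: "4 + ln (n + 1) + sqrt n * (sqrt D + 3) \<le> 10 * (?M * ?A * Q)" .
  have "3 / 2 * C0 * (?M * ?A * p powr \<kappa>) \<le> 3 / 2 * C0 * (?M * ?A * Q)"
    using C0 Qp by (intro mult_left_mono) auto
  with 1 show ?thesis unfolding Q_def[symmetric] by (simp add: algebra_simps)
qed

theorem theorem1p9:
  fixes k q :: real
  assumes "k > 2" and "2 < q" and "q < k"
  shows "\<exists>C\<^sub>1 C\<^sub>2 :: real. C\<^sub>1 > 0 \<and> C\<^sub>2 > 0 \<and>
    (\<forall>(F :: nat \<Rightarrow> (nat \<Rightarrow> real) \<Rightarrow> real) (C\<^sub>H :: real) (C\<^sub>I :: real).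
       (\<forall>N\<ge>4. sph_density N (F N)) \<and>
       A_mom F k < \<infinity> \<and> A_P F q < \<infinity> \<and>
       C\<^sub>H > 0 \<and> C\<^sub>I > 0 \<and>
       (INF N\<in>{4..}. ereal (entropyN N (F N) / real N)) \<ge> ereal C\<^sub>H \<and>
       (SUP N\<in>{4..}. fisherN N (F N) / of_nat N) \<le> ennreal C\<^sub>I \<longrightarrow>
       (\<forall>(\<beta> :: real) N. 0 < \<beta> \<and> \<beta> < k / 2 - 1 \<and> N \<ge> 4 \<longrightarrow>
          (\<Sum>j<N. \<integral>x. sph_marginal N j (F N) (x j) * ln (sph_marginal N j (F N) (x j)) \<partial>sigmaN N)
          \<le> (1 + C\<^sub>1 / (C\<^sub>H * real N)
             + C\<^sub>2 * 2 powr (3 / 2 + 2 / q) / C\<^sub>H * (1 + C_gamma k / 2) powr (1 / k)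
               * ((2 * C\<^sub>I + 2) powr (q / (2 * (q - 1)))
                    * enn2real (A_P F q) powr ((q - 2) / (2 * (q - 1))) + 2) powr (q / (q - 1))
               * ((1 + enn2real (A_mom F k)) powr (1 / k)
                    / (2 * real N) powr (1 / (2 * q) - 1 / (2 * k)))
             + enn2real (A_mom F k) / (2 * C\<^sub>H * real N powr (k / 2 - 1 - \<beta>))
             + real N / (2 * C\<^sub>H * (real N - 3))
               * (eta N \<beta> / (real N powr (k / 4 - 1 / 2)
                    * (1 - 1 / real N powr \<beta>) powr (k / 4 + 1 / 2)))
               * (2 * C\<^sub>I + 2) powr (1 / 2) * enn2real (A_mom F k) powr (1 / 2))
            * entropyN N (F N)))"
proof -
  define \<delta> where "\<delta> = 1 / (2 * q) - 1 / (2 * k)"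
  \<comment> \<open>The first bound lets p^\<kappa> be absorbed by the \<open>A_P\<close> factor,
    the second keeps the power of N at most 1 - \<delta>.\<close>
  define \<kappa> where "\<kappa> = min (q * (q - 2) / (2 * (q - 1)\<^sup>2)) (1 / 2 - 1 / (2 * k) - 1 / (2 * q))"
  define C0 where "C0 = 2 + 4 / (q / (q - 2) * \<kappa>)"
  define g where "g = (1 + C_gamma k / 2) powr (1 / k)"
  define B where "B = 10 + 3 / 2 * C0"
  have kq: "k > 2" "2 < q" "q < k" by fact+
  have ik: "1 / (2 * k) < 1 / 4" "1 / (2 * q) < 1 / 4" "1 / (2 * k) > 0"
    using kq by (auto simp: field_simps)
  have "0 < q * (q - 2) / (2 * (q - 1)\<^sup>2)" using kq by (intro divide_pos_pos mult_pos_pos) auto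
  moreover have "0 < 1 / 2 - 1 / (2 * k) - 1 / (2 * q)" using ik by linarith
  ultimately have \<kappa>: "0 < \<kappa>" "\<kappa> \<le> 1 / 2 - 1 / (2 * k) - 1 / (2 * q)" "\<kappa> \<le> q * (q - 2) / (2 * (q - 1)\<^sup>2)"
    unfolding \<kappa>_def by (simp_all only: min_less_iff_conj min.cobounded1 min.cobounded2 simp_thms)
  have \<delta>1: "\<delta> \<le> 1" using ik unfolding \<delta>_def by linarith
  have "4 / (q / (q - 2) * \<kappa>) > 0" using kq \<kappa>(1) by (intro divide_pos_pos mult_pos_pos) auto
  hence C0: "C0 \<ge> 0" by (simp add: C0_def)
  hence B: "B > 0" by (simp add: B_def)
  have g: "g > 0" using C_gamma_nonneg[OF kq(1)] by (simp add: g_def)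
  show ?thesis
  \<comment> \<open>Both constants depend on k and q only. Dividing by \<open>g\<close> cancels the
    factor with \<open>C_gamma\<close>, and the 2 pays for (2 N)^\<delta> \<le> 2 N^\<delta>; the
    value 1 is an arbitrary positive choice.\<close>
  proof (rule exI[of _ 1], rule exI[of _ "2 * B / g"], intro conjI allI impI; (elim conjE)?)
    show "0 < (1 :: real)" by simp
    show "0 < 2 * B / g" using B g by simp
    fix F :: "nat \<Rightarrow> (nat \<Rightarrow> real) \<Rightarrow> real" and C\<^sub>H C\<^sub>I \<beta> :: real and N :: nat
    assume dens: "\<forall>N\<ge>4. sph_density N (F N)" and fin: "A_mom F k < \<infinity>" "A_P F q < \<infinity>"
      and CH: "C\<^sub>H > 0" and CI: "C\<^sub>I > 0"
      and INF: "(INF N\<in>{4..}. ereal (entropyN N (F N) / real N)) \<ge> ereal C\<^sub>H"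
      and SUP: "(SUP N\<in>{4..}. fisherN N (F N) / of_nat N) \<le> ennreal C\<^sub>I"
      and \<beta>: "0 < \<beta>" "\<beta> < k / 2 - 1" and N: "N \<ge> 4"
    define a where "a = enn2real (A_mom F k)"
    define p where "p = enn2real (A_P F q)"
    define H where "H = entropyN N (F N)"
    define n where "n = real N"
    have n: "n \<ge> 4" using N by (simp add: n_def)
    have dN: "sph_density N (F N)" using dens N by simp
    have N4: "N \<in> {4..}" using N by simp
    have a: "a \<ge> 0" by (simp add: a_def)
    have aA: "ennreal a = A_mom F k" using fin by (simp add: a_def ennreal_enn2real)
    have pA: "ennreal p = A_P F q" using fin by (simp add: p_def ennreal_enn2real)
    have "(\<Sum>j<N. moment k (coord_density N j (F N))) / of_nat N \<le> ennreal a"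
      unfolding aA A_mom_def by (rule SUP_upper[OF N4])
    hence M: "(\<Sum>j<N. moment k (coord_density N j (F N))) \<le> ennreal a * of_nat N"
      using N by (intro ennreal_le_of_div) auto
    have "(\<Sum>j<N. Pmom N q j (F N)) / of_nat N \<le> ennreal p"
      unfolding pA A_P_def by (rule SUP_upper[OF N4])
    hence P: "(\<Sum>j<N. Pmom N q j (F N)) \<le> ennreal p * of_nat N"
      using N by (intro ennreal_le_of_div) auto
    have p: "p \<ge> 1"
    proof -
      have "(\<Sum>j<N. (1 :: ennreal)) \<le> (\<Sum>j<N. Pmom N q j (F N))"
        using kq by (intro sum_mono Pmom_ge_1[OF N dN]) auto
      hence "of_nat N \<le> ennreal p * of_nat N" using P by simp
      moreover have "ennreal p * of_nat N = ennreal (p * real N)" "of_nat N = ennreal (real N)"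
        by (simp_all add: ennreal_mult p_def ennreal_of_nat_eq_real_of_nat)
      ultimately have "ennreal (real N) \<le> ennreal (p * real N)" by simp
      hence "real N \<le> p * real N" by (subst (asm) ennreal_le_iff) (auto simp: p_def)
      thus ?thesis using N by simp
    qed
    have "ereal C\<^sub>H \<le> ereal (entropyN N (F N) / real N)"
      using INF by (rule order_trans) (rule INF_lower[OF N4])
    hence Hn: "C\<^sub>H * n \<le> H" using N by (simp add: H_def n_def pos_le_divide_eq)
    moreover have "C\<^sub>H * n > 0" using CH n by simp
    ultimately have H: "H > 0" by linarith
    \<comment> \<open>Without integrability the Bochner integral would be 0, against the positive
      lower bound on the entropy.\<close>
    have Hint: "integrable (sigmaN N) (\<lambda>x. F N x * ln (F N x))"
    proof (rule ccontr)
      assume "\<not> ?thesis"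
      hence "H = 0" by (simp add: H_def entropyN_def not_integrable_integral_eq)
      thus False using H by simp
    qed
    \<comment> \<open>The infimum in \<open>fisherN\<close> need not be attained; the strict slack
      yields an actual weak gradient, and 2 D is the quantity 2 C_I + 2 of the claim.\<close>
    define D where "D = C\<^sub>I + 1"
    have D: "D \<ge> 1" "D > 0" "2 * C\<^sub>I + 2 = 2 * D" using CI by (auto simp: D_def)
    have "fisherN N (F N) / of_nat N \<le> ennreal C\<^sub>I"
      using SUP_upper[OF N4] SUP by (rule order_trans)
    hence "fisherN N (F N) \<le> ennreal C\<^sub>I * of_nat N" using N by (intro ennreal_le_of_div) auto
    also have "\<dots> = ennreal (C\<^sub>I * real N)" using CI by (simp add: ennreal_mult ennreal_of_nat_eq_real_of_nat)
    also have "\<dots> < ennreal (D * real N)" using CI N by (intro ennreal_lessI) (auto simp: D_def)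
    finally obtain G where G: "weak_sph_grad {..<N} (sqrt (real N)) (F N) G"
      "(\<integral>\<^sup>+x. ennreal ((\<Sum>i<N. (G x i / F N x)\<^sup>2) * F N x) \<partial>sigmaN N) < ennreal (D * real N)"
      unfolding fisherN_def INF_less_iff by blast
    note cb = correction_bound[OF N dN kq M a P p \<kappa>(1,2)]
    interpret L: sphere_density N "F N" G D
      using N dN G D Hint cb(1) by unfold_locales auto
    define S where "S = (\<Sum>j<N. \<integral>x. sph_marginal N j (F N) (x j) * ln (sph_marginal N j (F N) (x j)) \<partial>sigmaN N)"
    define E where "E = n powr (1 - \<delta>) * (1 + a) powr (1 / k)
      * ((2 * D) powr (q / (2 * (q - 1))) * p powr ((q - 2) / (2 * (q - 1))) + 2) powr (q / (q - 1))"
    have "S \<le> H + (4 + ln (n + 1) + sqrt n * (sqrt D + 3)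
        + 3 / 2 * C0 * (n powr (1 - \<delta>) * (1 + a) powr (1 / k) * p powr \<kappa>))"
      using L.marginal_entropy_sum cb(2) unfolding S_def H_def n_def \<delta>_def C0_def by linarith
    also have "\<dots> \<le> H + B * E"
      using error_terms_le[OF n kq(2,3) a p D(1) C0 \<kappa>(3)] unfolding E_def B_def \<delta>_def by simp
    finally have SE: "S \<le> H + B * E" .
    define W where "W = 2 * B / g * 2 powr (3 / 2 + 2 / q) / C\<^sub>H * g
      * ((2 * D) powr (q / (2 * (q - 1))) * p powr ((q - 2) / (2 * (q - 1))) + 2) powr (q / (q - 1))
      * ((1 + a) powr (1 / k) / (2 * n) powr \<delta>)"
    \<comment> \<open>The power of n in \<open>E\<close> is n times n^(-\<delta>), and n \<le> H/C_H
      turns the first factor into entropy. The power of 2 in the claim is at least 1 and is given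
      away.\<close>
    have BE: "B * E \<le> W * H"
    proof -
      define Q where "Q = ((2 * D) powr (q / (2 * (q - 1))) * p powr ((q - 2) / (2 * (q - 1))) + 2) powr (q / (q - 1))"
      define A where "A = (1 + a) powr (1 / k)"
      have QA: "Q \<ge> 0" "A \<ge> 0" by (simp_all add: Q_def A_def)
      have two: "(2 :: real) powr (3 / 2 + 2 / q) \<ge> 1" using kq by (intro ge_one_powr_ge_zero) auto
      have "(2 :: real) powr \<delta> \<le> 2 powr 1" using \<delta>1 by (intro powr_mono) auto
      hence "(2 * n) powr \<delta> \<le> 2 * n powr \<delta>" using n by (simp add: powr_mult mult_right_mono)
      hence "n / (2 * n powr \<delta>) \<le> n / (2 * n) powr \<delta>" using n by (intro divide_left_mono mult_pos_pos) auto
      moreover have "n powr (1 - \<delta>) = n / n powr \<delta>" using n by (simp add: powr_diff)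
      ultimately have 1: "n powr (1 - \<delta>) \<le> 2 * (n / (2 * n) powr \<delta>)" by simp
      have "B * E = B * Q * A * n powr (1 - \<delta>)" by (simp add: E_def Q_def A_def)
      also have "\<dots> \<le> B * Q * A * (2 * (n / (2 * n) powr \<delta>))"
        using B QA by (intro mult_left_mono[OF 1]) auto
      also have "\<dots> = 1 * (2 * B * Q * (A / (2 * n) powr \<delta>)) * n" by simp
      also have "\<dots> \<le> 2 powr (3 / 2 + 2 / q) * (2 * B * Q * (A / (2 * n) powr \<delta>)) * (H / C\<^sub>H)"
        using B QA two n CH Hn by (intro mult_mono) (auto simp: pos_le_divide_eq mult.commute)
      also have "\<dots> = W * H" using g unfolding W_def Q_def A_def by (simp add: field_simps)
      finally show ?thesis .
    qed
    define R1 where "R1 = 1 / (C\<^sub>H * n)"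
    define R2 where "R2 = a / (2 * C\<^sub>H * n powr (k / 2 - 1 - \<beta>))"
    define R3 where "R3 = n / (2 * C\<^sub>H * (n - 3)) * (eta N \<beta> / (n powr (k / 4 - 1 / 2)
      * (1 - 1 / n powr \<beta>) powr (k / 4 + 1 / 2))) * (2 * C\<^sub>I + 2) powr (1 / 2) * a powr (1 / 2)"
    have R: "R1 \<ge> 0" "R2 \<ge> 0" "R3 \<ge> 0"
      using n CH a eta_nonneg[of N \<beta>] N \<beta> unfolding R1_def R2_def R3_def
      by (auto intro!: mult_nonneg_nonneg divide_nonneg_nonneg)
    have "S \<le> H + W * H" using SE BE by linarith
    also have "\<dots> = (1 + W) * H" by (simp add: algebra_simps)
    also have "\<dots> \<le> (1 + R1 + W + R2 + R3) * H" using R H by (intro mult_right_mono) auto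
    finally show "(\<Sum>j<N. \<integral>x. sph_marginal N j (F N) (x j) * ln (sph_marginal N j (F N) (x j)) \<partial>sigmaN N)
          \<le> (1 + 1 / (C\<^sub>H * real N)
             + (2 * B / g) * 2 powr (3 / 2 + 2 / q) / C\<^sub>H * (1 + C_gamma k / 2) powr (1 / k)
               * ((2 * C\<^sub>I + 2) powr (q / (2 * (q - 1)))
                    * enn2real (A_P F q) powr ((q - 2) / (2 * (q - 1))) + 2) powr (q / (q - 1))
               * ((1 + enn2real (A_mom F k)) powr (1 / k)
                    / (2 * real N) powr (1 / (2 * q) - 1 / (2 * k)))
             + enn2real (A_mom F k) / (2 * C\<^sub>H * real N powr (k / 2 - 1 - \<beta>))
             + real N / (2 * C\<^sub>H * (real N - 3))
               * (eta N \<beta> / (real N powr (k / 4 - 1 / 2)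
                    * (1 - 1 / real N powr \<beta>) powr (k / 4 + 1 / 2)))
               * (2 * C\<^sub>I + 2) powr (1 / 2) * enn2real (A_mom F k) powr (1 / 2))
            * entropyN N (F N)"
      unfolding S_def W_def R1_def R2_def R3_def a_def p_def H_def n_def g_def \<delta>_def D(3)[symmetric] .
  qed
qed

end
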